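(* Let $k$ be an algebraically closed field, $\mathcal C$ an essentially small locally finite semisimple tensor category over $k$, and $\mathcal M$ a nonzero essentially small locally finite semisimple $k$-linear left $\mathcal C$-module category. Let $\chi\in\operatorname{Hom}(U_{\mathcal C},\mathbb Z)$ and $d\in\mathbb Z$, let $t_q$ be the monoidal $t$-structure on $D^b(\mathcal C)$ with shift function $q(X)=\chi(\deg X)+d$, and let $p:\operatorname{Irr}(\mathcal M)\to\mathbb Z$ determine a bounded $t$-structure $t_p$ on $D^b(\mathcal M)$. (1) An integer $m$ is a module deviation (i.e. $m\in\operatorname{dev}_{t_q}(t_p)$) if and only if $$p(P)=q(X)+p(M)-m$$ whenever $X\in\operatorname{Irr}(\mathcal C)$, $M,P\in\operatorname{Irr}(\mathcal M)$, and $P$ is a direct summand of $X\odot M$. (2) A module deviation exists if and only if $$p(P)=p(M)+\chi(\deg X)\qquad(\ast)$$ for every such triple $(X,M,P)$. In this case $\operatorname{dev}_{t_q}(t_p)=\{d\}$. (3) For a component $\Omega$ of $\mathcal M$ with chosen base object $M_0\in\Omega$ and stabilizer $H_\Omega$, a function $p:\Omega\to\mathbb Z$ satisfying $(\ast)$ (for all $X\in\operatorname{Irr}(\mathcal C)$ and $M,P\in\Omega$ with $P$ a direct summand of $X\odot M$) exists if and only if $\chi(H_\Omega)=0$. When this condition holds, all such functions on $\Omega$ have the form $$p(P)=c_\Omega+\chi(g),\qquad P\in\mathcal M_{gH_\Omega},$$ where $c_\Omega\in\mathbb Z$ is arbitrary. The constants on different components can be chosen independently.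
   Context: Tensor categories are as in Etingof–Gelaki–Nikshych–Ostrik: $k$-linear abelian rigid monoidal categories with $k$-bilinear tensor product, finite-dimensional Hom spaces, every object of finite length, and simple unit $\mathbf 1$ with $\operatorname{End}(\mathbf 1)=k$. Module categories have action $\odot:\mathcal C\times\mathcal M\to\mathcal M$ that is $k$-bilinear and exact in each variable. The sets $\operatorname{Irr}$ of isomorphism classes of simple objects may be infinite. $D^b(\mathcal C)$ has the induced tensor product and acts on $D^b(\mathcal M)$ by $(K\odot L)^r=\bigoplus_{i+j=r}K^i\odot L^j$ with $d(x\odot y)=d_Kx\odot y+(-1)^ix\odot d_Ly$ for $x\in K^i$. Shift convention: $(K[a])^i=K^{i+a}$. For a $t$-structure $(D^{\le0},D^{\ge1})$ put $D^{\ge0}=D^{\ge1}[1]$, $D^{\le n}=D^{\le0}[-n]$, $D^{\ge n}=D^{\ge0}[-n]$. For $\mathcal A=\mathcal C$ or $\mathcal M$, a function $p:\operatorname{Irr}(\mathcal A)\to\mathbb Z$ determines the bounded $t$-structure $t_p$ on $D^b(\mathcal A)$ with $D_p^{\le0}=\operatorname{add}\{S[a]:a\ge p(S)\}$, $D_p^{\ge1}=\operatorname{add}\{S[a]:a<p(S)\}$; $p$ is called its shift function. Here $\operatorname{add}(\mathcal S)$ is the full subcategory of direct summands of finite direct sums of objects of $\mathcal S$. A bounded $t$-structure on $D^b(\mathcal C)$ is monoidal if for some $d\in\mathbb Z$ one has $D^{\le0}\otimes D^{\le d}\subseteq D^{\le0}$ and $D^{\ge0}\otimes D^{\ge d}\subseteq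 D^{\ge0}$. An integer $m$ is a module deviation of $t_p$ with respect to $t_q$ if $D_q^{\le0}\odot D_p^{\le m}\subseteq D_p^{\le0}$ and $D_q^{\ge0}\odot D_p^{\ge m}\subseteq D_p^{\ge0}$; the set of all such $m$ is $\operatorname{dev}_{t_q}(t_p)$. $U_{\mathcal C}$ is the universal grading group, with degree map $\deg:\operatorname{Irr}(\mathcal C)\to U_{\mathcal C}$: the universal map to a group satisfying $\deg Z=\deg X\deg Y$ whenever $Z$ is a direct summand of $X\otimes Y$. $\mathcal C_g$ is the full additive subcategory generated by simple objects of degree $g$. The graph of $\mathcal M$ has vertex set $\operatorname{Irr}(\mathcal M)$; $M$ and $P$ are joined when $P$ is a direct summand of $X\odot M$ for some $X\in\operatorname{Irr}(\mathcal C)$ (a symmetric relation). A component $\Omega$ of $\mathcal M$ is a connected component of this graph. Fix $M_0\in\Omega$. Then $$H_\Omega=\{g\in U_{\mathcal C}: M_0\text{ is a direct summand of }X_g\odot M_0\text{ for some }X_g\in\mathcal C_g\},$$ which is a subgroup of $U_{\mathcal C}$. Every $P\in\Omega$ is a direct summand of $X_g\odot M_0$ for some $g\in U_{\mathcal C}$ and $X_g\in\mathcal C_g$, and the coset $gH_\Omega$ depends only on $P$; it is the degree of $P$. $\mathcal M_{gH_\Omega}$ is the full additive subcategory generated by the simple objects in $\Omega$ of degree $gH_\Omega$; in the displayed formula $P$ is a simple object. *)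

theory Defs
  imports
    "HOL-Computational_Algebra.Polynomial"
    "HOL-Algebra.Elementary_Groups"
begin

section \<open>Categories\<close>

text \<open>
  A category is a record of a set of objects, a set of arrows and the usual operations.
  Objects and arrows live in arbitrary HOL types, so every such category is small.
  Outside the given objects and arrows the operations are unconstrained.
\<close>

record ('o, 'm) cat =
  Ob :: "'o set"
  Ar :: "'m set"
  Src :: "'m \<Rightarrow> 'o"
  Tgt :: "'m \<Rightarrow> 'o"
  Ident :: "'o \<Rightarrow> 'm"
  Cmp :: "'m \<Rightarrow> 'm \<Rightarrow> 'm" (infixl "\<cdot>\<index>" 70)

definition Hom :: "('o, 'm, 'x) cat_scheme \<Rightarrow> 'o \<Rightarrow> 'o \<Rightarrow> 'm set" where
  "Hom C X Y = {f \<in> Ar C. Src C f = X \<and> Tgt C f = Y}"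

locale category =
  fixes C :: "('o, 'm, 'x) cat_scheme" (structure)
  assumes Src_Ob: "f \<in> Ar C \<Longrightarrow> Src C f \<in> Ob C"
    and Tgt_Ob: "f \<in> Ar C \<Longrightarrow> Tgt C f \<in> Ob C"
    and Id_Hom: "X \<in> Ob C \<Longrightarrow> Ident C X \<in> Hom C X X"
    and Cmp_Hom: "f \<in> Hom C X Y \<Longrightarrow> g \<in> Hom C Y Z \<Longrightarrow> g \<cdot> f \<in> Hom C X Z"
    and Cmp_assoc: "f \<in> Hom C W X \<Longrightarrow> g \<in> Hom C X Y \<Longrightarrow> h \<in> Hom C Y Z \<Longrightarrow>
      (h \<cdot> g) \<cdot> f = h \<cdot> (g \<cdot> f)"
    and Id_left: "f \<in> Hom C X Y \<Longrightarrow> Ident C Y \<cdot> f = f"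
    and Id_right: "f \<in> Hom C X Y \<Longrightarrow> f \<cdot> Ident C X = f"

definition is_inverse :: "('o, 'm, 'x) cat_scheme \<Rightarrow> 'm \<Rightarrow> 'm \<Rightarrow> bool" where
  "is_inverse C f g \<longleftrightarrow> f \<in> Ar C \<and> g \<in> Hom C (Tgt C f) (Src C f) \<and>
     g \<cdot>\<^bsub>C\<^esub> f = Ident C (Src C f) \<and> f \<cdot>\<^bsub>C\<^esub> g = Ident C (Tgt C f)"

definition is_isomorphism :: "('o, 'm, 'x) cat_scheme \<Rightarrow> 'm \<Rightarrow> bool" where
  "is_isomorphism C f \<longleftrightarrow> (\<exists>g. is_inverse C f g)"

definition iso_class :: "('o, 'm, 'x) cat_scheme \<Rightarrow> 'o \<Rightarrow> 'o set" where
  "iso_class C X = {Y \<in> Ob C. \<exists>f \<in> Hom C X Y. is_isomorphism C f}"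

definition is_monic :: "('o, 'm, 'x) cat_scheme \<Rightarrow> 'm \<Rightarrow> bool" where
  "is_monic C f \<longleftrightarrow> f \<in> Ar C \<and>
     (\<forall>W. \<forall>g \<in> Hom C W (Src C f). \<forall>h \<in> Hom C W (Src C f). f \<cdot>\<^bsub>C\<^esub> g = f \<cdot>\<^bsub>C\<^esub> h \<longrightarrow> g = h)"

definition is_epic :: "('o, 'm, 'x) cat_scheme \<Rightarrow> 'm \<Rightarrow> bool" where
  "is_epic C f \<longleftrightarrow> f \<in> Ar C \<and>
     (\<forall>W. \<forall>g \<in> Hom C (Tgt C f) W. \<forall>h \<in> Hom C (Tgt C f) W. g \<cdot>\<^bsub>C\<^esub> f = h \<cdot>\<^bsub>C\<^esub> f \<longrightarrow> g = h)"

definition is_zero_object :: "('o, 'm, 'x) cat_scheme \<Rightarrow> 'o \<Rightarrow> bool" where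
  "is_zero_object C X \<longleftrightarrow> X \<in> Ob C \<and> (\<forall>Y \<in> Ob C. (\<exists>!f. f \<in> Hom C X Y) \<and> (\<exists>!f. f \<in> Hom C Y X))"

text \<open>
  Direct sums are expressed by their universal property as coproducts.  This is only used in
  additive categories, where finite coproducts are biproducts; it also allows index sets such
  as all integers, provided that almost all summands are zero.
\<close>

definition is_coproduct ::
  "('o, 'm, 'x) cat_scheme \<Rightarrow> 'i set \<Rightarrow> ('i \<Rightarrow> 'o) \<Rightarrow> 'o \<Rightarrow> ('i \<Rightarrow> 'm) \<Rightarrow> bool" where
  "is_coproduct C I F Y inc \<longleftrightarrow> Y \<in> Ob C \<and>
     (\<forall>i \<in> I. F i \<in> Ob C \<and> inc i \<in> Hom C (F i) Y) \<and>
     (\<forall>Z \<in> Ob C. \<forall>f. (\<forall>i \<in> I. f i \<in> Hom C (F i) Z) \<longrightarrow>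
        (\<exists>!h. h \<in> Hom C Y Z \<and> (\<forall>i \<in> I. h \<cdot>\<^bsub>C\<^esub> inc i = f i)))"

definition direct_summand :: "('o, 'm, 'x) cat_scheme \<Rightarrow> 'o \<Rightarrow> 'o \<Rightarrow> bool" where
  "direct_summand C X Y \<longleftrightarrow>
     (\<exists>F inc. is_coproduct C {0, 1::nat} F Y inc \<and> F 0 = X)"

definition finite_sums :: "('o, 'm, 'x) cat_scheme \<Rightarrow> 'o set \<Rightarrow> 'o set" where
  "finite_sums C S =
     {Y \<in> Ob C. \<exists>(n::nat) F inc. (\<forall>i<n. F i \<in> S) \<and> is_coproduct C {..<n} F Y inc}"

definition add_closure :: "('o, 'm, 'x) cat_scheme \<Rightarrow> 'o set \<Rightarrow> 'o set" where
  "add_closure C S = {X \<in> Ob C. \<exists>Y \<in> finite_sums C S. direct_summand C X Y}"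


section \<open>Linear and abelian categories\<close>

record ('o, 'm, 'k) lincat = "('o, 'm) cat" +
  Zer :: "'o \<Rightarrow> 'o \<Rightarrow> 'm"
  Add :: "'m \<Rightarrow> 'm \<Rightarrow> 'm"
  Scl :: "'k \<Rightarrow> 'm \<Rightarrow> 'm"

locale linear_category = category C
  for C :: "('o, 'm, 'k::field, 'x) lincat_scheme" (structure) +
  assumes Zer_Hom: "X \<in> Ob C \<Longrightarrow> Y \<in> Ob C \<Longrightarrow> Zer C X Y \<in> Hom C X Y"
    and Add_Hom: "f \<in> Hom C X Y \<Longrightarrow> g \<in> Hom C X Y \<Longrightarrow> Add C f g \<in> Hom C X Y"
    and Scl_Hom: "f \<in> Hom C X Y \<Longrightarrow> Scl C a f \<in> Hom C X Y"
    and Add_assoc: "f \<in> Hom C X Y \<Longrightarrow> g \<in> Hom C X Y \<Longrightarrow> h \<in> Hom C X Y \<Longrightarrow>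
      Add C (Add C f g) h = Add C f (Add C g h)"
    and Add_commute: "f \<in> Hom C X Y \<Longrightarrow> g \<in> Hom C X Y \<Longrightarrow> Add C f g = Add C g f"
    and Add_Zer: "f \<in> Hom C X Y \<Longrightarrow> Add C (Zer C X Y) f = f"
    and Add_inverse: "f \<in> Hom C X Y \<Longrightarrow> Add C (Scl C (- 1) f) f = Zer C X Y"
    and Scl_Add: "f \<in> Hom C X Y \<Longrightarrow> g \<in> Hom C X Y \<Longrightarrow>
      Scl C a (Add C f g) = Add C (Scl C a f) (Scl C a g)"
    and Scl_plus: "f \<in> Hom C X Y \<Longrightarrow> Scl C (a + b) f = Add C (Scl C a f) (Scl C b f)"
    and Scl_times: "f \<in> Hom C X Y \<Longrightarrow> Scl C (a * b) f = Scl C a (Scl C b f)"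
    and Scl_one: "f \<in> Hom C X Y \<Longrightarrow> Scl C 1 f = f"
    and Cmp_Add_left: "f \<in> Hom C X Y \<Longrightarrow> g \<in> Hom C Y Z \<Longrightarrow> g' \<in> Hom C Y Z \<Longrightarrow>
      Add C g g' \<cdot> f = Add C (g \<cdot> f) (g' \<cdot> f)"
    and Cmp_Add_right: "f \<in> Hom C X Y \<Longrightarrow> f' \<in> Hom C X Y \<Longrightarrow> g \<in> Hom C Y Z \<Longrightarrow>
      g \<cdot> Add C f f' = Add C (g \<cdot> f) (g \<cdot> f')"
    and Cmp_Scl_left: "f \<in> Hom C X Y \<Longrightarrow> g \<in> Hom C Y Z \<Longrightarrow> Scl C a g \<cdot> f = Scl C a (g \<cdot> f)"
    and Cmp_Scl_right: "f \<in> Hom C X Y \<Longrightarrow> g \<in> Hom C Y Z \<Longrightarrow> g \<cdot> Scl C a f = Scl C a (g \<cdot> f)"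

definition is_kernel :: "('o, 'm, 'k, 'x) lincat_scheme \<Rightarrow> 'm \<Rightarrow> 'm \<Rightarrow> bool" where
  "is_kernel A f k \<longleftrightarrow> f \<in> Ar A \<and> k \<in> Ar A \<and> Tgt A k = Src A f \<and>
     f \<cdot>\<^bsub>A\<^esub> k = Zer A (Src A k) (Tgt A f) \<and>
     (\<forall>W. \<forall>g \<in> Hom A W (Src A f). f \<cdot>\<^bsub>A\<^esub> g = Zer A W (Tgt A f) \<longrightarrow>
        (\<exists>!h. h \<in> Hom A W (Src A k) \<and> k \<cdot>\<^bsub>A\<^esub> h = g))"

definition is_cokernel :: "('o, 'm, 'k, 'x) lincat_scheme \<Rightarrow> 'm \<Rightarrow> 'm \<Rightarrow> bool" where
  "is_cokernel A f c \<longleftrightarrow> f \<in> Ar A \<and> c \<in> Ar A \<and> Src A c = Tgt A f \<and>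
     c \<cdot>\<^bsub>A\<^esub> f = Zer A (Src A f) (Tgt A c) \<and>
     (\<forall>W. \<forall>g \<in> Hom A (Tgt A f) W. g \<cdot>\<^bsub>A\<^esub> f = Zer A (Src A f) W \<longrightarrow>
        (\<exists>!h. h \<in> Hom A (Tgt A c) W \<and> h \<cdot>\<^bsub>A\<^esub> c = g))"

locale abelian_category = linear_category C
  for C :: "('o, 'm, 'k::field, 'x) lincat_scheme" (structure) +
  assumes zero_exists: "\<exists>X. is_zero_object C X"
    and sum_exists: "X \<in> Ob C \<Longrightarrow> Y \<in> Ob C \<Longrightarrow>
      \<exists>F S inc. is_coproduct C {0, 1::nat} F S inc \<and> F 0 = X \<and> F 1 = Y"
    and kernel_exists: "f \<in> Ar C \<Longrightarrow> \<exists>k. is_kernel C f k"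
    and cokernel_exists: "f \<in> Ar C \<Longrightarrow> \<exists>c. is_cokernel C f c"
    and monic_is_kernel: "is_monic C f \<Longrightarrow> \<exists>g. is_kernel C g f"
    and epic_is_cokernel: "is_epic C f \<Longrightarrow> \<exists>g. is_cokernel C g f"

definition short_exact :: "('o, 'm, 'k, 'x) lincat_scheme \<Rightarrow> 'm \<Rightarrow> 'm \<Rightarrow> bool" where
  "short_exact A f g \<longleftrightarrow> is_kernel A g f \<and> is_cokernel A f g"

definition is_simple :: "('o, 'm, 'x) cat_scheme \<Rightarrow> 'o \<Rightarrow> bool" where
  "is_simple A X \<longleftrightarrow> X \<in> Ob A \<and> \<not> is_zero_object A X \<and>
     (\<forall>i. is_monic A i \<and> Tgt A i = X \<longrightarrow> is_zero_object A (Src A i) \<or> is_isomorphism A i)"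

definition Irr_classes :: "('o, 'm, 'x) cat_scheme \<Rightarrow> 'o set set" where
  "Irr_classes A = {iso_class A X | X. is_simple A X}"

inductive finite_length :: "('o, 'm, 'k, 'x) lincat_scheme \<Rightarrow> 'o \<Rightarrow> bool"
  for A :: "('o, 'm, 'k, 'x) lincat_scheme" where
  zero: "is_zero_object A X \<Longrightarrow> finite_length A X"
| step: "finite_length A (Src A f) \<Longrightarrow> short_exact A f g \<Longrightarrow> is_simple A (Tgt A g) \<Longrightarrow>
    finite_length A (Tgt A f)"

definition lin_comb ::
  "('o, 'm, 'k, 'x) lincat_scheme \<Rightarrow> 'o \<Rightarrow> 'o \<Rightarrow> 'k list \<Rightarrow> 'm list \<Rightarrow> 'm" where
  "lin_comb A X Y as fs = foldr (\<lambda>(a, f) g. Add A (Scl A a f) g) (zip as fs) (Zer A X Y)"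

definition locally_finite :: "('o, 'm, 'k, 'x) lincat_scheme \<Rightarrow> bool" where
  "locally_finite A \<longleftrightarrow>
     (\<forall>X \<in> Ob A. finite_length A X) \<and>
     (\<forall>X \<in> Ob A. \<forall>Y \<in> Ob A. \<exists>fs. set fs \<subseteq> Hom A X Y \<and>
        (\<forall>f \<in> Hom A X Y. \<exists>as. length as = length fs \<and> f = lin_comb A X Y as fs))"

definition semisimple_category :: "('o, 'm, 'x) cat_scheme \<Rightarrow> bool" where
  "semisimple_category A \<longleftrightarrow> (\<forall>X \<in> Ob A. X \<in> finite_sums A {S. is_simple A S})"


section \<open>Tensor categories and module categories\<close>

locale bilinear_bifunctor =
  fixes A :: "('o1, 'm1, 'k::field, 'x1) lincat_scheme"
    and B :: "('o2, 'm2, 'k, 'x2) lincat_scheme"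
    and D :: "('o3, 'm3, 'k, 'x3) lincat_scheme"
    and FO :: "'o1 \<Rightarrow> 'o2 \<Rightarrow> 'o3"
    and FA :: "'m1 \<Rightarrow> 'm2 \<Rightarrow> 'm3"
  assumes FO_Ob: "X \<in> Ob A \<Longrightarrow> Y \<in> Ob B \<Longrightarrow> FO X Y \<in> Ob D"
    and FA_Hom: "f \<in> Hom A X X' \<Longrightarrow> g \<in> Hom B Y Y' \<Longrightarrow> FA f g \<in> Hom D (FO X Y) (FO X' Y')"
    and FA_Id: "X \<in> Ob A \<Longrightarrow> Y \<in> Ob B \<Longrightarrow> FA (Ident A X) (Ident B Y) = Ident D (FO X Y)"
    and FA_Cmp: "f \<in> Hom A X X' \<Longrightarrow> f' \<in> Hom A X' X'' \<Longrightarrow>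
      g \<in> Hom B Y Y' \<Longrightarrow> g' \<in> Hom B Y' Y'' \<Longrightarrow>
      FA (f' \<cdot>\<^bsub>A\<^esub> f) (g' \<cdot>\<^bsub>B\<^esub> g) = FA f' g' \<cdot>\<^bsub>D\<^esub> FA f g"
    and FA_Add_left: "f \<in> Hom A X X' \<Longrightarrow> f' \<in> Hom A X X' \<Longrightarrow> g \<in> Hom B Y Y' \<Longrightarrow>
      FA (Add A f f') g = Add D (FA f g) (FA f' g)"
    and FA_Add_right: "f \<in> Hom A X X' \<Longrightarrow> g \<in> Hom B Y Y' \<Longrightarrow> g' \<in> Hom B Y Y' \<Longrightarrow>
      FA f (Add B g g') = Add D (FA f g) (FA f g')"
    and FA_Scl_left: "f \<in> Hom A X X' \<Longrightarrow> g \<in> Hom B Y Y' \<Longrightarrow>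
      FA (Scl A a f) g = Scl D a (FA f g)"
    and FA_Scl_right: "f \<in> Hom A X X' \<Longrightarrow> g \<in> Hom B Y Y' \<Longrightarrow>
      FA f (Scl B a g) = Scl D a (FA f g)"

text \<open>
  \<open>tens\<close> and \<open>tensA\<close> are the tensor product on objects and on arrows;
  \<open>assoc_ar C X Y Z : (X \<otimes> Y) \<otimes> Z \<rightarrow> X \<otimes> (Y \<otimes> Z)\<close>, \<open>lunit C X : 1 \<otimes> X \<rightarrow> X\<close> and
  \<open>runit C X : X \<otimes> 1 \<rightarrow> X\<close> are the structure isomorphisms.
\<close>

record ('o, 'm, 'k) tencat = "('o, 'm, 'k) lincat" +
  tens :: "'o \<Rightarrow> 'o \<Rightarrow> 'o"
  tensA :: "'m \<Rightarrow> 'm \<Rightarrow> 'm"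
  unit_ob :: "'o"
  assoc_ar :: "'o \<Rightarrow> 'o \<Rightarrow> 'o \<Rightarrow> 'm"
  lunit :: "'o \<Rightarrow> 'm"
  runit :: "'o \<Rightarrow> 'm"

definition is_left_dual :: "('o, 'm, 'k, 'x) tencat_scheme \<Rightarrow> 'o \<Rightarrow> 'o \<Rightarrow> bool" where
  "is_left_dual C D X \<longleftrightarrow> D \<in> Ob C \<and> X \<in> Ob C \<and>
     (\<exists>ev coev inv_assoc.
        ev \<in> Hom C (tens C D X) (unit_ob C) \<and>
        coev \<in> Hom C (unit_ob C) (tens C X D) \<and>
        is_inverse C (assoc_ar C D X D) inv_assoc \<and>
        runit C X \<cdot>\<^bsub>C\<^esub> tensA C (Ident C X) ev \<cdot>\<^bsub>C\<^esub> assoc_ar C X D X \<cdot>\<^bsub>C\<^esub> tensA C coev (Ident C X) = lunit C X \<and>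
        lunit C D \<cdot>\<^bsub>C\<^esub> tensA C ev (Ident C D) \<cdot>\<^bsub>C\<^esub> inv_assoc \<cdot>\<^bsub>C\<^esub> tensA C (Ident C D) coev = runit C D)"

text \<open>\<open>X\<close> has right dual \<open>D\<close> exactly when \<open>D\<close> has left dual \<open>X\<close>.\<close>

locale tensor_category = abelian_category C
  for C :: "('o, 'm, 'k::field, 'x) tencat_scheme" (structure) +
  assumes loc_finite: "locally_finite C"
    and tens_bifunctor: "bilinear_bifunctor C C C (tens C) (tensA C)"
    and unit_Ob: "unit_ob C \<in> Ob C"
    and asc_Hom: "X \<in> Ob C \<Longrightarrow> Y \<in> Ob C \<Longrightarrow> Z \<in> Ob C \<Longrightarrow>
      assoc_ar C X Y Z \<in> Hom C (tens C (tens C X Y) Z) (tens C X (tens C Y Z)) \<and> is_isomorphism C (assoc_ar C X Y Z)"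
    and asc_natural: "f \<in> Hom C X X' \<Longrightarrow> g \<in> Hom C Y Y' \<Longrightarrow> h \<in> Hom C Z Z' \<Longrightarrow>
      assoc_ar C X' Y' Z' \<cdot> tensA C (tensA C f g) h = tensA C f (tensA C g h) \<cdot> assoc_ar C X Y Z"
    and lunit_Hom: "X \<in> Ob C \<Longrightarrow> lunit C X \<in> Hom C (tens C (unit_ob C) X) X \<and> is_isomorphism C (lunit C X)"
    and lunit_natural: "f \<in> Hom C X X' \<Longrightarrow> lunit C X' \<cdot> tensA C (Ident C (unit_ob C)) f = f \<cdot> lunit C X"
    and runit_Hom: "X \<in> Ob C \<Longrightarrow> runit C X \<in> Hom C (tens C X (unit_ob C)) X \<and> is_isomorphism C (runit C X)"
    and runit_natural: "f \<in> Hom C X X' \<Longrightarrow> runit C X' \<cdot> tensA C f (Ident C (unit_ob C)) = f \<cdot> runit C X"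
    and pentagon: "W \<in> Ob C \<Longrightarrow> X \<in> Ob C \<Longrightarrow> Y \<in> Ob C \<Longrightarrow> Z \<in> Ob C \<Longrightarrow>
      tensA C (Ident C W) (assoc_ar C X Y Z) \<cdot> assoc_ar C W (tens C X Y) Z \<cdot> tensA C (assoc_ar C W X Y) (Ident C Z) =
      assoc_ar C W X (tens C Y Z) \<cdot> assoc_ar C (tens C W X) Y Z"
    and triangle: "X \<in> Ob C \<Longrightarrow> Y \<in> Ob C \<Longrightarrow>
      tensA C (Ident C X) (lunit C Y) \<cdot> assoc_ar C X (unit_ob C) Y = tensA C (runit C X) (Ident C Y)"
    and rigid: "X \<in> Ob C \<Longrightarrow> (\<exists>D. is_left_dual C D X) \<and> (\<exists>D. is_left_dual C X D)"
    and unit_simple: "is_simple C (unit_ob C)"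
    and End_unit: "bij_betw (\<lambda>a. Scl C a (Ident C (unit_ob C))) UNIV (Hom C (unit_ob C) (unit_ob C))"

text \<open>
  In a module category over \<open>C\<close>, \<open>act\<close> and \<open>actA\<close> are the action on objects and arrows, and
  \<open>massoc M X Y N : (X \<otimes> Y) \<odot> N \<rightarrow> X \<odot> (Y \<odot> N)\<close> and \<open>munit M N : 1 \<odot> N \<rightarrow> N\<close> are the structure
  isomorphisms.
\<close>

record ('o, 'm, 'p, 'n, 'k) modcat = "('p, 'n, 'k) lincat" +
  act :: "'o \<Rightarrow> 'p \<Rightarrow> 'p"
  actA :: "'m \<Rightarrow> 'n \<Rightarrow> 'n"
  massoc :: "'o \<Rightarrow> 'o \<Rightarrow> 'p \<Rightarrow> 'n"
  munit :: "'p \<Rightarrow> 'n"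

locale module_category =
  C: tensor_category C + M: abelian_category M
  for C :: "('o, 'm, 'k::field, 'x) tencat_scheme"
    and M :: "('o, 'm, 'p, 'n, 'k, 'y) modcat_scheme" +
  assumes act_bifunctor: "bilinear_bifunctor C M M (act M) (actA M)"
    and act_exact_left: "short_exact C f g \<Longrightarrow> N \<in> Ob M \<Longrightarrow>
      short_exact M (actA M f (Ident M N)) (actA M g (Ident M N))"
    and act_exact_right: "X \<in> Ob C \<Longrightarrow> short_exact M u v \<Longrightarrow>
      short_exact M (actA M (Ident C X) u) (actA M (Ident C X) v)"
    and masc_Hom: "X \<in> Ob C \<Longrightarrow> Y \<in> Ob C \<Longrightarrow> N \<in> Ob M \<Longrightarrow>
      massoc M X Y N \<in> Hom M (act M (tens C X Y) N) (act M X (act M Y N)) \<and> is_isomorphism M (massoc M X Y N)"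
    and masc_natural: "f \<in> Hom C X X' \<Longrightarrow> g \<in> Hom C Y Y' \<Longrightarrow> h \<in> Hom M N N' \<Longrightarrow>
      massoc M X' Y' N' \<cdot>\<^bsub>M\<^esub> actA M (tensA C f g) h = actA M f (actA M g h) \<cdot>\<^bsub>M\<^esub> massoc M X Y N"
    and mun_Hom: "N \<in> Ob M \<Longrightarrow> munit M N \<in> Hom M (act M (unit_ob C) N) N \<and> is_isomorphism M (munit M N)"
    and mun_natural: "h \<in> Hom M N N' \<Longrightarrow>
      munit M N' \<cdot>\<^bsub>M\<^esub> actA M (Ident C (unit_ob C)) h = h \<cdot>\<^bsub>M\<^esub> munit M N"
    and mod_pentagon: "X \<in> Ob C \<Longrightarrow> Y \<in> Ob C \<Longrightarrow> Z \<in> Ob C \<Longrightarrow> N \<in> Ob M \<Longrightarrow>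
      actA M (Ident C X) (massoc M Y Z N) \<cdot>\<^bsub>M\<^esub> massoc M X (tens C Y Z) N \<cdot>\<^bsub>M\<^esub> actA M (assoc_ar C X Y Z) (Ident M N) =
      massoc M X Y (act M Z N) \<cdot>\<^bsub>M\<^esub> massoc M (tens C X Y) Z N"
    and mod_triangle: "X \<in> Ob C \<Longrightarrow> N \<in> Ob M \<Longrightarrow>
      actA M (Ident C X) (munit M N) \<cdot>\<^bsub>M\<^esub> massoc M X (unit_ob C) N = actA M (runit C X) (Ident M N)"


section \<open>Localization\<close>

text \<open>
  The localization_cat of \<open>C\<close> at a set \<open>W\<close> of arrows: an arrow from \<open>X\<close> to \<open>Y\<close> is a class of
  zigzags from \<open>X\<close> to \<open>Y\<close>.  Zigzags are lists read from left to right; \<open>Fwd f\<close> stands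
  for \<open>f\<close>, and \<open>Bwd s\<close> for the formal inverse of \<open>s \<in> W\<close>.  The endpoints are stored with the
  class, so that hom sets are disjoint.
\<close>

datatype 'm letter = Fwd 'm | Bwd 'm

inductive zigzag :: "('o, 'm, 'x) cat_scheme \<Rightarrow> 'm set \<Rightarrow> 'o \<Rightarrow> 'm letter list \<Rightarrow> 'o \<Rightarrow> bool"
  for C :: "('o, 'm, 'x) cat_scheme" and W :: "'m set" where
  Nil: "X \<in> Ob C \<Longrightarrow> zigzag C W X [] X"
| Fwd: "f \<in> Ar C \<Longrightarrow> zigzag C W (Tgt C f) w Y \<Longrightarrow> zigzag C W (Src C f) (Fwd f # w) Y"
| Bwd: "s \<in> Ar C \<Longrightarrow> s \<in> W \<Longrightarrow> zigzag C W (Src C s) w Y \<Longrightarrow> zigzag C W (Tgt C s) (Bwd s # w) Y"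

inductive zigzag_step :: "('o, 'm, 'x) cat_scheme \<Rightarrow> 'm letter list \<Rightarrow> 'm letter list \<Rightarrow> bool"
  for C :: "('o, 'm, 'x) cat_scheme" where
  "X \<in> Ob C \<Longrightarrow> zigzag_step C [Fwd (Ident C X)] []"
| "zigzag_step C [Fwd f, Fwd g] [Fwd (g \<cdot>\<^bsub>C\<^esub> f)]"
| "zigzag_step C [Fwd s, Bwd s] []"
| "zigzag_step C [Bwd s, Fwd s] []"

inductive zigzag_eq ::
  "('o, 'm, 'x) cat_scheme \<Rightarrow> 'm set \<Rightarrow> 'o \<Rightarrow> 'o \<Rightarrow> 'm letter list \<Rightarrow> 'm letter list \<Rightarrow> bool"
  for C :: "('o, 'm, 'x) cat_scheme" and W :: "'m set" and X Y :: 'o where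
  refl: "zigzag C W X w Y \<Longrightarrow> zigzag_eq C W X Y w w"
| sym: "zigzag_eq C W X Y v w \<Longrightarrow> zigzag_eq C W X Y w v"
| trans: "zigzag_eq C W X Y u v \<Longrightarrow> zigzag_eq C W X Y v w \<Longrightarrow> zigzag_eq C W X Y u w"
| step: "zigzag_step C a b \<Longrightarrow> zigzag C W X (u @ a @ v) Y \<Longrightarrow> zigzag C W X (u @ b @ v) Y \<Longrightarrow>
    zigzag_eq C W X Y (u @ a @ v) (u @ b @ v)"

definition zigzag_class ::
  "('o, 'm, 'x) cat_scheme \<Rightarrow> 'm set \<Rightarrow> 'o \<Rightarrow> 'o \<Rightarrow> 'm letter list \<Rightarrow> 'm letter list set" where
  "zigzag_class C W X Y w = {w'. zigzag_eq C W X Y w w'}"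

definition localization_cat ::
  "('o, 'm, 'x) cat_scheme \<Rightarrow> 'm set \<Rightarrow> ('o, 'o \<times> 'm letter list set \<times> 'o) cat" where
  "localization_cat C W =
     \<lparr>Ob = Ob C,
      Ar = {(X, zigzag_class C W X Y w, Y) | X w Y. zigzag C W X w Y},
      Src = (\<lambda>(X, w, Y). X),
      Tgt = (\<lambda>(X, w, Y). Y),
      Ident = (\<lambda>X. (X, zigzag_class C W X X [], X)),
      Cmp = (\<lambda>(Y', ws', Z) (X, ws, Y).
        (X, {u. \<exists>w \<in> ws. \<exists>w' \<in> ws'. zigzag_eq C W X Z (w @ w') u}, Z))\<rparr>"

lemma zigzag_ends:
  assumes "category C" and "zigzag C W X w Y"
  shows "X \<in> Ob C \<and> Y \<in> Ob C"
  using assms(2) assms(1) by induction (auto dest: category.Src_Ob category.Tgt_Ob)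

lemma zigzag_append:
  "zigzag C W X v Y \<Longrightarrow> zigzag C W Y w Z \<Longrightarrow> zigzag C W X (v @ w) Z"
  by (induction rule: zigzag.induct) (auto intro: zigzag.intros)

lemma zigzag_eq_zigzag:
  "zigzag_eq C W X Y v w \<Longrightarrow> zigzag C W X v Y \<and> zigzag C W X w Y"
  by (induction rule: zigzag_eq.induct) auto

lemma zigzag_eq_append:
  assumes "zigzag_eq C W X Y v w" and "zigzag C W X' a X" and "zigzag C W Y b Y'"
  shows "zigzag_eq C W X' Y' (a @ v @ b) (a @ w @ b)"
  using assms
proof (induction rule: zigzag_eq.induct)
  case (refl w)
  then show ?case by (intro zigzag_eq.refl zigzag_append)
next
  case (sym v w)
  then show ?case by (blast intro: zigzag_eq.sym)
next
  case (trans u v w)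
  then show ?case by (blast intro: zigzag_eq.trans)
next
  case (step r s u v)
  have "zigzag C W X' (a @ (u @ r @ v) @ b) Y'" "zigzag C W X' (a @ (u @ s @ v) @ b) Y'"
    using step(2,3) step.prems by (blast intro: zigzag_append)+
  with zigzag_eq.step[OF step(1), of W X' "a @ u" "v @ b" Y'] show ?case by simp
qed

lemma zigzag_eq_append2:
  assumes "zigzag_eq C W X Y v w" and "zigzag_eq C W Y Z v' w'"
    and "category C"
  shows "zigzag_eq C W X Z (v @ v') (w @ w')"
proof -
  have z: "zigzag C W X v Y" "zigzag C W X w Y" "zigzag C W Y v' Z" "zigzag C W Y w' Z"
    using zigzag_eq_zigzag[OF assms(1)] zigzag_eq_zigzag[OF assms(2)] by simp_all
  have nil: "zigzag C W X [] X" "zigzag C W Z [] Z"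
    using zigzag_ends[OF assms(3)] z by (auto intro: zigzag.Nil)
  have "zigzag_eq C W X Z ([] @ v @ v') ([] @ w @ v')"
    by (rule zigzag_eq_append[OF assms(1) nil(1) z(3)])
  moreover have "zigzag_eq C W X Z (w @ v' @ []) (w @ w' @ [])"
    by (rule zigzag_eq_append[OF assms(2) z(2) nil(2)])
  ultimately show ?thesis unfolding append_Nil append_Nil2 by (rule zigzag_eq.trans)
qed

lemma zigzag_class_eqI:
  assumes "zigzag_eq C W X Y v w"
  shows "zigzag_class C W X Y v = zigzag_class C W X Y w"
proof (intro equalityI subsetI)
  fix u assume "u \<in> zigzag_class C W X Y v"
  then show "u \<in> zigzag_class C W X Y w"
    using zigzag_eq.trans[OF zigzag_eq.sym[OF assms]] by (simp add: zigzag_class_def)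
next
  fix u assume "u \<in> zigzag_class C W X Y w"
  then show "u \<in> zigzag_class C W X Y v"
    using zigzag_eq.trans[OF assms] by (simp add: zigzag_class_def)
qed

lemma localization_cat_Hom:
  "Hom (localization_cat C W) X Y = {(X, zigzag_class C W X Y w, Y) | w. zigzag C W X w Y}"
  by (auto simp: Hom_def localization_cat_def)

lemma localization_cat_Cmp:
  assumes "category C" and "zigzag C W X v Y" and "zigzag C W Y w Z"
  shows "(Y, zigzag_class C W Y Z w, Z) \<cdot>\<^bsub>localization_cat C W\<^esub> (X, zigzag_class C W X Y v, Y) =
    (X, zigzag_class C W X Z (v @ w), Z)"
proof -
  have "zigzag_eq C W X Y v v" "zigzag_eq C W Y Z w w"
    using assms by (auto intro: zigzag_eq.refl)
  moreover have "zigzag_eq C W X Z (v @ w) u"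
    if "zigzag_eq C W X Y v a" "zigzag_eq C W Y Z w b" "zigzag_eq C W X Z (a @ b) u" for a b u
    using zigzag_eq_append2[OF that(1,2) assms(1)] that(3) by (rule zigzag_eq.trans)
  ultimately have "{u. \<exists>a \<in> zigzag_class C W X Y v. \<exists>b \<in> zigzag_class C W Y Z w.
      zigzag_eq C W X Z (a @ b) u} = zigzag_class C W X Z (v @ w)"
    unfolding zigzag_class_def by blast
  then show ?thesis by (simp add: localization_cat_def)
qed

theorem localization_cat_category:
  assumes C: "category C"
  shows "category (localization_cat C W)"
proof
  let ?L = "localization_cat C W"
  show "Src ?L f \<in> Ob ?L" if "f \<in> Ar ?L" for f
    using that zigzag_ends[OF C] by (auto simp: localization_cat_def)
  show "Tgt ?L f \<in> Ob ?L" if "f \<in> Ar ?L" for f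
    using that zigzag_ends[OF C] by (auto simp: localization_cat_def)
  have Id: "Ident ?L X = (X, zigzag_class C W X X [], X)" for X
    by (simp add: localization_cat_def)
  show "Ident ?L X \<in> Hom ?L X X" if "X \<in> Ob ?L" for X
    using that zigzag.Nil[of X C W] unfolding Id localization_cat_Hom
    by (auto simp: localization_cat_def)
  have dest: "\<exists>w. zigzag C W X w Y \<and> f = (X, zigzag_class C W X Y w, Y)"
    if "f \<in> Hom ?L X Y" for f X Y
    using that by (simp add: localization_cat_Hom conj_commute)
  show "g \<cdot>\<^bsub>?L\<^esub> f \<in> Hom ?L X Z" if fg: "f \<in> Hom ?L X Y" "g \<in> Hom ?L Y Z" for f g X Y Z
  proof -
    obtain v where v: "zigzag C W X v Y" "f = (X, zigzag_class C W X Y v, Y)"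
      using dest[OF fg(1)] by (elim exE conjE)
    obtain w where w: "zigzag C W Y w Z" "g = (Y, zigzag_class C W Y Z w, Z)"
      using dest[OF fg(2)] by (elim exE conjE)
    have "g \<cdot>\<^bsub>?L\<^esub> f = (X, zigzag_class C W X Z (v @ w), Z)"
      unfolding v(2) w(2) by (rule localization_cat_Cmp[OF C v(1) w(1)])
    then show ?thesis
      unfolding localization_cat_Hom using zigzag_append[OF v(1) w(1)] by blast
  qed
  show "(h \<cdot>\<^bsub>?L\<^esub> g) \<cdot>\<^bsub>?L\<^esub> f = h \<cdot>\<^bsub>?L\<^esub> (g \<cdot>\<^bsub>?L\<^esub> f)"
    if fgh: "f \<in> Hom ?L V X" "g \<in> Hom ?L X Y" "h \<in> Hom ?L Y Z" for f g h V X Y Z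
  proof -
    obtain u where u: "zigzag C W V u X" "f = (V, zigzag_class C W V X u, X)"
      using dest[OF fgh(1)] by (elim exE conjE)
    obtain v where v: "zigzag C W X v Y" "g = (X, zigzag_class C W X Y v, Y)"
      using dest[OF fgh(2)] by (elim exE conjE)
    obtain w where w: "zigzag C W Y w Z" "h = (Y, zigzag_class C W Y Z w, Z)"
      using dest[OF fgh(3)] by (elim exE conjE)
    show ?thesis
      unfolding u(2) v(2) w(2) localization_cat_Cmp[OF C u(1) v(1)]
        localization_cat_Cmp[OF C v(1) w(1)]
        localization_cat_Cmp[OF C u(1) zigzag_append[OF v(1) w(1)]]
        localization_cat_Cmp[OF C zigzag_append[OF u(1) v(1)] w(1)] append_assoc
      by (rule HOL.refl)
  qed
  show "Ident ?L Y \<cdot>\<^bsub>?L\<^esub> f = f" if f: "f \<in> Hom ?L X Y" for f X Y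
  proof -
    obtain u where u: "zigzag C W X u Y" "f = (X, zigzag_class C W X Y u, Y)"
      using dest[OF f] by (elim exE conjE)
    have "zigzag C W Y [] Y" using zigzag_ends[OF C u(1)] by (simp add: zigzag.Nil)
    then show ?thesis unfolding Id u(2) using localization_cat_Cmp[OF C u(1)] by simp
  qed
  show "f \<cdot>\<^bsub>?L\<^esub> Ident ?L X = f" if f: "f \<in> Hom ?L X Y" for f X Y
  proof -
    obtain u where u: "zigzag C W X u Y" "f = (X, zigzag_class C W X Y u, Y)"
      using dest[OF f] by (elim exE conjE)
    have "zigzag C W X [] X" using zigzag_ends[OF C u(1)] by (simp add: zigzag.Nil)
    then show ?thesis unfolding Id u(2) using localization_cat_Cmp[OF C _ u(1)] by simp
  qed
qed

theorem localization_cat_inverts: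
  assumes C: "category C" and s: "s \<in> W" "s \<in> Hom C X Y"
  shows "is_isomorphism (localization_cat C W) (X, zigzag_class C W X Y [Fwd s], Y)"
proof -
  let ?L = "localization_cat C W"
  have ob: "X \<in> Ob C" "Y \<in> Ob C"
    using s category.Src_Ob[OF C] category.Tgt_Ob[OF C] by (auto simp: Hom_def)
  have nil: "zigzag C W X [] X" "zigzag C W Y [] Y" using ob by (auto intro: zigzag.Nil)
  have f: "zigzag C W X [Fwd s] Y"
    using zigzag.Fwd[of s C W "[]" Y] s nil by (auto simp: Hom_def)
  have b: "zigzag C W Y [Bwd s] X"
    using zigzag.Bwd[of s C W "[]" X] s nil by (auto simp: Hom_def)
  have "zigzag_eq C W X X ([] @ [Fwd s, Bwd s] @ []) ([] @ [] @ [])"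
    using zigzag_append[OF f b] nil by (intro zigzag_eq.step zigzag_step.intros) auto
  then have fb: "zigzag_class C W X X [Fwd s, Bwd s] = zigzag_class C W X X []"
    by (intro zigzag_class_eqI) simp
  have "zigzag_eq C W Y Y ([] @ [Bwd s, Fwd s] @ []) ([] @ [] @ [])"
    using zigzag_append[OF b f] nil by (intro zigzag_eq.step zigzag_step.intros) auto
  then have bf: "zigzag_class C W Y Y [Bwd s, Fwd s] = zigzag_class C W Y Y []"
    by (intro zigzag_class_eqI) simp
  have "is_inverse ?L (X, zigzag_class C W X Y [Fwd s], Y) (Y, zigzag_class C W Y X [Bwd s], X)"
    using localization_cat_Cmp[OF C f b] localization_cat_Cmp[OF C b f] fb bf f b
    unfolding is_inverse_def localization_cat_Hom
    by (auto simp: localization_cat_def)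
  then show ?thesis by (auto simp: is_isomorphism_def)
qed


section \<open>Bounded derived categories\<close>

record ('o, 'm) cochain =
  CO :: "int \<Rightarrow> 'o"
  CD :: "int \<Rightarrow> 'm"

definition bounded_complex ::
  "('o, 'm, 'k, 'x) lincat_scheme \<Rightarrow> ('o, 'm) cochain \<Rightarrow> bool" where
  "bounded_complex A K \<longleftrightarrow>
     (\<forall>i. CO K i \<in> Ob A \<and> CD K i \<in> Hom A (CO K i) (CO K (i + 1)) \<and>
        CD K (i + 1) \<cdot>\<^bsub>A\<^esub> CD K i = Zer A (CO K i) (CO K (i + 1 + 1))) \<and>
     (\<exists>n. \<forall>i. \<bar>i\<bar> > n \<longrightarrow> is_zero_object A (CO K i))"

definition complex_map ::
  "('o, 'm, 'k, 'x) lincat_scheme \<Rightarrow> ('o, 'm) cochain \<Rightarrow> (int \<Rightarrow> 'm) \<Rightarrow> ('o, 'm) cochain \<Rightarrow> bool" where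
  "complex_map A K f L \<longleftrightarrow>
     (\<forall>i. f i \<in> Hom A (CO K i) (CO L i) \<and> f (i + 1) \<cdot>\<^bsub>A\<^esub> CD K i = CD L i \<cdot>\<^bsub>A\<^esub> f i)"

type_synonym ('o, 'm) cochain_arrow = "('o, 'm) cochain \<times> (int \<Rightarrow> 'm) \<times> ('o, 'm) cochain"

definition complex_cat ::
  "('o, 'm, 'k, 'x) lincat_scheme \<Rightarrow> (('o, 'm) cochain, ('o, 'm) cochain_arrow) cat" where
  "complex_cat A =
     \<lparr>Ob = {K. bounded_complex A K},
      Ar = {(K, f, L) | K f L. bounded_complex A K \<and> bounded_complex A L \<and> complex_map A K f L},
      Src = (\<lambda>(K, f, L). K),
      Tgt = (\<lambda>(K, f, L). L),
      Ident = (\<lambda>K. (K, \<lambda>i. Ident A (CO K i), K)),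
      Cmp = (\<lambda>(L', g, N) (K, f, L). (K, \<lambda>i. g i \<cdot>\<^bsub>A\<^esub> f i, N))\<rparr>"

lemma complex_cat_category:
  assumes "linear_category A"
  shows "category (complex_cat A)"
proof -
  interpret A: linear_category A by fact
  have ob: "CO K i \<in> Ob A" and d: "CD K i \<in> Hom A (CO K i) (CO K (i + 1))"
    if "bounded_complex A K" for K i
    using that by (auto simp: bounded_complex_def)
  have comp: "complex_map A K (\<lambda>i. g i \<cdot>\<^bsub>A\<^esub> f i) N"
    if K: "bounded_complex A K" "bounded_complex A L" "bounded_complex A N"
      and f: "complex_map A K f L" and g: "complex_map A L g N" for K L N f g
    unfolding complex_map_def
  proof (intro allI conjI)
    fix i
    have fi: "f i \<in> Hom A (CO K i) (CO L i)" "f (i + 1) \<cdot>\<^bsub>A\<^esub> CD K i = CD L i \<cdot>\<^bsub>A\<^esub> f i" for i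
      using f by (auto simp: complex_map_def)
    have gi: "g i \<in> Hom A (CO L i) (CO N i)" "g (i + 1) \<cdot>\<^bsub>A\<^esub> CD L i = CD N i \<cdot>\<^bsub>A\<^esub> g i" for i
      using g by (auto simp: complex_map_def)
    show "g i \<cdot>\<^bsub>A\<^esub> f i \<in> Hom A (CO K i) (CO N i)"
      by (rule A.Cmp_Hom[OF fi(1) gi(1)])
    show "(g (i + 1) \<cdot>\<^bsub>A\<^esub> f (i + 1)) \<cdot>\<^bsub>A\<^esub> CD K i = CD N i \<cdot>\<^bsub>A\<^esub> (g i \<cdot>\<^bsub>A\<^esub> f i)"
      using A.Cmp_assoc[OF d[OF K(1)] fi(1) gi(1)] A.Cmp_assoc[OF fi(1) d[OF K(2)] gi(1)]
        A.Cmp_assoc[OF fi(1) gi(1) d[OF K(3)]] by (simp add: fi(2) gi(2))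
  qed
  have ident: "complex_map A K (\<lambda>i. Ident A (CO K i)) K" if "bounded_complex A K" for K
    using A.Id_Hom[OF ob[OF that]] A.Id_left[OF d[OF that]] A.Id_right[OF d[OF that]]
    by (simp add: complex_map_def)
  have Hom_iff: "(F \<in> Hom (complex_cat A) K L) \<longleftrightarrow>
      (\<exists>f. F = (K, f, L) \<and> bounded_complex A K \<and> bounded_complex A L \<and> complex_map A K f L)"
    for F K L
    by (auto simp: Hom_def complex_cat_def)
  have maps: "f i \<in> Hom A (CO K i) (CO L i)" if "complex_map A K f L" for K L f i
    using that by (simp add: complex_map_def)
  show ?thesis
  proof
    show "Src (complex_cat A) F \<in> Ob (complex_cat A)" if "F \<in> Ar (complex_cat A)" for F
      using that by (auto simp: complex_cat_def)
    show "Tgt (complex_cat A) F \<in> Ob (complex_cat A)" if "F \<in> Ar (complex_cat A)" for F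
      using that by (auto simp: complex_cat_def)
    show "Ident (complex_cat A) K \<in> Hom (complex_cat A) K K" if "K \<in> Ob (complex_cat A)" for K
      using that ident unfolding Hom_iff by (simp add: complex_cat_def)
    show "G \<cdot>\<^bsub>complex_cat A\<^esub> F \<in> Hom (complex_cat A) K N"
      if "F \<in> Hom (complex_cat A) K L" "G \<in> Hom (complex_cat A) L N" for F G K L N
      using that comp unfolding Hom_iff by (auto simp: complex_cat_def)
    show "(H \<cdot>\<^bsub>complex_cat A\<^esub> G) \<cdot>\<^bsub>complex_cat A\<^esub> F = H \<cdot>\<^bsub>complex_cat A\<^esub> (G \<cdot>\<^bsub>complex_cat A\<^esub> F)"
      if "F \<in> Hom (complex_cat A) J K" "G \<in> Hom (complex_cat A) K L" "H \<in> Hom (complex_cat A) L N"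
      for F G H J K L N
      using that unfolding Hom_iff
      by (auto simp: complex_cat_def fun_eq_iff intro: A.Cmp_assoc maps)
    show "Ident (complex_cat A) L \<cdot>\<^bsub>complex_cat A\<^esub> F = F" if "F \<in> Hom (complex_cat A) K L" for F K L
      using that unfolding Hom_iff
      by (auto simp: complex_cat_def fun_eq_iff intro: A.Id_left maps)
    show "F \<cdot>\<^bsub>complex_cat A\<^esub> Ident (complex_cat A) K = F" if "F \<in> Hom (complex_cat A) K L" for F K L
      using that unfolding Hom_iff
      by (auto simp: complex_cat_def fun_eq_iff intro: A.Id_right maps)
  qed
qed

text \<open>
  \<open>is_cohomology A K i z b c\<close>: \<open>z\<close> is a kernel of the \<open>i\<close>-th differential, the preceding
  differential factors through \<open>z\<close> as \<open>b\<close>, and \<open>c\<close> is a cokernel of \<open>b\<close>; the target of \<open>c\<close>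
  is the \<open>i\<close>-th cohomology object.
\<close>

definition is_cohomology ::
  "('o, 'm, 'k, 'x) lincat_scheme \<Rightarrow> ('o, 'm) cochain \<Rightarrow> int \<Rightarrow> 'm \<Rightarrow> 'm \<Rightarrow> 'm \<Rightarrow> bool" where
  "is_cohomology A K i z b c \<longleftrightarrow> is_kernel A (CD K i) z \<and>
     b \<in> Hom A (CO K (i - 1)) (Src A z) \<and> z \<cdot>\<^bsub>A\<^esub> b = CD K (i - 1) \<and> is_cokernel A b c"

definition induced_on_cohomology ::
  "('o, 'm, 'k, 'x) lincat_scheme \<Rightarrow> ('o, 'm) cochain \<Rightarrow> (int \<Rightarrow> 'm) \<Rightarrow> ('o, 'm) cochain \<Rightarrow> int \<Rightarrow> 'm \<Rightarrow> bool"
  where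
  "induced_on_cohomology A K f L i h \<longleftrightarrow>
     (\<exists>z b c z' b' c' t. is_cohomology A K i z b c \<and> is_cohomology A L i z' b' c' \<and>
        t \<in> Hom A (Src A z) (Src A z') \<and> z' \<cdot>\<^bsub>A\<^esub> t = f i \<cdot>\<^bsub>A\<^esub> z \<and>
        h \<in> Hom A (Tgt A c) (Tgt A c') \<and> h \<cdot>\<^bsub>A\<^esub> c = c' \<cdot>\<^bsub>A\<^esub> t)"

definition quasi_isos :: "('o, 'm, 'k, 'x) lincat_scheme \<Rightarrow> ('o, 'm) cochain_arrow set" where
  "quasi_isos A = {(K, f, L). (K, f, L) \<in> Ar (complex_cat A) \<and>
     (\<forall>i h. induced_on_cohomology A K f L i h \<longrightarrow> is_isomorphism A h)}"

definition derived_cat ::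
  "('o, 'm, 'k, 'x) lincat_scheme \<Rightarrow>
   (('o, 'm) cochain, ('o, 'm) cochain \<times> ('o, 'm) cochain_arrow letter list set \<times> ('o, 'm) cochain) cat" where
  "derived_cat A = localization_cat (complex_cat A) (quasi_isos A)"

definition shift_complex :: "('o, 'm, 'k::field, 'x) lincat_scheme \<Rightarrow> int \<Rightarrow> ('o, 'm) cochain \<Rightarrow> ('o, 'm) cochain" where
  "shift_complex A a K =
     \<lparr>CO = (\<lambda>i. CO K (i + a)),
      CD = (\<lambda>i. if even a then CD K (i + a) else Scl A (- 1) (CD K (i + a)))\<rparr>"

definition chosen_zero :: "('o, 'm, 'x) cat_scheme \<Rightarrow> 'o" where
  "chosen_zero A = (SOME X. is_zero_object A X)"

definition stalk :: "('o, 'm, 'k, 'x) lincat_scheme \<Rightarrow> 'o \<Rightarrow> ('o, 'm) cochain" where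
  "stalk A S = (let F = (\<lambda>i::int. if i = 0 then S else chosen_zero A)
                in \<lparr>CO = F, CD = (\<lambda>i. Zer A (F i) (F (i + 1)))\<rparr>)"

text \<open>
  A \<open>t\<close>-structure is represented by the pair of object sets \<open>(D\<^sup>\<le>\<^sup>0, D\<^sup>\<ge>\<^sup>1)\<close>.
\<close>

type_synonym ('o, 'm) t_structure = "('o, 'm) cochain set \<times> ('o, 'm) cochain set"

definition t_le ::
  "('o, 'm, 'k::field, 'x) lincat_scheme \<Rightarrow> ('o, 'm) t_structure \<Rightarrow> int \<Rightarrow> ('o, 'm) cochain set" where
  "t_le A t n = shift_complex A (- n) ` fst t"

definition t_ge ::
  "('o, 'm, 'k::field, 'x) lincat_scheme \<Rightarrow> ('o, 'm) t_structure \<Rightarrow> int \<Rightarrow> ('o, 'm) cochain set" where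
  "t_ge A t n = shift_complex A (- n) ` shift_complex A 1 ` snd t"

definition shift_t_structure ::
  "('o, 'm, 'k::field, 'x) lincat_scheme \<Rightarrow> ('o set \<Rightarrow> int) \<Rightarrow> ('o, 'm) t_structure" where
  "shift_t_structure A p =
     (add_closure (derived_cat A) {shift_complex A a (stalk A S) | S a. is_simple A S \<and> a \<ge> p (iso_class A S)},
      add_closure (derived_cat A) {shift_complex A a (stalk A S) | S a. is_simple A S \<and> a < p (iso_class A S)})"

text \<open>
  \<open>T\<close> is the complex \<open>K \<odot> L\<close>, with \<open>\<iota> i j\<close> the inclusion of \<open>K\<^sup>i \<odot> L\<^sup>j\<close> into \<open>T\<close>.
  Degree \<open>r\<close> of \<open>T\<close> is a sum over all \<open>i\<close>, with \<open>j = r - i\<close>.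
\<close>

definition is_action_complex ::
  "('o, 'm, 'k::field, 'x) lincat_scheme \<Rightarrow> ('o, 'm, 'p, 'n, 'k, 'y) modcat_scheme \<Rightarrow>
   ('o, 'm) cochain \<Rightarrow> ('p, 'n) cochain \<Rightarrow> ('p, 'n) cochain \<Rightarrow> bool" where
  "is_action_complex C M K L T \<longleftrightarrow> bounded_complex M T \<and>
     (\<exists>\<iota> :: int \<Rightarrow> int \<Rightarrow> 'n.
        (\<forall>r. is_coproduct M (UNIV :: int set) (\<lambda>i. act M (CO K i) (CO L (r - i))) (CO T r)
               (\<lambda>i. \<iota> i (r - i))) \<and>
        (\<forall>i j. CD T (i + j) \<cdot>\<^bsub>M\<^esub> \<iota> i j =
           Add M (\<iota> (i + 1) j \<cdot>\<^bsub>M\<^esub> actA M (CD K i) (Ident M (CO L j)))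
                 (Scl M (if even i then 1 else - 1) (\<iota> i (j + 1) \<cdot>\<^bsub>M\<^esub> actA M (Ident C (CO K i)) (CD L j)))))"

definition derived_act ::
  "('o, 'm, 'k::field, 'x) lincat_scheme \<Rightarrow> ('o, 'm, 'p, 'n, 'k, 'y) modcat_scheme \<Rightarrow>
   ('o, 'm) cochain \<Rightarrow> ('p, 'n) cochain \<Rightarrow> ('p, 'n) cochain" where
  "derived_act C M K L = (SOME T. is_action_complex C M K L T)"

definition module_deviations ::
  "('o, 'm, 'k::field, 'x) lincat_scheme \<Rightarrow> ('o, 'm, 'p, 'n, 'k, 'y) modcat_scheme \<Rightarrow>
   ('o, 'm) t_structure \<Rightarrow> ('p, 'n) t_structure \<Rightarrow> int set" where
  "module_deviations C M tq tp = {m.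
     (\<forall>K \<in> t_le C tq 0. \<forall>L \<in> t_le M tp m. derived_act C M K L \<in> t_le M tp 0) \<and>
     (\<forall>K \<in> t_ge C tq 0. \<forall>L \<in> t_ge M tp m. derived_act C M K L \<in> t_ge M tp 0)}"


section \<open>The universal grading group\<close>

text \<open>
  The group with generators \<open>G\<close> and relations \<open>R\<close>.  A letter \<open>(g, True)\<close> stands for the
  generator \<open>g\<close> and \<open>(g, False)\<close> for its inverse.
\<close>

type_synonym 'g word = "('g \<times> bool) list"

inductive pres_eq :: "'g set \<Rightarrow> ('g word \<times> 'g word) set \<Rightarrow> 'g word \<Rightarrow> 'g word \<Rightarrow> bool"
  for G :: "'g set" and R :: "('g word \<times> 'g word) set" where
  refl: "w \<in> lists (G \<times> UNIV) \<Longrightarrow> pres_eq G R w w"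
| sym: "pres_eq G R v w \<Longrightarrow> pres_eq G R w v"
| trans: "pres_eq G R u v \<Longrightarrow> pres_eq G R v w \<Longrightarrow> pres_eq G R u w"
| cancel: "g \<in> G \<Longrightarrow> u \<in> lists (G \<times> UNIV) \<Longrightarrow> v \<in> lists (G \<times> UNIV) \<Longrightarrow>
    pres_eq G R (u @ [(g, e), (g, \<not> e)] @ v) (u @ v)"
| relation: "(r, s) \<in> R \<Longrightarrow> r \<in> lists (G \<times> UNIV) \<Longrightarrow> s \<in> lists (G \<times> UNIV) \<Longrightarrow>
    u \<in> lists (G \<times> UNIV) \<Longrightarrow> v \<in> lists (G \<times> UNIV) \<Longrightarrow> pres_eq G R (u @ r @ v) (u @ s @ v)"

definition pres_class :: "'g set \<Rightarrow> ('g word \<times> 'g word) set \<Rightarrow> 'g word \<Rightarrow> 'g word set" where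
  "pres_class G R w = {w'. pres_eq G R w w'}"

definition presented_group :: "'g set \<Rightarrow> ('g word \<times> 'g word) set \<Rightarrow> 'g word set monoid" where
  "presented_group G R =
     \<lparr>carrier = pres_class G R ` lists (G \<times> UNIV),
      monoid.mult = (\<lambda>A B. {w. \<exists>a \<in> A. \<exists>b \<in> B. pres_eq G R (a @ b) w}),
      one = pres_class G R []\<rparr>"

lemma pres_eq_words:
  "pres_eq G R v w \<Longrightarrow> v \<in> lists (G \<times> UNIV) \<and> w \<in> lists (G \<times> UNIV)"
  by (induction rule: pres_eq.induct) auto

lemma pres_eq_append:
  assumes "pres_eq G R v w" and "a \<in> lists (G \<times> UNIV)" and "b \<in> lists (G \<times> UNIV)"
  shows "pres_eq G R (a @ v @ b) (a @ w @ b)"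
  using assms
proof (induction rule: pres_eq.induct)
  case (refl w)
  then show ?case by (intro pres_eq.refl) auto
next
  case (sym v w)
  then show ?case by (blast intro: pres_eq.sym)
next
  case (trans u v w)
  then show ?case by (blast intro: pres_eq.trans)
next
  case (cancel g u v e)
  then show ?case using pres_eq.cancel[of g G "a @ u" "v @ b" R e] by simp
next
  case (relation r s u v)
  then show ?case using pres_eq.relation[of r s R G "a @ u" "v @ b"] by simp
qed

lemma pres_eq_append2:
  assumes "pres_eq G R v w" and "pres_eq G R v' w'"
  shows "pres_eq G R (v @ v') (w @ w')"
proof -
  have "pres_eq G R ([] @ v @ v') ([] @ w @ v')"
    using assms by (intro pres_eq_append) (auto dest: pres_eq_words)
  moreover have "pres_eq G R (w @ v' @ []) (w @ w' @ [])"
    using assms by (intro pres_eq_append) (auto dest: pres_eq_words)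
  ultimately show ?thesis by (auto intro: pres_eq.trans)
qed

lemma pres_class_eq_iff:
  assumes "v \<in> lists (G \<times> UNIV)"
  shows "pres_class G R v = pres_class G R w \<longleftrightarrow> pres_eq G R v w"
  using assms unfolding pres_class_def
  by (auto intro: pres_eq.refl pres_eq.sym pres_eq.trans)

lemma presented_group_mult:
  assumes "v \<in> lists (G \<times> UNIV)" and "w \<in> lists (G \<times> UNIV)"
  shows "pres_class G R v \<otimes>\<^bsub>presented_group G R\<^esub> pres_class G R w = pres_class G R (v @ w)"
proof -
  have "pres_eq G R v v" "pres_eq G R w w"
    using assms by (auto intro: pres_eq.refl)
  then show ?thesis
    unfolding pres_class_def presented_group_def
    by (auto intro: pres_eq.trans pres_eq_append2)
qed

lemma presented_group_inverse:
  assumes "w \<in> lists (G \<times> UNIV)"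
  shows "pres_eq G R (rev (map (\<lambda>(g, e). (g, \<not> e)) w) @ w) []"
  using assms
proof (induction w)
  case Nil
  then show ?case by (simp add: pres_eq.refl)
next
  case (Cons x w)
  obtain g e where x: "x = (g, e)" by force
  let ?u = "rev (map (\<lambda>(g, e). (g, \<not> e)) w)"
  have gw: "g \<in> G" "w \<in> lists (G \<times> UNIV)" using Cons.hyps x by simp_all
  have "?u \<in> lists (G \<times> UNIV)" using gw(2) by auto
  then have "pres_eq G R (?u @ [(g, \<not> e), (g, \<not> \<not> e)] @ w) (?u @ w)"
    using gw by (intro pres_eq.cancel)
  with Cons x show ?case by (auto intro: pres_eq.trans)
qed

lemma presented_group_is_group: "group (presented_group G R)"
proof (rule groupI)
  show "\<one>\<^bsub>presented_group G R\<^esub> \<in> carrier (presented_group G R)"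
    by (simp add: presented_group_def)
next
  fix x y assume "x \<in> carrier (presented_group G R)" "y \<in> carrier (presented_group G R)"
  then obtain v w where vw: "v \<in> lists (G \<times> UNIV)" "w \<in> lists (G \<times> UNIV)"
      and xy: "x = pres_class G R v" "y = pres_class G R w"
    by (auto simp: presented_group_def)
  have "v @ w \<in> lists (G \<times> UNIV)" using vw by auto
  then show "x \<otimes>\<^bsub>presented_group G R\<^esub> y \<in> carrier (presented_group G R)"
    unfolding xy presented_group_mult[OF vw] by (simp add: presented_group_def)
next
  fix x y z
  assume "x \<in> carrier (presented_group G R)" "y \<in> carrier (presented_group G R)"
    "z \<in> carrier (presented_group G R)"
  then obtain u v w where uvw: "u \<in> lists (G \<times> UNIV)" "v \<in> lists (G \<times> UNIV)" "w \<in> lists (G \<times> UNIV)"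
      and xyz: "x = pres_class G R u" "y = pres_class G R v" "z = pres_class G R w"
    by (auto simp: presented_group_def)
  have "u @ v \<in> lists (G \<times> UNIV)" "v @ w \<in> lists (G \<times> UNIV)" using uvw by auto
  then show "x \<otimes>\<^bsub>presented_group G R\<^esub> y \<otimes>\<^bsub>presented_group G R\<^esub> z =
      x \<otimes>\<^bsub>presented_group G R\<^esub> (y \<otimes>\<^bsub>presented_group G R\<^esub> z)"
    using uvw by (simp only: xyz presented_group_mult append_assoc)
next
  fix x assume "x \<in> carrier (presented_group G R)"
  then obtain w where w: "w \<in> lists (G \<times> UNIV)" and x: "x = pres_class G R w"
    by (auto simp: presented_group_def)
  have one: "\<one>\<^bsub>presented_group G R\<^esub> = pres_class G R []"
    by (simp add: presented_group_def)
  show "\<one>\<^bsub>presented_group G R\<^esub> \<otimes>\<^bsub>presented_group G R\<^esub> x = x"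
    using presented_group_mult[of "[]" G w R] w x one by simp
  let ?w = "rev (map (\<lambda>(g, e). (g, \<not> e)) w)"
  have w': "?w \<in> lists (G \<times> UNIV)" using w by auto
  have "pres_class G R (?w @ w) = pres_class G R []"
    using presented_group_inverse[OF w, of R] w w' by (simp add: pres_class_eq_iff)
  then have "pres_class G R ?w \<otimes>\<^bsub>presented_group G R\<^esub> x = \<one>\<^bsub>presented_group G R\<^esub>"
    using presented_group_mult[OF w' w, of R] x one by simp
  moreover have "pres_class G R ?w \<in> carrier (presented_group G R)"
    using w' by (simp add: presented_group_def)
  ultimately show "\<exists>y \<in> carrier (presented_group G R).
      y \<otimes>\<^bsub>presented_group G R\<^esub> x = \<one>\<^bsub>presented_group G R\<^esub>" by blast
qed

definition word_value :: "('u, 'x) monoid_scheme \<Rightarrow> ('g \<Rightarrow> 'u) \<Rightarrow> 'g word \<Rightarrow> 'u" where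
  "word_value U f w = foldr (\<lambda>(g, e) x. (if e then f g else inv\<^bsub>U\<^esub> f g) \<otimes>\<^bsub>U\<^esub> x) w \<one>\<^bsub>U\<^esub>"

lemma presented_group_universal:
  assumes "group U" and f: "f \<in> G \<rightarrow> carrier U"
    and rel: "\<And>r s. (r, s) \<in> R \<Longrightarrow> word_value U f r = word_value U f s"
  shows "\<exists>h \<in> hom (presented_group G R) U. \<forall>g \<in> G. h (pres_class G R [(g, True)]) = f g"
    and "\<And>h h' x. h \<in> hom (presented_group G R) U \<Longrightarrow> h' \<in> hom (presented_group G R) U \<Longrightarrow>
      \<forall>g \<in> G. h (pres_class G R [(g, True)]) = h' (pres_class G R [(g, True)]) \<Longrightarrow>
      x \<in> carrier (presented_group G R) \<Longrightarrow> h x = h' x"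
proof -
  interpret U: group U by fact
  interpret P: group "presented_group G R" by (rule presented_group_is_group)
  have val: "word_value U f w \<in> carrier U" if "w \<in> lists (G \<times> UNIV)" for w
    using that f by (induction w) (auto simp: word_value_def Pi_iff)
  have app: "word_value U f (v @ w) = word_value U f v \<otimes>\<^bsub>U\<^esub> word_value U f w"
    if "v \<in> lists (G \<times> UNIV)" "w \<in> lists (G \<times> UNIV)" for v w
    using that(1)
  proof (induction v)
    case Nil
    then show ?case using val[OF that(2)] by (simp add: word_value_def)
  next
    case (Cons x v)
    obtain g e where x: "x = (g, e)" by force
    have "f g \<in> carrier U" "v \<in> lists (G \<times> UNIV)" using Cons.hyps x f by (simp_all add: Pi_iff)
    moreover have "word_value U f v \<in> carrier U" "word_value U f w \<in> carrier U"
      using val that(2) calculation by auto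
    ultimately show ?case using Cons.IH x by (simp add: word_value_def U.m_assoc)
  qed
  have resp: "word_value U f v = word_value U f w" if "pres_eq G R v w" for v w
    using that
  proof (induction rule: pres_eq.induct)
    case (cancel g u v e)
    have l: "[(g, e), (g, \<not> e)] \<in> lists (G \<times> UNIV)" using cancel by auto
    have "f g \<in> carrier U" using cancel f by auto
    then have "word_value U f [(g, e), (g, \<not> e)] = \<one>\<^bsub>U\<^esub>"
      by (simp add: word_value_def)
    moreover have "[(g, e), (g, \<not> e)] @ v \<in> lists (G \<times> UNIV)" using l cancel by auto
    ultimately show ?case using cancel l by (simp only: app val U.l_one)
  next
    case (relation r s u v)
    have "r @ v \<in> lists (G \<times> UNIV)" "s @ v \<in> lists (G \<times> UNIV)" using relation by auto
    then show ?case using relation rel[OF relation(1)] by (simp only: app)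
  qed auto
  define h where "h A = word_value U f (SOME w. w \<in> A)" for A
  have h: "h (pres_class G R w) = word_value U f w" if "w \<in> lists (G \<times> UNIV)" for w
  proof -
    have "w \<in> pres_class G R w" using that by (simp add: pres_class_def pres_eq.refl)
    then have "(SOME v. v \<in> pres_class G R w) \<in> pres_class G R w" by (rule someI)
    then show ?thesis using resp unfolding h_def by (simp add: pres_class_def)
  qed
  have "h \<in> hom (presented_group G R) U"
  proof (rule homI)
    fix x assume "x \<in> carrier (presented_group G R)"
    then obtain w where "w \<in> lists (G \<times> UNIV)" "x = pres_class G R w"
      by (auto simp: presented_group_def)
    then show "h x \<in> carrier U" using h val by simp
  next
    fix x y assume "x \<in> carrier (presented_group G R)" "y \<in> carrier (presented_group G R)"
    then obtain v w where vw: "v \<in> lists (G \<times> UNIV)" "w \<in> lists (G \<times> UNIV)"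
        and xy: "x = pres_class G R v" "y = pres_class G R w"
      by (auto simp: presented_group_def)
    have "v @ w \<in> lists (G \<times> UNIV)" using vw by auto
    then show "h (x \<otimes>\<^bsub>presented_group G R\<^esub> y) = h x \<otimes>\<^bsub>U\<^esub> h y"
      using vw by (simp only: xy presented_group_mult h app)
  qed
  moreover have "\<forall>g \<in> G. h (pres_class G R [(g, True)]) = f g"
    using h f by (auto simp: word_value_def Pi_iff)
  ultimately show "\<exists>h \<in> hom (presented_group G R) U.
      \<forall>g \<in> G. h (pres_class G R [(g, True)]) = f g" by blast
  show "h x = h' x"
    if hom: "h \<in> hom (presented_group G R) U" "h' \<in> hom (presented_group G R) U"
      and gen: "\<forall>g \<in> G. h (pres_class G R [(g, True)]) = h' (pres_class G R [(g, True)])"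
      and x: "x \<in> carrier (presented_group G R)" for h h' x
  proof -
    interpret h: group_hom "presented_group G R" U h
      using hom(1) by unfold_locales
    interpret h': group_hom "presented_group G R" U h'
      using hom(2) by unfold_locales
    have letter: "h (pres_class G R [(g, e)]) = h' (pres_class G R [(g, e)])" if g: "g \<in> G" for g e
    proof (cases e)
      case True
      then show ?thesis using gen g by simp
    next
      case False
      have w: "[(g, False)] \<in> lists (G \<times> UNIV)" "[(g, True)] \<in> lists (G \<times> UNIV)" using g by auto
      have "pres_eq G R ([] @ [(g, False), (g, \<not> False)] @ []) ([] @ [])"
        using g by (intro pres_eq.cancel) auto
      then have "pres_class G R ([(g, False)] @ [(g, True)]) = pres_class G R []"
        using w(1) by (intro pres_class_eq_iff[THEN iffD2]) simp_all
      then have "pres_class G R [(g, False)] \<otimes>\<^bsub>presented_group G R\<^esub> pres_class G R [(g, True)]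
          = \<one>\<^bsub>presented_group G R\<^esub>"
        unfolding presented_group_mult[OF w] by (simp add: presented_group_def)
      moreover have c: "pres_class G R [(g, False)] \<in> carrier (presented_group G R)"
          "pres_class G R [(g, True)] \<in> carrier (presented_group G R)"
        using w by (auto simp: presented_group_def)
      ultimately have "pres_class G R [(g, False)] =
          inv\<^bsub>presented_group G R\<^esub> pres_class G R [(g, True)]"
        using P.inv_equality by metis
      then show ?thesis using False gen g c by simp
    qed
    obtain w where w: "w \<in> lists (G \<times> UNIV)" and xw: "x = pres_class G R w"
      using x by (auto simp: presented_group_def)
    have "h (pres_class G R w) = h' (pres_class G R w)" using w
    proof (induction w)
      case Nil
      have "\<one>\<^bsub>presented_group G R\<^esub> = pres_class G R []" by (simp add: presented_group_def)
      then show ?case using h.hom_one h'.hom_one by simp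
    next
      case (Cons y w)
      obtain g e where y: "y = (g, e)" by force
      have l: "[(g, e)] \<in> lists (G \<times> UNIV)" "w \<in> lists (G \<times> UNIV)" "g \<in> G" using Cons.hyps y by simp_all
      have c: "pres_class G R [(g, e)] \<in> carrier (presented_group G R)"
          "pres_class G R w \<in> carrier (presented_group G R)"
        using l by (auto simp: presented_group_def)
      have "pres_class G R (y # w) =
          pres_class G R [(g, e)] \<otimes>\<^bsub>presented_group G R\<^esub> pres_class G R w"
        using presented_group_mult[OF l(1,2), of R] y by simp
      then show ?case
        using c l letter Cons.IH by (simp add: h.hom_mult h'.hom_mult)
    qed
    then show ?thesis using xw by simp
  qed
qed

definition tensor_summand :: "('o, 'm, 'k, 'x) tencat_scheme \<Rightarrow> 'o set \<Rightarrow> 'o set \<Rightarrow> 'o set \<Rightarrow> bool" where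
  "tensor_summand C X Y Z \<longleftrightarrow> X \<in> Irr_classes C \<and> Y \<in> Irr_classes C \<and> Z \<in> Irr_classes C \<and>
     (\<exists>x \<in> X. \<exists>y \<in> Y. \<exists>z \<in> Z. direct_summand C z (tens C x y))"

definition grading_relations :: "('o, 'm, 'k, 'x) tencat_scheme \<Rightarrow> ('o set word \<times> 'o set word) set" where
  "grading_relations C = {([(Z, True)], [(X, True), (Y, True)]) | X Y Z. tensor_summand C X Y Z}"

definition grading_group :: "('o, 'm, 'k, 'x) tencat_scheme \<Rightarrow> 'o set word set monoid" where
  "grading_group C = presented_group (Irr_classes C) (grading_relations C)"

definition grading_deg :: "('o, 'm, 'k, 'x) tencat_scheme \<Rightarrow> 'o set \<Rightarrow> 'o set word set" where
  "grading_deg C X = pres_class (Irr_classes C) (grading_relations C) [(X, True)]"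

text \<open>
  \<open>grading_deg\<close> is the universal map to a group that satisfies the defining equation.
\<close>

theorem grading_deg_multiplicative:
  assumes "tensor_summand C X Y Z"
  shows "grading_deg C Z = grading_deg C X \<otimes>\<^bsub>grading_group C\<^esub> grading_deg C Y"
proof -
  let ?G = "Irr_classes C" and ?R = "grading_relations C"
  have w: "[(X, True)] \<in> lists (?G \<times> UNIV)" "[(Y, True)] \<in> lists (?G \<times> UNIV)"
      "[(Z, True)] \<in> lists (?G \<times> UNIV)" "[(X, True), (Y, True)] \<in> lists (?G \<times> UNIV)"
    using assms by (auto simp: tensor_summand_def)
  have "([(Z, True)], [(X, True), (Y, True)]) \<in> ?R"
    using assms by (auto simp: grading_relations_def)
  then have "pres_eq ?G ?R ([] @ [(Z, True)] @ []) ([] @ [(X, True), (Y, True)] @ [])"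
    using w by (intro pres_eq.relation) auto
  then show ?thesis
    unfolding grading_deg_def grading_group_def presented_group_mult[OF w(1,2)]
    by (simp add: pres_class_eq_iff[OF w(3)])
qed

theorem grading_group_universal:
  assumes "group U" and f: "f \<in> Irr_classes C \<rightarrow> carrier U"
    and mult: "\<And>X Y Z. tensor_summand C X Y Z \<Longrightarrow> f Z = f X \<otimes>\<^bsub>U\<^esub> f Y"
  shows "\<exists>h \<in> hom (grading_group C) U. \<forall>X \<in> Irr_classes C. h (grading_deg C X) = f X"
    and "\<And>h h' x. h \<in> hom (grading_group C) U \<Longrightarrow> h' \<in> hom (grading_group C) U \<Longrightarrow>
      \<forall>X \<in> Irr_classes C. h (grading_deg C X) = h' (grading_deg C X) \<Longrightarrow>
      x \<in> carrier (grading_group C) \<Longrightarrow> h x = h' x"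
proof -
  interpret U: group U by fact
  have rel: "word_value U f r = word_value U f s" if "(r, s) \<in> grading_relations C" for r s
  proof -
    obtain X Y Z where t: "tensor_summand C X Y Z"
        and rs: "r = [(Z, True)]" "s = [(X, True), (Y, True)]"
      using \<open>(r, s) \<in> grading_relations C\<close> unfolding grading_relations_def by blast
    have "f X \<in> carrier U" "f Y \<in> carrier U" "f Z \<in> carrier U"
      using t f by (auto simp: tensor_summand_def)
    then show ?thesis using mult[OF t] by (simp add: rs word_value_def)
  qed
  show "\<exists>h \<in> hom (grading_group C) U. \<forall>X \<in> Irr_classes C. h (grading_deg C X) = f X"
    unfolding grading_group_def grading_deg_def
    by (rule presented_group_universal(1)[OF assms(1) f rel])
  show "h x = h' x"
    if "h \<in> hom (grading_group C) U" "h' \<in> hom (grading_group C) U"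
      "\<forall>X \<in> Irr_classes C. h (grading_deg C X) = h' (grading_deg C X)"
      "x \<in> carrier (grading_group C)" for h h' x
    using presented_group_universal(2)[where h = h and h' = h', OF assms(1) f rel] that
    unfolding grading_group_def grading_deg_def by blast
qed

definition graded_part :: "('o, 'm, 'k, 'x) tencat_scheme \<Rightarrow> 'o set word set \<Rightarrow> 'o set" where
  "graded_part C g = finite_sums C {x. is_simple C x \<and> grading_deg C (iso_class C x) = g}"


section \<open>Components of a module category\<close>

definition action_summand ::
  "('o, 'm, 'k, 'x) tencat_scheme \<Rightarrow> ('o, 'm, 'p, 'n, 'k, 'y) modcat_scheme \<Rightarrow>
   'o set \<Rightarrow> 'p set \<Rightarrow> 'p set \<Rightarrow> bool" where
  "action_summand C M X N P \<longleftrightarrow> X \<in> Irr_classes C \<and> N \<in> Irr_classes M \<and> P \<in> Irr_classes M \<and>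
     (\<exists>x \<in> X. \<exists>n \<in> N. \<exists>r \<in> P. direct_summand M r (act M x n))"

definition module_edges ::
  "('o, 'm, 'k, 'x) tencat_scheme \<Rightarrow> ('o, 'm, 'p, 'n, 'k, 'y) modcat_scheme \<Rightarrow> ('p set \<times> 'p set) set" where
  "module_edges C M = {(N, P). \<exists>X. action_summand C M X N P}"

definition module_components ::
  "('o, 'm, 'k, 'x) tencat_scheme \<Rightarrow> ('o, 'm, 'p, 'n, 'k, 'y) modcat_scheme \<Rightarrow> 'p set set set" where
  "module_components C M =
     {{P \<in> Irr_classes M. (N, P) \<in> (module_edges C M \<union> (module_edges C M)\<inverse>)\<^sup>*} | N. N \<in> Irr_classes M}"

definition component_stabilizer ::
  "('o, 'm, 'k, 'x) tencat_scheme \<Rightarrow> ('o, 'm, 'p, 'n, 'k, 'y) modcat_scheme \<Rightarrow>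
   'p set \<Rightarrow> 'o set word set set" where
  "component_stabilizer C M M0 = {g \<in> carrier (grading_group C).
     \<exists>X \<in> graded_part C g. \<exists>n \<in> M0. direct_summand M n (act M X n)}"

definition module_degree ::
  "('o, 'm, 'k, 'x) tencat_scheme \<Rightarrow> ('o, 'm, 'p, 'n, 'k, 'y) modcat_scheme \<Rightarrow>
   'p set \<Rightarrow> 'p set \<Rightarrow> 'o set word set set" where
  "module_degree C M M0 P = (THE K. \<exists>g \<in> carrier (grading_group C).
     K = g <#\<^bsub>grading_group C\<^esub> component_stabilizer C M M0 \<and>
     (\<exists>X \<in> graded_part C g. \<exists>n \<in> M0. \<exists>r \<in> P. direct_summand M r (act M X n)))"

definition module_graded_part ::
  "('o, 'm, 'k, 'x) tencat_scheme \<Rightarrow> ('o, 'm, 'p, 'n, 'k, 'y) modcat_scheme \<Rightarrow>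
   'p set set \<Rightarrow> 'p set \<Rightarrow> 'o set word set set \<Rightarrow> 'p set" where
  "module_graded_part C M \<Omega> M0 K = finite_sums M
     {r. is_simple M r \<and> iso_class M r \<in> \<Omega> \<and> module_degree C M M0 (iso_class M r) = K}"

text \<open>The equation \<open>p P = p N + \<chi> (grading_deg X)\<close>, for all \<open>N\<close> and \<open>P\<close> in a given set of classes.\<close>

definition degree_compatible ::
  "('o, 'm, 'k, 'x) tencat_scheme \<Rightarrow> ('o, 'm, 'p, 'n, 'k, 'y) modcat_scheme \<Rightarrow>
   ('o set word set \<Rightarrow> int) \<Rightarrow> 'p set set \<Rightarrow> ('p set \<Rightarrow> int) \<Rightarrow> bool" where
  "degree_compatible C M \<chi> S p \<longleftrightarrow>
     (\<forall>X. \<forall>N \<in> S. \<forall>P \<in> S. action_summand C M X N P \<longrightarrow> p P = p N + \<chi> (grading_deg C X))"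

text \<open>The equation \<open>p P = c + \<chi> g\<close>, for simple \<open>P\<close> in \<open>\<Omega>\<close> of degree \<open>g H\<close>.\<close>

definition coset_formula ::
  "('o, 'm, 'k, 'x) tencat_scheme \<Rightarrow> ('o, 'm, 'p, 'n, 'k, 'y) modcat_scheme \<Rightarrow>
   ('o set word set \<Rightarrow> int) \<Rightarrow> 'p set set \<Rightarrow> 'p set \<Rightarrow> int \<Rightarrow> ('p set \<Rightarrow> int) \<Rightarrow> bool" where
  "coset_formula C M \<chi> \<Omega> M0 c p \<longleftrightarrow>
     (\<forall>g \<in> carrier (grading_group C).
        \<forall>r \<in> module_graded_part C M \<Omega> M0 (g <#\<^bsub>grading_group C\<^esub> component_stabilizer C M M0).
          is_simple M r \<longrightarrow> p (iso_class M r) = c + \<chi> g)"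

end

theory Submission
  imports Defs
begin

text \<open>
  In a semisimple category every arrow \<open>f\<close> admits \<open>g\<close> with \<open>f g f = f\<close>, so every bounded complex has a
  deformation retraction onto its cohomology.  Hence every arrow of the derived category is the image of a
  chain map and is determined by its effect on cohomology, and membership in the additive closure of
  shifted simple objects only restricts which simple objects occur in which cohomology.  Retractions
  of \<open>K\<close> and \<open>L\<close> combine to one of \<open>K \<odot> L\<close>; this Kuenneth argument turns the two inclusions that
  define a deviation into opposite inequalities for \<open>p\<close>, which become equalities on stalk complexes.
  The unit object forces the deviation to be \<open>d\<close>.

  The relation ``\<open>P\<close> is a summand of \<open>X \<odot> N\<close> for a simple \<open>X\<close> of degree \<open>g\<close>'' composes along
  products in the grading group and, by rigidity, can be reversed with \<open>g\<close> replaced by its inverse.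
  So a solution of \<open>(\<ast>)\<close> on a component is determined by its value at the base object, and it
  exists exactly when \<open>\<chi>\<close> vanishes on the loops at the base object, that is, on the stabilizer.
\<close>

section \<open>Arrows of a linear category\<close>

text \<open>The derived category is a bare localization by zigzags, with neither an additive
  structure nor a calculus of fractions at hand. That two of its arrows differ is detected by
  extending the cohomology functors to zigzags. Equality and fullness rest on the fact that the
  inclusion of the cohomology complex becomes invertible: the formal inverse of a quasi-isomorphism
  is then the image of an honest chain map. Direct sums in the derived category are accessible only
  through their universal property, and images of zero chain maps stand in for zero arrows.

  All later arguments see a complex only through the predicate \<open>occurs\<close>, which mentions
  no choice of retraction; this is why the arbitrary representative picked by
  \<open>derived_act\<close> is harmless. The equalities in (1) arise because a stalk complex in the
  right degree lies in both halves of a t-structure, so that both inclusions apply to one and the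
  same pair of complexes.

  In the graded part, summands are replaced throughout by nonzero arrows from simple objects, since
  these can be composed, transported along structure isomorphisms and passed through
  duality.\<close>

context category
begin

lemma HomD:
  assumes "f \<in> Hom C X Y"
  shows "f \<in> Ar C" "Src C f = X" "Tgt C f = Y" "X \<in> Ob C" "Y \<in> Ob C"
  using assms Src_Ob Tgt_Ob by (auto simp: Hom_def)

lemma Ar_Id: "X \<in> Ob C \<Longrightarrow> Ident C X \<in> Ar C"
  and Src_Id: "X \<in> Ob C \<Longrightarrow> Src C (Ident C X) = X"
  and Tgt_Id: "X \<in> Ob C \<Longrightarrow> Tgt C (Ident C X) = X"
  using Id_Hom[of X] by (auto simp: Hom_def)

lemma Ar_Cmp: "f \<in> Ar C \<Longrightarrow> g \<in> Ar C \<Longrightarrow> Tgt C f = Src C g \<Longrightarrow> g \<cdot> f \<in> Ar C"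
  and Src_Cmp: "f \<in> Ar C \<Longrightarrow> g \<in> Ar C \<Longrightarrow> Tgt C f = Src C g \<Longrightarrow> Src C (g \<cdot> f) = Src C f"
  and Tgt_Cmp: "f \<in> Ar C \<Longrightarrow> g \<in> Ar C \<Longrightarrow> Tgt C f = Src C g \<Longrightarrow> Tgt C (g \<cdot> f) = Tgt C g"
  using Cmp_Hom[of f "Src C f" "Tgt C f" g "Tgt C g"] by (auto simp: Hom_def)

lemma Cmp_assoc_Ar: "f \<in> Ar C \<Longrightarrow> g \<in> Ar C \<Longrightarrow> h \<in> Ar C \<Longrightarrow> Tgt C f = Src C g \<Longrightarrow>
    Tgt C g = Src C h \<Longrightarrow> (h \<cdot> g) \<cdot> f = h \<cdot> (g \<cdot> f)"
  using Cmp_assoc[of f "Src C f" "Tgt C f" g "Tgt C g" h "Tgt C h"] by (auto simp: Hom_def)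

lemma Id_left_Ar: "f \<in> Ar C \<Longrightarrow> Tgt C f = Y \<Longrightarrow> Ident C Y \<cdot> f = f"
  and Id_right_Ar: "f \<in> Ar C \<Longrightarrow> Src C f = X \<Longrightarrow> f \<cdot> Ident C X = f"
  using Id_left Id_right by (auto simp: Hom_def)

lemmas arr = Ar_Id Src_Id Tgt_Id Ar_Cmp Src_Cmp Tgt_Cmp Cmp_assoc_Ar Id_left_Ar Id_right_Ar
  Src_Ob Tgt_Ob

lemma isomorphismE:
  assumes "is_isomorphism C f" "f \<in> Hom C X Y"
  obtains g where "g \<in> Hom C Y X" "g \<cdot> f = Ident C X" "f \<cdot> g = Ident C Y"
  using assms by (auto simp: is_isomorphism_def is_inverse_def Hom_def)

lemma isomorphismI:
  assumes "f \<in> Hom C X Y" "g \<in> Hom C Y X" "g \<cdot> f = Ident C X" "f \<cdot> g = Ident C Y"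
  shows "is_isomorphism C f"
  using assms by (auto simp: is_isomorphism_def is_inverse_def Hom_def)

lemma isomorphism_Id: "X \<in> Ob C \<Longrightarrow> is_isomorphism C (Ident C X)"
  by (rule isomorphismI[of _ X X "Ident C X"]) (auto simp: arr intro: Id_Hom)

lemma isomorphism_Cmp:
  assumes "is_isomorphism C f" "is_isomorphism C g" and fg: "f \<in> Hom C X Y" "g \<in> Hom C Y Z"
  shows "is_isomorphism C (g \<cdot> f)"
proof -
  obtain f' where f': "f' \<in> Hom C Y X" "f' \<cdot> f = Ident C X" "f \<cdot> f' = Ident C Y"
    using isomorphismE[OF assms(1) fg(1)] by blast
  obtain g' where g': "g' \<in> Hom C Z Y" "g' \<cdot> g = Ident C Y" "g \<cdot> g' = Ident C Z"
    using isomorphismE[OF assms(2) fg(2)] by blast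
  note a = HomD[OF fg(1)] HomD[OF fg(2)] HomD[OF f'(1)] HomD[OF g'(1)]
  have "(f' \<cdot> g') \<cdot> (g \<cdot> f) = f' \<cdot> ((g' \<cdot> g) \<cdot> f)" using a by (simp add: arr)
  also have "\<dots> = Ident C X" using a f'(2) g'(2) by (simp add: arr)
  finally have 1: "(f' \<cdot> g') \<cdot> (g \<cdot> f) = Ident C X" .
  have "(g \<cdot> f) \<cdot> (f' \<cdot> g') = g \<cdot> ((f \<cdot> f') \<cdot> g')" using a by (simp add: arr)
  also have "\<dots> = Ident C Z" using a f'(3) g'(3) by (simp add: arr)
  finally show ?thesis
    by (intro isomorphismI[of _ X Z "f' \<cdot> g'"] 1 Cmp_Hom[of _ _ Y] fg f' g')
qed

lemma iso_class_iff:
  "Y \<in> iso_class C X \<longleftrightarrow> (\<exists>f g. f \<in> Hom C X Y \<and> g \<in> Hom C Y X \<and> g \<cdot> f = Ident C X \<and> f \<cdot> g = Ident C Y)"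
proof
  assume "Y \<in> iso_class C X"
  then obtain f where f: "f \<in> Hom C X Y" "is_isomorphism C f" by (auto simp: iso_class_def)
  then show "\<exists>f g. f \<in> Hom C X Y \<and> g \<in> Hom C Y X \<and> g \<cdot> f = Ident C X \<and> f \<cdot> g = Ident C Y"
    using isomorphismE[OF f(2,1)] by blast
next
  assume "\<exists>f g. f \<in> Hom C X Y \<and> g \<in> Hom C Y X \<and> g \<cdot> f = Ident C X \<and> f \<cdot> g = Ident C Y"
  then obtain f g where "f \<in> Hom C X Y" "g \<in> Hom C Y X" "g \<cdot> f = Ident C X" "f \<cdot> g = Ident C Y"
    by blast
  then show "Y \<in> iso_class C X"
    using isomorphismI HomD(5) unfolding iso_class_def by blast
qed

lemma iso_class_refl: "X \<in> Ob C \<Longrightarrow> X \<in> iso_class C X"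
  using isomorphism_Id Id_Hom unfolding iso_class_def by blast

lemma iso_class_sym: "Y \<in> iso_class C X \<Longrightarrow> X \<in> iso_class C Y"
  unfolding iso_class_iff by blast

lemma iso_class_trans:
  assumes "Y \<in> iso_class C X" "Z \<in> iso_class C Y"
  shows "Z \<in> iso_class C X"
proof -
  obtain f where f: "f \<in> Hom C X Y" "is_isomorphism C f" using assms by (auto simp: iso_class_def)
  obtain g where g: "g \<in> Hom C Y Z" "is_isomorphism C g" using assms by (auto simp: iso_class_def)
  show ?thesis
    using isomorphism_Cmp[OF f(2) g(2) f(1) g(1)] Cmp_Hom[OF f(1) g(1)] HomD(5)[OF g(1)]
    unfolding iso_class_def by blast
qed

lemma iso_class_eq: "Y \<in> iso_class C X \<Longrightarrow> iso_class C Y = iso_class C X"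
  using iso_class_sym iso_class_trans by blast

lemma coproduct_ext:
  assumes "is_coproduct C I F Y inc" "f \<in> Hom C Y Z" "g \<in> Hom C Y Z"
    and "\<And>i. i \<in> I \<Longrightarrow> f \<cdot> inc i = g \<cdot> inc i"
  shows "f = g"
proof -
  have "Z \<in> Ob C" using assms(2) HomD by blast
  moreover have "\<forall>i\<in>I. g \<cdot> inc i \<in> Hom C (F i) Z"
    using assms(1,3) unfolding is_coproduct_def by (blast intro: Cmp_Hom)
  ultimately have "\<exists>!h. h \<in> Hom C Y Z \<and> (\<forall>i\<in>I. h \<cdot> inc i = g \<cdot> inc i)"
    using assms(1) unfolding is_coproduct_def
    by (elim conjE allE[where x = "\<lambda>i. g \<cdot> inc i"] ballE[where x = Z]) simp_all
  then show ?thesis using assms(2-4) by blast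
qed

lemma coproductE:
  assumes "is_coproduct C I F Y inc" "Z \<in> Ob C" "\<And>i. i \<in> I \<Longrightarrow> f i \<in> Hom C (F i) Z"
  obtains h where "h \<in> Hom C Y Z" "\<And>i. i \<in> I \<Longrightarrow> h \<cdot> inc i = f i"
proof -
  have "\<exists>!h. h \<in> Hom C Y Z \<and> (\<forall>i\<in>I. h \<cdot> inc i = f i)"
    using assms unfolding is_coproduct_def by blast
  then show ?thesis using that by blast
qed

lemma coproductD:
  assumes "is_coproduct C I F Y inc"
  shows "Y \<in> Ob C" "i \<in> I \<Longrightarrow> F i \<in> Ob C" "i \<in> I \<Longrightarrow> inc i \<in> Hom C (F i) Y"
  using assms by (auto simp: is_coproduct_def)

lemma coproductI:
  assumes "Y \<in> Ob C" "\<And>i. i \<in> I \<Longrightarrow> inc i \<in> Hom C (F i) Y"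
    and "\<And>Z f. Z \<in> Ob C \<Longrightarrow> (\<And>i. i \<in> I \<Longrightarrow> f i \<in> Hom C (F i) Z) \<Longrightarrow>
      \<exists>h \<in> Hom C Y Z. \<forall>i\<in>I. h \<cdot> inc i = f i"
    and "\<And>Z f g. f \<in> Hom C Y Z \<Longrightarrow> g \<in> Hom C Y Z \<Longrightarrow> (\<And>i. i \<in> I \<Longrightarrow> f \<cdot> inc i = g \<cdot> inc i) \<Longrightarrow> f = g"
  shows "is_coproduct C I F Y inc"
  unfolding is_coproduct_def
proof (intro conjI ballI allI impI)
  show "Y \<in> Ob C" by fact
  show "F i \<in> Ob C" if "i \<in> I" for i using assms(2)[OF that] HomD by blast
  show "inc i \<in> Hom C (F i) Y" if "i \<in> I" for i using assms(2)[OF that] .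
  fix Z f assume Z: "Z \<in> Ob C" and f: "\<forall>i\<in>I. f i \<in> Hom C (F i) Z"
  then obtain h where h: "h \<in> Hom C Y Z" "\<forall>i\<in>I. h \<cdot> inc i = f i" using assms(3)[of Z f] by blast
  show "\<exists>!h. h \<in> Hom C Y Z \<and> (\<forall>i\<in>I. h \<cdot> inc i = f i)"
  proof (rule ex1I[of _ h])
    show "k = h" if "k \<in> Hom C Y Z \<and> (\<forall>i\<in>I. k \<cdot> inc i = f i)" for k
      using that h by (intro assms(4)[of k Z h]) auto
  qed (use h in blast)
qed

lemma coproduct_reindex:
  assumes "is_coproduct C I F Y inc" "bij_betw b J I"
  shows "is_coproduct C J (F \<circ> b) Y (inc \<circ> b)"
proof (rule coproductI)
  have bI: "b j \<in> I" if "j \<in> J" for j using assms(2) that by (auto simp: bij_betw_def)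
  have bs: "i \<in> I \<Longrightarrow> \<exists>j\<in>J. b j = i" for i using assms(2) by (auto simp: bij_betw_def)
  show "Y \<in> Ob C" using coproductD[OF assms(1)] by blast
  show "(inc \<circ> b) i \<in> Hom C ((F \<circ> b) i) Y" if "i \<in> J" for i
    using coproductD(3)[OF assms(1) bI[OF that]] by simp
  show "\<exists>h\<in>Hom C Y Z. \<forall>i\<in>J. h \<cdot> (inc \<circ> b) i = f i"
    if Z: "Z \<in> Ob C" and f: "\<And>i. i \<in> J \<Longrightarrow> f i \<in> Hom C ((F \<circ> b) i) Z" for Z f
  proof -
    have inv: "inv_into J b (b j) = j" if "j \<in> J" for j
      using assms(2) that by (auto simp: bij_betw_def)
    have "f (inv_into J b i) \<in> Hom C (F i) Z" if "i \<in> I" for i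
      using bs[OF that] f inv by auto
    then obtain h where "h \<in> Hom C Y Z" "\<And>i. i \<in> I \<Longrightarrow> h \<cdot> inc i = f (inv_into J b i)"
      using coproductE[OF assms(1) Z, of "\<lambda>i. f (inv_into J b i)"] by blast
    then show ?thesis using bI inv by (intro bexI[of _ h]) auto
  qed
  show "f = g" if "f \<in> Hom C Y Z" "g \<in> Hom C Y Z"
    "\<And>i. i \<in> J \<Longrightarrow> f \<cdot> (inc \<circ> b) i = g \<cdot> (inc \<circ> b) i" for Z f g
    using that bs by (intro coproduct_ext[OF assms(1) that(1,2)]) force
qed

lemma finite_sums_single:
  assumes "S \<in> Ob C" "S \<in> A"
  shows "S \<in> finite_sums C A"
proof -
  have "is_coproduct C {..<1::nat} (\<lambda>_. S) S (\<lambda>_. Ident C S)"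
    by (rule coproductI) (use assms in \<open>auto simp: Id_Hom Id_right\<close>)
  then show ?thesis unfolding finite_sums_def using assms
    by (intro CollectI conjI exI[of _ "1::nat"] exI[of _ "\<lambda>_. S"] exI[of _ "\<lambda>_. Ident C S"]) auto
qed

text \<open>\<open>finite_sums\<close> only admits the index sets \<open>{..<n}\<close>, whereas the
  summands of a complex are later indexed by pairs of a degree and a position.\<close>

lemma finite_sumsI:
  assumes "is_coproduct C I F Y inc" "finite I" "\<And>i. i \<in> I \<Longrightarrow> F i \<in> A"
  shows "Y \<in> finite_sums C A"
proof -
  obtain b where b: "bij_betw b {0..<card I} I"
    using ex_bij_betw_nat_finite[OF assms(2)] by blast
  then have "is_coproduct C {..<card I} (F \<circ> b) Y (inc \<circ> b)"
    using coproduct_reindex[OF assms(1), of b] by (simp add: atLeast0LessThan)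
  moreover have "\<forall>i<card I. (F \<circ> b) i \<in> A" using bij_betwE[OF b] assms(3) by simp
  ultimately show ?thesis
    using coproductD(1)[OF assms(1)] unfolding finite_sums_def by blast
qed

text \<open>A commutative square with two invertible opposite sides. It replaces an arrow induced on
  cohomology by one computed from splittings.\<close>

lemma isomorphism_comp_iff:
  assumes "u \<in> Hom C X X'" "v \<in> Hom C Y Y'" "is_isomorphism C u" "is_isomorphism C v"
    "f \<in> Hom C X Y" "g \<in> Hom C X' Y'" "v \<cdot> f = g \<cdot> u"
  shows "is_isomorphism C f \<longleftrightarrow> is_isomorphism C g"
proof -
  obtain u' where u': "u' \<in> Hom C X' X" "u' \<cdot> u = Ident C X" "u \<cdot> u' = Ident C X'"
    using isomorphismE[OF assms(3) assms(1)] by blast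
  obtain v' where v': "v' \<in> Hom C Y' Y" "v' \<cdot> v = Ident C Y" "v \<cdot> v' = Ident C Y'"
    using isomorphismE[OF assms(4) assms(2)] by blast
  note a = HomD[OF assms(1)] HomD[OF assms(2)] HomD[OF assms(5)] HomD[OF assms(6)]
    HomD[OF u'(1)] HomD[OF v'(1)]
  have iu: "is_isomorphism C u'" by (rule isomorphismI[OF u'(1) assms(1) u'(3,2)])
  have iv: "is_isomorphism C v'" by (rule isomorphismI[OF v'(1) assms(2) v'(3,2)])
  have "f = (v' \<cdot> v) \<cdot> f" using a v' by (simp add: arr)
  also have "\<dots> = v' \<cdot> (v \<cdot> f)" using a by (simp add: Cmp_assoc_Ar)
  finally have 1: "f = v' \<cdot> (g \<cdot> u)" using assms(7) by simp
  have "g = g \<cdot> (u \<cdot> u')" using a u' by (simp add: arr)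
  also have "\<dots> = (g \<cdot> u) \<cdot> u'" using a by (simp add: Cmp_assoc_Ar)
  finally have 2: "g = v \<cdot> (f \<cdot> u')" using a assms(7)[symmetric] by (simp add: arr)
  show ?thesis
  proof
    assume "is_isomorphism C f"
    then show "is_isomorphism C g"
      unfolding 2 using assms u' iu by (meson isomorphism_Cmp Cmp_Hom)
  next
    assume "is_isomorphism C g"
    then show "is_isomorphism C f"
      unfolding 1 using assms v' iv by (meson isomorphism_Cmp Cmp_Hom)
  qed
qed

end

section \<open>Calculation with zero arrows, sums and scalar multiples\<close>

context linear_category
begin

lemma Ar_Zer: "X \<in> Ob C \<Longrightarrow> Y \<in> Ob C \<Longrightarrow> Zer C X Y \<in> Ar C"
  and Src_Zer: "X \<in> Ob C \<Longrightarrow> Y \<in> Ob C \<Longrightarrow> Src C (Zer C X Y) = X"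
  and Tgt_Zer: "X \<in> Ob C \<Longrightarrow> Y \<in> Ob C \<Longrightarrow> Tgt C (Zer C X Y) = Y"
  using Zer_Hom[of X Y] by (auto simp: Hom_def)

lemma Ar_Add: "f \<in> Ar C \<Longrightarrow> g \<in> Ar C \<Longrightarrow> Src C f = Src C g \<Longrightarrow> Tgt C f = Tgt C g \<Longrightarrow> Add C f g \<in> Ar C"
  and Src_Add: "f \<in> Ar C \<Longrightarrow> g \<in> Ar C \<Longrightarrow> Src C f = Src C g \<Longrightarrow> Tgt C f = Tgt C g \<Longrightarrow> Src C (Add C f g) = Src C g"
  and Tgt_Add: "f \<in> Ar C \<Longrightarrow> g \<in> Ar C \<Longrightarrow> Src C f = Src C g \<Longrightarrow> Tgt C f = Tgt C g \<Longrightarrow> Tgt C (Add C f g) = Tgt C g"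
  using Add_Hom[of f "Src C f" "Tgt C f" g] by (auto simp: Hom_def)

lemma Ar_Scl: "f \<in> Ar C \<Longrightarrow> Scl C a f \<in> Ar C"
  and Src_Scl: "f \<in> Ar C \<Longrightarrow> Src C (Scl C a f) = Src C f"
  and Tgt_Scl: "f \<in> Ar C \<Longrightarrow> Tgt C (Scl C a f) = Tgt C f"
  using Scl_Hom[of f "Src C f" "Tgt C f" a] by (auto simp: Hom_def)

lemmas lin = arr Ar_Zer Src_Zer Tgt_Zer Ar_Add Src_Add Tgt_Add Ar_Scl Src_Scl Tgt_Scl

lemma Add_assoc_Ar: "f \<in> Ar C \<Longrightarrow> g \<in> Ar C \<Longrightarrow> h \<in> Ar C \<Longrightarrow> Src C f = Src C g \<Longrightarrow> Tgt C f = Tgt C g \<Longrightarrow>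
    Src C g = Src C h \<Longrightarrow> Tgt C g = Tgt C h \<Longrightarrow> Add C (Add C f g) h = Add C f (Add C g h)"
  using Add_assoc[of f "Src C f" "Tgt C f" g h] by (auto simp: Hom_def)

lemma Add_commute_Ar: "f \<in> Ar C \<Longrightarrow> g \<in> Ar C \<Longrightarrow> Src C f = Src C g \<Longrightarrow> Tgt C f = Tgt C g \<Longrightarrow>
    Add C f g = Add C g f"
  using Add_commute[of f "Src C f" "Tgt C f" g] by (auto simp: Hom_def)

lemma Add_left_commute_Ar: "f \<in> Ar C \<Longrightarrow> g \<in> Ar C \<Longrightarrow> h \<in> Ar C \<Longrightarrow> Src C f = Src C g \<Longrightarrow> Tgt C f = Tgt C g \<Longrightarrow>
    Src C g = Src C h \<Longrightarrow> Tgt C g = Tgt C h \<Longrightarrow> Add C f (Add C g h) = Add C g (Add C f h)"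
  using Add_assoc_Ar[of f g h] Add_assoc_Ar[of g f h] Add_commute_Ar[of f g] by simp

lemma Add_Zer_left: "f \<in> Ar C \<Longrightarrow> Src C f = X \<Longrightarrow> Tgt C f = Y \<Longrightarrow> Add C (Zer C X Y) f = f"
  and Add_Zer_right: "f \<in> Ar C \<Longrightarrow> Src C f = X \<Longrightarrow> Tgt C f = Y \<Longrightarrow> Add C f (Zer C X Y) = f"
proof -
  assume f: "f \<in> Ar C" "Src C f = X" "Tgt C f = Y"
  then show 1: "Add C (Zer C X Y) f = f" using Add_Zer by (auto simp: Hom_def)
  show "Add C f (Zer C X Y) = f"
    using Add_commute_Ar[of f "Zer C X Y"] f 1 by (auto simp: lin)
qed

lemma Add_cancel:
  assumes "f \<in> Hom C X Y" "g \<in> Hom C X Y" "h \<in> Hom C X Y" "Add C f g = Add C f h"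
  shows "g = h"
proof -
  note a = HomD[OF assms(1)] HomD[OF assms(2)] HomD[OF assms(3)]
  have "Add C (Scl C (-1) f) (Add C f g) = Add C (Scl C (-1) f) (Add C f h)" using assms(4) by simp
  then show ?thesis
    using a Add_inverse[OF assms(1)]
      Add_assoc_Ar[of "Scl C (-1) f" f g, symmetric] Add_assoc_Ar[of "Scl C (-1) f" f h, symmetric]
    by (simp add: lin Add_Zer_left)
qed

lemma Scl_Scl: "f \<in> Ar C \<Longrightarrow> Scl C a (Scl C b f) = Scl C (a * b) f"
  and Scl_1: "f \<in> Ar C \<Longrightarrow> Scl C 1 f = f"
  and Scl_Add_Ar: "f \<in> Ar C \<Longrightarrow> g \<in> Ar C \<Longrightarrow> Src C f = Src C g \<Longrightarrow> Tgt C f = Tgt C g \<Longrightarrow>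
    Scl C a (Add C f g) = Add C (Scl C a f) (Scl C a g)"
  and Add_Scl_Scl: "f \<in> Ar C \<Longrightarrow> Add C (Scl C a f) (Scl C b f) = Scl C (a + b) f"
  using Scl_times[of f "Src C f" "Tgt C f"] Scl_one[of f "Src C f" "Tgt C f"]
    Scl_Add[of f "Src C f" "Tgt C f" g] Scl_plus[of f "Src C f" "Tgt C f"]
  by (auto simp: Hom_def)

lemma Scl_0: "f \<in> Ar C \<Longrightarrow> Scl C 0 f = Zer C (Src C f) (Tgt C f)"
  using Add_Scl_Scl[of f "-1" 1] Scl_1[of f] Add_inverse[of f "Src C f" "Tgt C f"]
  by (auto simp: Hom_def)

lemma Scl_Zer: "X \<in> Ob C \<Longrightarrow> Y \<in> Ob C \<Longrightarrow> Scl C a (Zer C X Y) = Zer C X Y"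
  using Scl_Scl[of "Zer C X Y" a 0] Scl_0[of "Zer C X Y"] by (simp add: lin)

text \<open>A zero arrow is 0 times itself, and scalars can be pulled out of composites.\<close>

lemma Cmp_Zer_right: "g \<in> Ar C \<Longrightarrow> X \<in> Ob C \<Longrightarrow> Src C g = Y \<Longrightarrow> g \<cdot> Zer C X Y = Zer C X (Tgt C g)"
  and Cmp_Zer_left: "f \<in> Ar C \<Longrightarrow> Z \<in> Ob C \<Longrightarrow> Tgt C f = Y \<Longrightarrow> Zer C Y Z \<cdot> f = Zer C (Src C f) Z"
proof -
  assume g: "g \<in> Ar C" "X \<in> Ob C" "Src C g = Y"
  then have Y: "Y \<in> Ob C" by (auto simp: lin)
  have "g \<cdot> Zer C X Y = g \<cdot> Scl C 0 (Zer C X Y)" using g Y by (simp add: Scl_Zer)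
  also have "\<dots> = Scl C 0 (g \<cdot> Zer C X Y)"
    using Cmp_Scl_right[OF Zer_Hom, of X Y g "Tgt C g" 0] g Y by (simp add: Hom_def)
  finally show "g \<cdot> Zer C X Y = Zer C X (Tgt C g)" using g Y by (simp add: Scl_0 lin)
next
  assume f: "f \<in> Ar C" "Z \<in> Ob C" "Tgt C f = Y"
  then have Y: "Y \<in> Ob C" by (auto simp: lin)
  have "Zer C Y Z \<cdot> f = Scl C 0 (Zer C Y Z) \<cdot> f" using f Y by (simp add: Scl_Zer)
  also have "\<dots> = Scl C 0 (Zer C Y Z \<cdot> f)"
    using Cmp_Scl_left[OF _ Zer_Hom, of f "Src C f" Y Z 0] f Y by (simp add: Hom_def)
  finally show "Zer C Y Z \<cdot> f = Zer C (Src C f) Z" using f Y by (simp add: Scl_0 lin)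
qed

lemma Cmp_Add_left_Ar: "f \<in> Ar C \<Longrightarrow> g \<in> Ar C \<Longrightarrow> g' \<in> Ar C \<Longrightarrow> Tgt C f = Src C g \<Longrightarrow>
    Src C g = Src C g' \<Longrightarrow> Tgt C g = Tgt C g' \<Longrightarrow> Add C g g' \<cdot> f = Add C (g \<cdot> f) (g' \<cdot> f)"
  using Cmp_Add_left[of f "Src C f" "Src C g" g "Tgt C g" g'] by (auto simp: Hom_def)

lemma Cmp_Add_right_Ar: "f \<in> Ar C \<Longrightarrow> f' \<in> Ar C \<Longrightarrow> g \<in> Ar C \<Longrightarrow> Tgt C f' = Src C g \<Longrightarrow>
    Src C f = Src C f' \<Longrightarrow> Tgt C f = Tgt C f' \<Longrightarrow> g \<cdot> Add C f f' = Add C (g \<cdot> f) (g \<cdot> f')"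
  using Cmp_Add_right[of f "Src C f" "Src C g" f' g "Tgt C g"] by (auto simp: Hom_def)

lemma Cmp_Scl_left_Ar: "f \<in> Ar C \<Longrightarrow> g \<in> Ar C \<Longrightarrow> Tgt C f = Src C g \<Longrightarrow> Scl C a g \<cdot> f = Scl C a (g \<cdot> f)"
  and Cmp_Scl_right_Ar: "f \<in> Ar C \<Longrightarrow> g \<in> Ar C \<Longrightarrow> Tgt C f = Src C g \<Longrightarrow> g \<cdot> Scl C a f = Scl C a (g \<cdot> f)"
  using Cmp_Scl_left[of f "Src C f" "Src C g" g "Tgt C g" a] Cmp_Scl_right[of f "Src C f" "Src C g" g "Tgt C g" a]
  by (auto simp: Hom_def)

lemmas dist = Scl_Scl Scl_1 Scl_0 Scl_Zer Scl_Add_Ar Add_Scl_Scl Cmp_Zer_left Cmp_Zer_right Add_Zer_left Add_Zer_right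
  Cmp_Add_left_Ar Cmp_Add_right_Ar Cmp_Scl_left_Ar Cmp_Scl_right_Ar
lemmas add_ac = Add_assoc_Ar Add_commute_Ar Add_left_commute_Ar

lemma Add_minus: "f \<in> Ar C \<Longrightarrow> Add C f (Scl C (- 1) f) = Zer C (Src C f) (Tgt C f)"
  using Add_Scl_Scl[of f 1 "-1"] by (simp add: Scl_1 Scl_0)

lemma Add_minus_left: "f \<in> Ar C \<Longrightarrow> g \<in> Ar C \<Longrightarrow> Src C f = Src C g \<Longrightarrow> Tgt C f = Tgt C g \<Longrightarrow>
    Add C f (Add C (Scl C (- 1) f) g) = g"
  using Add_assoc_Ar[of f "Scl C (- 1) f" g, symmetric] by (simp add: Add_minus lin dist)

lemma Add_minus_mid: "f \<in> Ar C \<Longrightarrow> g \<in> Ar C \<Longrightarrow> Src C f = Src C g \<Longrightarrow> Tgt C f = Tgt C g \<Longrightarrow>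
    Add C f (Add C g (Scl C (- 1) f)) = g"
  using Add_minus_left[of f g] Add_commute_Ar[of g "Scl C (-1) f"] by (simp add: lin)

lemmas cancel = Add_minus Add_minus_left Add_minus_mid

lemma diff_ZerD:
  assumes "f \<in> Hom C X Y" "g \<in> Hom C X Y" "Add C f (Scl C (- 1) g) = Zer C X Y"
  shows "f = g"
proof -
  have "Add C (Scl C (-1) g) f = Add C (Scl C (-1) g) g"
    using assms Add_commute_Ar[of f "Scl C (-1) g"] Add_inverse[OF assms(2)]
    by (simp add: lin Hom_def)
  then show ?thesis using Add_cancel[OF Scl_Hom[OF assms(2)] assms(1,2)] by blast
qed

lemma zero_object_Hom_eq:
  assumes "is_zero_object C X" "f \<in> Hom C X Y"
  shows "f = Zer C X Y"
  using assms HomD[OF assms(2)] Zer_Hom[of X Y] unfolding is_zero_object_def by blast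

lemma zero_object_Hom_eq':
  assumes "is_zero_object C Y" "f \<in> Hom C X Y"
  shows "f = Zer C X Y"
  using assms HomD[OF assms(2)] Zer_Hom[of X Y] unfolding is_zero_object_def by blast

lemma zero_object_iff: "is_zero_object C X \<longleftrightarrow> X \<in> Ob C \<and> Ident C X = Zer C X X"
proof
  assume "is_zero_object C X"
  then show "X \<in> Ob C \<and> Ident C X = Zer C X X"
    using zero_object_Hom_eq Id_Hom is_zero_object_def by metis
next
  assume X: "X \<in> Ob C \<and> Ident C X = Zer C X X"
  have "f = Zer C X Y" if "f \<in> Hom C X Y" for f Y
  proof -
    have "f = f \<cdot> Ident C X" using that Id_right by simp
    also have "\<dots> = Zer C X Y" using X that by (simp add: dist HomD[OF that])
    finally show ?thesis .
  qed
  moreover have "f = Zer C Y X" if "f \<in> Hom C Y X" for f Y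
  proof -
    have "f = Ident C X \<cdot> f" using that Id_left by simp
    also have "\<dots> = Zer C Y X" using X that by (simp add: dist HomD[OF that])
    finally show ?thesis .
  qed
  ultimately show "is_zero_object C X" unfolding is_zero_object_def using X Zer_Hom by blast
qed

lemma zero_object_factor:
  assumes "f \<in> Hom C X Y" "g \<in> Hom C Y Z" "is_zero_object C Y"
  shows "g \<cdot> f = Zer C X Z"
  using zero_object_Hom_eq'[OF assms(3,1)] assms(2) HomD[OF assms(1)] HomD[OF assms(2)]
  by (simp add: dist)

lemma coproduct_zero:
  assumes "is_coproduct C I F Y inc" "\<And>i. i \<in> I \<Longrightarrow> is_zero_object C (F i)"
  shows "is_zero_object C Y"
  unfolding zero_object_iff
proof
  show Y: "Y \<in> Ob C" using coproductD[OF assms(1)] by blast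
  show "Ident C Y = Zer C Y Y"
  proof (rule coproduct_ext[OF assms(1) Id_Hom[OF Y] Zer_Hom[OF Y Y]])
    fix i assume i: "i \<in> I"
    have "inc i = Zer C (F i) Y"
      using zero_object_Hom_eq assms(2)[OF i] coproductD(3)[OF assms(1) i] by blast
    moreover have "F i \<in> Ob C" using coproductD(2)[OF assms(1) i] .
    ultimately show "Ident C Y \<cdot> inc i = Zer C Y Y \<cdot> inc i" using Y by (simp add: lin dist)
  qed
qed

text \<open>This replaces the formula expressing the identity of \<open>Y\<close> as the sum of the projections
  onto its summands.\<close>

lemma coproduct_Ident_induct [consumes 2, case_names Zer Add factor]:
  assumes cop: "is_coproduct C I F Y inc" and fin: "finite {i \<in> I. \<not> is_zero_object C (F i)}"
    and Zer: "P (Zer C Y Y)"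
    and Add: "\<And>a b. a \<in> Hom C Y Y \<Longrightarrow> b \<in> Hom C Y Y \<Longrightarrow> P a \<Longrightarrow> P b \<Longrightarrow> P (Add C a b)"
    and factor: "\<And>i g. i \<in> I \<Longrightarrow> g \<in> Hom C Y (F i) \<Longrightarrow> P (inc i \<cdot> g)"
  shows "P (Ident C Y)"
proof -
  note Y = coproductD(1)[OF cop] and F = coproductD(2)[OF cop] and inc = coproductD(3)[OF cop]
  \<comment> \<open>The arrow \<open>a\<close> plays the part of the projection onto the summands
    indexed by \<open>J\<close>, built up one summand at a time.\<close>
  have *: "\<exists>a \<in> Hom C Y Y. P a \<and> (\<forall>i\<in>I. a \<cdot> inc i = (if i \<in> J then inc i else Zer C (F i) Y))"
    if "finite J" "J \<subseteq> I" for J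
    using that
  proof (induction J rule: finite_induct)
    case empty
    then show ?case using Zer Zer_Hom[OF Y Y] HomD[OF inc] Y
      by (intro bexI[of _ "Zer C Y Y"]) (auto simp: dist)
  next
    case (insert j J)
    then obtain a where a: "a \<in> Hom C Y Y" "P a"
      "\<And>i. i \<in> I \<Longrightarrow> a \<cdot> inc i = (if i \<in> J then inc i else Zer C (F i) Y)" by auto
    have j: "j \<in> I" using insert by simp
    have "(if i = j then Ident C (F j) else Zer C (F i) (F j)) \<in> Hom C (F i) (F j)" if "i \<in> I" for i
      using F[OF that] F[OF j] by (simp add: Zer_Hom Id_Hom)
    then obtain r where r: "r \<in> Hom C Y (F j)"
      "\<And>i. i \<in> I \<Longrightarrow> r \<cdot> inc i = (if i = j then Ident C (F j) else Zer C (F i) (F j))"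
      using coproductE[OF cop F[OF j], of "\<lambda>i. if i = j then Ident C (F j) else Zer C (F i) (F j)"]
      by blast
    let ?b = "Add C a (inc j \<cdot> r)"
    have b: "inc j \<cdot> r \<in> Hom C Y Y" using Cmp_Hom[OF r(1) inc[OF j]] .
    have "?b \<cdot> inc i = (if i \<in> insert j J then inc i else Zer C (F i) Y)" if i: "i \<in> I" for i
    proof -
      note h = HomD[OF inc[OF i]] HomD[OF inc[OF j]] HomD[OF r(1)] HomD[OF a(1)] F[OF i] F[OF j] Y
      have "?b \<cdot> inc i = Add C (a \<cdot> inc i) (inc j \<cdot> (r \<cdot> inc i))"
        using h by (simp add: lin dist)
      then show ?thesis using a(3)[OF i] r(2)[OF i] h insert.hyps(2)
        by (auto simp: lin dist)
    qed
    then show ?case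
      using Add[OF a(1) b a(2) factor[OF j r(1)]] Add_Hom[OF a(1) b] by (intro bexI[of _ ?b]) auto
  qed
  \<comment> \<open>Summands outside \<open>?J\<close> are zero objects, so the partial sum over
    \<open>?J\<close> already agrees with the identity on every inclusion.\<close>
  let ?J = "{i \<in> I. \<not> is_zero_object C (F i)}"
  obtain a where a: "a \<in> Hom C Y Y" "P a"
      "\<And>i. i \<in> I \<Longrightarrow> a \<cdot> inc i = (if i \<in> ?J then inc i else Zer C (F i) Y)"
    using *[OF fin] by auto
  have "a = Ident C Y"
  proof (rule coproduct_ext[OF cop a(1) Id_Hom[OF Y]])
    fix i assume i: "i \<in> I"
    have "inc i = Zer C (F i) Y" if "i \<notin> ?J"
      using that i zero_object_Hom_eq[of "F i" "inc i" Y] inc[OF i] by auto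
    then show "a \<cdot> inc i = Ident C Y \<cdot> inc i" using a(3)[OF i] inc[OF i] by (auto simp: Id_left)
  qed
  then show ?thesis using a(2) by simp
qed

text \<open>The property \<open>w a f = 0\<close> of endomorphisms \<open>a\<close> of
  \<open>Y\<close> is closed under sums. If it held for every \<open>a\<close> that factors through
  a summand, it would hold for the identity.\<close>

lemma coproduct_detect_Cmp:
  assumes cop: "is_coproduct C I F Y inc" and fin: "finite {i \<in> I. \<not> is_zero_object C (F i)}"
    and f: "f \<in> Hom C X Y" and w: "w \<in> Hom C Y Z" and wf: "w \<cdot> f \<noteq> Zer C X Z"
  obtains i g where "i \<in> I" "g \<in> Hom C Y (F i)" "w \<cdot> (inc i \<cdot> (g \<cdot> f)) \<noteq> Zer C X Z"
proof -
  note h = HomD[OF f] HomD[OF w]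
  have "\<exists>i g. i \<in> I \<and> g \<in> Hom C Y (F i) \<and> w \<cdot> (inc i \<cdot> (g \<cdot> f)) \<noteq> Zer C X Z"
  proof (rule ccontr)
    assume none: "\<not> ?thesis"
    have "w \<cdot> (Ident C Y \<cdot> f) = Zer C X Z"
      using cop fin
    proof (induction rule: coproduct_Ident_induct)
      case Zer
      then show ?case using h by (simp add: dist lin)
    next
      case (Add a b)
      then show ?case using h HomD[OF Add(1)] HomD[OF Add(2)] by (simp add: dist lin)
    next
      case (factor i g)
      then show ?case using none h HomD[OF factor(2)] HomD[OF coproductD(3)[OF cop factor(1)]]
        by (auto simp: lin)
    qed
    then show False using f wf by (simp add: Id_left)
  qed
  then show ?thesis using that by blast
qed

lemma coproduct_detect:
  assumes cop: "is_coproduct C I F Y inc" and fin: "finite {i \<in> I. \<not> is_zero_object C (F i)}"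
    and f: "f \<in> Hom C X Y" "f \<noteq> Zer C X Y"
  obtains i g where "i \<in> I" "g \<in> Hom C Y (F i)" "inc i \<cdot> (g \<cdot> f) \<noteq> Zer C X Y" "g \<cdot> f \<noteq> Zer C X (F i)"
proof -
  note h = HomD[OF f(1)]
  obtain i g where ig: "i \<in> I" "g \<in> Hom C Y (F i)" "Ident C Y \<cdot> (inc i \<cdot> (g \<cdot> f)) \<noteq> Zer C X Y"
    by (rule coproduct_detect_Cmp[OF cop fin f(1) Id_Hom]) (use h f in \<open>simp_all add: arr\<close>)
  note h = h HomD[OF ig(2)] HomD[OF coproductD(3)[OF cop ig(1)]]
  have "inc i \<cdot> (g \<cdot> f) \<noteq> Zer C X Y" using ig(3) h by (simp add: arr)
  moreover from this have "g \<cdot> f \<noteq> Zer C X (F i)" using h by (auto simp: dist)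
  ultimately show ?thesis using that ig(1,2) by blast
qed

end

section \<open>Semisimple abelian categories\<close>

context linear_category
begin

lemma kernelD:
  assumes "is_kernel C f k" "f \<in> Hom C X Y"
  shows "k \<in> Hom C (Src C k) X" "f \<cdot> k = Zer C (Src C k) Y"
  using assms by (auto simp: is_kernel_def Hom_def)

lemma kernelE:
  assumes "is_kernel C f k" "f \<in> Hom C X Y" "g \<in> Hom C W X" "f \<cdot> g = Zer C W Y"
  obtains h where "h \<in> Hom C W (Src C k)" "k \<cdot> h = g"
proof -
  have "g \<in> Hom C W (Src C f)" "f \<cdot> g = Zer C W (Tgt C f)" using assms by (auto simp: Hom_def)
  then have "\<exists>!h. h \<in> Hom C W (Src C k) \<and> k \<cdot> h = g"
    using assms(1) unfolding is_kernel_def by blast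
  then show ?thesis using that by blast
qed

lemma kernel_cancel:
  assumes "is_kernel C f k" "f \<in> Hom C X Y" "g \<in> Hom C W (Src C k)" "h \<in> Hom C W (Src C k)"
    "k \<cdot> g = k \<cdot> h"
  shows "g = h"
proof -
  note k = kernelD[OF assms(1,2)]
  have kg: "k \<cdot> g \<in> Hom C W X" using Cmp_Hom[OF assms(3) k(1)] .
  have "f \<cdot> (k \<cdot> g) = Zer C W Y"
    using HomD[OF k(1)] HomD[OF assms(3)] HomD[OF assms(2)] Cmp_assoc_Ar[of g k f, symmetric]
    by (simp add: k(2) dist)
  moreover have "k \<cdot> g \<in> Hom C W (Src C f)" "Y = Tgt C f" using kg assms by (auto simp: Hom_def)
  ultimately have "\<exists>!l. l \<in> Hom C W (Src C k) \<and> k \<cdot> l = k \<cdot> g"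
    using assms(1) unfolding is_kernel_def by blast
  then show ?thesis using assms by metis
qed

lemma kernel_monic:
  assumes "is_kernel C f k"
  shows "is_monic C k"
proof -
  have f: "f \<in> Hom C (Src C f) (Tgt C f)" and k: "k \<in> Ar C"
    using assms by (auto simp: is_kernel_def Hom_def)
  then show ?thesis unfolding is_monic_def using kernel_cancel[OF assms f] by blast
qed

lemma cokernelD:
  assumes "is_cokernel C f c" "f \<in> Hom C X Y"
  shows "c \<in> Hom C Y (Tgt C c)" "c \<cdot> f = Zer C X (Tgt C c)"
  using assms by (auto simp: is_cokernel_def Hom_def)

lemma cokernelE:
  assumes "is_cokernel C f c" "f \<in> Hom C X Y" "g \<in> Hom C Y W" "g \<cdot> f = Zer C X W"
  obtains h where "h \<in> Hom C (Tgt C c) W" "h \<cdot> c = g"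
proof -
  have "g \<in> Hom C (Tgt C f) W" "g \<cdot> f = Zer C (Src C f) W" using assms by (auto simp: Hom_def)
  then have "\<exists>!h. h \<in> Hom C (Tgt C c) W \<and> h \<cdot> c = g"
    using assms(1) unfolding is_cokernel_def by blast
  then show ?thesis using that by blast
qed

lemma cokernel_cancel:
  assumes "is_cokernel C f c" "f \<in> Hom C X Y" "g \<in> Hom C (Tgt C c) W" "h \<in> Hom C (Tgt C c) W"
    "g \<cdot> c = h \<cdot> c"
  shows "g = h"
proof -
  note c = cokernelD[OF assms(1,2)]
  have kg: "g \<cdot> c \<in> Hom C Y W" using Cmp_Hom[OF c(1) assms(3)] .
  have "(g \<cdot> c) \<cdot> f = Zer C X W"
    using HomD[OF c(1)] HomD[OF assms(3)] HomD[OF assms(2)] by (simp add: arr c(2) dist)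
  moreover have "g \<cdot> c \<in> Hom C (Tgt C f) W" "X = Src C f" using kg assms by (auto simp: Hom_def)
  ultimately have "\<exists>!l. l \<in> Hom C (Tgt C c) W \<and> l \<cdot> c = g \<cdot> c"
    using assms(1) unfolding is_cokernel_def by blast
  then show ?thesis using assms by metis
qed

lemma zero_object_iso:
  assumes "is_zero_object C X" "f \<in> Hom C X Y" "is_isomorphism C f"
  shows "is_zero_object C Y"
proof -
  obtain g where g: "g \<in> Hom C Y X" "f \<cdot> g = Ident C Y" using isomorphismE[OF assms(3,2)] by blast
  have "f \<cdot> g = Zer C Y Y" using zero_object_factor[OF g(1) assms(2,1)] .
  then show ?thesis using g HomD[OF assms(2)] by (simp add: zero_object_iff)
qed

lemma simpleD:
  assumes "is_simple C S"
  shows "S \<in> Ob C" "\<not> is_zero_object C S" "Ident C S \<noteq> Zer C S S"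
  using assms by (auto simp: is_simple_def zero_object_iff)

lemma isomorphism_nonzero:
  assumes "is_simple C S" "f \<in> Hom C X S" "is_isomorphism C f"
  shows "f \<noteq> Zer C X S"
proof -
  obtain g where g: "g \<in> Hom C S X" "f \<cdot> g = Ident C S" using isomorphismE[OF assms(3,2)] .
  then have "Zer C X S \<cdot> g \<noteq> Ident C S"
    using simpleD[OF assms(1)] HomD[OF g(1)] Cmp_Zer_left[of g S X] by auto
  then show ?thesis using g by auto
qed

text \<open>Composition with \<open>g\<close> turns a monic into \<open>T\<close> into a monic into
  \<open>S\<close>, where simplicity can be applied; composition with \<open>f\<close> leads
  back.\<close>

lemma simple_iso_class:
  assumes S: "is_simple C S" and T: "T \<in> iso_class C S"
  shows "is_simple C T"
proof -
  obtain f g where f: "f \<in> Hom C S T" and g: "g \<in> Hom C T S"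
    and gf: "g \<cdot> f = Ident C S" and fg: "f \<cdot> g = Ident C T"
    using T unfolding iso_class_iff by blast
  have ig: "is_isomorphism C g" by (rule isomorphismI[OF g f fg gf])
  have if': "is_isomorphism C f" by (rule isomorphismI[OF f g gf fg])
  note a = HomD[OF f] HomD[OF g]
  have "\<not> is_zero_object C T" using zero_object_iso[OF _ g ig] simpleD(2)[OF S] by blast
  moreover have "is_zero_object C (Src C i) \<or> is_isomorphism C i"
    if i: "is_monic C i" "Tgt C i = T" for i
  proof -
    have iA: "i \<in> Ar C" using i by (simp add: is_monic_def)
    then have iH: "i \<in> Hom C (Src C i) T" using i by (simp add: Hom_def)
    have gi: "g \<cdot> i \<in> Hom C (Src C i) S" using Cmp_Hom[OF iH g] .
    have "is_monic C (g \<cdot> i)"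
      unfolding is_monic_def
    proof (intro conjI allI ballI impI)
      show "g \<cdot> i \<in> Ar C" using HomD[OF gi] by simp
      fix W u v assume uv: "u \<in> Hom C W (Src C (g \<cdot> i))" "v \<in> Hom C W (Src C (g \<cdot> i))"
        and eq: "(g \<cdot> i) \<cdot> u = (g \<cdot> i) \<cdot> v"
      have uv': "u \<in> Hom C W (Src C i)" "v \<in> Hom C W (Src C i)" using uv HomD[OF gi] by auto
      have "f \<cdot> ((g \<cdot> i) \<cdot> u) = i \<cdot> u" "f \<cdot> ((g \<cdot> i) \<cdot> v) = i \<cdot> v"
        using a HomD[OF iH] HomD[OF uv'(1)] HomD[OF uv'(2)] fg Cmp_assoc_Ar[of _ g f, symmetric]
        by (simp_all add: arr)
      then have "i \<cdot> u = i \<cdot> v" using eq by simp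
      then show "u = v" using i(1) uv' unfolding is_monic_def by blast
    qed
    then have "is_zero_object C (Src C i) \<or> is_isomorphism C (g \<cdot> i)"
      using S HomD[OF gi] unfolding is_simple_def by metis
    moreover have "is_isomorphism C i" if "is_isomorphism C (g \<cdot> i)"
    proof -
      have "f \<cdot> (g \<cdot> i) = i" using a HomD[OF iH] fg Cmp_assoc_Ar[of i g f] by (simp add: arr)
      then show ?thesis using isomorphism_Cmp[OF that if' gi f] by simp
    qed
    ultimately show ?thesis by blast
  qed
  ultimately show ?thesis unfolding is_simple_def using a by blast
qed

lemma Irr_classesD:
  assumes "X \<in> Irr_classes C" "x \<in> X"
  shows "is_simple C x" "X = iso_class C x"
  using assms simple_iso_class iso_class_eq unfolding Irr_classes_def by auto

lemma Irr_classesE: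
  assumes "X \<in> Irr_classes C"
  obtains x where "x \<in> X" "is_simple C x" "X = iso_class C x"
  using assms iso_class_refl simpleD(1) unfolding Irr_classes_def by blast

lemma Irr_classesI: "is_simple C x \<Longrightarrow> iso_class C x \<in> Irr_classes C"
  by (auto simp: Irr_classes_def)

end

section \<open>Schur's lemma and split monics\<close>

context abelian_category
begin

text \<open>The kernel of \<open>f\<close> is a monic into \<open>S\<close> that is not invertible,
  so its source is zero. Then \<open>f\<close> itself is a monic into \<open>T\<close> with nonzero
  source, and simplicity of \<open>T\<close> applies.\<close>

lemma Schur:
  assumes S: "is_simple C S" and T: "is_simple C T" and f: "f \<in> Hom C S T" "f \<noteq> Zer C S T"
  shows "is_isomorphism C f"
proof -
  note a = HomD[OF f(1)]
  obtain k where k: "is_kernel C f k" using kernel_exists a by blast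
  note kD = kernelD[OF k f(1)]
  have "is_zero_object C (Src C k) \<or> is_isomorphism C k"
    using kernel_monic[OF k] S HomD[OF kD(1)] unfolding is_simple_def by blast
  moreover have "\<not> is_isomorphism C k"
  proof
    assume "is_isomorphism C k"
    then obtain l where l: "l \<in> Hom C S (Src C k)" "k \<cdot> l = Ident C S"
      using isomorphismE[OF _ kD(1)] by blast
    have "f = f \<cdot> (k \<cdot> l)" using l a by (simp add: arr)
    also have "\<dots> = (f \<cdot> k) \<cdot> l" using a HomD[OF l(1)] HomD[OF kD(1)] by (simp add: arr)
    also have "\<dots> = Zer C S T" using kD a HomD[OF l(1)] by (simp add: dist)
    finally show False using f by simp
  qed
  ultimately have z: "is_zero_object C (Src C k)" by blast
  have "is_monic C f"
    unfolding is_monic_def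
  proof (intro conjI allI ballI impI)
    show "f \<in> Ar C" by (rule a)
    fix W g h assume gh: "g \<in> Hom C W (Src C f)" "h \<in> Hom C W (Src C f)" "f \<cdot> g = f \<cdot> h"
    have gh': "g \<in> Hom C W S" "h \<in> Hom C W S" using gh a by auto
    let ?d = "Add C g (Scl C (-1) h)"
    have d: "?d \<in> Hom C W S" using gh' by (intro Add_Hom Scl_Hom)
    have "f \<cdot> ?d = Zer C W T"
      using a HomD[OF gh'(1)] HomD[OF gh'(2)] gh(3) by (simp add: lin dist Add_minus)
    then obtain l where l: "l \<in> Hom C W (Src C k)" "k \<cdot> l = ?d"
      using kernelE[OF k f(1) d] by blast
    have "?d = Zer C W S" using zero_object_factor[OF l(1) kD(1) z] l(2) by simp
    then show "g = h" using diff_ZerD gh' by blast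
  qed
  then show ?thesis using T a simpleD(2)[OF S] unfolding is_simple_def by blast
qed

text \<open>The complement is the kernel \<open>k\<close> of the retraction \<open>r\<close>; its
  projection \<open>l\<close> comes from factoring \<open>1 - u r\<close> through
  \<open>k\<close>.\<close>

lemma split_monic_direct_summand:
  assumes u: "u \<in> Hom C S Y" and r: "r \<in> Hom C Y S" and ru: "r \<cdot> u = Ident C S"
  shows "direct_summand C S Y"
proof -
  obtain k where k: "is_kernel C r k" using kernel_exists HomD[OF r] by blast
  note kD = kernelD[OF k r]
  note a = HomD[OF u] HomD[OF r] HomD[OF kD(1)]
  have ru': "r \<cdot> (u \<cdot> x) = x" if "x \<in> Ar C" "Tgt C x = S" for x
    using that a ru Cmp_assoc_Ar[of x u r, symmetric] by (simp add: arr)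
  have rk': "r \<cdot> (k \<cdot> x) = Zer C (Src C x) S" if "x \<in> Ar C" "Tgt C x = Src C k" for x
    using that a kD(2) Cmp_assoc_Ar[of x k r, symmetric] by (simp add: dist)
  let ?e = "Add C (Ident C Y) (Scl C (-1) (u \<cdot> r))"
  have e: "?e \<in> Hom C Y Y" using Cmp_Hom[OF r u] Id_Hom a by (intro Add_Hom Scl_Hom) auto
  have "r \<cdot> ?e = Zer C Y S" using a ru' by (simp add: lin dist Add_minus)
  then obtain l where l: "l \<in> Hom C Y (Src C k)" "k \<cdot> l = ?e" using kernelE[OF k r e] by blast
  note a = a HomD[OF l(1)]
  have kl': "k \<cdot> (l \<cdot> x) = ?e \<cdot> x" if "x \<in> Ar C" "Tgt C x = Y" for x
    using that a l(2) Cmp_assoc_Ar[of x l k] by simp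
  have lu: "l \<cdot> u = Zer C S (Src C k)"
    by (rule kernel_cancel[OF k r])
      (use a ru kl' in \<open>auto simp: lin dist Add_minus intro!: Cmp_Hom[OF u l(1)] Zer_Hom\<close>)
  have lk: "l \<cdot> k = Ident C (Src C k)"
    by (rule kernel_cancel[OF k r])
      (use a kD(2) kl' in \<open>auto simp: lin dist Add_minus intro!: Cmp_Hom[OF kD(1) l(1)] Id_Hom\<close>)
  let ?F = "\<lambda>i::nat. if i = 0 then S else Src C k" and ?inc = "\<lambda>i::nat. if i = 0 then u else k"
  have "is_coproduct C {0, 1::nat} ?F Y ?inc"
  proof (rule coproductI)
    show "Y \<in> Ob C" using a by blast
    show "?inc i \<in> Hom C (?F i) Y" if "i \<in> {0, 1}" for i using u kD that by auto
    show "\<exists>h\<in>Hom C Y Z. \<forall>i\<in>{0, 1}. h \<cdot> ?inc i = f i"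
      if Z: "Z \<in> Ob C" and f: "\<And>i. i \<in> {0, 1} \<Longrightarrow> f i \<in> Hom C (?F i) Z" for Z f
    proof -
      have f0: "f 0 \<in> Hom C S Z" and f1: "f 1 \<in> Hom C (Src C k) Z" using f[of 0] f[of 1] by auto
      note b = a HomD[OF f0] HomD[OF f1]
      have "Add C (f 0 \<cdot> r) (f 1 \<cdot> l) \<cdot> u = f 0" using b ru lu by (simp add: lin dist)
      moreover have "Add C (f 0 \<cdot> r) (f 1 \<cdot> l) \<cdot> k = f 1" using b lk kD(2) by (simp add: lin dist)
      ultimately show ?thesis using Add_Hom[OF Cmp_Hom[OF r f0] Cmp_Hom[OF l(1) f1]]
        by (intro bexI[of _ "Add C (f 0 \<cdot> r) (f 1 \<cdot> l)"]) auto
    qed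
    show "f = g" if fg: "f \<in> Hom C Y Z" "g \<in> Hom C Y Z"
      and eq: "\<And>i. i \<in> {0, 1} \<Longrightarrow> f \<cdot> ?inc i = g \<cdot> ?inc i" for f g Z
    proof -
      have fu: "f \<cdot> u = g \<cdot> u" and fk: "f \<cdot> k = g \<cdot> k" using eq[of 0] eq[of 1] by auto
      have *: "h = Add C ((h \<cdot> u) \<cdot> r) ((h \<cdot> k) \<cdot> l)" if h: "h \<in> Hom C Y Z" for h
        using a HomD[OF h] l(2) by (simp add: lin dist add_ac Add_minus Add_minus_left)
      show ?thesis using *[OF fg(1)] *[OF fg(2)] fu fk by simp
    qed
  qed
  then show ?thesis unfolding direct_summand_def by (intro exI[of _ ?F] exI[of _ ?inc]) simp
qed

lemma direct_summandE:
  assumes "direct_summand C S Y"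
  obtains u r where "u \<in> Hom C S Y" "r \<in> Hom C Y S" "r \<cdot> u = Ident C S"
proof -
  obtain F inc where F: "is_coproduct C {0, 1::nat} F Y inc" "F 0 = S"
    using assms unfolding direct_summand_def by blast
  have ob: "F i \<in> Ob C" if "i \<in> {0,1}" for i using coproductD(2)[OF F(1) that] .
  let ?f = "\<lambda>i. if i = 0 then Ident C S else Zer C (F i) S"
  have "?f i \<in> Hom C (F i) S" if "i \<in> {0, 1}" for i
    using ob[OF that] ob[of 0] F(2) by (auto intro: Id_Hom Zer_Hom)
  moreover have "S \<in> Ob C" using ob[of 0] F(2) by simp
  ultimately obtain r where "r \<in> Hom C Y S" "\<And>i. i \<in> {0, 1} \<Longrightarrow> r \<cdot> inc i = ?f i"
    using coproductE[OF F(1), of S ?f] by blast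
  then show ?thesis using that[of "inc 0" r] coproductD(3)[OF F(1), of 0] F(2) by simp
qed

end

section \<open>Semisimple categories and quasi-inverses of arrows\<close>

locale semisimple_abelian_category = abelian_category C
  for C :: "('o, 'm, 'k::field, 'x) lincat_scheme" (structure) +
  assumes semisimple: "semisimple_category C"
begin

lemma decomposition:
  assumes "X \<in> Ob C"
  obtains n :: nat and F inc where "is_coproduct C {..<n} F X inc" "\<And>i. i < n \<Longrightarrow> is_simple C (F i)"
  using assms semisimple unfolding semisimple_category_def finite_sums_def by blast

text \<open>If some arrow between simple summands of \<open>X\<close> and \<open>Y\<close> induced by \<open>f\<close> is nonzero, then it
  is invertible, and it can be used as a pivot to make \<open>f\<close> vanish on one more summand of \<open>X\<close>.\<close>

lemma regular:
  assumes f: "f \<in> Hom C X Y"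
  obtains g where "g \<in> Hom C Y X" "f \<cdot> (g \<cdot> f) = f"
proof -
  obtain n :: nat and F inc where X: "is_coproduct C {..<n} F X inc"
    and F: "\<And>i. i < n \<Longrightarrow> is_simple C (F i)"
    using decomposition HomD(4)[OF f] by metis
  obtain m :: nat and G jnc where Y: "is_coproduct C {..<m} G Y jnc"
    and G: "\<And>i. i < m \<Longrightarrow> is_simple C (G i)"
    using decomposition HomD(5)[OF f] by metis
  have inc: "inc i \<in> Hom C (F i) X" if "i < n" for i using coproductD(3)[OF X] that by auto
  have "\<exists>g \<in> Hom C Y X. f \<cdot> (g \<cdot> f) = f"
    using f
  proof (induction "card {i. i < n \<and> f \<cdot> inc i \<noteq> Zer C (F i) Y}" arbitrary: f rule: less_induct)
    case (less f)
    note a = HomD[OF less.prems]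
    show ?case
    proof (cases "\<exists>i<n. f \<cdot> inc i \<noteq> Zer C (F i) Y")
      case False
      have "f = Zer C X Y"
        by (rule coproduct_ext[OF X less.prems Zer_Hom])
          (use False a HomD[OF inc] in \<open>auto simp: dist\<close>)
      then show ?thesis using a by (intro bexI[of _ "Zer C Y X"]) (auto simp: dist lin Zer_Hom)
    next
      case True
      then obtain i where i: "i < n" "f \<cdot> inc i \<noteq> Zer C (F i) Y" by blast
      obtain j h where j: "j \<in> {..<m}" "h \<in> Hom C Y (G j)"
        "h \<cdot> (f \<cdot> inc i) \<noteq> Zer C (F i) (G j)"
        by (rule coproduct_detect[OF Y _ Cmp_Hom[OF inc[OF i(1)] less.prems] i(2)]) auto
      let ?p = "h \<cdot> (f \<cdot> inc i)"
      have p: "?p \<in> Hom C (F i) (G j)" using inc[OF i(1)] less.prems j(2) by (blast intro: Cmp_Hom)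
      have "is_isomorphism C ?p" using Schur[OF F[OF i(1)] G p j(3)] j(1) by simp
      then obtain q where q: "q \<in> Hom C (G j) (F i)" "q \<cdot> ?p = Ident C (F i)" "?p \<cdot> q = Ident C (G j)"
        using isomorphismE[OF _ p] by blast
      note b = a HomD[OF inc[OF i(1)]] HomD[OF j(2)] HomD[OF q(1)] HomD[OF p]
      \<comment> \<open>The inverse \<open>q\<close> of the pivot, transported to an arrow from
        \<open>Y\<close> to \<open>X\<close>. It satisfies \<open>e f e = e\<close>, and
        \<open>e f\<close> fixes \<open>inc i\<close>.\<close>
      define e where "e = inc i \<cdot> (q \<cdot> h)"
      have e: "e \<in> Hom C Y X" unfolding e_def using inc[OF i(1)] q(1) j(2) by (blast intro: Cmp_Hom)
      note b = b HomD[OF e]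
      have "e \<cdot> (f \<cdot> inc i) = inc i \<cdot> (q \<cdot> ?p)" unfolding e_def using b by (simp add: arr)
      then have ei: "e \<cdot> (f \<cdot> inc i) = inc i" using b q(2) by (simp add: arr)
      have "e \<cdot> (f \<cdot> e) = inc i \<cdot> ((q \<cdot> ?p) \<cdot> (q \<cdot> h))" unfolding e_def using b by (simp add: arr)
      then have ee: "e \<cdot> (f \<cdot> e) = e" using b q(2) by (simp add: arr e_def)
      \<comment> \<open>Subtracting \<open>f e f\<close> clears column \<open>i\<close>, and a
        column that was zero stays zero, so the number of nonzero columns drops.\<close>
      let ?f = "Add C f (Scl C (-1) (f \<cdot> (e \<cdot> f)))"
      have f': "?f \<in> Hom C X Y" using less.prems e by (intro Add_Hom Scl_Hom Cmp_Hom) auto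
      have k: "?f \<cdot> inc k = Add C (f \<cdot> inc k) (Scl C (-1) (f \<cdot> (e \<cdot> (f \<cdot> inc k))))" if "k < n" for k
        using b HomD[OF inc[OF that]] by (simp add: lin dist)
      have "{k. k < n \<and> ?f \<cdot> inc k \<noteq> Zer C (F k) Y} \<subset> {k. k < n \<and> f \<cdot> inc k \<noteq> Zer C (F k) Y}"
      proof (rule psubsetI)
        show "{k. k < n \<and> ?f \<cdot> inc k \<noteq> Zer C (F k) Y} \<subseteq> {k. k < n \<and> f \<cdot> inc k \<noteq> Zer C (F k) Y}"
          using k b HomD[OF inc] by (auto simp: lin dist)
        have "?f \<cdot> inc i = Zer C (F i) Y" using k[OF i(1)] ei b by (simp add: lin Add_minus)
        then show "{k. k < n \<and> ?f \<cdot> inc k \<noteq> Zer C (F k) Y} \<noteq> {k. k < n \<and> f \<cdot> inc k \<noteq> Zer C (F k) Y}"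
          using i by blast
      qed
      then have "card {k. k < n \<and> ?f \<cdot> inc k \<noteq> Zer C (F k) Y} < card {k. k < n \<and> f \<cdot> inc k \<noteq> Zer C (F k) Y}"
        by (intro psubset_card_mono) auto
      then obtain g where g: "g \<in> Hom C Y X" "?f \<cdot> (g \<cdot> ?f) = ?f" using less.hyps f' by blast
      \<comment> \<open>If \<open>g\<close> is a quasi-inverse of \<open>f - f e f\<close>, then
        \<open>e + (1 - e f) g (1 - f e)\<close> is one of \<open>f\<close>, because
        \<open>f (1 - e f)\<close> and \<open>(1 - f e) f\<close> both equal
        \<open>f - f e f\<close>.\<close>
      let ?a = "Add C (Ident C X) (Scl C (-1) (e \<cdot> f))" and ?b = "Add C (Ident C Y) (Scl C (-1) (f \<cdot> e))"
      let ?g = "Add C e (?a \<cdot> (g \<cdot> ?b))"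
      note b = b HomD[OF g(1)]
      have ab: "?a \<in> Hom C X X" "?b \<in> Hom C Y Y"
        using e less.prems b by (auto intro!: Add_Hom Scl_Hom Cmp_Hom Id_Hom)
      have fa: "f \<cdot> ?a = ?f" "?b \<cdot> f = ?f" using b by (simp_all add: lin dist)
      note c = b HomD[OF ab(1)] HomD[OF ab(2)]
      have "f \<cdot> (?a \<cdot> (g \<cdot> ?b)) \<cdot> f = (f \<cdot> ?a) \<cdot> (g \<cdot> (?b \<cdot> f))"
        using c
        by (smt (verit) Ar_Cmp Src_Cmp Tgt_Cmp Cmp_assoc_Ar)
      also have "\<dots> = ?f" unfolding fa by (rule g(2))
      finally have 1: "f \<cdot> (?a \<cdot> (g \<cdot> ?b)) \<cdot> f = ?f" .
      have g': "?a \<cdot> (g \<cdot> ?b) \<in> Hom C Y X" using ab g by (blast intro: Cmp_Hom)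
      have "f \<cdot> (?g \<cdot> f) = Add C (f \<cdot> (e \<cdot> f)) (f \<cdot> (?a \<cdot> (g \<cdot> ?b)) \<cdot> f)"
        using b HomD[OF g'] by (simp add: Cmp_Add_left_Ar Cmp_Add_right_Ar arr)
      also have "\<dots> = f" unfolding 1 using b by (simp add: lin dist add_ac Add_minus Add_minus_left)
      finally show ?thesis using Add_Hom[OF e g'] by blast
    qed
  qed
  then show ?thesis using that by blast
qed

text \<open>For a quasi-inverse \<open>g\<close> of \<open>u\<close>, the composite
  \<open>g u\<close> is a nonzero endomorphism of \<open>S\<close>, hence invertible by Schur's
  lemma.\<close>

lemma simple_split_monic:
  assumes S: "is_simple C S" and u: "u \<in> Hom C S Y" "u \<noteq> Zer C S Y"
  obtains r where "r \<in> Hom C Y S" "r \<cdot> u = Ident C S"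
proof -
  obtain g where g: "g \<in> Hom C Y S" "u \<cdot> (g \<cdot> u) = u" using regular[OF u(1)] by blast
  have gu: "g \<cdot> u \<in> Hom C S S" using Cmp_Hom[OF u(1) g(1)] .
  note a = HomD[OF u(1)] HomD[OF g(1)]
  have "g \<cdot> u \<noteq> Zer C S S" using g(2) u(2) a by (auto simp: dist)
  then obtain w where w: "w \<in> Hom C S S" "w \<cdot> (g \<cdot> u) = Ident C S"
    using Schur[OF S S gu] isomorphismE[OF _ gu] by blast
  show ?thesis using that[of "w \<cdot> g"] Cmp_Hom[OF g(1) w(1)] w(2) a HomD[OF w(1)] by (simp add: arr)
qed

lemma simple_split_epic:
  assumes S: "is_simple C S" and u: "u \<in> Hom C Y S" "u \<noteq> Zer C Y S"
  obtains r where "r \<in> Hom C S Y" "u \<cdot> r = Ident C S"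
proof -
  obtain g where g: "g \<in> Hom C S Y" "u \<cdot> (g \<cdot> u) = u" using regular[OF u(1)] by blast
  have ug: "u \<cdot> g \<in> Hom C S S" using Cmp_Hom[OF g(1) u(1)] .
  note a = HomD[OF u(1)] HomD[OF g(1)]
  have "u \<cdot> g \<noteq> Zer C S S" using g(2) u(2) a Cmp_assoc_Ar[of u g u] by (auto simp: dist)
  then obtain w where w: "w \<in> Hom C S S" "(u \<cdot> g) \<cdot> w = Ident C S"
    using Schur[OF S S ug] isomorphismE[OF _ ug] by blast
  show ?thesis using that[of "g \<cdot> w"] Cmp_Hom[OF w(1) g(1)] w(2) a HomD[OF w(1)] by (simp add: arr)
qed

text \<open>This turns every statement about simple summands into the nonvanishing of an arrow, the
  form in which the later arguments run.\<close>

lemma simple_direct_summand_iff: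
  assumes "is_simple C S"
  shows "direct_summand C S Y \<longleftrightarrow> (\<exists>u \<in> Hom C S Y. u \<noteq> Zer C S Y)"
proof
  assume "direct_summand C S Y"
  then obtain u r where u: "u \<in> Hom C S Y" "r \<in> Hom C Y S" "r \<cdot> u = Ident C S"
    using direct_summandE by blast
  have "r \<cdot> Zer C S Y = Zer C S S"
    using HomD[OF u(1)] HomD[OF u(2)] by (simp add: dist)
  then have "u \<noteq> Zer C S Y" using simpleD(3)[OF assms] u(3) by auto
  then show "\<exists>u \<in> Hom C S Y. u \<noteq> Zer C S Y" using u by blast
next
  assume "\<exists>u \<in> Hom C S Y. u \<noteq> Zer C S Y"
  then show "direct_summand C S Y"
    using simple_split_monic[OF assms] split_monic_direct_summand by metis
qed

lemma simple_direct_summandI_epic: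
  assumes S: "is_simple C S" and u: "u \<in> Hom C Y S" "u \<noteq> Zer C Y S"
  shows "direct_summand C S Y"
  using simple_split_epic[OF assms] split_monic_direct_summand u by metis

lemma nonzero_simple_summand:
  assumes "X \<in> Ob C" "\<not> is_zero_object C X"
  obtains S u where "is_simple C S" "u \<in> Hom C S X" "u \<noteq> Zer C S X"
proof -
  obtain n :: nat and F inc where X: "is_coproduct C {..<n} F X inc"
    and F: "\<And>i. i < n \<Longrightarrow> is_simple C (F i)"
    using decomposition assms(1) by metis
  have "Ident C X \<noteq> Zer C X X" using assms by (simp add: zero_object_iff)
  then obtain i g where i: "i \<in> {..<n}" "g \<in> Hom C X (F i)" "inc i \<cdot> (g \<cdot> Ident C X) \<noteq> Zer C X X"
    by (rule coproduct_detect[OF X _ Id_Hom[OF assms(1)], rotated]) auto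
  then have "inc i \<noteq> Zer C (F i) X"
    using HomD[OF i(2)] by (auto simp: dist arr)
  then show ?thesis using that[OF F coproductD(3)[OF X i(1)]] i(1) by auto
qed

end

section \<open>Functors on localizations\<close>

lemma zigzag_Nil_iff: "zigzag C W X [] Y \<longleftrightarrow> X \<in> Ob C \<and> Y = X"
  by (auto elim: zigzag.cases intro: zigzag.Nil)

lemma zigzag_Fwd_iff: "zigzag C W X (Fwd f # w) Y \<longleftrightarrow> f \<in> Ar C \<and> X = Src C f \<and> zigzag C W (Tgt C f) w Y"
  by (auto elim: zigzag.cases intro: zigzag.Fwd)

lemma zigzag_Bwd_iff:
  "zigzag C W X (Bwd f # w) Y \<longleftrightarrow> f \<in> Ar C \<and> f \<in> W \<and> X = Tgt C f \<and> zigzag C W (Src C f) w Y"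
  by (auto elim: zigzag.cases intro: zigzag.Bwd)

lemmas zigzag_iffs = zigzag_Nil_iff zigzag_Fwd_iff zigzag_Bwd_iff

lemma zigzag_appendD:
  assumes "category C" "zigzag C W X (u @ v) Y"
  shows "\<exists>Z. zigzag C W X u Z \<and> zigzag C W Z v Y"
  using assms(2)
proof (induction u arbitrary: X)
  case Nil
  then show ?case using zigzag_ends[OF assms(1)] by (auto simp: zigzag_iffs)
next
  case (Cons a u)
  then show ?case by (cases a) (auto simp: zigzag_iffs)
qed

lemma zigzag_end_unique: "zigzag C W X u Y \<Longrightarrow> zigzag C W X u Y' \<Longrightarrow> Y' = Y"
proof (induction u arbitrary: X)
  case (Cons a u)
  then show ?case by (cases a) (auto simp: zigzag_iffs)
qed (auto simp: zigzag_iffs)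

text \<open>The part of the universal property of a localization that is used: \<open>zeval\<close>
  evaluates zigzags in \<open>B\<close>, and equivalent zigzags have equal values. This is the only
  means of telling arrows of the derived category apart.\<close>

locale inverting_functor = C: category C + B: category B
  for C :: "('o, 'm, 'x) cat_scheme" and B :: "('p, 'n, 'y) cat_scheme" +
  fixes W :: "'m set" and FO :: "'o \<Rightarrow> 'p" and FA :: "'m \<Rightarrow> 'n"
  assumes FO_Ob: "X \<in> Ob C \<Longrightarrow> FO X \<in> Ob B"
    and FA_Hom: "f \<in> Hom C X Y \<Longrightarrow> FA f \<in> Hom B (FO X) (FO Y)"
    and FA_Id: "X \<in> Ob C \<Longrightarrow> FA (Ident C X) = Ident B (FO X)"
    and FA_Cmp: "f \<in> Hom C X Y \<Longrightarrow> g \<in> Hom C Y Z \<Longrightarrow> FA (g \<cdot>\<^bsub>C\<^esub> f) = FA g \<cdot>\<^bsub>B\<^esub> FA f"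
    and FA_inverts: "f \<in> Ar C \<Longrightarrow> f \<in> W \<Longrightarrow> is_isomorphism B (FA f)"
begin

definition FA_inv :: "'m \<Rightarrow> 'n" where
  "FA_inv f = (SOME g. is_inverse B (FA f) g)"

primrec zeval :: "'m letter list \<Rightarrow> 'o \<Rightarrow> 'n" where
  "zeval [] X = Ident B (FO X)"
| "zeval (l # w) X = (case l of Fwd f \<Rightarrow> zeval w (Tgt C f) \<cdot>\<^bsub>B\<^esub> FA f
    | Bwd f \<Rightarrow> zeval w (Src C f) \<cdot>\<^bsub>B\<^esub> FA_inv f)"

lemma FA_inv:
  assumes "f \<in> Ar C" "f \<in> W"
  shows "FA_inv f \<in> Hom B (FO (Tgt C f)) (FO (Src C f))"
    "FA_inv f \<cdot>\<^bsub>B\<^esub> FA f = Ident B (FO (Src C f))" "FA f \<cdot>\<^bsub>B\<^esub> FA_inv f = Ident B (FO (Tgt C f))"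
proof -
  have "is_inverse B (FA f) (FA_inv f)"
    using FA_inverts[OF assms] unfolding is_isomorphism_def FA_inv_def by (rule someI_ex)
  moreover have "FA f \<in> Hom B (FO (Src C f)) (FO (Tgt C f))"
    using assms by (intro FA_Hom) (simp add: Hom_def)
  ultimately show "FA_inv f \<in> Hom B (FO (Tgt C f)) (FO (Src C f))"
    "FA_inv f \<cdot>\<^bsub>B\<^esub> FA f = Ident B (FO (Src C f))" "FA f \<cdot>\<^bsub>B\<^esub> FA_inv f = Ident B (FO (Tgt C f))"
    by (auto simp: is_inverse_def Hom_def)
qed

lemma FA_Ar: "f \<in> Ar C \<Longrightarrow> FA f \<in> Hom B (FO (Src C f)) (FO (Tgt C f))"
  by (intro FA_Hom) (simp add: Hom_def)

lemma zeval_Hom: "zigzag C W X w Y \<Longrightarrow> zeval w X \<in> Hom B (FO X) (FO Y)"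
proof (induction rule: zigzag.induct)
  case (Nil X)
  then show ?case by (simp add: B.Id_Hom FO_Ob)
next
  case (Fwd f w Y)
  then show ?case using B.Cmp_Hom[OF FA_Ar] by simp
next
  case (Bwd f w Y)
  then show ?case using B.Cmp_Hom[OF FA_inv(1)] by simp
qed

lemma zeval_append:
  "zigzag C W X u Y \<Longrightarrow> zigzag C W Y v Z \<Longrightarrow> zeval (u @ v) X = zeval v Y \<cdot>\<^bsub>B\<^esub> zeval u X"
proof (induction rule: zigzag.induct)
  case (Nil X)
  then show ?case using B.Id_right[OF zeval_Hom] by simp
next
  case (Fwd f w Y)
  then show ?case
    using B.Cmp_assoc[OF FA_Ar[OF Fwd(1)] zeval_Hom[OF Fwd(2)] zeval_Hom[OF Fwd(4)]] by simp
next
  case (Bwd f w Y)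
  then show ?case
    using B.Cmp_assoc[OF FA_inv(1)[OF Bwd(1,2)] zeval_Hom[OF Bwd(3)] zeval_Hom[OF Bwd(5)]] by simp
qed

lemma zeval_step:
  assumes "zigzag_step C a b" "zigzag C W X a Y" "zigzag C W X b Y'"
  shows "Y' = Y \<and> zeval a X = zeval b X"
  using assms
proof (cases rule: zigzag_step.cases)
  case (1 Z)
  then show ?thesis
    using assms FO_Ob by (auto simp: zigzag_iffs C.arr FA_Id B.arr)
next
  case (2 f g)
  then have fg: "f \<in> Ar C" "g \<in> Ar C" "Tgt C f = Src C g" using assms by (auto simp: zigzag_iffs)
  then have "FA (g \<cdot>\<^bsub>C\<^esub> f) = FA g \<cdot>\<^bsub>B\<^esub> FA f" by (intro FA_Cmp) (auto simp: Hom_def)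
  then show ?thesis
    using 2 assms fg B.HomD[OF FA_Ar[OF fg(1)]] B.HomD[OF FA_Ar[OF fg(2)]]
    by (auto simp: zigzag_iffs C.arr B.arr)
next
  case (3 f)
  then show ?thesis using assms B.Id_left[OF FA_inv(1)] FA_inv(2) by (auto simp: zigzag_iffs)
next
  case (4 f)
  then show ?thesis using assms B.Id_left[OF FA_Ar] FA_inv(3) by (auto simp: zigzag_iffs)
qed

text \<open>A rewriting step changes only a middle segment, so both zigzags are cut into three
  pieces. The cutting points agree because the end of a zigzag is determined by its word and its
  start.\<close>

lemma zeval_eq: "zigzag_eq C W X Y v w \<Longrightarrow> zeval v X = zeval w X"
proof (induction rule: zigzag_eq.induct)
  case (step a b u v)
  obtain Z1 Z2 where 1: "zigzag C W X u Z1" "zigzag C W Z1 a Z2" "zigzag C W Z2 v Y"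
    using zigzag_appendD[OF C.category_axioms step(2)] zigzag_appendD[OF C.category_axioms] by blast
  obtain Z3 Z4 where 2: "zigzag C W X u Z3" "zigzag C W Z3 b Z4" "zigzag C W Z4 v Y"
    using zigzag_appendD[OF C.category_axioms step(3)] zigzag_appendD[OF C.category_axioms] by blast
  have Z: "Z3 = Z1" using zigzag_end_unique[OF 1(1) 2(1)] .
  have "Z4 = Z2" "zeval a Z1 = zeval b Z1"
    using zeval_step[OF step(1) 1(2)] 2(2) unfolding Z by auto
  then have "zeval (a @ v) Z1 = zeval (b @ v) Z1"
    using zeval_append[OF 1(2,3)] zeval_append[OF 2(2,3)] Z by simp
  then show ?case
    using zeval_append[OF 1(1) zigzag_append[OF 1(2,3)]]
      zeval_append[OF 2(1) zigzag_append[OF 2(2,3)]] Z by simp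
qed auto

end


section \<open>Cohomology in a semisimple category\<close>

context linear_category
begin

lemma complexD:
  assumes "bounded_complex C K"
  shows "CO K i \<in> Ob C" "CD K i \<in> Ar C" "Src C (CD K i) = CO K i" "Tgt C (CD K i) = CO K (i + 1)"
    "CD K (i + 1) \<cdot> CD K i = Zer C (CO K i) (CO K (i + 1 + 1))"
    "CD K i \<cdot> CD K (i - 1) = Zer C (CO K (i - 1)) (CO K (i + 1))"
    "Tgt C (CD K (i - 1)) = CO K i"
proof -
  show 1: "CO K i \<in> Ob C" "CD K i \<in> Ar C" "Src C (CD K i) = CO K i" "Tgt C (CD K i) = CO K (i + 1)"
    "CD K (i + 1) \<cdot> CD K i = Zer C (CO K i) (CO K (i + 1 + 1))" for i
    using assms by (auto simp: bounded_complex_def Hom_def)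
  show "CD K i \<cdot> CD K (i - 1) = Zer C (CO K (i - 1)) (CO K (i + 1))" using 1(5)[of "i - 1"] by simp
  show "Tgt C (CD K (i - 1)) = CO K i" using 1(4)[of "i - 1"] by simp
qed

lemma complex_Hom: "bounded_complex C K \<Longrightarrow> CD K i \<in> Hom C (CO K i) (CO K (i + 1))"
    "bounded_complex C K \<Longrightarrow> CD K (i - 1) \<in> Hom C (CO K (i - 1)) (CO K i)"
  by (simp_all add: Hom_def complexD)

text \<open>A deformation retraction of \<open>K\<close> onto a complex \<open>H\<close> with zero differential.\<close>

definition splitting where
  "splitting K H \<iota> \<pi> s \<longleftrightarrow> (\<forall>i::int. H i \<in> Ob C \<and> \<iota> i \<in> Hom C (H i) (CO K i) \<and>
     \<pi> i \<in> Hom C (CO K i) (H i) \<and> s i \<in> Hom C (CO K i) (CO K (i - 1)) \<and>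
     \<pi> i \<cdot> \<iota> i = Ident C (H i) \<and> CD K i \<cdot> \<iota> i = Zer C (H i) (CO K (i + 1)) \<and>
     \<pi> i \<cdot> CD K (i - 1) = Zer C (CO K (i - 1)) (H i) \<and>
     Add C (\<iota> i \<cdot> \<pi> i) (Add C (CD K (i - 1) \<cdot> s i) (s (i + 1) \<cdot> CD K i)) = Ident C (CO K i))"

lemma splittingD:
  assumes "splitting K H \<iota> \<pi> s"
  shows "H i \<in> Ob C" "\<iota> i \<in> Hom C (H i) (CO K i)" "\<pi> i \<in> Hom C (CO K i) (H i)"
    "s i \<in> Hom C (CO K i) (CO K (i - 1))" "\<pi> i \<cdot> \<iota> i = Ident C (H i)"
    "CD K i \<cdot> \<iota> i = Zer C (H i) (CO K (i + 1))" "\<pi> i \<cdot> CD K (i - 1) = Zer C (CO K (i - 1)) (H i)"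
    "Add C (\<iota> i \<cdot> \<pi> i) (Add C (CD K (i - 1) \<cdot> s i) (s (i + 1) \<cdot> CD K i)) = Ident C (CO K i)"
    "\<pi> (i + 1) \<cdot> CD K i = Zer C (CO K i) (H (i + 1))"
    "s (i + 1) \<in> Hom C (CO K (i + 1)) (CO K i)"
  using assms[unfolded splitting_def, rule_format, of i]
    assms[unfolded splitting_def, rule_format, of "i + 1"] by simp_all

text \<open>This is the homotopy identity applied to \<open>x\<close>. Its last summand vanishes on
  a cocycle, so \<open>x\<close> differs from its retraction by a coboundary.\<close>

lemma splitting_cocycle:
  assumes K: "bounded_complex C K" and sp: "splitting K H \<iota> \<pi> s"
    and x: "x \<in> Hom C W (CO K i)" "CD K i \<cdot> x = Zer C W (CO K (i + 1))"
  shows "x = Add C (\<iota> i \<cdot> (\<pi> i \<cdot> x)) (CD K (i - 1) \<cdot> (s i \<cdot> x))"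
proof -
  note a = HomD[OF x(1)] HomD[OF splittingD(2)[OF sp, of i]] HomD[OF splittingD(3)[OF sp, of i]]
    HomD[OF splittingD(4)[OF sp, of i]] HomD[OF splittingD(10)[OF sp, of i]] complexD[OF K]
  have "x = Ident C (CO K i) \<cdot> x" using x by (simp add: Id_left)
  also have "\<dots> = Add C (\<iota> i \<cdot> (\<pi> i \<cdot> x)) (CD K (i - 1) \<cdot> (s i \<cdot> x))"
    unfolding splittingD(8)[OF sp, symmetric] using a x(2) by (simp add: lin dist)
  finally show ?thesis .
qed

lemma splitting_zero_object:
  assumes "splitting K H \<iota> \<pi> s" "is_zero_object C (CO K i)"
  shows "is_zero_object C (H i)"
  using zero_object_factor[OF splittingD(2,3)[OF assms(1)] assms(2)] splittingD(1,5)[OF assms(1), of i]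
  by (simp add: zero_object_iff)

lemma splitting_zero_differential:
  assumes K: "bounded_complex C K" and "\<And>i. CD K i = Zer C (CO K i) (CO K (i + 1))"
  shows "splitting K (CO K) (\<lambda>i. Ident C (CO K i)) (\<lambda>i. Ident C (CO K i)) (\<lambda>i. Zer C (CO K i) (CO K (i - 1)))"
  unfolding splitting_def
  using complexD(1)[OF K] by (simp add: assms(2) lin dist Id_Hom Zer_Hom)

text \<open>A cocycle on \<open>S\<close> in degree \<open>i\<close> that is no coboundary; for simple \<open>S\<close> this means that
  \<open>S\<close> is a summand of the \<open>i\<close>-th cohomology object.\<close>

definition occurs where
  "occurs K i S \<longleftrightarrow> (\<exists>x \<in> Hom C S (CO K i). CD K i \<cdot> x = Zer C S (CO K (i + 1)) \<and>
     (\<forall>y \<in> Hom C S (CO K (i - 1)). CD K (i - 1) \<cdot> y \<noteq> x))"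

text \<open>The projection kills coboundaries, and by \<open>splitting_cocycle\<close> a cocycle
  that it kills is a coboundary; the inclusion turns arrows into \<open>H i\<close> into cocycles.
  In particular any two splittings see the same simple objects.\<close>

lemma occurs_iff:
  assumes K: "bounded_complex C K" and sp: "splitting K H \<iota> \<pi> s"
  shows "occurs K i S \<longleftrightarrow> (\<exists>u \<in> Hom C S (H i). u \<noteq> Zer C S (H i))"
proof
  assume "occurs K i S"
  then obtain x where x: "x \<in> Hom C S (CO K i)" "CD K i \<cdot> x = Zer C S (CO K (i + 1))"
    "\<forall>y \<in> Hom C S (CO K (i - 1)). CD K (i - 1) \<cdot> y \<noteq> x" unfolding occurs_def by blast
  note a = HomD[OF x(1)] HomD[OF splittingD(2)[OF sp, of i]] HomD[OF splittingD(4)[OF sp, of i]] complexD[OF K]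
  have "\<pi> i \<cdot> x \<noteq> Zer C S (H i)"
  proof
    assume "\<pi> i \<cdot> x = Zer C S (H i)"
    then have "x = CD K (i - 1) \<cdot> (s i \<cdot> x)"
      using splitting_cocycle[OF K sp x(1,2)] a by (simp add: lin dist)
    then show False using x(3) Cmp_Hom[OF x(1) splittingD(4)[OF sp]] by metis
  qed
  then show "\<exists>u \<in> Hom C S (H i). u \<noteq> Zer C S (H i)"
    using Cmp_Hom[OF x(1) splittingD(3)[OF sp]] by blast
next
  assume "\<exists>u \<in> Hom C S (H i). u \<noteq> Zer C S (H i)"
  then obtain u where u: "u \<in> Hom C S (H i)" "u \<noteq> Zer C S (H i)" by blast
  note a = HomD[OF u(1)] HomD[OF splittingD(2)[OF sp, of i]] HomD[OF splittingD(3)[OF sp, of i]] complexD[OF K]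
  have 1: "CD K i \<cdot> (\<iota> i \<cdot> u) = Zer C S (CO K (i + 1))"
    using a splittingD(6)[OF sp, of i] Cmp_assoc_Ar[of u "\<iota> i" "CD K i", symmetric] by (simp add: dist)
  have 2: "\<pi> i \<cdot> (\<iota> i \<cdot> u) = u"
    using a splittingD(5)[OF sp, of i] Cmp_assoc_Ar[of u "\<iota> i" "\<pi> i", symmetric] by (simp add: arr)
  have "CD K (i - 1) \<cdot> y \<noteq> \<iota> i \<cdot> u" if y: "y \<in> Hom C S (CO K (i - 1))" for y
  proof
    assume "CD K (i - 1) \<cdot> y = \<iota> i \<cdot> u"
    then have "u = \<pi> i \<cdot> (CD K (i - 1) \<cdot> y)" using 2 by simp
    also have "\<dots> = Zer C S (H i)"
      using a HomD[OF y] splittingD(7)[OF sp, of i] Cmp_assoc_Ar[of y "CD K (i - 1)" "\<pi> i", symmetric]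
      by (simp add: dist)
    finally show False using u by simp
  qed
  then show "occurs K i S"
    unfolding occurs_def using 1 Cmp_Hom[OF u(1) splittingD(2)[OF sp]] by blast
qed

lemma complex_mapD:
  assumes "complex_map C K f L"
  shows "f i \<in> Hom C (CO K i) (CO L i)" "f (i + 1) \<cdot> CD K i = CD L i \<cdot> f i"
    "f i \<cdot> CD K (i - 1) = CD L (i - 1) \<cdot> f (i - 1)"
proof -
  show 1: "f i \<in> Hom C (CO K i) (CO L i)" "f (i + 1) \<cdot> CD K i = CD L i \<cdot> f i" for i
    using assms by (auto simp: complex_map_def)
  show "f i \<cdot> CD K (i - 1) = CD L (i - 1) \<cdot> f (i - 1)" using 1(2)[of "i - 1"] by simp
qed

text \<open>A cocycle and its retraction differ by a coboundary, which \<open>f\<close> sends to a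
  coboundary and \<open>\<pi>'\<close> then kills.\<close>

lemma splitting_map_cocycle:
  assumes K: "bounded_complex C K" and L: "bounded_complex C L" and f: "complex_map C K f L"
    and sp: "splitting K H \<iota> \<pi> s" and sp': "splitting L H' \<iota>' \<pi>' s'"
    and x: "x \<in> Hom C W (CO K i)" "CD K i \<cdot> x = Zer C W (CO K (i + 1))"
  shows "\<pi>' i \<cdot> (f i \<cdot> (\<iota> i \<cdot> (\<pi> i \<cdot> x))) = \<pi>' i \<cdot> (f i \<cdot> x)"
proof -
  note a = HomD[OF x(1)] HomD[OF splittingD(2)[OF sp, of i]] HomD[OF splittingD(3)[OF sp, of i]]
    HomD[OF splittingD(4)[OF sp, of i]] complexD[OF K] complexD[OF L]
    HomD[OF splittingD(3)[OF sp', of i]] HomD[OF complex_mapD(1)[OF f, of i]]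
    HomD[OF complex_mapD(1)[OF f, of "i - 1"]]
  let ?y = "s i \<cdot> x"
  have y: "?y \<in> Hom C W (CO K (i - 1))" using Cmp_Hom[OF x(1) splittingD(4)[OF sp]] .
  have "\<pi>' i \<cdot> (f i \<cdot> (CD K (i - 1) \<cdot> ?y)) = \<pi>' i \<cdot> ((f i \<cdot> CD K (i - 1)) \<cdot> ?y)"
    using a HomD[OF y] Cmp_assoc_Ar[of ?y "CD K (i - 1)" "f i"] by simp
  also have "\<dots> = (\<pi>' i \<cdot> CD L (i - 1)) \<cdot> (f (i - 1) \<cdot> ?y)"
    unfolding complex_mapD(3)[OF f] using a HomD[OF y]
      Cmp_assoc_Ar[of ?y "f (i - 1)" "CD L (i - 1)"]
      Cmp_assoc_Ar[of "f (i - 1) \<cdot> ?y" "CD L (i - 1)" "\<pi>' i"] by (simp add: Src_Cmp Tgt_Cmp Ar_Cmp)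
  also have "\<dots> = Zer C W (H' i)"
    using a HomD[OF y] by (simp add: splittingD(7)[OF sp'] Src_Cmp Tgt_Cmp Ar_Cmp dist)
  finally have 1: "\<pi>' i \<cdot> (f i \<cdot> (CD K (i - 1) \<cdot> ?y)) = Zer C W (H' i)" .
  have "\<pi>' i \<cdot> (f i \<cdot> x) = \<pi>' i \<cdot> (f i \<cdot> Add C (\<iota> i \<cdot> (\<pi> i \<cdot> x)) (CD K (i - 1) \<cdot> ?y))"
    using splitting_cocycle[OF K sp x] by simp
  also have "\<dots> = Add C (\<pi>' i \<cdot> (f i \<cdot> (\<iota> i \<cdot> (\<pi> i \<cdot> x)))) (\<pi>' i \<cdot> (f i \<cdot> (CD K (i - 1) \<cdot> ?y)))"
    using a HomD[OF y]
    by (simp add: Cmp_Add_right_Ar Ar_Cmp Src_Cmp Tgt_Cmp Ar_Add Src_Add Tgt_Add)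
  finally show ?thesis unfolding 1 using a by (simp add: lin dist)
qed

text \<open>The arrow \<open>v\<close> is induced by \<open>\<pi> z\<close> on the cokernel. Its
  inverse is \<open>c j\<close>, where \<open>j\<close> is the factorization of
  \<open>\<iota>\<close> through the kernel \<open>z\<close>.\<close>

lemma cohomology_iso_splitting:
  assumes K: "bounded_complex C K" and sp: "splitting K H \<iota> \<pi> s" and coh: "is_cohomology C K i z b c"
  obtains v where "v \<in> Hom C (Tgt C c) (H i)" "is_isomorphism C v" "v \<cdot> c = \<pi> i \<cdot> z"
proof -
  have z: "is_kernel C (CD K i) z" and b: "b \<in> Hom C (CO K (i - 1)) (Src C z)"
    and zb: "z \<cdot> b = CD K (i - 1)" and c: "is_cokernel C b c"
    using coh by (auto simp: is_cohomology_def)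
  note zD = kernelD[OF z complex_Hom(1)[OF K]] and cD = cokernelD[OF c b]
  note a = HomD[OF zD(1)] HomD[OF b] HomD[OF cD(1)] HomD[OF splittingD(2)[OF sp, of i]]
    HomD[OF splittingD(3)[OF sp, of i]] HomD[OF splittingD(4)[OF sp, of i]] complexD[OF K]
  have "(\<pi> i \<cdot> z) \<cdot> b = Zer C (CO K (i - 1)) (H i)"
    using a zb splittingD(7)[OF sp, of i] by (simp add: arr)
  then obtain v where v: "v \<in> Hom C (Tgt C c) (H i)" "v \<cdot> c = \<pi> i \<cdot> z"
    using cokernelE[OF c b Cmp_Hom[OF zD(1) splittingD(3)[OF sp]]] by blast
  obtain j where j: "j \<in> Hom C (H i) (Src C z)" "z \<cdot> j = \<iota> i"
    using kernelE[OF z complex_Hom(1)[OF K] splittingD(2,6)[OF sp]] by blast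
  note a = a HomD[OF v(1)] HomD[OF j(1)]
  have "v \<cdot> (c \<cdot> j) = (v \<cdot> c) \<cdot> j" using a by (simp add: arr)
  also have "\<dots> = Ident C (H i)" unfolding v(2) using a j(2) splittingD(5)[OF sp, of i] by (simp add: arr)
  finally have vu: "v \<cdot> (c \<cdot> j) = Ident C (H i)" .
  have u: "c \<cdot> j \<in> Hom C (H i) (Tgt C c)" using Cmp_Hom[OF j(1) cD(1)] .
  let ?w = "s i \<cdot> z"
  have w: "?w \<in> Hom C (Src C z) (CO K (i - 1))" using Cmp_Hom[OF zD(1) splittingD(4)[OF sp]] .
  have pz: "\<pi> i \<cdot> z \<in> Hom C (Src C z) (H i)" using Cmp_Hom[OF zD(1) splittingD(3)[OF sp]] .
  \<comment> \<open>The homotopy identity on the cocycles, with the common factor \<open>z\<close>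
    cancelled, writes the identity of the kernel as \<open>j \<pi> z\<close> plus a term that
    factors through \<open>b\<close>; the cokernel \<open>c\<close> kills the latter.\<close>
  have "z \<cdot> Add C (j \<cdot> (\<pi> i \<cdot> z)) (b \<cdot> ?w) = Add C ((z \<cdot> j) \<cdot> (\<pi> i \<cdot> z)) ((z \<cdot> b) \<cdot> ?w)"
    using a HomD[OF w] HomD[OF pz] by (simp add: lin Cmp_Add_right_Ar)
  also have "\<dots> = z \<cdot> Ident C (Src C z)"
    using splitting_cocycle[OF K sp zD(1,2)] a by (simp add: j(2) zb arr)
  finally have 1: "Add C (j \<cdot> (\<pi> i \<cdot> z)) (b \<cdot> ?w) = Ident C (Src C z)"
    by (rule kernel_cancel[OF z complex_Hom(1)[OF K], rotated -1])
      (use a in \<open>auto intro!: Add_Hom Id_Hom Cmp_Hom[OF pz j(1)] Cmp_Hom[OF w b]\<close>)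
  have "c = c \<cdot> Add C (j \<cdot> (\<pi> i \<cdot> z)) (b \<cdot> ?w)" unfolding 1 using a by (simp add: arr)
  also have "\<dots> = Add C (c \<cdot> (j \<cdot> (\<pi> i \<cdot> z))) ((c \<cdot> b) \<cdot> ?w)"
    using a HomD[OF w] HomD[OF pz] by (simp add: lin Cmp_Add_right_Ar)
  also have "\<dots> = c \<cdot> (j \<cdot> (\<pi> i \<cdot> z))"
    using a HomD[OF w] HomD[OF pz] cD(2) by (simp add: dist Ar_Cmp Src_Cmp Tgt_Cmp)
  also have "\<dots> = ((c \<cdot> j) \<cdot> v) \<cdot> c" unfolding v(2)[symmetric] using a by (simp add: arr)
  finally have 2: "((c \<cdot> j) \<cdot> v) \<cdot> c = Ident C (Tgt C c) \<cdot> c" using a by (simp add: arr)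
  have uv: "(c \<cdot> j) \<cdot> v = Ident C (Tgt C c)"
    by (rule cokernel_cancel[OF c b Cmp_Hom[OF v(1) u] _ 2]) (use a Id_Hom in auto)
  show ?thesis by (rule that[OF v(1) isomorphismI[OF v(1) u uv vu] v(2)])
qed

end

section \<open>Arrows induced on cohomology and quasi-isomorphisms\<close>

context abelian_category
begin

lemma cohomology_exists:
  assumes K: "bounded_complex C K"
  obtains z b c where "is_cohomology C K i z b c"
proof -
  obtain z where z: "is_kernel C (CD K i) z" using kernel_exists complexD(2)[OF K] by blast
  obtain b where b: "b \<in> Hom C (CO K (i - 1)) (Src C z)" "z \<cdot> b = CD K (i - 1)"
    using kernelE[OF z complex_Hom(1)[OF K] complex_Hom(2)[OF K] complexD(6)[OF K]] .
  obtain c where "is_cokernel C b c" using cokernel_exists HomD[OF b(1)] by blast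
  then show ?thesis using that z b by (auto simp: is_cohomology_def)
qed

text \<open>\<open>quasi_isos\<close> quantifies over all arrows induced on cohomology; existence
  keeps that condition from being vacuous.\<close>

lemma induced_exists:
  assumes K: "bounded_complex C K" and L: "bounded_complex C L" and f: "complex_map C K f L"
  obtains h where "induced_on_cohomology C K f L i h"
proof -
  obtain z b c where 1: "is_cohomology C K i z b c" using cohomology_exists[OF K] .
  obtain z' b' c' where 2: "is_cohomology C L i z' b' c'" using cohomology_exists[OF L] .
  have z: "is_kernel C (CD K i) z" and b: "b \<in> Hom C (CO K (i - 1)) (Src C z)"
    and zb: "z \<cdot> b = CD K (i - 1)" and c: "is_cokernel C b c"
    using 1 by (auto simp: is_cohomology_def)
  have z': "is_kernel C (CD L i) z'" and b': "b' \<in> Hom C (CO L (i - 1)) (Src C z')"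
    and zb': "z' \<cdot> b' = CD L (i - 1)" and c': "is_cokernel C b' c'"
    using 2 by (auto simp: is_cohomology_def)
  note zD = kernelD[OF z complex_Hom(1)[OF K]] and cD = cokernelD[OF c b]
  note zD' = kernelD[OF z' complex_Hom(1)[OF L]] and cD' = cokernelD[OF c' b']
  note fD = complex_mapD[OF f]
  note a = HomD[OF zD(1)] HomD[OF b] HomD[OF cD(1)] complexD[OF K] complexD[OF L]
    HomD[OF zD'(1)] HomD[OF b'] HomD[OF cD'(1)] HomD[OF fD(1)]
  have "CD L i \<cdot> (f i \<cdot> z) = (f (i + 1) \<cdot> CD K i) \<cdot> z" unfolding fD(2) using a by (simp add: arr)
  also have "\<dots> = Zer C (Src C z) (CO L (i + 1))" using a zD(2) by (simp add: arr dist)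
  finally obtain t where t: "t \<in> Hom C (Src C z) (Src C z')" "z' \<cdot> t = f i \<cdot> z"
    using kernelE[OF z' complex_Hom(1)[OF L] Cmp_Hom[OF zD(1) fD(1)]] by blast
  note a = a HomD[OF t(1)]
  have "z' \<cdot> (t \<cdot> b) = (z' \<cdot> t) \<cdot> b" using a by (simp add: arr)
  also have "\<dots> = f i \<cdot> (z \<cdot> b)" unfolding t(2) using a by (simp add: arr)
  also have "\<dots> = (z' \<cdot> b') \<cdot> f (i - 1)" unfolding zb zb' by (rule fD(3))
  also have "\<dots> = z' \<cdot> (b' \<cdot> f (i - 1))" using a by (simp add: arr)
  finally have tb: "t \<cdot> b = b' \<cdot> f (i - 1)"
    by (rule kernel_cancel[OF z' complex_Hom(1)[OF L] Cmp_Hom[OF b t(1)] Cmp_Hom[OF fD(1) b']])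
  have "(c' \<cdot> t) \<cdot> b = (c' \<cdot> b') \<cdot> f (i - 1)" using a tb by (simp add: arr)
  also have "\<dots> = Zer C (CO K (i - 1)) (Tgt C c')" using a cD'(2) by (simp add: dist)
  finally obtain h where "h \<in> Hom C (Tgt C c) (Tgt C c')" "h \<cdot> c = c' \<cdot> t"
    using cokernelE[OF c b Cmp_Hom[OF t(1) cD'(1)]] by blast
  then show ?thesis using that 1 2 t unfolding induced_on_cohomology_def by blast
qed

text \<open>The isomorphisms of \<open>cohomology_iso_splitting\<close> for \<open>K\<close> and
  \<open>L\<close> intertwine \<open>h\<close> with the arrow read off from the splittings. It
  suffices to compare the two after composing with the cokernel \<open>c\<close>.\<close>

lemma induced_iso_iff:
  assumes K: "bounded_complex C K" and L: "bounded_complex C L" and f: "complex_map C K f L"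
    and sp: "splitting K H \<iota> \<pi> s" and sp': "splitting L H' \<iota>' \<pi>' s'"
    and h: "induced_on_cohomology C K f L i h"
  shows "is_isomorphism C h \<longleftrightarrow> is_isomorphism C (\<pi>' i \<cdot> (f i \<cdot> \<iota> i))"
proof -
  obtain z b c z' b' c' t where 1: "is_cohomology C K i z b c" and 2: "is_cohomology C L i z' b' c'"
    and t: "t \<in> Hom C (Src C z) (Src C z')" "z' \<cdot> t = f i \<cdot> z"
    and h: "h \<in> Hom C (Tgt C c) (Tgt C c')" "h \<cdot> c = c' \<cdot> t"
    using h unfolding induced_on_cohomology_def by blast
  have z: "is_kernel C (CD K i) z" and b: "b \<in> Hom C (CO K (i - 1)) (Src C z)"
    and c: "is_cokernel C b c"
    using 1 by (auto simp: is_cohomology_def)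
  have z': "is_kernel C (CD L i) z'" and b': "b' \<in> Hom C (CO L (i - 1)) (Src C z')"
    and c': "is_cokernel C b' c'"
    using 2 by (auto simp: is_cohomology_def)
  note zD = kernelD[OF z complex_Hom(1)[OF K]] and cD = cokernelD[OF c b]
  note zD' = kernelD[OF z' complex_Hom(1)[OF L]] and cD' = cokernelD[OF c' b']
  obtain v where v: "v \<in> Hom C (Tgt C c) (H i)" "is_isomorphism C v" "v \<cdot> c = \<pi> i \<cdot> z"
    using cohomology_iso_splitting[OF K sp 1] .
  obtain v' where v': "v' \<in> Hom C (Tgt C c') (H' i)" "is_isomorphism C v'" "v' \<cdot> c' = \<pi>' i \<cdot> z'"
    using cohomology_iso_splitting[OF L sp' 2] .
  note fD = complex_mapD[OF f] and spD = splittingD[OF sp] and spD' = splittingD[OF sp']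
  note a = HomD[OF zD(1)] HomD[OF cD(1)] HomD[OF zD'(1)] HomD[OF cD'(1)] HomD[OF t(1)] HomD[OF h(1)]
    HomD[OF v(1)] HomD[OF v'(1)] HomD[OF fD(1)[of i]]
    HomD[OF spD(2)[of i]] HomD[OF spD(3)[of i]] HomD[OF spD'(3)[of i]]
  have g: "\<pi>' i \<cdot> (f i \<cdot> \<iota> i) \<in> Hom C (H i) (H' i)"
    using Cmp_Hom[OF Cmp_Hom[OF spD(2) fD(1)] spD'(3)] .
  have "(v' \<cdot> h) \<cdot> c = v' \<cdot> (c' \<cdot> t)" using a h(2) by (simp add: arr)
  also have "\<dots> = (v' \<cdot> c') \<cdot> t" using a by (simp add: arr)
  also have "\<dots> = \<pi>' i \<cdot> (f i \<cdot> z)" unfolding v'(3) using a t(2) by (simp add: arr)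
  also have "\<dots> = \<pi>' i \<cdot> (f i \<cdot> (\<iota> i \<cdot> (v \<cdot> c)))"
    unfolding v(3) by (rule splitting_map_cocycle[OF K L f sp sp' zD, symmetric])
  also have "\<dots> = ((\<pi>' i \<cdot> (f i \<cdot> \<iota> i)) \<cdot> v) \<cdot> c" using a by (simp add: arr)
  finally have "v' \<cdot> h = (\<pi>' i \<cdot> (f i \<cdot> \<iota> i)) \<cdot> v"
    by (rule cokernel_cancel[OF c b Cmp_Hom[OF h(1) v'(1)] Cmp_Hom[OF v(1) g]])
  then show ?thesis by (rule isomorphism_comp_iff[OF v(1) v'(1) v(2) v'(2) h(1) g])
qed

lemma quasi_isos_iff:
  assumes K: "bounded_complex C K" and L: "bounded_complex C L" and f: "complex_map C K f L"
    and sp: "splitting K H \<iota> \<pi> s" and sp': "splitting L H' \<iota>' \<pi>' s'"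
  shows "(K, f, L) \<in> quasi_isos C \<longleftrightarrow> (\<forall>i. is_isomorphism C (\<pi>' i \<cdot> (f i \<cdot> \<iota> i)))"
proof -
  have "(K, f, L) \<in> Ar (complex_cat C)" using K L f by (simp add: complex_cat_def)
  moreover have "(\<forall>h. induced_on_cohomology C K f L i h \<longrightarrow> is_isomorphism C h) \<longleftrightarrow>
      is_isomorphism C (\<pi>' i \<cdot> (f i \<cdot> \<iota> i))" for i
    using induced_iso_iff[OF K L f sp sp'] induced_exists[OF K L f, of i] by metis
  ultimately show ?thesis by (auto simp: quasi_isos_def)
qed

end

section \<open>Existence of deformation retractions\<close>

context semisimple_abelian_category
begin

text \<open>If \<open>d g d = d\<close> for every differential, then \<open>p = g d\<close> and \<open>q = d g\<close> are idempotents of each \<open>K\<^sup>i\<close>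
  with \<open>p q = 0\<close>; the retract is the image of the idempotent \<open>(1 - q) (1 - p)\<close>, and \<open>g (1 - p)\<close> is a
  homotopy from it to the identity.\<close>

lemma splitting_exists:
  assumes K: "bounded_complex C K"
  obtains H \<iota> \<pi> s where "splitting K H \<iota> \<pi> s"
proof -
  note cD = complexD[OF K]
  have "\<exists>g. \<forall>i. g i \<in> Hom C (CO K (i + 1)) (CO K i) \<and> CD K i \<cdot> (g i \<cdot> CD K i) = CD K i"
  proof (rule choice[of "\<lambda>i g. g \<in> Hom C (CO K (i + 1)) (CO K i) \<and> CD K i \<cdot> (g \<cdot> CD K i) = CD K i"], rule allI)
    fix i
    obtain g where "g \<in> Hom C (CO K (i + 1)) (CO K i)" "CD K i \<cdot> (g \<cdot> CD K i) = CD K i"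
      by (rule regular[OF complex_Hom(1)[OF K]])
    then show "\<exists>g. g \<in> Hom C (CO K (i + 1)) (CO K i) \<and> CD K i \<cdot> (g \<cdot> CD K i) = CD K i" by blast
  qed
  then obtain g where g0: "\<And>i. g i \<in> Hom C (CO K (i + 1)) (CO K i)"
    and dgd: "\<And>i. CD K i \<cdot> (g i \<cdot> CD K i) = CD K i" by blast
  have g1: "g (i - 1) \<in> Hom C (CO K i) (CO K (i - 1))" for i using g0[of "i - 1"] by simp
  define p where "p i = g i \<cdot> CD K i" for i
  define q where "q i = CD K (i - 1) \<cdot> g (i - 1)" for i
  define A where "A i = Add C (Ident C (CO K i)) (Scl C (-1) (q i))" for i
  define B where "B i = Add C (Ident C (CO K i)) (Scl C (-1) (p i))" for i
  define e where "e i = A i \<cdot> B i" for i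
  define s where "s i = g (i - 1) \<cdot> B i" for i
  have p: "p i \<in> Hom C (CO K i) (CO K i)" and q: "q i \<in> Hom C (CO K i) (CO K i)" for i
    unfolding p_def q_def using Cmp_Hom[OF complex_Hom(1)[OF K] g0] Cmp_Hom[OF g1 complex_Hom(2)[OF K]] .
  have A: "A i \<in> Hom C (CO K i) (CO K i)" and B: "B i \<in> Hom C (CO K i) (CO K i)" for i
    unfolding A_def B_def using p q Id_Hom cD(1) by (blast intro: Add_Hom Scl_Hom)+
  have e: "e i \<in> Hom C (CO K i) (CO K i)" for i unfolding e_def using Cmp_Hom[OF B A] .
  have s: "s i \<in> Hom C (CO K i) (CO K (i - 1))" for i unfolding s_def using Cmp_Hom[OF B g1] .
  note a = cD HomD[OF p] HomD[OF q] HomD[OF A] HomD[OF B] HomD[OF e] HomD[OF g0] HomD[OF g1] HomD[OF s]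
  have dp: "CD K i \<cdot> p i = CD K i" for i unfolding p_def by (rule dgd)
  have dq: "CD K i \<cdot> q i = Zer C (CO K i) (CO K (i + 1))" for i
    unfolding q_def using a Cmp_assoc_Ar[of "g (i - 1)" "CD K (i - 1)" "CD K i", symmetric] by (simp add: dist)
  have qd: "q i \<cdot> CD K (i - 1) = CD K (i - 1)" for i
    unfolding q_def using a dgd[of "i - 1"] by (simp add: arr)
  have pd: "p i \<cdot> CD K (i - 1) = Zer C (CO K (i - 1)) (CO K i)" for i
    unfolding p_def using a by (simp add: arr dist)
  have pp: "p i \<cdot> p i = p i" for i
  proof -
    have "p i \<cdot> p i = g i \<cdot> (CD K i \<cdot> p i)" unfolding p_def using a by (simp add: arr)
    then show ?thesis unfolding dp by (simp add: p_def)
  qed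
  have qq: "q i \<cdot> q i = q i" for i
  proof -
    have "q i \<cdot> q i = (q i \<cdot> CD K (i - 1)) \<cdot> g (i - 1)" unfolding q_def using a by (simp add: arr)
    then show ?thesis unfolding qd by (simp add: q_def)
  qed
  have pq: "p i \<cdot> q i = Zer C (CO K i) (CO K i)" for i
  proof -
    have "p i \<cdot> q i = (p i \<cdot> CD K (i - 1)) \<cdot> g (i - 1)" unfolding q_def using a by (simp add: arr)
    then show ?thesis unfolding pd using a by (simp add: dist)
  qed
  have BA: "B i \<cdot> A i = Add C (A i) (Scl C (-1) (p i))" for i
    unfolding A_def B_def using a pq by (simp add: lin dist add_ac)
  have pB: "p i \<cdot> B i = Zer C (CO K i) (CO K i)" for i
    unfolding B_def using a pp by (simp add: lin dist Add_minus)
  have AA: "A i \<cdot> A i = A i" for i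
    unfolding A_def using a qq[of i] by (simp add: lin dist add_ac Add_minus Add_minus_left)
  have BB: "B i \<cdot> B i = B i" for i
    unfolding B_def using a pp[of i] by (simp add: lin dist add_ac Add_minus Add_minus_left)
  have dA: "CD K i \<cdot> A i = CD K i" for i
    unfolding A_def using a dq[of i] by (simp add: lin dist)
  have dB: "CD K i \<cdot> B i = Zer C (CO K i) (CO K (i + 1))" for i
    unfolding B_def using a dp[of i] by (simp add: lin dist Add_minus)
  have Ad: "A i \<cdot> CD K (i - 1) = Zer C (CO K (i - 1)) (CO K i)" for i
    unfolding A_def using a qd[of i] by (simp add: lin dist Add_minus)
  have Bd: "B i \<cdot> CD K (i - 1) = CD K (i - 1)" for i
    unfolding B_def using a pd[of i] by (simp add: lin dist)
  \<comment> \<open>Since \<open>B A = A - p\<close>, the square is \<open>A (A - p) B\<close>, and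
    \<open>p B = 0\<close> leaves \<open>A A B = A B\<close>.\<close>
  have ee: "e i \<cdot> e i = e i" for i
  proof -
    have "e i \<cdot> e i = A i \<cdot> ((B i \<cdot> A i) \<cdot> B i)" unfolding e_def using a by (simp add: arr)
    also have "\<dots> = Add C ((A i \<cdot> A i) \<cdot> B i) (Scl C (-1) (A i \<cdot> (p i \<cdot> B i)))"
      unfolding BA using a by (simp add: lin dist)
    finally show ?thesis unfolding AA pB e_def[symmetric] using a by (simp add: lin dist)
  qed
  have de: "CD K i \<cdot> e i = Zer C (CO K i) (CO K (i + 1))" for i
    unfolding e_def using a dA[of i] dB[of i] Cmp_assoc_Ar[of "B i" "A i" "CD K i", symmetric] by simp
  have ed: "e i \<cdot> CD K (i - 1) = Zer C (CO K (i - 1)) (CO K i)" for i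
    unfolding e_def using a Ad[of i] Bd[of i] by (simp add: arr)
  have sd: "s (i + 1) \<cdot> CD K i = p i" for i
  proof -
    have "B (i + 1) \<cdot> CD K i = CD K i" using Bd[of "i + 1"] by simp
    then show ?thesis unfolding s_def p_def using a HomD[OF B[of "i + 1"]] by (simp add: arr)
  qed
  \<comment> \<open>Because \<open>A + q = 1\<close> and \<open>B + p = 1\<close>, the sum
    \<open>A B + q B + p\<close> collapses to \<open>B + p\<close> and then to the identity.\<close>
  have hom: "Add C (e i) (Add C (CD K (i - 1) \<cdot> s i) (s (i + 1) \<cdot> CD K i)) = Ident C (CO K i)" for i
  proof -
    have ds: "CD K (i - 1) \<cdot> s i = q i \<cdot> B i" unfolding s_def q_def using a by (simp add: arr)
    have "Add C (e i) (q i \<cdot> B i) = Add C (A i) (q i) \<cdot> B i" unfolding e_def using a by (simp add: lin dist)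
    also have "Add C (A i) (q i) = Ident C (CO K i)" unfolding A_def using a
      by (simp add: lin dist add_ac cancel)
    also have "Ident C (CO K i) \<cdot> B i = B i" using a by (simp add: arr)
    finally have "Add C (Add C (e i) (q i \<cdot> B i)) (p i) = Add C (B i) (p i)" by simp
    also have "\<dots> = Ident C (CO K i)" unfolding B_def using a by (simp add: lin dist add_ac cancel)
    finally show ?thesis unfolding ds sd using a by (simp add: lin add_ac)
  qed
  \<comment> \<open>Idempotents split in an abelian category: the kernel of \<open>1 - e\<close> is
    the image of \<open>e\<close>.\<close>
  have "\<exists>k r. k \<in> Hom C (Src C k) (CO K i) \<and> r \<in> Hom C (CO K i) (Src C k) \<and>
      k \<cdot> r = e i \<and> r \<cdot> k = Ident C (Src C k)" for i
  proof -
    let ?f = "Add C (Ident C (CO K i)) (Scl C (-1) (e i))"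
    have f: "?f \<in> Hom C (CO K i) (CO K i)" using e Id_Hom cD(1) by (auto intro: Add_Hom Scl_Hom)
    obtain k where k: "is_kernel C ?f k" using kernel_exists HomD[OF f] by blast
    note kD = kernelD[OF k f]
    have "?f \<cdot> e i = Zer C (CO K i) (CO K i)" using a ee[of i] by (simp add: lin dist Add_minus)
    then obtain r where r: "r \<in> Hom C (CO K i) (Src C k)" "k \<cdot> r = e i" using kernelE[OF k f e] by blast
    note b = a HomD[OF kD(1)] HomD[OF r(1)]
    have ek: "e i \<cdot> k = k"
      using kD(2) b diff_ZerD[OF kD(1) Cmp_Hom[OF kD(1) e]] by (simp add: lin dist)
    have "k \<cdot> (r \<cdot> k) = k \<cdot> Ident C (Src C k)"
      using b r(2) ek Cmp_assoc_Ar[of k r k] by (simp add: arr)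
    then have "r \<cdot> k = Ident C (Src C k)"
      by (rule kernel_cancel[OF k f Cmp_Hom[OF kD(1) r(1)] Id_Hom, rotated]) (use b in auto)
    then show ?thesis using kD r by blast
  qed
  then obtain k r where k: "\<And>i. k i \<in> Hom C (Src C (k i)) (CO K i)"
    and r: "\<And>i. r i \<in> Hom C (CO K i) (Src C (k i))"
    and kr: "\<And>i. k i \<cdot> r i = e i" and rk: "\<And>i. r i \<cdot> k i = Ident C (Src C (k i))" by metis
  note b = a HomD[OF k] HomD[OF r]
  have ek: "e i \<cdot> k i = k i" for i unfolding kr[symmetric] using b rk by (simp add: arr)
  have re: "r i \<cdot> e i = r i" for i
    unfolding kr[symmetric] using b rk Cmp_assoc_Ar[of "r i" "k i" "r i", symmetric] by (simp add: arr)
  have dk: "CD K i \<cdot> k i = Zer C (Src C (k i)) (CO K (i + 1))" for i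
  proof -
    have "CD K i \<cdot> k i = (CD K i \<cdot> e i) \<cdot> k i" using b ek by (simp add: arr)
    then show ?thesis unfolding de using b by (simp add: dist)
  qed
  have rd: "r i \<cdot> CD K (i - 1) = Zer C (CO K (i - 1)) (Src C (k i))" for i
  proof -
    have "r i \<cdot> CD K (i - 1) = r i \<cdot> (e i \<cdot> CD K (i - 1))"
      using b re Cmp_assoc_Ar[of "CD K (i - 1)" "e i" "r i", symmetric] by simp
    then show ?thesis unfolding ed using b by (simp add: dist)
  qed
  have "splitting K (\<lambda>i. Src C (k i)) k r s"
    unfolding splitting_def kr using k r s rk dk rd hom b by simp
  then show ?thesis by (rule that)
qed

end

section \<open>The derived category of a semisimple category\<close>

lemma (in category) inverse_unique:
  assumes "f \<in> Hom C X Y" "g \<in> Hom C Y X" "h \<in> Hom C Y X" "g \<cdot> f = Ident C X" "f \<cdot> h = Ident C Y"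
  shows "g = h"
proof -
  have "g = (g \<cdot> (f \<cdot> h))" using assms Id_right by simp
  also have "\<dots> = (g \<cdot> f) \<cdot> h" using Cmp_assoc[OF assms(3,1,2)] by simp
  finally show ?thesis using assms Id_left by simp
qed

context linear_category
begin

lemma chosen_zero: "\<exists>X. is_zero_object C X \<Longrightarrow> is_zero_object C (chosen_zero C)"
  unfolding chosen_zero_def by (rule someI_ex)

lemma coproduct_retraction:
  assumes "is_coproduct C I F Y inc" "i \<in> I"
  obtains r where "r \<in> Hom C Y (F i)" "r \<cdot> inc i = Ident C (F i)"
    "\<And>j. j \<in> I \<Longrightarrow> j \<noteq> i \<Longrightarrow> r \<cdot> inc j = Zer C (F j) (F i)"
proof -
  let ?f = "\<lambda>j. if j = i then Ident C (F i) else Zer C (F j) (F i)"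
  have "?f j \<in> Hom C (F j) (F i)" if "j \<in> I" for j
    using coproductD(2)[OF assms(1)] assms(2) that by (simp add: Id_Hom Zer_Hom)
  then obtain r where "r \<in> Hom C Y (F i)" "\<And>j. j \<in> I \<Longrightarrow> r \<cdot> inc j = ?f j"
    using coproductE[OF assms(1) coproductD(2)[OF assms], of ?f] by blast
  then show ?thesis using that[of r] assms(2) by auto
qed

lemma complex_cat_Hom_iff: "F \<in> Hom (complex_cat C) K L \<longleftrightarrow>
    (\<exists>f. F = (K, f, L) \<and> bounded_complex C K \<and> bounded_complex C L \<and> complex_map C K f L)"
  by (auto simp: Hom_def complex_cat_def)

lemma complex_cat_simps:
  "Ob (complex_cat C) = {K. bounded_complex C K}"
  "Ident (complex_cat C) K = (K, \<lambda>i. Ident C (CO K i), K)"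
  "(L', g, N) \<cdot>\<^bsub>complex_cat C\<^esub> (K, f, L) = (K, \<lambda>i. g i \<cdot> f i, N)"
  "Src (complex_cat C) (K, f, L) = K" "Tgt (complex_cat C) (K, f, L) = L"
  "(K, f, L) \<in> Ar (complex_cat C) \<longleftrightarrow> bounded_complex C K \<and> bounded_complex C L \<and> complex_map C K f L"
  by (auto simp: complex_cat_def)

lemma complex_map_Cmp:
  assumes "bounded_complex C K" "bounded_complex C L" "bounded_complex C N"
    and "complex_map C K f L" "complex_map C L g N"
  shows "complex_map C K (\<lambda>i. g i \<cdot> f i) N"
  using category.Cmp_Hom[OF complex_cat_category[OF linear_category_axioms], of "(K, f, L)" K L "(L, g, N)" N] assms
  by (auto simp: complex_cat_Hom_iff complex_cat_simps)

lemma complex_map_Id: "bounded_complex C K \<Longrightarrow> complex_map C K (\<lambda>i. Ident C (CO K i)) K"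
  using category.Id_Hom[OF complex_cat_category[OF linear_category_axioms], of K]
  by (auto simp: complex_cat_Hom_iff complex_cat_simps)

lemma complex_map_Zer:
  "bounded_complex C K \<Longrightarrow> bounded_complex C L \<Longrightarrow> complex_map C K (\<lambda>i. Zer C (CO K i) (CO L i)) L"
  unfolding complex_map_def by (simp add: complexD Zer_Hom dist)

lemma shift_complex_0: "bounded_complex C K \<Longrightarrow> shift_complex C 0 K = K"
  by (simp add: shift_complex_def)

lemma shift_complex_shift:
  assumes "bounded_complex C K"
  shows "shift_complex C a (shift_complex C b K) = shift_complex C (a + b) K"
  using complexD(2)[OF assms]
  by (auto simp: shift_complex_def fun_eq_iff Scl_Scl Scl_1 add.assoc intro!: cochain.equality)

lemma shift_complex_bounded:
  assumes K: "bounded_complex C K"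
  shows "bounded_complex C (shift_complex C a K)"
proof -
  obtain n where n: "\<And>i. \<bar>i\<bar> > n \<Longrightarrow> is_zero_object C (CO K i)"
    using K by (auto simp: bounded_complex_def)
  have "is_zero_object C (CO K (i + a))" if "\<bar>i\<bar> > \<bar>n\<bar> + \<bar>a\<bar>" for i
    using that by (intro n) linarith
  then have "\<exists>n. \<forall>i. \<bar>i\<bar> > n \<longrightarrow> is_zero_object C (CO K (i + a))" by blast
  moreover have "CO K (i + 1 + a) = CO K (i + a + 1)" "CD K (i + 1 + a) = CD K (i + a + 1)" for i
    by (simp_all add: algebra_simps)
  moreover have "CO K (i + 1 + 1 + a) = CO K (i + a + 1 + 1)" for i
    by (simp add: algebra_simps)
  ultimately show ?thesis
    using complexD[OF K]
    unfolding bounded_complex_def shift_complex_def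
    by (auto simp: Hom_def Ar_Scl Src_Scl Tgt_Scl dist simp del: add_uminus_conv_diff)
qed

text \<open>The sign that an odd shift puts on the differential changes neither the cocycles nor the
  coboundaries.\<close>

lemma occurs_shift:
  assumes K: "bounded_complex C K"
  shows "occurs (shift_complex C a K) j S \<longleftrightarrow> occurs K (j + a) S"
proof -
  have e: "CO K (j + 1 + a) = CO K (j + a + 1)" "CO K (j - 1 + a) = CO K (j + a - 1)"
    "CD K (j - 1 + a) = CD K (j + a - 1)" by (simp_all add: algebra_simps)
  note c = complexD[OF K, of "j + a"] complexD[OF K, of "j + a - 1"] complexD(1)[OF K]
  show ?thesis
  proof (cases "even a")
    case True
    then show ?thesis unfolding occurs_def shift_complex_def by (simp add: e)
  next
    case False
    have 1: "Scl C (-1) (CD K (j + a)) \<cdot> x = Zer C S (CO K (j + a + 1)) \<longleftrightarrow>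
        CD K (j + a) \<cdot> x = Zer C S (CO K (j + a + 1))" if x: "x \<in> Hom C S (CO K (j + a))" for x
    proof
      assume h: "Scl C (-1) (CD K (j + a)) \<cdot> x = Zer C S (CO K (j + a + 1))"
      have "CD K (j + a) \<cdot> x = Scl C (-1) (Scl C (-1) (CD K (j + a)) \<cdot> x)"
        using c HomD[OF x] by (simp add: lin dist)
      then show "CD K (j + a) \<cdot> x = Zer C S (CO K (j + a + 1))"
        unfolding h using c HomD[OF x] by (simp add: Scl_Zer)
    qed (use c HomD[OF x] in \<open>simp add: dist\<close>)
    have 2: "(\<forall>y \<in> Hom C S (CO K (j + a - 1)). Scl C (-1) (CD K (j + a - 1)) \<cdot> y \<noteq> x) \<longleftrightarrow>
        (\<forall>y \<in> Hom C S (CO K (j + a - 1)). CD K (j + a - 1) \<cdot> y \<noteq> x)" for x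
    proof -
      have "Scl C (-1) (CD K (j + a - 1)) \<cdot> y = CD K (j + a - 1) \<cdot> Scl C (-1) y"
        "Scl C (-1) (CD K (j + a - 1)) \<cdot> Scl C (-1) y = CD K (j + a - 1) \<cdot> y"
        if y: "y \<in> Hom C S (CO K (j + a - 1))" for y
        using c HomD[OF y] by (simp_all add: lin dist)
      then show ?thesis using Scl_Hom by metis
    qed
    show ?thesis using False 1 2 unfolding occurs_def shift_complex_def by (simp add: e)
  qed
qed

end

section \<open>Chain maps as arrows of the derived category\<close>

context semisimple_abelian_category
begin

lemma chosen_zero_object: "is_zero_object C (chosen_zero C)" "chosen_zero C \<in> Ob C"
  using chosen_zero[OF zero_exists] by (auto simp: is_zero_object_def)

text \<open>The complex \<open>S[-j]\<close>, that is, \<open>S\<close> in cohomological degree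
  \<open>j\<close>. Degrees add up under the action, which makes them more convenient than
  shifts.\<close>

definition stalk_at :: "int \<Rightarrow> 'o \<Rightarrow> ('o, 'm) cochain" where
  "stalk_at j S = shift_complex C (- j) (stalk C S)"

lemma CO_stalk_at: "CO (stalk_at j S) i = (if i = j then S else chosen_zero C)"
  by (simp add: stalk_at_def shift_complex_def stalk_def Let_def)

lemma CD_stalk_at:
  assumes "S \<in> Ob C"
  shows "CD (stalk_at j S) i = Zer C (CO (stalk_at j S) i) (CO (stalk_at j S) (i + 1))"
proof -
  have "i + 1 - j = i - j + 1" by simp
  then show ?thesis
    using assms chosen_zero_object(2)
    by (simp add: stalk_at_def shift_complex_def stalk_def Let_def Scl_Zer)
qed

lemma stalk_at_bounded:
  assumes "S \<in> Ob C"
  shows "bounded_complex C (stalk_at j S)"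
proof -
  have ob: "CO (stalk_at j S) i \<in> Ob C" for i using assms chosen_zero_object by (simp add: CO_stalk_at)
  have "\<forall>i. \<bar>i\<bar> > \<bar>j\<bar> \<longrightarrow> is_zero_object C (CO (stalk_at j S) i)"
    using chosen_zero_object by (auto simp: CO_stalk_at)
  then show ?thesis
    unfolding bounded_complex_def using ob
    by (auto simp: CD_stalk_at[OF assms] Zer_Hom dist lin)
qed

lemma stalk_map_from:
  assumes L: "bounded_complex C L" and x: "x \<in> Hom C S (CO L j)" "CD L j \<cdot> x = Zer C S (CO L (j + 1))"
  shows "complex_map C (stalk_at j S) (\<lambda>i. if i = j then x else Zer C (CO (stalk_at j S) i) (CO L i)) L"
proof -
  have S: "S \<in> Ob C" using HomD[OF x(1)] by simp
  note a = complexD[OF L] HomD[OF x(1)] complexD(1)[OF stalk_at_bounded[OF S]] chosen_zero_object(2)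
  show ?thesis
    unfolding complex_map_def
    using a x by (auto simp: CD_stalk_at[OF S] CO_stalk_at Zer_Hom lin dist)
qed

lemma stalk_map_to:
  assumes L: "bounded_complex C L" and y: "y \<in> Hom C (CO L j) S"
    "y \<cdot> CD L (j - 1) = Zer C (CO L (j - 1)) S"
  shows "complex_map C L (\<lambda>i. if i = j then y else Zer C (CO L i) (CO (stalk_at j S) i)) (stalk_at j S)"
proof -
  have S: "S \<in> Ob C" using HomD[OF y(1)] by simp
  note a = complexD[OF L] HomD[OF y(1)] complexD(1)[OF stalk_at_bounded[OF S]] chosen_zero_object(2)
  have "y \<cdot> CD L i = Zer C (CO L i) S" if "i + 1 = j" for i using that y(2) by auto
  then show ?thesis
    unfolding complex_map_def
    using a y by (auto simp: CD_stalk_at[OF S] CO_stalk_at Zer_Hom lin dist)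
qed

text \<open>\<open>HO\<close>, \<open>HI\<close>, \<open>HP\<close>, \<open>HS\<close> are the cohomology objects, inclusions, projections and homotopies of a
  chosen splitting; \<open>hmap\<close> is the map that a chain map induces on cohomology.\<close>

definition split_data where
  "split_data K = (SOME (H, \<iota>, \<pi>, s). splitting K H \<iota> \<pi> s)"

definition HO where "HO K = fst (split_data K)"
definition HI where "HI K = fst (snd (split_data K))"
definition HP where "HP K = fst (snd (snd (split_data K)))"
definition HS where "HS K = snd (snd (snd (split_data K)))"

lemma splitting_H:
  assumes "bounded_complex C K"
  shows "splitting K (HO K) (HI K) (HP K) (HS K)"
proof -
  have "\<exists>x. (case x of (H, \<iota>, \<pi>, s) \<Rightarrow> splitting K H \<iota> \<pi> s)"
    using splitting_exists[OF assms] by (metis case_prodI)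
  then have "case split_data K of (H, \<iota>, \<pi>, s) \<Rightarrow> splitting K H \<iota> \<pi> s"
    unfolding split_data_def by (rule someI_ex)
  then show ?thesis by (auto simp: HO_def HI_def HP_def HS_def split: prod.splits)
qed

lemmas HD = splittingD[OF splitting_H]

definition hmap :: "('o, 'm) cochain_arrow \<Rightarrow> int \<Rightarrow> 'm" where
  "hmap = (\<lambda>(K, f, L) i. HP L i \<cdot> (f i \<cdot> HI K i))"

lemma hmap_simp: "hmap (K, f, L) i = HP L i \<cdot> (f i \<cdot> HI K i)"
  by (simp add: hmap_def)

lemma hmap_Hom:
  assumes "bounded_complex C K" "bounded_complex C L" "complex_map C K f L"
  shows "hmap (K, f, L) i \<in> Hom C (HO K i) (HO L i)"
  unfolding hmap_simp using HD(2)[OF assms(1)] HD(3)[OF assms(2)] complex_mapD(1)[OF assms(3)]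
  by (blast intro: Cmp_Hom)

text \<open>The composite of \<open>f\<close> with the inclusion is a cocycle of \<open>L\<close>,
  so passing through the cohomology of \<open>L\<close> is invisible after the projection of
  \<open>N\<close>.\<close>

lemma hmap_Cmp:
  assumes K: "bounded_complex C K" and L: "bounded_complex C L" and N: "bounded_complex C N"
    and f: "complex_map C K f L" and g: "complex_map C L g N"
  shows "hmap (K, \<lambda>i. g i \<cdot> f i, N) i = hmap (L, g, N) i \<cdot> hmap (K, f, L) i"
proof -
  note a = complexD[OF K] complexD[OF L] HomD[OF HD(2)[OF K, of i]] HomD[OF HD(2)[OF L, of i]]
    HomD[OF HD(3)[OF L, of i]] HomD[OF HD(3)[OF N, of i]] HomD[OF complex_mapD(1)[OF f]]
    HomD[OF complex_mapD(1)[OF g]]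
  let ?x = "f i \<cdot> HI K i"
  have x: "?x \<in> Hom C (HO K i) (CO L i)" using HD(2)[OF K] complex_mapD(1)[OF f] by (blast intro: Cmp_Hom)
  have "CD L i \<cdot> ?x = (f (i + 1) \<cdot> CD K i) \<cdot> HI K i"
    unfolding complex_mapD(2)[OF f] using a by (simp add: arr)
  also have "\<dots> = Zer C (HO K i) (CO L (i + 1))" using a HD(6)[OF K, of i] by (simp add: arr dist)
  finally have "HP N i \<cdot> (g i \<cdot> (HI L i \<cdot> (HP L i \<cdot> ?x))) = HP N i \<cdot> (g i \<cdot> ?x)"
    by (rule splitting_map_cocycle[OF L N g splitting_H[OF L] splitting_H[OF N] x])
  then show ?thesis unfolding hmap_simp using a by (simp add: arr)
qed

lemma quasi_isos_hmap:
  assumes "bounded_complex C K" "bounded_complex C L" "complex_map C K f L"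
  shows "(K, f, L) \<in> quasi_isos C \<longleftrightarrow> (\<forall>i. is_isomorphism C (hmap (K, f, L) i))"
  using quasi_isos_iff[OF assms splitting_H[OF assms(1)] splitting_H[OF assms(2)]]
  by (simp add: hmap_simp)

text \<open>In a fixed degree cohomology is an ordinary functor that inverts quasi-isomorphisms, so
  zigzags of chain maps can be evaluated in \<open>C\<close>.\<close>

lemma hmap_functor:
  "inverting_functor (complex_cat C) C (quasi_isos C) (\<lambda>K. HO K i) (\<lambda>F. hmap F i)"
proof (intro inverting_functor.intro inverting_functor_axioms.intro)
  show "category (complex_cat C)" by (rule complex_cat_category[OF linear_category_axioms])
  show "category C" by (rule category_axioms)
  show "HO K i \<in> Ob C" if "K \<in> Ob (complex_cat C)" for K
    using that HD(1) by (simp add: complex_cat_simps)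
  show "hmap F i \<in> Hom C (HO K i) (HO L i)" if "F \<in> Hom (complex_cat C) K L" for F K L
    using that hmap_Hom by (auto simp: complex_cat_Hom_iff)
  show "hmap (Ident (complex_cat C) K) i = Ident C (HO K i)" if "K \<in> Ob (complex_cat C)" for K
    using that HomD[OF HD(2)[of K i]] HD(5)[of K i] by (simp add: complex_cat_simps hmap_simp arr)
  show "hmap (G \<cdot>\<^bsub>complex_cat C\<^esub> F) i = hmap G i \<cdot> hmap F i"
    if "F \<in> Hom (complex_cat C) K L" "G \<in> Hom (complex_cat C) L N" for F G K L N
    using that hmap_Cmp by (auto simp: complex_cat_Hom_iff complex_cat_simps)
  show "is_isomorphism C (hmap F i)" if "F \<in> Ar (complex_cat C)" "F \<in> quasi_isos C" for F
    using that quasi_isos_hmap by (cases F) (auto simp: complex_cat_simps)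
qed

abbreviation (input) D where "D \<equiv> derived_cat C"

lemma complex_category: "category (complex_cat C)"
  by (rule complex_cat_category[OF linear_category_axioms])

lemma D_category: "category D"
  unfolding derived_cat_def by (rule localization_cat_category[OF complex_category])

lemma D_simps: "Ob D = {K. bounded_complex C K}"
  "Ident D K = (K, zigzag_class (complex_cat C) (quasi_isos C) K K [], K)"
  by (simp_all add: derived_cat_def localization_cat_def complex_cat_simps)

text \<open>The image of a chain map under the localization functor.\<close>

definition Q where
  "Q K f L = (K, zigzag_class (complex_cat C) (quasi_isos C) K L [Fwd (K, f, L)], L)"

lemma zigzag_single:
  "zigzag (complex_cat C) W X [Fwd (K, f, L)] Y \<longleftrightarrow>
    X = K \<and> Y = L \<and> bounded_complex C K \<and> bounded_complex C L \<and> complex_map C K f L"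
  by (auto simp: zigzag_iffs complex_cat_simps)

lemma Q_Hom:
  assumes "bounded_complex C K" "bounded_complex C L" "complex_map C K f L"
  shows "Q K f L \<in> Hom D K L"
  using assms by (auto simp: derived_cat_def localization_cat_Hom Q_def zigzag_single)

lemma Q_Id: "bounded_complex C K \<Longrightarrow> Q K (\<lambda>i. Ident C (CO K i)) K = Ident D K"
  unfolding Q_def D_simps
  using zigzag_eq.step[OF zigzag_step.intros(1)[of K "complex_cat C"], of "quasi_isos C" K "[]" "[]" K]
    complex_map_Id
  by (auto intro!: zigzag_class_eqI simp: complex_cat_simps zigzag_single zigzag_Nil_iff)

lemma Q_Cmp:
  assumes K: "bounded_complex C K" and L: "bounded_complex C L" and N: "bounded_complex C N"
    and f: "complex_map C K f L" and g: "complex_map C L g N"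
  shows "Q L g N \<cdot>\<^bsub>D\<^esub> Q K f L = Q K (\<lambda>i. g i \<cdot> f i) N"
proof -
  have zf: "zigzag (complex_cat C) (quasi_isos C) K [Fwd (K, f, L)] L"
    and zg: "zigzag (complex_cat C) (quasi_isos C) L [Fwd (L, g, N)] N"
    using assms by (auto simp: zigzag_single)
  have "zigzag (complex_cat C) (quasi_isos C) K [Fwd (K, \<lambda>i. g i \<cdot> f i, N)] N"
    using assms complex_map_Cmp by (auto simp: zigzag_single)
  then have "zigzag_class (complex_cat C) (quasi_isos C) K N ([Fwd (K, f, L)] @ [Fwd (L, g, N)]) =
      zigzag_class (complex_cat C) (quasi_isos C) K N [Fwd (K, \<lambda>i. g i \<cdot> f i, N)]"
    using zigzag_append[OF zf zg]
      zigzag_eq.step[OF zigzag_step.intros(2)[of "complex_cat C" "(K, f, L)" "(L, g, N)"], of "quasi_isos C" K "[]" "[]" N]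
    by (intro zigzag_class_eqI) (simp add: complex_cat_simps)
  then show ?thesis
    unfolding Q_def derived_cat_def localization_cat_Cmp[OF complex_category zf zg] by simp
qed

lemma Q_iso:
  assumes "(K, f, L) \<in> quasi_isos C"
  shows "is_isomorphism D (Q K f L)"
proof -
  have "(K, f, L) \<in> Hom (complex_cat C) K L"
    using assms by (auto simp: quasi_isos_def complex_cat_simps complex_cat_Hom_iff)
  then show ?thesis
    using localization_cat_inverts[OF complex_category assms, of K L] by (simp add: Q_def derived_cat_def)
qed

text \<open>Equal classes mean equivalent one-letter zigzags, and these have the same value under
  the cohomology functor.\<close>

lemma Q_eqD:
  assumes K: "bounded_complex C K" and L: "bounded_complex C L"
    and f: "complex_map C K f L" and g: "complex_map C K g L" and eq: "Q K f L = Q K g L"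
  shows "hmap (K, f, L) i = hmap (K, g, L) i"
proof -
  interpret H: inverting_functor "complex_cat C" C "quasi_isos C" "\<lambda>K. HO K i" "\<lambda>F. hmap F i"
    by (rule hmap_functor)
  have z: "zigzag (complex_cat C) (quasi_isos C) K [Fwd (K, h, L)] L" if "complex_map C K h L" for h
    using that K L by (simp add: zigzag_single)
  have "[Fwd (K, g, L)] \<in> zigzag_class (complex_cat C) (quasi_isos C) K L [Fwd (K, g, L)]"
    using zigzag_eq.refl[OF z[OF g]] by (simp add: zigzag_class_def)
  also have "zigzag_class (complex_cat C) (quasi_isos C) K L [Fwd (K, g, L)] =
      zigzag_class (complex_cat C) (quasi_isos C) K L [Fwd (K, f, L)]"
    using eq by (simp add: Q_def)
  finally have "zigzag_eq (complex_cat C) (quasi_isos C) K L [Fwd (K, f, L)] [Fwd (K, g, L)]"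
    by (simp add: zigzag_class_def)
  then have "H.zeval [Fwd (K, f, L)] K = H.zeval [Fwd (K, g, L)] K" by (rule H.zeval_eq)
  then show ?thesis
    using Id_left[OF hmap_Hom[OF K L f]] Id_left[OF hmap_Hom[OF K L g]] by (simp add: complex_cat_simps)
qed

text \<open>The cohomology of \<open>K\<close> as a complex with zero differential, which serves as
  a normal form of \<open>K\<close> in the derived category.\<close>

definition HC where
  "HC K = \<lparr>CO = HO K, CD = (\<lambda>i. Zer C (HO K i) (HO K (i + 1)))\<rparr>"

lemma HC_bounded:
  assumes K: "bounded_complex C K"
  shows "bounded_complex C (HC K)"
proof -
  obtain n where "\<And>i. \<bar>i\<bar> > n \<Longrightarrow> is_zero_object C (CO K i)"
    using K by (auto simp: bounded_complex_def)
  then have "\<exists>n. \<forall>i. \<bar>i\<bar> > n \<longrightarrow> is_zero_object C (HO K i)"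
    using splitting_zero_object[OF splitting_H[OF K]] by blast
  then show ?thesis unfolding bounded_complex_def HC_def using HD(1)[OF K] by (simp add: Zer_Hom dist lin)
qed

lemma HI_map: "bounded_complex C K \<Longrightarrow> complex_map C (HC K) (HI K) K"
  unfolding complex_map_def HC_def using HD(2,6)[of K] HD(1)[of K]
  by (auto simp: dist HomD[OF HD(2)[of K]])

lemma HP_map: "bounded_complex C K \<Longrightarrow> complex_map C K (HP K) (HC K)"
  unfolding complex_map_def HC_def using HD(3,9)[of K] HD(1)[of K]
  by (auto simp: dist HomD[OF HD(3)[of K]])

text \<open>The inclusion is a quasi-isomorphism and so becomes invertible. The projection is a left
  inverse of it already as a chain map, hence equals the two-sided inverse.\<close>

lemma HI_HP:
  assumes K: "bounded_complex C K"
  shows "Q (HC K) (HI K) K \<cdot>\<^bsub>D\<^esub> Q K (HP K) (HC K) = Ident D K"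
proof -
  interpret D: category D by (rule D_category)
  note HC = HC_bounded[OF K]
  have "Q K (HP K) (HC K) \<cdot>\<^bsub>D\<^esub> Q (HC K) (HI K) K = Q (HC K) (\<lambda>i. HP K i \<cdot> HI K i) (HC K)"
    by (rule Q_Cmp[OF HC K HC HI_map[OF K] HP_map[OF K]])
  also have "(\<lambda>i. HP K i \<cdot> HI K i) = (\<lambda>i. Ident C (CO (HC K) i))"
    using HD(5)[OF K] by (auto simp: HC_def)
  finally have 1: "Q K (HP K) (HC K) \<cdot>\<^bsub>D\<^esub> Q (HC K) (HI K) K = Ident D (HC K)"
    using Q_Id[OF HC] by simp
  have "splitting (HC K) (CO (HC K)) (\<lambda>i. Ident C (CO (HC K) i)) (\<lambda>i. Ident C (CO (HC K) i))
      (\<lambda>i. Zer C (CO (HC K) i) (CO (HC K) (i - 1)))"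
    using splitting_zero_differential[OF HC] by (simp add: HC_def)
  from quasi_isos_iff[OF HC K HI_map[OF K] this splitting_H[OF K]]
  have "(HC K, HI K, K) \<in> quasi_isos C"
    using HD(1,5)[OF K] HomD[OF HD(2)[OF K]] by (simp add: HC_def arr isomorphism_Id)
  then have "is_isomorphism D (Q (HC K) (HI K) K)" by (rule Q_iso)
  then obtain G where G: "G \<in> Hom D K (HC K)" "Q (HC K) (HI K) K \<cdot>\<^bsub>D\<^esub> G = Ident D K"
    using D.isomorphismE[OF _ Q_Hom[OF HC K HI_map[OF K]]] by blast
  have "Q K (HP K) (HC K) = G"
    by (rule D.inverse_unique[OF Q_Hom[OF HC K HI_map[OF K]] Q_Hom[OF K HC HP_map[OF K]] G(1) 1 G(2)])
  then show ?thesis using G by simp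
qed

text \<open>Conjugation with the inclusions and projections of \<open>K\<close> and
  \<open>L\<close>, which are invertible in the derived category, expresses \<open>Q K f L\<close>
  through \<open>hmap\<close> alone.\<close>

lemma Q_eqI:
  assumes K: "bounded_complex C K" and L: "bounded_complex C L"
    and f: "complex_map C K f L" and g: "complex_map C K g L"
    and eq: "\<And>i. hmap (K, f, L) i = hmap (K, g, L) i"
  shows "Q K f L = Q K g L"
proof -
  interpret D: category D by (rule D_category)
  note HK = HC_bounded[OF K] and HL = HC_bounded[OF L]
  have *: "Q K f L = Q (HC L) (HI L) L \<cdot>\<^bsub>D\<^esub> (Q (HC K) (\<lambda>i. hmap (K, f, L) i) (HC L) \<cdot>\<^bsub>D\<^esub> Q K (HP K) (HC K))"
    if f: "complex_map C K f L" for f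
  proof -
    have fi: "complex_map C (HC K) (\<lambda>i. f i \<cdot> HI K i) L"
      by (rule complex_map_Cmp[OF HK K L HI_map[OF K] f])
    have "Q (HC K) (\<lambda>i. hmap (K, f, L) i) (HC L) =
        Q L (HP L) (HC L) \<cdot>\<^bsub>D\<^esub> (Q K f L \<cdot>\<^bsub>D\<^esub> Q (HC K) (HI K) K)"
      unfolding hmap_simp Q_Cmp[OF HK K L HI_map[OF K] f] Q_Cmp[OF HK L HL fi HP_map[OF L]] ..
    then have "Q (HC L) (HI L) L \<cdot>\<^bsub>D\<^esub> (Q (HC K) (\<lambda>i. hmap (K, f, L) i) (HC L) \<cdot>\<^bsub>D\<^esub> Q K (HP K) (HC K))
      = Q (HC L) (HI L) L \<cdot>\<^bsub>D\<^esub> ((Q L (HP L) (HC L) \<cdot>\<^bsub>D\<^esub> (Q K f L \<cdot>\<^bsub>D\<^esub> Q (HC K) (HI K) K)) \<cdot>\<^bsub>D\<^esub> Q K (HP K) (HC K))"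
      by simp
    also have "\<dots> = (Q (HC L) (HI L) L \<cdot>\<^bsub>D\<^esub> Q L (HP L) (HC L)) \<cdot>\<^bsub>D\<^esub>
        (Q K f L \<cdot>\<^bsub>D\<^esub> (Q (HC K) (HI K) K \<cdot>\<^bsub>D\<^esub> Q K (HP K) (HC K)))"
      using D.HomD[OF Q_Hom[OF HK K HI_map[OF K]]] D.HomD[OF Q_Hom[OF K HK HP_map[OF K]]]
        D.HomD[OF Q_Hom[OF HL L HI_map[OF L]]] D.HomD[OF Q_Hom[OF L HL HP_map[OF L]]]
        D.HomD[OF Q_Hom[OF K L f]] by (simp add: D.arr)
    also have "\<dots> = Q K f L"
      unfolding HI_HP[OF K] HI_HP[OF L] using D.HomD[OF Q_Hom[OF K L f]] by (simp add: D.arr)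
    finally show ?thesis by simp
  qed
  show ?thesis using *[OF f] *[OF g] eq by simp
qed

text \<open>Only a backward letter needs an argument. The formal inverse of a quasi-isomorphism
  \<open>f\<close> is the image of the chain map that projects to cohomology, applies there the
  inverse \<open>v\<close> of the map induced by \<open>f\<close>, and includes again.\<close>

lemma Q_full:
  assumes "F \<in> Hom D K L"
  obtains f where "complex_map C K f L" "F = Q K f L"
proof -
  interpret D: category D by (rule D_category)
  let ?C = "complex_cat C" and ?W = "quasi_isos C"
  have loc: "(Y, zigzag_class ?C ?W Y Z w, Z) \<cdot>\<^bsub>D\<^esub> (X, zigzag_class ?C ?W X Y v, Y) =
      (X, zigzag_class ?C ?W X Z (v @ w), Z)" if "zigzag ?C ?W X v Y" "zigzag ?C ?W Y w Z" for X Y Z v w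
    unfolding derived_cat_def by (rule localization_cat_Cmp[OF complex_category that])
  have *: "\<exists>f. complex_map C K f L \<and> (K, zigzag_class ?C ?W K L w, L) = Q K f L"
    if "zigzag ?C ?W K w L" for K w L
    using that
  proof (induction rule: zigzag.induct)
    case (Nil K)
    then have K: "bounded_complex C K" by (simp add: complex_cat_simps)
    show ?case using Q_Id[OF K] complex_map_Id[OF K] by (metis D_simps(2))
  next
    case (Fwd F w L)
    obtain K f K' where F: "F = (K, f, K')" by (cases F)
    have b: "bounded_complex C K" "bounded_complex C K'" "complex_map C K f K'"
      using Fwd(1) by (auto simp: F complex_cat_simps)
    have L: "bounded_complex C L" using zigzag_ends[OF complex_category Fwd(2)] by (simp add: complex_cat_simps)
    obtain g where g: "complex_map C K' g L" "(K', zigzag_class ?C ?W K' L w, L) = Q K' g L"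
      using Fwd(3) by (auto simp: F complex_cat_simps)
    have "(K, zigzag_class ?C ?W K L ([Fwd F] @ w), L) = Q K' g L \<cdot>\<^bsub>D\<^esub> Q K f K'"
      unfolding g(2)[symmetric] unfolding Q_def F
      by (rule loc[symmetric]) (use b Fwd(2) in \<open>auto simp: zigzag_single F complex_cat_simps\<close>)
    then show ?case
      using Q_Cmp[OF b(1,2) L b(3) g(1)] complex_map_Cmp[OF b(1,2) L b(3) g(1)]
      by (auto simp: F complex_cat_simps)
  next
    case (Bwd F w L)
    obtain K' f K where F: "F = (K', f, K)" by (cases F)
    have b: "bounded_complex C K" "bounded_complex C K'" "complex_map C K' f K"
      using Bwd(1) by (auto simp: F complex_cat_simps)
    have L: "bounded_complex C L" using zigzag_ends[OF complex_category Bwd(3)] by (simp add: complex_cat_simps)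
    obtain g where g: "complex_map C K' g L" "(K', zigzag_class ?C ?W K' L w, L) = Q K' g L"
      using Bwd(4) by (auto simp: F complex_cat_simps)
    have "\<forall>i. is_isomorphism C (hmap F i)" using quasi_isos_hmap[OF b(2,1,3)] Bwd(2) F by simp
    then have "\<forall>i. \<exists>v. v \<in> Hom C (HO K i) (HO K' i) \<and> hmap F i \<cdot> v = Ident C (HO K i)"
      using isomorphismE[OF _ hmap_Hom[OF b(2,1,3)]] unfolding F by metis
    then obtain v where v: "\<And>i. v i \<in> Hom C (HO K i) (HO K' i)" "\<And>i. hmap F i \<cdot> v i = Ident C (HO K i)"
      by metis
    have vm: "complex_map C (HC K) v (HC K')"
      unfolding complex_map_def HC_def using v(1) HomD[OF v(1)] by (simp add: dist)
    have vp: "complex_map C K (\<lambda>i. v i \<cdot> HP K i) (HC K')"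
      by (rule complex_map_Cmp[OF b(1) HC_bounded HC_bounded HP_map vm]) (use b in auto)
    let ?t = "\<lambda>i. HI K' i \<cdot> (v i \<cdot> HP K i)"
    have t: "complex_map C K ?t K'"
      by (rule complex_map_Cmp[OF b(1) HC_bounded b(2) vp HI_map]) (use b in auto)
    have ft: "complex_map C K (\<lambda>i. f i \<cdot> ?t i) K" by (rule complex_map_Cmp[OF b(1,2,1) t b(3)])
    have "hmap (K, \<lambda>i. f i \<cdot> ?t i, K) i = hmap (K, \<lambda>i. Ident C (CO K i), K) i" for i
    proof -
      note a = HomD[OF HD(2)[OF b(1), of i]] HomD[OF HD(3)[OF b(1), of i]] HomD[OF HD(2)[OF b(2), of i]]
        HomD[OF v(1)[of i]] HomD[OF complex_mapD(1)[OF b(3), of i]]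
      have "hmap (K, \<lambda>i. f i \<cdot> ?t i, K) i = (hmap F i \<cdot> v i) \<cdot> (HP K i \<cdot> HI K i)"
        unfolding F hmap_simp using a by (simp add: arr)
      also have "\<dots> = Ident C (HO K i)" unfolding v(2) using HD(5)[OF b(1), of i] a by (simp add: arr)
      finally show ?thesis unfolding hmap_simp using HD(5)[OF b(1), of i] a by (simp add: arr)
    qed
    then have "Q K (\<lambda>i. f i \<cdot> ?t i) K = Ident D K"
      using Q_eqI[OF b(1,1) ft complex_map_Id[OF b(1)]] Q_Id[OF b(1)] by simp
    then have st: "Q K' f K \<cdot>\<^bsub>D\<^esub> Q K ?t K' = Ident D K" using Q_Cmp[OF b(1,2,1) t b(3)] by simp
    have zB: "zigzag ?C ?W K [Bwd F] K'" and zF: "zigzag ?C ?W K' [Fwd F] K"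
      using b Bwd(2) by (auto simp: F zigzag_iffs complex_cat_simps)
    have zFB: "zigzag ?C ?W K' [Fwd F, Bwd F] K'" using zigzag_append[OF zF zB] by simp
    have "zigzag_eq ?C ?W K' K' ([] @ [Fwd F, Bwd F] @ []) ([] @ [] @ [])"
      using zFB b by (intro zigzag_eq.step zigzag_step.intros) (auto simp: zigzag_Nil_iff complex_cat_simps)
    then have "zigzag_class ?C ?W K' K' [Fwd F, Bwd F] = zigzag_class ?C ?W K' K' []"
      by (intro zigzag_class_eqI) simp
    then have BF: "(K, zigzag_class ?C ?W K K' [Bwd F], K') \<cdot>\<^bsub>D\<^esub> Q K' f K = Ident D K'"
      using loc[OF zF zB] by (simp add: Q_def F D_simps)
    have hB: "(K, zigzag_class ?C ?W K K' [Bwd F], K') \<in> Hom D K K'"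
      using zB by (auto simp: derived_cat_def localization_cat_Hom)
    \<comment> \<open>A left inverse, from the zigzag relations, and a right inverse, from the
      comparison on cohomology, coincide.\<close>
    have B: "(K, zigzag_class ?C ?W K K' [Bwd F], K') = Q K ?t K'"
      by (rule D.inverse_unique[OF Q_Hom[OF b(2,1,3)] hB Q_Hom[OF b(1,2) t] BF st])
    have "(K, zigzag_class ?C ?W K L ([Bwd F] @ w), L) = Q K' g L \<cdot>\<^bsub>D\<^esub> Q K ?t K'"
      unfolding g(2)[symmetric] B[symmetric]
      by (rule loc[symmetric]) (use zB Bwd(3) in \<open>auto simp: F complex_cat_simps\<close>)
    then show ?case
      using Q_Cmp[OF b(1,2) L t g(1)] complex_map_Cmp[OF b(1,2) L t g(1)]
      by (auto simp: F complex_cat_simps)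
  qed
  obtain w where "zigzag ?C ?W K w L" "F = (K, zigzag_class ?C ?W K L w, L)"
    using assms by (auto simp: derived_cat_def localization_cat_Hom)
  then show ?thesis using that * by blast
qed

end

section \<open>Stalk complexes and t-structures\<close>

context semisimple_abelian_category
begin

text \<open>One predicate \<open>P\<close> covers the generators of both halves of a shift
  t-structure, so that membership is analysed only once.\<close>

definition stalks :: "('o \<Rightarrow> int \<Rightarrow> bool) \<Rightarrow> ('o, 'm) cochain set" where
  "stalks P = {shift_complex C a (stalk C S) | S a. is_simple C S \<and> P S a}"

lemma stalksE:
  assumes "F \<in> stalks P"
  obtains S j where "F = stalk_at j S" "is_simple C S" "P S (- j)"
proof -
  obtain S a where "F = shift_complex C a (stalk C S)" "is_simple C S" "P S a"
    using assms by (auto simp: stalks_def)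
  then show ?thesis using that[of "- a" S] by (simp add: stalk_at_def)
qed

lemma stalk_at_in_stalks: "is_simple C S \<Longrightarrow> P S (- j) \<Longrightarrow> stalk_at j S \<in> stalks P"
  unfolding stalks_def stalk_at_def by blast

lemma occurs_stalk_at:
  assumes "is_simple C S"
  shows "occurs (stalk_at j S) j S"
proof -
  note S = simpleD[OF assms]
  have "CD (stalk_at j S) (j - 1) \<cdot> y \<noteq> Ident C S"
    if "y \<in> Hom C S (CO (stalk_at j S) (j - 1))" for y
  proof -
    have "CD (stalk_at j S) (j - 1) \<cdot> y = Zer C S S"
      using HomD[OF that] S(1) chosen_zero_object(2) by (simp add: CD_stalk_at CO_stalk_at dist)
    then show ?thesis using S(3) by simp
  qed
  moreover have "CD (stalk_at j S) j \<cdot> Ident C S = Zer C S (CO (stalk_at j S) (j + 1))"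
    using S(1) chosen_zero_object(2) by (simp add: CD_stalk_at CO_stalk_at lin)
  ultimately show ?thesis
    unfolding occurs_def using S(1) by (intro bexI[of _ "Ident C S"]) (auto simp: CO_stalk_at Id_Hom)
qed

lemma occurs_stalk_atD:
  assumes T: "is_simple C T" and S: "is_simple C S" and occ: "occurs (stalk_at j T) l S"
  shows "l = j" "S \<in> iso_class C T"
proof -
  let ?T = "stalk_at j T"
  note b = complexD[OF stalk_at_bounded[OF simpleD(1)[OF T], of j]]
  obtain x where x: "x \<in> Hom C S (CO ?T l)"
    "\<forall>y \<in> Hom C S (CO ?T (l - 1)). CD ?T (l - 1) \<cdot> y \<noteq> x" using occ unfolding occurs_def by blast
  have "CD ?T (l - 1) \<cdot> Zer C S (CO ?T (l - 1)) = Zer C S (CO ?T l)"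
    using b simpleD(1)[OF S] by (simp add: dist)
  then have x0: "x \<noteq> Zer C S (CO ?T l)" using x(2) Zer_Hom[OF simpleD(1)[OF S] b(1)] by metis
  have "\<not> is_zero_object C (CO ?T l)" using x0 zero_object_Hom_eq'[OF _ x(1)] by blast
  then show l: "l = j" using chosen_zero_object by (auto simp: CO_stalk_at split: if_splits)
  have x': "x \<in> Hom C S T" using x(1) l by (simp add: CO_stalk_at)
  have "is_isomorphism C x" using Schur[OF S T x'] x0 l by (simp add: CO_stalk_at)
  then have "T \<in> iso_class C S" using x' simpleD(1)[OF T] unfolding iso_class_def by blast
  then show "S \<in> iso_class C T" by (rule iso_class_sym)
qed

lemma occurs_HO:
  "bounded_complex C K \<Longrightarrow> occurs K i S \<longleftrightarrow> (\<exists>u \<in> Hom C S (HO K i). u \<noteq> Zer C S (HO K i))"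
  by (rule occurs_iff[OF _ splitting_H])

text \<open>Distinct chain maps differ in some degree, and in that degree neither stalk is a zero
  object. The difference there is a nonzero arrow between simple objects.\<close>

lemma occurs_stalk_at_iso:
  assumes T: "is_simple C T" and S: "is_simple C S"
    and f: "complex_map C (stalk_at i T) f (stalk_at j S)"
    and g: "complex_map C (stalk_at i T) g (stalk_at j S)" and "f \<noteq> g"
  shows "i = j \<and> S \<in> iso_class C T"
proof -
  obtain l where l: "f l \<noteq> g l" using assms(5) by blast
  note h = complex_mapD(1)[OF f, of l] complex_mapD(1)[OF g, of l]
  have "l = j"
  proof (rule ccontr)
    assume "l \<noteq> j"
    then have "is_zero_object C (CO (stalk_at j S) l)" using chosen_zero_object by (simp add: CO_stalk_at)
    then show False using l h zero_object_Hom_eq' by metis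
  qed
  moreover have "l = i"
  proof (rule ccontr)
    assume "l \<noteq> i"
    then have "is_zero_object C (CO (stalk_at i T) l)" using chosen_zero_object by (simp add: CO_stalk_at)
    then show False using l h zero_object_Hom_eq by metis
  qed
  ultimately have ij: "i = j" and h': "f l \<in> Hom C T S" "g l \<in> Hom C T S"
    using h by (auto simp: CO_stalk_at)
  let ?d = "Add C (f l) (Scl C (-1) (g l))"
  have d: "?d \<in> Hom C T S" using h' by (intro Add_Hom Scl_Hom)
  have "?d \<noteq> Zer C T S" using diff_ZerD[OF h'] l by blast
  then have "is_isomorphism C ?d" using Schur[OF T S d] by blast
  then show ?thesis using ij d simpleD(1)[OF S] unfolding iso_class_def by blast
qed

text \<open>If a simple object occurs in degree \<open>j\<close>, its stalk complex is a retract of \<open>K\<close>, hence of a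
  coproduct of stalk complexes.  An arrow from the coproduct to the stalk complex that is not the zero
  arrow is nonzero on some summand.\<close>

lemma occurs_add_closure:
  assumes K: "K \<in> add_closure D (stalks P)" and S: "is_simple C S" and occ: "occurs K j S"
    and P: "\<And>T U a. is_simple C T \<Longrightarrow> U \<in> iso_class C T \<Longrightarrow> P T a \<Longrightarrow> P U a"
  shows "P S (- j)"
proof -
  interpret D: category D by (rule D_category)
  obtain Y where bK: "bounded_complex C K" and Y: "Y \<in> finite_sums D (stalks P)" "direct_summand D K Y"
    using K by (auto simp: add_closure_def D_simps)
  obtain n :: nat and F inc where F: "\<And>i. i < n \<Longrightarrow> F i \<in> stalks P"
    and copY: "is_coproduct D {..<n} F Y inc"
    using Y(1) unfolding finite_sums_def by blast
  obtain G jnc where copK: "is_coproduct D {0, 1::nat} G Y jnc" and G0: "G 0 = K"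
    using Y(2) unfolding direct_summand_def by blast
  have bY: "bounded_complex C Y" using D.coproductD(1)[OF copY] by (simp add: D_simps)
  have bG: "bounded_complex C (G i)" if "i \<in> {0, 1}" for i
    using D.coproductD(2)[OF copK that] by (simp add: D_simps)
  \<comment> \<open>Zero arrows are represented by images of zero chain maps, since the derived
    category carries no additive structure here.\<close>
  let ?z = "\<lambda>K L. Q K (\<lambda>i. Zer C (CO K i) (CO L i)) L"
  have z: "?z K L \<in> Hom D K L" if "bounded_complex C K" "bounded_complex C L" for K L
    using Q_Hom complex_map_Zer that by blast
  have "(if i = 0 then Ident D K else ?z (G i) K) \<in> Hom D (G i) K" if "i \<in> {0, 1}" for i
    using z[OF bG[OF that] bK] D.Id_Hom[of K] bK G0 by (auto simp: D_simps(1))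
  moreover have "K \<in> Ob D" using bK by (simp add: D_simps)
  ultimately obtain r where r: "r \<in> Hom D Y K" and
    r': "\<And>i. i \<in> {0, 1} \<Longrightarrow> r \<cdot>\<^bsub>D\<^esub> jnc i = (if i = 0 then Ident D K else ?z (G i) K)"
    using D.coproductE[OF copK, of K "\<lambda>i. if i = 0 then Ident D K else ?z (G i) K"] by blast
  have rj: "r \<cdot>\<^bsub>D\<^esub> jnc 0 = Ident D K" using r'[of 0] by simp
  have j0: "jnc 0 \<in> Hom D K Y" using D.coproductD(3)[OF copK, of 0] G0 by simp
  let ?S = "stalk_at j S"
  have bS: "bounded_complex C ?S" using stalk_at_bounded simpleD(1)[OF S] by blast
  obtain u where u: "u \<in> Hom C S (HO K j)" "u \<noteq> Zer C S (HO K j)" using occ occurs_HO[OF bK] by blast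
  obtain v where v: "v \<in> Hom C (HO K j) S" "v \<cdot> u = Ident C S" using simple_split_monic[OF S u] .
  note a = HomD[OF u(1)] HomD[OF v(1)] HomD[OF HD(2)[OF bK, of j]] HomD[OF HD(3)[OF bK, of j]]
    complexD[OF bK] complexD(1)[OF bS]
  have x: "HI K j \<cdot> u \<in> Hom C S (CO K j)" using Cmp_Hom[OF u(1) HD(2)[OF bK]] .
  have y: "v \<cdot> HP K j \<in> Hom C (CO K j) S" using Cmp_Hom[OF HD(3)[OF bK] v(1)] .
  have "CD K j \<cdot> (HI K j \<cdot> u) = Zer C S (CO K (j + 1))"
    using a HD(6)[OF bK, of j] Cmp_assoc_Ar[of u "HI K j" "CD K j", symmetric] by (simp add: dist)
  note \<sigma> = stalk_map_from[OF bK x this]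
  have "(v \<cdot> HP K j) \<cdot> CD K (j - 1) = Zer C (CO K (j - 1)) S"
    using a HD(7)[OF bK, of j] by (simp add: arr dist)
  note \<rho> = stalk_map_to[OF bK y this]
  let ?\<sigma> = "\<lambda>i. if i = j then HI K j \<cdot> u else Zer C (CO ?S i) (CO K i)"
  let ?\<rho> = "\<lambda>i. if i = j then v \<cdot> HP K j else Zer C (CO K i) (CO ?S i)"
  have "?\<rho> i \<cdot> ?\<sigma> i = Ident C (CO ?S i)" for i
  proof (cases "i = j")
    case True
    have "(v \<cdot> HP K j) \<cdot> (HI K j \<cdot> u) = v \<cdot> ((HP K j \<cdot> HI K j) \<cdot> u)" using a by (simp add: arr)
    also have "\<dots> = Ident C S" unfolding HD(5)[OF bK] using a v(2) by (simp add: arr)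
    finally show ?thesis using True by (simp add: CO_stalk_at)
  next
    case False
    then have "Ident C (CO ?S i) = Zer C (CO ?S i) (CO ?S i)"
      using chosen_zero_object by (simp add: CO_stalk_at zero_object_iff)
    then show ?thesis using False a by (simp add: lin dist)
  qed
  then have "Q K ?\<rho> ?S \<cdot>\<^bsub>D\<^esub> Q ?S ?\<sigma> K = Ident D ?S"
    unfolding Q_Cmp[OF bS bK bS \<sigma> \<rho>] Q_Id[OF bS, symmetric] by presburger
  note \<rho>\<sigma> = this
  note \<sigma>H = Q_Hom[OF bS bK \<sigma>] and \<rho>H = Q_Hom[OF bK bS \<rho>]
  let ?p = "Q K ?\<rho> ?S \<cdot>\<^bsub>D\<^esub> r"
  have p: "?p \<in> Hom D Y ?S" using D.Cmp_Hom[OF r \<rho>H] .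
  \<comment> \<open>Otherwise the identity of the stalk would be the image of a zero chain map, and
    its cohomology in degree \<open>j\<close> would vanish.\<close>
  have "?p \<noteq> ?z Y ?S"
  proof
    assume eq: "?p = ?z Y ?S"
    have "?p \<cdot>\<^bsub>D\<^esub> (jnc 0 \<cdot>\<^bsub>D\<^esub> Q ?S ?\<sigma> K) = Q K ?\<rho> ?S \<cdot>\<^bsub>D\<^esub> ((r \<cdot>\<^bsub>D\<^esub> jnc 0) \<cdot>\<^bsub>D\<^esub> Q ?S ?\<sigma> K)"
      using D.HomD[OF r] D.HomD[OF j0] D.HomD[OF \<sigma>H] D.HomD[OF \<rho>H] by (simp add: D.arr)
    also have "\<dots> = Ident D ?S" unfolding rj using \<rho>\<sigma> D.HomD[OF \<sigma>H] by (simp add: D.arr)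
    finally have 1: "?z Y ?S \<cdot>\<^bsub>D\<^esub> (jnc 0 \<cdot>\<^bsub>D\<^esub> Q ?S ?\<sigma> K) = Ident D ?S" unfolding eq .
    obtain g where g: "complex_map C ?S g Y" "jnc 0 \<cdot>\<^bsub>D\<^esub> Q ?S ?\<sigma> K = Q ?S g Y"
      using Q_full[OF D.Cmp_Hom[OF \<sigma>H j0]] by blast
    have "Q ?S (\<lambda>i. Zer C (CO Y i) (CO ?S i) \<cdot> g i) ?S = Q ?S (\<lambda>i. Ident C (CO ?S i)) ?S"
      using 1 unfolding g(2) Q_Cmp[OF bS bY bS g(1) complex_map_Zer[OF bY bS]] Q_Id[OF bS] .
    from Q_eqD[OF bS bS complex_map_Cmp[OF bS bY bS g(1) complex_map_Zer[OF bY bS]] complex_map_Id[OF bS] this, of j]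
    have "Zer C (HO ?S j) (HO ?S j) = Ident C (HO ?S j)"
      using HomD[OF HD(2)[OF bS, of j]] HomD[OF HD(3)[OF bS, of j]] HomD[OF complex_mapD(1)[OF g(1), of j]]
        HD(5)[OF bS, of j]
      by (simp add: hmap_simp lin dist)
    then have "is_zero_object C (HO ?S j)" using HD(1)[OF bS] by (simp add: zero_object_iff)
    then show False
      using occurs_stalk_at[OF S, of j] occurs_HO[OF bS] zero_object_Hom_eq' by metis
  qed
  then obtain i where i: "i < n" "?p \<cdot>\<^bsub>D\<^esub> inc i \<noteq> ?z Y ?S \<cdot>\<^bsub>D\<^esub> inc i"
    using D.coproduct_ext[OF copY p z[OF bY bS]] by blast
  obtain T l where T: "F i = stalk_at l T" "is_simple C T" "P T (- l)" using stalksE[OF F[OF i(1)]] .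
  have inc: "inc i \<in> Hom D (stalk_at l T) Y" unfolding T(1)[symmetric] using D.coproductD(3)[OF copY] i(1) by simp
  obtain f where f: "complex_map C (stalk_at l T) f ?S" "?p \<cdot>\<^bsub>D\<^esub> inc i = Q (stalk_at l T) f ?S"
    using Q_full[OF D.Cmp_Hom[OF inc p]] by blast
  obtain g where g: "complex_map C (stalk_at l T) g ?S" "?z Y ?S \<cdot>\<^bsub>D\<^esub> inc i = Q (stalk_at l T) g ?S"
    using Q_full[OF D.Cmp_Hom[OF inc z[OF bY bS]]] by blast
  have "l = j \<and> S \<in> iso_class C T"
    by (rule occurs_stalk_at_iso[OF T(2) S f(1) g(1)]) (use i(2) f(2) g(2) in auto)
  then show ?thesis using P[OF T(2)] T(3) by blast
qed

text \<open>\<open>direct_summand\<close> asks for a complement, here the zero complex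
  \<open>Z\<close>. Arrows out of \<open>Z\<close> are unique because they are images of chain
  maps.\<close>

lemma add_closure_self:
  assumes "K \<in> finite_sums D A"
  shows "K \<in> add_closure D A"
proof -
  interpret D: category D by (rule D_category)
  have K: "bounded_complex C K" using assms by (simp add: finite_sums_def D_simps)
  define Z where "Z = \<lparr>CO = (\<lambda>_::int. chosen_zero C), CD = (\<lambda>_. Zer C (chosen_zero C) (chosen_zero C))\<rparr>"
  have Z: "bounded_complex C Z"
    using chosen_zero_object by (simp add: Z_def bounded_complex_def Zer_Hom lin dist)
  have uniq: "f = g" if fg: "f \<in> Hom D Z L" "g \<in> Hom D Z L" for f g L
  proof -
    obtain f' where f': "complex_map C Z f' L" "f = Q Z f' L" using Q_full[OF fg(1)] .
    obtain g' where g': "complex_map C Z g' L" "g = Q Z g' L" using Q_full[OF fg(2)] .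
    have "f' = g'"
    proof
      fix i
      have "is_zero_object C (CO Z i)" using chosen_zero_object(1) by (simp add: Z_def)
      then show "f' i = g' i"
        using zero_object_Hom_eq[of "CO Z i"] complex_mapD(1)[OF f'(1), of i]
          complex_mapD(1)[OF g'(1), of i] by metis
    qed
    then show ?thesis using f' g' by simp
  qed
  let ?F = "\<lambda>i::nat. if i = 0 then K else Z"
  let ?inc = "\<lambda>i::nat. if i = 0 then Ident D K else Q Z (\<lambda>i. Zer C (CO Z i) (CO K i)) K"
  have inc: "?inc i \<in> Hom D (?F i) K" for i
    using D.Id_Hom[of K] K Q_Hom[OF Z K complex_map_Zer[OF Z K]] by (simp add: D_simps(1))
  have "is_coproduct D {0, 1::nat} ?F K ?inc"
  proof (rule D.coproductI)
    show "K \<in> Ob D" using K by (simp add: D_simps)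
    show "?inc i \<in> Hom D (?F i) K" for i by (rule inc)
    show "\<exists>h\<in>Hom D K L. \<forall>i\<in>{0, 1}. h \<cdot>\<^bsub>D\<^esub> ?inc i = f i"
      if f: "\<And>i. i \<in> {0, 1} \<Longrightarrow> f i \<in> Hom D (?F i) L" for L f
    proof (intro bexI[of _ "f 0"] ballI)
      show f0: "f 0 \<in> Hom D K L" using f[of 0] by simp
      have f1: "f 1 \<in> Hom D Z L" using f[of 1] by simp
      show "f 0 \<cdot>\<^bsub>D\<^esub> ?inc i = f i" if "i \<in> {0, 1}" for i
      proof (cases "i = 0")
        case True
        then show ?thesis using D.Id_right[OF f0] by simp
      next
        case False
        then have "f 0 \<cdot>\<^bsub>D\<^esub> ?inc i \<in> Hom D Z L" using D.Cmp_Hom[OF inc[of i]] f0 by simp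
        then show ?thesis using uniq f1 that False by auto
      qed
    qed
    show "f = g" if "f \<in> Hom D K L" "g \<in> Hom D K L"
      "\<And>i. i \<in> {0, 1} \<Longrightarrow> f \<cdot>\<^bsub>D\<^esub> ?inc i = g \<cdot>\<^bsub>D\<^esub> ?inc i" for L f g
      using that(3)[of 0] D.Id_right[OF that(1)] D.Id_right[OF that(2)] by simp
  qed
  then have "direct_summand D K K" unfolding direct_summand_def by (intro exI[of _ ?F] exI[of _ ?inc]) simp
  then show ?thesis using assms K unfolding add_closure_def by (auto simp: D_simps)
qed

text \<open>In the derived category \<open>K\<close> is the coproduct of the stalks of all simple
  summands of its cohomology objects. The index set is finite because cohomology vanishes beyond the
  bound \<open>N\<close>.\<close>

lemma add_closure_stalksI:
  assumes K: "bounded_complex C K" and P: "\<And>j S. is_simple C S \<Longrightarrow> occurs K j S \<Longrightarrow> P S (- j)"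
  shows "K \<in> add_closure D (stalks P)"
proof -
  interpret D: category D by (rule D_category)
  have "\<exists>n F inc. is_coproduct C {..<n::nat} F (HO K i) inc \<and> (\<forall>l<n. is_simple C (F l))" for i
    using decomposition[OF HD(1)[OF K, of i]] by metis
  then obtain n F inc where cop: "\<And>i. is_coproduct C {..<n i::nat} (F i) (HO K i) (inc i)"
    and F: "\<And>i l. l < n i \<Longrightarrow> is_simple C (F i l)" by metis
  obtain N where N: "\<And>i. \<bar>i\<bar> > N \<Longrightarrow> is_zero_object C (CO K i)"
    using K by (auto simp: bounded_complex_def)
  have HZ: "is_zero_object C (HO K i)" if "\<bar>i\<bar> > N" for i
    using splitting_zero_object[OF splitting_H[OF K] N[OF that]] .
  define I where "I = Sigma {-N..N} (\<lambda>i. {..<n i})"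
  have II: "(i, l) \<in> I \<longleftrightarrow> \<bar>i\<bar> \<le> N \<and> l < n i" for i l by (auto simp: I_def)
  have inc: "inc i l \<in> Hom C (F i l) (HO K i)" if "l < n i" for i l
    using coproductD(3)[OF cop] that by auto
  define x where "x i l = HI K i \<cdot> inc i l" for i l
  have x: "x i l \<in> Hom C (F i l) (CO K i)" if "l < n i" for i l
    unfolding x_def using Cmp_Hom[OF inc[OF that] HD(2)[OF K]] .
  have dx: "CD K i \<cdot> x i l = Zer C (F i l) (CO K (i + 1))" if "l < n i" for i l
    unfolding x_def using HomD[OF inc[OF that]] HomD[OF HD(2)[OF K, of i]] complexD[OF K]
      HD(6)[OF K, of i] Cmp_assoc_Ar[of "inc i l" "HI K i" "CD K i", symmetric] by (simp add: dist)
  have px: "HP K i \<cdot> x i l = inc i l" if "l < n i" for i l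
    unfolding x_def using HomD[OF inc[OF that]] HomD[OF HD(2)[OF K, of i]] HomD[OF HD(3)[OF K, of i]]
      HD(5)[OF K, of i] Cmp_assoc_Ar[of "inc i l" "HI K i" "HP K i", symmetric] by (simp add: arr)
  let ?S = "\<lambda>i l. stalk_at i (F i l)"
  define m where "m i l k = (if k = i then x i l else Zer C (CO (?S i l) k) (CO K k))" for i l k
  have m: "complex_map C (?S i l) (m i l) K" if "l < n i" for i l
    unfolding m_def using stalk_map_from[OF K x[OF that] dx[OF that]] .
  have bS: "bounded_complex C (?S i l)" if "l < n i" for i l
    using stalk_at_bounded simpleD(1)[OF F[OF that]] by blast
  have "is_coproduct D I (\<lambda>(i, l). ?S i l) K (\<lambda>(i, l). Q (?S i l) (m i l) K)"
  proof (rule D.coproductI)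
    show "K \<in> Ob D" using K by (simp add: D_simps)
    show "(case t of (i, l) \<Rightarrow> Q (?S i l) (m i l) K) \<in> Hom D (case t of (i, l) \<Rightarrow> ?S i l) K"
      if "t \<in> I" for t
      using that Q_Hom[OF bS K m] by (auto simp: I_def)
    show "\<exists>h\<in>Hom D K Z. \<forall>t\<in>I. h \<cdot>\<^bsub>D\<^esub> (case t of (i, l) \<Rightarrow> Q (?S i l) (m i l) K) = f t"
      if Z: "Z \<in> Ob D" and f: "\<And>t. t \<in> I \<Longrightarrow> f t \<in> Hom D (case t of (i, l) \<Rightarrow> ?S i l) Z" for Z f
    proof -
      have bZ: "bounded_complex C Z" using Z by (simp add: D_simps)
      have "\<exists>\<phi>. complex_map C (?S i l) \<phi> Z \<and> f (i, l) = Q (?S i l) \<phi> Z" if "(i, l) \<in> I" for i l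
        using Q_full[of "f (i, l)" "?S i l" Z] f[OF that] by auto
      then obtain \<phi> where \<phi>: "\<And>i l. (i, l) \<in> I \<Longrightarrow> complex_map C (?S i l) (\<phi> i l) Z"
        "\<And>i l. (i, l) \<in> I \<Longrightarrow> f (i, l) = Q (?S i l) (\<phi> i l) Z" by metis
      have \<phi>i: "\<phi> i l i \<in> Hom C (F i l) (CO Z i)" if "(i, l) \<in> I" for i l
        using complex_mapD(1)[OF \<phi>(1)[OF that], of i] by (simp add: CO_stalk_at)
      have d\<phi>: "CD Z i \<cdot> \<phi> i l i = Zer C (F i l) (CO Z (i + 1))" if "(i, l) \<in> I" for i l
        using complex_mapD(2)[OF \<phi>(1)[OF that], of i] HomD[OF complex_mapD(1)[OF \<phi>(1)[OF that], of "i + 1"]]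
          simpleD(1)[OF F[of l i]] that chosen_zero_object(2)
        by (simp add: CO_stalk_at CD_stalk_at dist II)
      \<comment> \<open>A chain map has to be given in every degree. Beyond the bound, where no
        summand is indexed, the zero arrow is taken.\<close>
      have "\<exists>h. h \<in> Hom C (HO K i) (CO Z i) \<and> (\<bar>i\<bar> \<le> N \<longrightarrow> (\<forall>l<n i. h \<cdot> inc i l = \<phi> i l i)) \<and>
          CD Z i \<cdot> h = Zer C (HO K i) (CO Z (i + 1))" for i
      proof (cases "\<bar>i\<bar> \<le> N")
        case True
        obtain h where h: "h \<in> Hom C (HO K i) (CO Z i)" "\<And>l. l \<in> {..<n i} \<Longrightarrow> h \<cdot> inc i l = \<phi> i l i"
          using coproductE[OF cop[of i] complexD(1)[OF bZ, of i], of "\<lambda>l. \<phi> i l i"] \<phi>i True II by auto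
        have "CD Z i \<cdot> h = Zer C (HO K i) (CO Z (i + 1))"
        proof (rule coproduct_ext[OF cop[of i] Cmp_Hom[OF h(1) complex_Hom(1)[OF bZ]]])
          show "Zer C (HO K i) (CO Z (i + 1)) \<in> Hom C (HO K i) (CO Z (i + 1))"
            using HD(1)[OF K] complexD(1)[OF bZ] Zer_Hom by blast
          fix l assume l: "l \<in> {..<n i}"
          then have "CD Z i \<cdot> (h \<cdot> inc i l) = Zer C (F i l) (CO Z (i + 1))"
            using h(2) d\<phi> True by (simp add: II)
          then show "(CD Z i \<cdot> h) \<cdot> inc i l = Zer C (HO K i) (CO Z (i + 1)) \<cdot> inc i l"
            using HomD[OF h(1)] complexD[OF bZ] HomD[OF inc[of l i]] l by (simp add: arr dist)
        qed
        then show ?thesis using h by blast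
      next
        case False
        then show ?thesis using HD(1)[OF K] complexD[OF bZ] by (auto intro!: exI[of _ "Zer C (HO K i) (CO Z i)"] simp: Zer_Hom dist)
      qed
      then obtain h where h: "\<And>i. h i \<in> Hom C (HO K i) (CO Z i)"
        "\<And>i l. (i, l) \<in> I \<Longrightarrow> h i \<cdot> inc i l = \<phi> i l i"
        "\<And>i. CD Z i \<cdot> h i = Zer C (HO K i) (CO Z (i + 1))" unfolding II by metis
      \<comment> \<open>This is a chain map because both sides of the commutation vanish:
        \<open>HP\<close> kills coboundaries and \<open>h\<close> takes values in cocycles.\<close>
      let ?h = "\<lambda>i. h i \<cdot> HP K i"
      have hm: "complex_map C K ?h Z"
        unfolding complex_map_def
      proof (intro allI conjI)
        fix i
        show "?h i \<in> Hom C (CO K i) (CO Z i)" using Cmp_Hom[OF HD(3)[OF K] h(1)] .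
        note a = HomD[OF h(1)] HomD[OF HD(3)[OF K]] complexD[OF K] complexD[OF bZ]
        show "?h (i + 1) \<cdot> CD K i = CD Z i \<cdot> ?h i"
          using a HD(9)[OF K, of i] h(3)[of i] Cmp_assoc_Ar[of "HP K i" "h i" "CD Z i", symmetric]
            Cmp_assoc_Ar[of "CD K i" "HP K (i + 1)" "h (i + 1)"] by (simp add: dist)
      qed
      have "Q K ?h Z \<cdot>\<^bsub>D\<^esub> Q (?S i l) (m i l) K = f (i, l)" if il: "(i, l) \<in> I" for i l
      proof -
        have l: "l < n i" using il II by blast
        have "?h k \<cdot> m i l k = \<phi> i l k" for k
        proof (cases "k = i")
          case True
          have "?h i \<cdot> x i l = h i \<cdot> (HP K i \<cdot> x i l)"
            using HomD[OF h(1)[of i]] HomD[OF HD(3)[OF K, of i]] HomD[OF x[OF l]] by (simp add: arr)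
          then show ?thesis using True px[OF l] h(2)[OF il] by (simp add: m_def)
        next
          case False
          have "?h k \<cdot> m i l k \<in> Hom C (CO (?S i l) k) (CO Z k)"
            using Cmp_Hom[OF complex_mapD(1)[OF m[OF l]] complex_mapD(1)[OF hm]] .
          moreover have "is_zero_object C (CO (?S i l) k)"
            using False chosen_zero_object by (simp add: CO_stalk_at)
          ultimately show ?thesis
            using zero_object_Hom_eq complex_mapD(1)[OF \<phi>(1)[OF il], of k] by metis
        qed
        then show ?thesis unfolding Q_Cmp[OF bS[OF l] K bZ m[OF l] hm] \<phi>(2)[OF il] by presburger
      qed
      then show ?thesis using Q_Hom[OF K bZ hm] by (intro bexI[of _ "Q K ?h Z"]) auto
    qed
    show "f = g" if f: "f \<in> Hom D K Z" and g: "g \<in> Hom D K Z"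
      and eq: "\<And>t. t \<in> I \<Longrightarrow> f \<cdot>\<^bsub>D\<^esub> (case t of (i, l) \<Rightarrow> Q (?S i l) (m i l) K) =
        g \<cdot>\<^bsub>D\<^esub> (case t of (i, l) \<Rightarrow> Q (?S i l) (m i l) K)" for Z f g
    proof -
      have bZ: "bounded_complex C Z" using D.HomD(5)[OF f] by (simp add: D_simps)
      obtain f' where f': "complex_map C K f' Z" "f = Q K f' Z" using Q_full[OF f] .
      obtain g' where g': "complex_map C K g' Z" "g = Q K g' Z" using Q_full[OF g] .
      \<comment> \<open>By \<open>Q_eqI\<close> uniqueness can be tested on cohomology, and there on
        each simple summand.\<close>
      have "hmap (K, f', Z) i = hmap (K, g', Z) i" for i
      proof (cases "\<bar>i\<bar> \<le> N")
        case False
        then show ?thesis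
          using HZ[of i] zero_object_Hom_eq hmap_Hom[OF K bZ f'(1)] hmap_Hom[OF K bZ g'(1)] by (metis not_le)
      next
        case True
        show ?thesis
        proof (rule coproduct_ext[OF cop[of i] hmap_Hom[OF K bZ f'(1)] hmap_Hom[OF K bZ g'(1)]])
          fix l assume "l \<in> {..<n i}"
          then have l: "l < n i" and il: "(i, l) \<in> I" using True II by auto
          note bSl = bS[OF l] and mm = m[OF l]
          let ?T = "?S i l"
          \<comment> \<open>The splitting chosen for a stalk need not be the obvious one, but with
            zero differential its homotopy identity reduces to this equation.\<close>
          have TI: "HI ?T i \<cdot> HP ?T i = Ident C (F i l)"
          proof -
            note t = HomD[OF HD(2)[OF bSl, of i]] HomD[OF HD(3)[OF bSl, of i]] complexD(1)[OF bSl]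
              HomD[OF HD(4)[OF bSl, of i]] HomD[OF HD(10)[OF bSl, of i]]
            show ?thesis
              using HD(8)[OF bSl, of i] t simpleD(1)[OF F[OF l]] chosen_zero_object(2)
              by (simp add: CD_stalk_at CO_stalk_at lin dist)
          qed
          have e: "hmap (K, k, Z) i \<cdot> inc i l = hmap (?T, \<lambda>r. k r \<cdot> m i l r, Z) i \<cdot> HP ?T i"
            if k: "complex_map C K k Z" for k
          proof -
            have HT: "HI ?T i \<in> Hom C (HO ?T i) (F i l)" "HP ?T i \<in> Hom C (F i l) (HO ?T i)"
              using HD(2,3)[OF bSl, of i] by (simp_all add: CO_stalk_at)
            note t = HomD[OF HT(1)] HomD[OF HT(2)] HomD[OF complex_mapD(1)[OF k, of i]]
              HomD[OF HD(2)[OF K, of i]] HomD[OF HD(3)[OF bZ, of i]] HomD[OF inc[OF l]] HomD[OF x[OF l]]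
            have "hmap (?T, \<lambda>r. k r \<cdot> m i l r, Z) i \<cdot> HP ?T i =
                HP Z i \<cdot> (k i \<cdot> (x i l \<cdot> (HI ?T i \<cdot> HP ?T i)))"
              using t by (simp add: hmap_simp m_def arr)
            also have "\<dots> = hmap (K, k, Z) i \<cdot> inc i l"
              unfolding TI using t by (simp add: hmap_simp x_def arr)
            finally show ?thesis by simp
          qed
          have "Q ?T (\<lambda>r. f' r \<cdot> m i l r) Z = Q ?T (\<lambda>r. g' r \<cdot> m i l r) Z"
            using eq[OF il] Q_Cmp[OF bSl K bZ mm f'(1)] Q_Cmp[OF bSl K bZ mm g'(1)] f'(2) g'(2) by simp
          from Q_eqD[OF bSl bZ complex_map_Cmp[OF bSl K bZ mm f'(1)] complex_map_Cmp[OF bSl K bZ mm g'(1)] this]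
          show "hmap (K, f', Z) i \<cdot> inc i l = hmap (K, g', Z) i \<cdot> inc i l"
            unfolding e[OF f'(1)] e[OF g'(1)] by simp
        qed
      qed
      then show ?thesis using Q_eqI[OF K bZ f'(1) g'(1)] f'(2) g'(2) by simp
    qed
  qed
  moreover have "finite I" by (simp add: I_def)
  moreover have "(case t of (i, l) \<Rightarrow> ?S i l) \<in> stalks P" if "t \<in> I" for t
  proof -
    obtain i l where t: "t = (i, l)" "l < n i" using \<open>t \<in> I\<close> by (auto simp: I_def)
    obtain r where "r \<in> Hom C (HO K i) (F i l)" "r \<cdot> inc i l = Ident C (F i l)"
      using coproduct_retraction[OF cop[of i], of l] t(2) by auto
    moreover from this have "r \<cdot> Zer C (F i l) (HO K i) = Zer C (F i l) (F i l)"
      using simpleD(1)[OF F[OF t(2)]] HomD[of r] by (simp add: dist)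
    ultimately have "inc i l \<noteq> Zer C (F i l) (HO K i)" using simpleD(3)[OF F[OF t(2)]] by auto
    then have "occurs K i (F i l)" using occurs_HO[OF K] inc[OF t(2)] by blast
    then show ?thesis using stalk_at_in_stalks F[OF t(2)] P t(1) by auto
  qed
  ultimately have "K \<in> finite_sums D (stalks P)" by (rule D.finite_sumsI)
  then show ?thesis by (rule add_closure_self)
qed

text \<open>The hypothesis makes \<open>P\<close> a condition on isomorphism classes, which is all
  that cohomology can determine.\<close>

theorem add_closure_stalks_iff:
  assumes "\<And>T U a. is_simple C T \<Longrightarrow> U \<in> iso_class C T \<Longrightarrow> P T a \<Longrightarrow> P U a"
  shows "K \<in> add_closure D (stalks P) \<longleftrightarrow> bounded_complex C K \<and>
    (\<forall>j S. is_simple C S \<longrightarrow> occurs K j S \<longrightarrow> P S (- j))"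
proof
  assume K: "K \<in> add_closure D (stalks P)"
  then have "bounded_complex C K" by (simp add: add_closure_def D_simps)
  then show "bounded_complex C K \<and> (\<forall>j S. is_simple C S \<longrightarrow> occurs K j S \<longrightarrow> P S (- j))"
    by (intro conjI allI impI occurs_add_closure[OF K]) (use assms in blast)+
qed (use add_closure_stalksI in blast)

lemma shift_t_structure_stalks:
  "shift_t_structure C p = (add_closure D (stalks (\<lambda>S a. p (iso_class C S) \<le> a)),
    add_closure D (stalks (\<lambda>S a. a < p (iso_class C S))))"
  by (simp add: shift_t_structure_def stalks_def)

text \<open>\<open>t_le\<close> and \<open>t_ge\<close> are images under shifts; this trades the
  image for a condition on the shifted complex, to which \<open>occurs_shift\<close>
  applies.\<close>

lemma shift_complex_image_iff:
  assumes "\<And>K. K \<in> A \<Longrightarrow> bounded_complex C K"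
  shows "L \<in> shift_complex C a ` A \<longleftrightarrow> bounded_complex C L \<and> shift_complex C (- a) L \<in> A"
proof
  assume "L \<in> shift_complex C a ` A"
  then obtain K where K: "K \<in> A" "L = shift_complex C a K" by blast
  then show "bounded_complex C L \<and> shift_complex C (- a) L \<in> A"
    using assms shift_complex_bounded by (simp add: shift_complex_shift shift_complex_0)
next
  assume L: "bounded_complex C L \<and> shift_complex C (- a) L \<in> A"
  then have "L = shift_complex C a (shift_complex C (- a) L)"
    by (simp add: shift_complex_shift shift_complex_0)
  then show "L \<in> shift_complex C a ` A" using L by blast
qed

text \<open>A simple \<open>S\<close> in degree \<open>j\<close> is the stalk \<open>S[-j]\<close>,
  which lies in the half of level \<open>n\<close> exactly when
  \<open>p(S) \<le> n - j\<close>.\<close>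

lemma t_le_iff:
  "L \<in> t_le C (shift_t_structure C p) n \<longleftrightarrow> bounded_complex C L \<and>
    (\<forall>j S. is_simple C S \<longrightarrow> occurs L j S \<longrightarrow> p (iso_class C S) \<le> n - j)"
proof -
  have iff: "K \<in> add_closure D (stalks (\<lambda>S a. p (iso_class C S) \<le> a)) \<longleftrightarrow> bounded_complex C K \<and>
      (\<forall>j S. is_simple C S \<longrightarrow> occurs K j S \<longrightarrow> p (iso_class C S) \<le> - j)" for K
    by (rule add_closure_stalks_iff) (simp add: iso_class_eq)
  have "L \<in> t_le C (shift_t_structure C p) n \<longleftrightarrow> bounded_complex C L \<and>
      (\<forall>j S. is_simple C S \<longrightarrow> occurs L (j + n) S \<longrightarrow> p (iso_class C S) \<le> - j)"
    unfolding t_le_def shift_t_structure_stalks fst_conv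
    using iff by (subst shift_complex_image_iff) (auto simp: shift_complex_bounded occurs_shift)
  also have "\<dots> \<longleftrightarrow> bounded_complex C L \<and>
      (\<forall>j S. is_simple C S \<longrightarrow> occurs L j S \<longrightarrow> p (iso_class C S) \<le> n - j)"
  proof -
    have "(\<forall>j. R (j + n) (- j)) \<longleftrightarrow> (\<forall>j. R j (n - j))" for R :: "int \<Rightarrow> int \<Rightarrow> bool"
    proof (intro iffI allI)
      fix j
      show "R j (n - j)" if "\<forall>j. R (j + n) (- j)" using spec[OF that, of "j - n"] by simp
      show "R (j + n) (- j)" if "\<forall>j. R j (n - j)" using spec[OF that, of "j + n"] by simp
    qed
    from this[of "\<lambda>j a. \<forall>S. is_simple C S \<longrightarrow> occurs L j S \<longrightarrow> p (iso_class C S) \<le> a"]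
    show ?thesis by simp
  qed
  finally show ?thesis .
qed

text \<open>The second component of the t-structure is the half of level 1 and uses a strict
  inequality. The extra shift by 1 in \<open>t_ge\<close> absorbs the strictness, so the bound is
  the weak inequality opposite to that of \<open>t_le_iff\<close>.\<close>

lemma t_ge_iff:
  "L \<in> t_ge C (shift_t_structure C p) n \<longleftrightarrow> bounded_complex C L \<and>
    (\<forall>j S. is_simple C S \<longrightarrow> occurs L j S \<longrightarrow> n - j \<le> p (iso_class C S))"
proof -
  have iff: "K \<in> add_closure D (stalks (\<lambda>S a. a < p (iso_class C S))) \<longleftrightarrow> bounded_complex C K \<and>
      (\<forall>j S. is_simple C S \<longrightarrow> occurs K j S \<longrightarrow> - j < p (iso_class C S))" for K
    by (rule add_closure_stalks_iff) (simp add: iso_class_eq)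
  have bounded: "\<And>K. K \<in> add_closure D (stalks P) \<Longrightarrow> bounded_complex C K" for P
    by (simp add: add_closure_def D_simps)
  have "L \<in> t_ge C (shift_t_structure C p) n \<longleftrightarrow> bounded_complex C L \<and>
      shift_complex C (- 1) (shift_complex C n L) \<in> add_closure D (stalks (\<lambda>S a. a < p (iso_class C S)))"
    unfolding t_ge_def shift_t_structure_stalks snd_conv
    using bounded shift_complex_bounded by (subst shift_complex_image_iff, blast, subst shift_complex_image_iff) auto
  also have "\<dots> \<longleftrightarrow> bounded_complex C L \<and>
      (\<forall>j S. is_simple C S \<longrightarrow> occurs L (j - 1 + n) S \<longrightarrow> - j < p (iso_class C S))"
    unfolding iff by (auto simp: shift_complex_bounded occurs_shift)
  also have "\<dots> \<longleftrightarrow> bounded_complex C L \<and>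
      (\<forall>j S. is_simple C S \<longrightarrow> occurs L j S \<longrightarrow> n - j \<le> p (iso_class C S))"
  proof -
    have "(\<forall>j. R (j - 1 + n) (1 - j)) \<longleftrightarrow> (\<forall>j. R j (n - j))" for R :: "int \<Rightarrow> int \<Rightarrow> bool"
    proof (intro iffI allI)
      fix j
      show "R j (n - j)" if "\<forall>j. R (j - 1 + n) (1 - j)" using spec[OF that, of "j - n + 1"] by simp
      show "R (j - 1 + n) (1 - j)" if "\<forall>j. R j (n - j)" using spec[OF that, of "j - 1 + n"] by simp
    qed
    from this[of "\<lambda>j a. \<forall>S. is_simple C S \<longrightarrow> occurs L j S \<longrightarrow> a \<le> p (iso_class C S)"]
    moreover have "- j < k \<longleftrightarrow> 1 - j \<le> k" for j k :: int by linarith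
    ultimately show ?thesis by simp
  qed
  finally show ?thesis .
qed

end

section \<open>The action on complexes\<close>

context abelian_category
begin

lemma finite_coproduct_exists:
  assumes "finite I" "\<And>i. i \<in> I \<Longrightarrow> F i \<in> Ob C"
  shows "\<exists>Y inc. is_coproduct C I F Y inc"
  using assms
proof (induction I rule: finite_induct)
  case empty
  obtain Z where Z: "is_zero_object C Z" using zero_exists by blast
  have "is_coproduct C {} F Z inc" for inc
    using Z unfolding is_coproduct_def is_zero_object_def by auto
  then show ?case by blast
next
  case (insert j J)
  then obtain Y inc where Y: "is_coproduct C J F Y inc" by auto
  obtain G S jnc where S: "is_coproduct C {0, 1::nat} G S jnc" and G: "G 0 = Y" "G 1 = F j"
    using sum_exists[of Y "F j"] insert.prems coproductD(1)[OF Y] by blast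
  have j0: "jnc 0 \<in> Hom C Y S" and j1: "jnc 1 \<in> Hom C (F j) S"
    using coproductD(3)[OF S, of 0] coproductD(3)[OF S, of 1] G by auto
  let ?inc = "\<lambda>i. if i = j then jnc 1 else jnc 0 \<cdot> inc i"
  have inc: "inc i \<in> Hom C (F i) Y" if "i \<in> J" for i using coproductD(3)[OF Y that] .
  have "is_coproduct C (insert j J) F S ?inc"
  proof (rule coproductI)
    show "S \<in> Ob C" using coproductD(1)[OF S] .
    show "?inc i \<in> Hom C (F i) S" if "i \<in> insert j J" for i
      using that j0 j1 inc Cmp_Hom[OF inc j0] by auto
    show "\<exists>h\<in>Hom C S Z. \<forall>i\<in>insert j J. h \<cdot> ?inc i = f i"
      if Z: "Z \<in> Ob C" and f: "\<And>i. i \<in> insert j J \<Longrightarrow> f i \<in> Hom C (F i) Z" for Z f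
    proof -
      obtain k where k: "k \<in> Hom C Y Z" "\<And>i. i \<in> J \<Longrightarrow> k \<cdot> inc i = f i"
        using coproductE[OF Y Z, of f] f by blast
      have "(if i = 0 then k else f j) \<in> Hom C (G i) Z" if "i \<in> {0, 1}" for i :: nat
        using that k(1) f[of j] G by auto
      then obtain h where h: "h \<in> Hom C S Z" and h': "\<And>i. i \<in> {0, 1} \<Longrightarrow> h \<cdot> jnc i = (if i = 0 then k else f j)"
        using coproductE[OF S Z, of "\<lambda>i. if i = 0 then k else f j"] by blast
      have "h \<cdot> (jnc 0 \<cdot> inc i) = f i" if "i \<in> J" for i
        using Cmp_assoc[OF inc[OF that] j0 h] h'[of 0] k(2)[OF that] by simp
      then show ?thesis using h h'[of 1] by (intro bexI[of _ h]) auto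
    qed
    show "f = g" if f: "f \<in> Hom C S Z" and g: "g \<in> Hom C S Z"
      and eq: "\<And>i. i \<in> insert j J \<Longrightarrow> f \<cdot> ?inc i = g \<cdot> ?inc i" for Z f g
    proof (rule coproduct_ext[OF S f g])
      have "f \<cdot> jnc 0 = g \<cdot> jnc 0"
      proof (rule coproduct_ext[OF Y Cmp_Hom[OF j0 f] Cmp_Hom[OF j0 g]])
        fix i assume i: "i \<in> J"
        then have "i \<noteq> j" using insert.hyps by blast
        then show "(f \<cdot> jnc 0) \<cdot> inc i = (g \<cdot> jnc 0) \<cdot> inc i"
          using eq[of i] i Cmp_assoc[OF inc[OF i] j0 f] Cmp_assoc[OF inc[OF i] j0 g] by simp
      qed
      then show "f \<cdot> jnc i = g \<cdot> jnc i" if "i \<in> {0, 1}" for i using that eq[of j] by auto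
    qed
  qed
  then show ?case by blast
qed

text \<open>Zero summands contribute nothing, so a finite coproduct is extended by zero arrows. The
  degrees of an action complex are coproducts over all integers of this kind.\<close>

lemma coproduct_exists:
  assumes ob: "\<And>i. i \<in> I \<Longrightarrow> F i \<in> Ob C" and fin: "finite {i \<in> I. \<not> is_zero_object C (F i)}"
  shows "\<exists>Y inc. is_coproduct C I F Y inc"
proof -
  let ?J = "{i \<in> I. \<not> is_zero_object C (F i)}"
  obtain Y inc where Y: "is_coproduct C ?J F Y inc" using finite_coproduct_exists[OF fin] ob by blast
  let ?inc = "\<lambda>i. if i \<in> ?J then inc i else Zer C (F i) Y"
  have Yo: "Y \<in> Ob C" using coproductD(1)[OF Y] .
  have inc: "?inc i \<in> Hom C (F i) Y" if "i \<in> I" for i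
    using coproductD(3)[OF Y, of i] ob[OF that] Yo by (auto simp: Zer_Hom)
  have "is_coproduct C I F Y ?inc"
  proof (rule coproductI[OF Yo inc])
    show "\<exists>h\<in>Hom C Y Z. \<forall>i\<in>I. h \<cdot> ?inc i = f i"
      if Z: "Z \<in> Ob C" and f: "\<And>i. i \<in> I \<Longrightarrow> f i \<in> Hom C (F i) Z" for Z f
    proof -
      obtain h where h: "h \<in> Hom C Y Z" "\<And>i. i \<in> ?J \<Longrightarrow> h \<cdot> inc i = f i"
        using coproductE[OF Y Z, of f] f by blast
      have "h \<cdot> ?inc i = f i" if "i \<in> I" for i
      proof (cases "i \<in> ?J")
        case False
        then have "is_zero_object C (F i)" using that by simp
        then show ?thesis
          using zero_object_Hom_eq[OF _ f[OF that]] zero_object_Hom_eq[OF _ Cmp_Hom[OF inc[OF that] h(1)]]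
          by simp
      qed (use h in auto)
      then show ?thesis using h by blast
    qed
    show "f = g" if "f \<in> Hom C Y Z" "g \<in> Hom C Y Z" "\<And>i. i \<in> I \<Longrightarrow> f \<cdot> ?inc i = g \<cdot> ?inc i" for Z f g
      using that(3) by (intro coproduct_ext[OF Y that(1,2)]) (smt (verit) mem_Collect_eq)
  qed
  then show ?thesis by blast
qed

end

section \<open>Bilinear bifunctors and direct sums\<close>

locale linear_bifunctor = bilinear_bifunctor A B D FO FA +
  A: linear_category A + B: linear_category B + D: linear_category D
  for A :: "('o1, 'm1, 'k::field, 'x1) lincat_scheme"
    and B :: "('o2, 'm2, 'k, 'x2) lincat_scheme"
    and D :: "('o3, 'm3, 'k, 'x3) lincat_scheme" (structure)
    and FO :: "'o1 \<Rightarrow> 'o2 \<Rightarrow> 'o3"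
    and FA :: "'m1 \<Rightarrow> 'm2 \<Rightarrow> 'm3"
begin

lemma Ar_FA: "f \<in> Ar A \<Longrightarrow> g \<in> Ar B \<Longrightarrow> FA f g \<in> Ar D"
  and Src_FA: "f \<in> Ar A \<Longrightarrow> g \<in> Ar B \<Longrightarrow> Src D (FA f g) = FO (Src A f) (Src B g)"
  and Tgt_FA: "f \<in> Ar A \<Longrightarrow> g \<in> Ar B \<Longrightarrow> Tgt D (FA f g) = FO (Tgt A f) (Tgt B g)"
  using FA_Hom[of f "Src A f" "Tgt A f" g "Src B g" "Tgt B g"] by (auto simp: Hom_def)

lemma FA_Cmp_Ar: "f \<in> Ar A \<Longrightarrow> f' \<in> Ar A \<Longrightarrow> Tgt A f = Src A f' \<Longrightarrow> g \<in> Ar B \<Longrightarrow> g' \<in> Ar B \<Longrightarrow>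
    Tgt B g = Src B g' \<Longrightarrow> FA f' g' \<cdot> FA f g = FA (f' \<cdot>\<^bsub>A\<^esub> f) (g' \<cdot>\<^bsub>B\<^esub> g)"
  using FA_Cmp[of f "Src A f" "Tgt A f" f' "Tgt A f'" g "Src B g" "Tgt B g" g' "Tgt B g'"]
  by (auto simp: Hom_def)

lemma FA_Cmp_assoc: "f \<in> Ar A \<Longrightarrow> f' \<in> Ar A \<Longrightarrow> Tgt A f = Src A f' \<Longrightarrow> g \<in> Ar B \<Longrightarrow> g' \<in> Ar B \<Longrightarrow>
    Tgt B g = Src B g' \<Longrightarrow> h \<in> Ar D \<Longrightarrow> Tgt D h = FO (Src A f) (Src B g) \<Longrightarrow>
    FA f' g' \<cdot> (FA f g \<cdot> h) = FA (f' \<cdot>\<^bsub>A\<^esub> f) (g' \<cdot>\<^bsub>B\<^esub> g) \<cdot> h"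
  using FA_Cmp_Ar[of f f' g g'] D.Cmp_assoc_Ar[of h "FA f g" "FA f' g'"]
  by (simp add: Ar_FA Src_FA Tgt_FA)

lemma FA_Add_left_Ar: "f \<in> Ar A \<Longrightarrow> f' \<in> Ar A \<Longrightarrow> Src A f = Src A f' \<Longrightarrow> Tgt A f = Tgt A f' \<Longrightarrow> g \<in> Ar B \<Longrightarrow>
    FA (Add A f f') g = Add D (FA f g) (FA f' g)"
  using FA_Add_left[of f "Src A f" "Tgt A f" f' g "Src B g" "Tgt B g"] by (auto simp: Hom_def)

lemma FA_Add_right_Ar: "g \<in> Ar B \<Longrightarrow> g' \<in> Ar B \<Longrightarrow> Src B g = Src B g' \<Longrightarrow> Tgt B g = Tgt B g' \<Longrightarrow> f \<in> Ar A \<Longrightarrow>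
    FA f (Add B g g') = Add D (FA f g) (FA f g')"
  using FA_Add_right[of f "Src A f" "Tgt A f" g "Src B g" "Tgt B g" g'] by (auto simp: Hom_def)

lemma FA_Scl_Ar: "f \<in> Ar A \<Longrightarrow> g \<in> Ar B \<Longrightarrow> FA (Scl A a f) g = Scl D a (FA f g)"
  "f \<in> Ar A \<Longrightarrow> g \<in> Ar B \<Longrightarrow> FA f (Scl B a g) = Scl D a (FA f g)"
  using FA_Scl_left[of f "Src A f" "Tgt A f" g "Src B g" "Tgt B g" a]
    FA_Scl_right[of f "Src A f" "Tgt A f" g "Src B g" "Tgt B g" a] by (auto simp: Hom_def)

lemma FA_Zer_left: "X \<in> Ob A \<Longrightarrow> X' \<in> Ob A \<Longrightarrow> g \<in> Ar B \<Longrightarrow>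
    FA (Zer A X X') g = Zer D (FO X (Src B g)) (FO X' (Tgt B g))"
  using FA_Scl_Ar(1)[of "Zer A X X'" g 0] D.Scl_0[of "FA (Zer A X X') g"]
  by (simp add: A.Scl_Zer A.lin Ar_FA Src_FA Tgt_FA)

lemma FA_Zer_right: "Y \<in> Ob B \<Longrightarrow> Y' \<in> Ob B \<Longrightarrow> f \<in> Ar A \<Longrightarrow>
    FA f (Zer B Y Y') = Zer D (FO (Src A f) Y) (FO (Tgt A f) Y')"
  using FA_Scl_Ar(2)[of f "Zer B Y Y'" 0] D.Scl_0[of "FA f (Zer B Y Y')"]
  by (simp add: B.Scl_Zer B.lin Ar_FA Src_FA Tgt_FA)

lemmas bif = Ar_FA Src_FA Tgt_FA FO_Ob FA_Id FA_Cmp_Ar FA_Cmp_assoc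
lemmas bif_dist = FA_Add_left_Ar FA_Add_right_Ar FA_Scl_Ar FA_Zer_left FA_Zer_right

lemma FO_zero:
  assumes "X \<in> Ob A" "Y \<in> Ob B" "is_zero_object A X \<or> is_zero_object B Y"
  shows "is_zero_object D (FO X Y)"
proof -
  have "Ident D (FO X Y) = FA (Ident A X) (Ident B Y)" using assms by (simp add: FA_Id)
  also have "\<dots> = Zer D (FO X Y) (FO X Y)"
    using assms FA_Zer_left[of X X "Ident B Y"] FA_Zer_right[of Y Y "Ident A X"]
    by (auto simp: A.zero_object_iff B.zero_object_iff A.arr B.arr)
  finally show ?thesis using assms by (simp add: D.zero_object_iff FO_Ob)
qed

text \<open>Bilinearity carries the decomposition of the identity of \<open>X\<close> over to the
  identity of \<open>FO X Y\<close>; no coproduct of the objects \<open>FO (F i) Y\<close> has to be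
  constructed.\<close>

lemma detect_left:
  assumes cop: "is_coproduct A I F X inc" and fin: "finite {i \<in> I. \<not> is_zero_object A (F i)}"
    and w: "w \<in> Hom D (FO X Y) Z" "w \<noteq> Zer D (FO X Y) Z" and Y: "Y \<in> Ob B"
  obtains i where "i \<in> I" "w \<cdot> FA (inc i) (Ident B Y) \<noteq> Zer D (FO (F i) Y) Z"
proof -
  note X = A.coproductD(1)[OF cop] and inc = A.coproductD(3)[OF cop]
  note h = D.HomD[OF w(1)] Y X
  have "\<exists>i\<in>I. w \<cdot> FA (inc i) (Ident B Y) \<noteq> Zer D (FO (F i) Y) Z"
  proof (rule ccontr)
    assume none: "\<not> ?thesis"
    have "w \<cdot> FA (Ident A X) (Ident B Y) = Zer D (FO X Y) Z"
      using cop fin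
    proof (induction rule: A.coproduct_Ident_induct)
      case Zer
      then show ?case using h by (simp add: B.arr bif bif_dist D.dist)
    next
      case (Add a b)
      then show ?case using h A.HomD[OF Add(1)] A.HomD[OF Add(2)]
        by (simp add: B.arr bif bif_dist D.dist D.lin)
    next
      case (factor i g)
      note t = A.HomD[OF factor(2)] A.HomD[OF inc[OF factor(1)]]
      have "w \<cdot> FA (inc i \<cdot>\<^bsub>A\<^esub> g) (Ident B Y) = (w \<cdot> FA (inc i) (Ident B Y)) \<cdot> FA g (Ident B Y)"
        using h t by (simp add: D.Cmp_assoc_Ar B.arr bif)
      then show ?case using none factor(1) h t by (simp add: B.arr bif bif_dist D.dist)
    qed
    then show False using w h by (simp add: FA_Id D.arr)
  qed
  then show ?thesis using that by blast
qed

text \<open>The same argument in each variable in turn. It is the passage from a summand of a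
  product of arbitrary objects to a summand of a product of simple ones.\<close>

lemma detect_FO:
  assumes copX: "is_coproduct A I F X inc" and finX: "finite {i \<in> I. \<not> is_zero_object A (F i)}"
    and copY: "is_coproduct B J G Y jnc" and finY: "finite {j \<in> J. \<not> is_zero_object B (G j)}"
    and u: "u \<in> Hom D W (FO X Y)" "u \<noteq> Zer D W (FO X Y)"
  obtains i j v where "i \<in> I" "j \<in> J" "v \<in> Hom D W (FO (F i) (G j))" "v \<noteq> Zer D W (FO (F i) (G j))"
proof -
  note X = A.coproductD[OF copX] and Y = B.coproductD[OF copY]
  note h = D.HomD[OF u(1)] X(1) Y(1)
  have 1: "\<exists>i g. i \<in> I \<and> g \<in> Hom A X (F i) \<and> FA (inc i \<cdot>\<^bsub>A\<^esub> g) (Ident B Y) \<cdot> u \<noteq> Zer D W (FO X Y)"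
  proof (rule ccontr)
    assume none: "\<not> ?thesis"
    have "FA (Ident A X) (Ident B Y) \<cdot> u = Zer D W (FO X Y)"
      using copX finX
    proof (induction rule: A.coproduct_Ident_induct)
      case Zer
      then show ?case using h by (simp add: B.arr bif bif_dist D.dist)
    next
      case (Add a b)
      then show ?case using h A.HomD[OF Add(1)] A.HomD[OF Add(2)]
        by (simp add: B.arr bif bif_dist D.dist D.lin)
    qed (use none in blast)
    then show False using u h by (simp add: FA_Id D.arr)
  qed
  then obtain i g where i: "i \<in> I" "g \<in> Hom A X (F i)" "FA (inc i \<cdot>\<^bsub>A\<^esub> g) (Ident B Y) \<cdot> u \<noteq> Zer D W (FO X Y)"
    by blast
  note h = h A.HomD[OF i(2)] A.HomD[OF X(3)[OF i(1)]]
  define u' where "u' = FA g (Ident B Y) \<cdot> u"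
  have u': "u' \<in> Hom D W (FO (F i) Y)" unfolding u'_def using h by (simp add: Hom_def D.arr bif B.arr)
  have "FA (inc i) (Ident B Y) \<cdot> u' = FA (inc i \<cdot>\<^bsub>A\<^esub> g) (Ident B Y) \<cdot> u"
    unfolding u'_def using h by (simp add: bif B.arr)
  then have u'0: "u' \<noteq> Zer D W (FO (F i) Y)" using i(3) h by (auto simp: D.dist bif B.arr)
  note h' = h D.HomD[OF u']
  have "\<exists>j f. j \<in> J \<and> f \<in> Hom B Y (G j) \<and> FA (Ident A (F i)) (jnc j \<cdot>\<^bsub>B\<^esub> f) \<cdot> u' \<noteq> Zer D W (FO (F i) Y)"
  proof (rule ccontr)
    assume none: "\<not> ?thesis"
    have "FA (Ident A (F i)) (Ident B Y) \<cdot> u' = Zer D W (FO (F i) Y)"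
      using copY finY
    proof (induction rule: B.coproduct_Ident_induct)
      case Zer
      then show ?case using h' by (simp add: A.arr bif_dist D.dist)
    next
      case (Add a b)
      then show ?case using h' B.HomD[OF Add(1)] B.HomD[OF Add(2)]
        by (simp add: A.arr Ar_FA Src_FA Tgt_FA FO_Ob bif_dist D.dist D.lin)
    qed (use none in blast)
    then show False using u'0 h' by (simp add: FA_Id D.Id_left_Ar)
  qed
  then obtain j f where j: "j \<in> J" "f \<in> Hom B Y (G j)"
    "FA (Ident A (F i)) (jnc j \<cdot>\<^bsub>B\<^esub> f) \<cdot> u' \<noteq> Zer D W (FO (F i) Y)" by blast
  note h' = h' B.HomD[OF j(2)] B.HomD[OF Y(3)[OF j(1)]]
  define v where "v = FA (Ident A (F i)) f \<cdot> u'"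
  have v: "v \<in> Hom D W (FO (F i) (G j))"
    unfolding v_def using D.Cmp_Hom[OF u' FA_Hom[OF A.Id_Hom j(2)]] h' by blast
  have "FA (Ident A (F i)) (jnc j) \<cdot> v = FA (Ident A (F i)) (jnc j \<cdot>\<^bsub>B\<^esub> f) \<cdot> u'"
    unfolding v_def using h' FA_Cmp_assoc[of "Ident A (F i)" "Ident A (F i)" f "jnc j" u'] by (simp add: A.arr)
  then have "v \<noteq> Zer D W (FO (F i) (G j))" using j(3) h' by (auto simp: D.dist Ar_FA Src_FA Tgt_FA FO_Ob A.arr)
  then show ?thesis using that[OF i(1) j(1) v] by blast
qed

end

lemma abs_sum_finite: "finite {i::int. \<bar>i\<bar> \<le> a \<and> \<bar>r - i\<bar> \<le> b}"
  by (rule finite_subset[of _ "{-a..a}"]) auto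

section \<open>Existence of the action complex\<close>

locale semisimple_module_category = module_category C M
  for C :: "('o, 'm, 'k::field, 'x) tencat_scheme"
    and M :: "('o, 'm, 'p, 'n, 'k, 'y) modcat_scheme" (structure) +
  assumes semisimple_C: "semisimple_category C" and semisimple_M: "semisimple_category M"
begin

sublocale C: semisimple_abelian_category C
  by unfold_locales (rule semisimple_C)

sublocale M: semisimple_abelian_category M
  by unfold_locales (rule semisimple_M)

sublocale act: linear_bifunctor C M M "act M" "actA M"
  by (intro linear_bifunctor.intro act_bifunctor C.linear_category_axioms M.linear_category_axioms)

sublocale tens: linear_bifunctor C C C "tens C" "tensA C"
  by (intro linear_bifunctor.intro C.tens_bifunctor C.linear_category_axioms)

definition sgn_deg :: "int \<Rightarrow> 'k" where
  "sgn_deg i = (if even i then 1 else - 1)"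

lemma sgn_deg: "sgn_deg (i + 1) = - sgn_deg i" "sgn_deg (i - 1) = - sgn_deg i" "sgn_deg i * sgn_deg i = 1"
  by (auto simp: sgn_deg_def)

text \<open>The total differential restricted to the summand \<open>(i, j)\<close>, with the Koszul
  sign \<open>(-1)^i\<close>.\<close>

definition action_term where
  "action_term K L \<iota> i j = Add M (\<iota> (i + 1) j \<cdot> actA M (CD K i) (Ident M (CO L j)))
     (Scl M (sgn_deg i) (\<iota> i (j + 1) \<cdot> actA M (Ident C (CO K i)) (CD L j)))"

lemma is_action_complex_iff:
  "is_action_complex C M K L T \<longleftrightarrow> bounded_complex M T \<and>
    (\<exists>\<iota>. (\<forall>r. is_coproduct M UNIV (\<lambda>i. act M (CO K i) (CO L (r - i))) (CO T r) (\<lambda>i. \<iota> i (r - i))) \<and>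
      (\<forall>i j. CD T (i + j) \<cdot> \<iota> i j = action_term K L \<iota> i j))"
  unfolding is_action_complex_def action_term_def sgn_deg_def by blast

lemma finite_action:
  assumes K: "bounded_complex C K" and L: "bounded_complex M L"
  shows "finite {i \<in> UNIV. \<not> is_zero_object M (act M (CO K i) (CO L (r - i)))}"
proof -
  obtain a where a: "\<And>i. \<bar>i\<bar> > a \<Longrightarrow> is_zero_object C (CO K i)" using K by (auto simp: bounded_complex_def)
  obtain b where b: "\<And>i. \<bar>i\<bar> > b \<Longrightarrow> is_zero_object M (CO L i)" using L by (auto simp: bounded_complex_def)
  have "is_zero_object M (act M (CO K i) (CO L (r - i)))" if "\<not> (\<bar>i\<bar> \<le> a \<and> \<bar>r - i\<bar> \<le> b)" for i
    using that a[of i] b[of "r - i"] act.FO_zero C.complexD(1)[OF K] M.complexD(1)[OF L]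
    by (meson not_le)
  then show ?thesis by (intro finite_subset[OF _ abs_sum_finite[of a r b]]) blast
qed

text \<open>\<open>derived_act\<close> is a choice of such a complex, so nothing can be said about
  it before one is constructed. The construction is the usual total complex.\<close>

lemma action_complex_exists:
  assumes K: "bounded_complex C K" and L: "bounded_complex M L"
  shows "\<exists>T. is_action_complex C M K L T"
proof -
  note kD = C.complexD[OF K] and lD = M.complexD[OF L]
  have "\<exists>Y inc. is_coproduct M UNIV (\<lambda>i. act M (CO K i) (CO L (r - i))) Y inc" for r
    using M.coproduct_exists[OF _ finite_action[OF K L]] act.FO_Ob kD(1) lD(1) by blast
  then obtain Y inc where
    cop: "\<And>r. is_coproduct M UNIV (\<lambda>i. act M (CO K i) (CO L (r - i))) (Y r) (inc r)" by metis
  define \<iota> where "\<iota> i j = inc (i + j) i" for i j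
  have inc: "inc r = (\<lambda>i. \<iota> i (r - i))" for r by (simp add: \<iota>_def)
  have Y: "Y r \<in> Ob M" for r using M.coproductD(1)[OF cop] .
  have \<iota>: "\<iota> i j \<in> Hom M (act M (CO K i) (CO L j)) (Y (i + j))" for i j
    using M.coproductD(3)[OF cop, of i "i + j"] by (simp add: \<iota>_def)
  have \<iota>1: "\<iota> (i + 1) j \<in> Hom M (act M (CO K (i + 1)) (CO L j)) (Y (i + j + 1))"
    and \<iota>2: "\<iota> i (j + 1) \<in> Hom M (act M (CO K i) (CO L (j + 1))) (Y (i + j + 1))" for i j
    using \<iota>[of "i + 1" j] \<iota>[of i "j + 1"] by (simp_all add: algebra_simps)
  have tm: "action_term K L \<iota> i j \<in> Hom M (act M (CO K i) (CO L j)) (Y (i + j + 1))" for i j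
    unfolding action_term_def
    using act.FA_Hom[OF C.complex_Hom(1)[OF K, of i] M.Id_Hom[OF lD(1), of j]]
      act.FA_Hom[OF C.Id_Hom[OF kD(1), of i] M.complex_Hom(1)[OF L, of j]] \<iota>1[of i j] \<iota>2[of i j]
    by (intro M.Add_Hom M.Scl_Hom) (blast intro: M.Cmp_Hom)+
  have "\<exists>d. d \<in> Hom M (Y r) (Y (r + 1)) \<and> (\<forall>i. d \<cdot> inc r i = action_term K L \<iota> i (r - i))" for r
    using M.coproductE[OF cop[of r] Y[of "r + 1"], of "\<lambda>i. action_term K L \<iota> i (r - i)"] tm[of _ "r - _"]
    by (metis UNIV_I add.commute diff_add_cancel)
  then obtain d where d: "\<And>r. d r \<in> Hom M (Y r) (Y (r + 1))"
    and d': "\<And>r i. d r \<cdot> inc r i = action_term K L \<iota> i (r - i)" by metis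
  have d\<iota>: "d (i + j) \<cdot> \<iota> i j = action_term K L \<iota> i j" for i j
    using d'[of "i + j" i] by (simp add: \<iota>_def)
  have d\<iota>1: "d (i + j + 1) \<cdot> \<iota> (i + 1) j = action_term K L \<iota> (i + 1) j"
    and d\<iota>2: "d (i + j + 1) \<cdot> \<iota> i (j + 1) = action_term K L \<iota> i (j + 1)" for i j
    using d\<iota>[of "i + 1" j] d\<iota>[of i "j + 1"] by (simp_all add: algebra_simps)
  \<comment> \<open>The differential squares to zero on the summand \<open>(i, j)\<close>: the
    unmixed terms vanish, and the two mixed terms carry the signs of \<open>i + 1\<close> and
    \<open>i\<close>, which are opposite.\<close>
  have dd: "d (i + j + 1) \<cdot> action_term K L \<iota> i j = Zer M (act M (CO K i) (CO L j)) (Y (i + j + 1 + 1))" for i j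
  proof -
    \<comment> \<open>Sums of degrees are brought to one normal form so that sources and targets
      match syntactically.\<close>
    have e: "i + 1 + j = i + j + 1" "i + 1 + (j + 1) = i + j + 1 + 1" "i + (j + 1) = i + j + 1"
      "i + 1 + 1 + j = i + j + 1 + 1" "i + (j + 1 + 1) = i + j + 1 + 1" by simp_all
    note h = M.HomD[OF d[of "i + j + 1"]] M.HomD[OF \<iota>1[of i j]] M.HomD[OF \<iota>2[of i j]]
      M.HomD[OF \<iota>1[of "i + 1" j, unfolded e]] M.HomD[OF \<iota>1[of i "j + 1", unfolded e]]
      M.HomD[OF \<iota>2[of i "j + 1", unfolded e]] kD lD Y
    have "d (i + j + 1) \<cdot> action_term K L \<iota> i j =
        Add M ((d (i + j + 1) \<cdot> \<iota> (i + 1) j) \<cdot> actA M (CD K i) (Ident M (CO L j)))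
         (Scl M (sgn_deg i) ((d (i + j + 1) \<cdot> \<iota> i (j + 1)) \<cdot> actA M (Ident C (CO K i)) (CD L j)))"
      unfolding action_term_def using h
      by (simp add: M.lin M.Cmp_Add_right_Ar M.Cmp_Scl_right_Ar C.arr act.Ar_FA act.Src_FA act.Tgt_FA)
    also have "\<dots> = Add M
        (Scl M (sgn_deg (i + 1)) (\<iota> (i + 1) (j + 1) \<cdot> actA M (CD K i) (CD L j)))
        (Scl M (sgn_deg i) (\<iota> (i + 1) (j + 1) \<cdot> actA M (CD K i) (CD L j)))"
      unfolding d\<iota>1 d\<iota>2 action_term_def using h
      by (simp add: M.lin M.dist C.arr act.Ar_FA act.Src_FA act.Tgt_FA act.FO_Ob act.FA_Cmp_Ar act.bif_dist
          del: one_add_one add_2_eq_Suc add_2_eq_Suc')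
    also have "\<dots> = Zer M (act M (CO K i) (CO L j)) (Y (i + j + 1 + 1))"
      using h by (simp add: M.lin M.dist sgn_deg act.Ar_FA act.Src_FA act.Tgt_FA)
    finally show ?thesis .
  qed
  let ?T = "\<lparr>CO = Y, CD = d\<rparr>"
  have "d (r + 1) \<cdot> d r = Zer M (Y r) (Y (r + 1 + 1))" for r
  proof (rule M.coproduct_ext[OF cop[of r] M.Cmp_Hom[OF d d] M.Zer_Hom[OF Y Y]])
    fix i :: int
    note h = M.HomD[OF d[of r]] M.HomD[OF d[of "r + 1"]] M.HomD[OF \<iota>[of i "r - i"]] Y
    show "(d (r + 1) \<cdot> d r) \<cdot> inc r i = Zer M (Y r) (Y (r + 1 + 1)) \<cdot> inc r i"
      using h dd[of i "r - i"] d'[of r i] by (simp add: inc M.arr M.dist)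
  qed
  moreover have "\<exists>n. \<forall>r. \<bar>r\<bar> > n \<longrightarrow> is_zero_object M (Y r)"
  proof -
    obtain a where a: "\<And>i. \<bar>i\<bar> > a \<Longrightarrow> is_zero_object C (CO K i)" using K by (auto simp: bounded_complex_def)
    obtain b where b: "\<And>i. \<bar>i\<bar> > b \<Longrightarrow> is_zero_object M (CO L i)" using L by (auto simp: bounded_complex_def)
    have "is_zero_object M (Y r)" if r: "\<bar>r\<bar> > a + b" for r
    proof (rule M.coproduct_zero[OF cop[of r]])
      fix i
      have "\<bar>i\<bar> > a \<or> \<bar>r - i\<bar> > b" using r by linarith
      then show "is_zero_object M (act M (CO K i) (CO L (r - i)))"
        using a[of i] b[of "r - i"] act.FO_zero kD(1) lD(1) by blast
    qed
    then show ?thesis by blast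
  qed
  ultimately have "bounded_complex M ?T" unfolding bounded_complex_def using d Y by simp
  then have "is_action_complex C M K L ?T"
    unfolding is_action_complex_iff using cop d\<iota> unfolding inc by (intro conjI exI[of _ \<iota>]) simp_all
  then show ?thesis by blast
qed

end

section \<open>The Kuenneth argument and deviations\<close>

context semisimple_module_category
begin

lemma action_complexE:
  assumes "is_action_complex C M K L T"
  obtains \<iota> where "bounded_complex M T"
    "\<And>r. is_coproduct M UNIV (\<lambda>i. act M (CO K i) (CO L (r - i))) (CO T r) (\<lambda>i. \<iota> i (r - i))"
    "\<And>i j. CD T (i + j) \<cdot> \<iota> i j = action_term K L \<iota> i j"
    "\<And>i j. \<iota> i j \<in> Hom M (act M (CO K i) (CO L j)) (CO T (i + j))"
proof -
  obtain \<iota> where \<iota>: "bounded_complex M T"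
    "\<And>r. is_coproduct M UNIV (\<lambda>i. act M (CO K i) (CO L (r - i))) (CO T r) (\<lambda>i. \<iota> i (r - i))"
    "\<And>i j. CD T (i + j) \<cdot> \<iota> i j = action_term K L \<iota> i j"
    using assms unfolding is_action_complex_iff by blast
  moreover have "\<iota> i j \<in> Hom M (act M (CO K i) (CO L j)) (CO T (i + j))" for i j
    using M.coproductD(3)[OF \<iota>(2)[of "i + j"], of i] by simp
  ultimately show ?thesis using that by blast
qed

text \<open>With \<open>e\<close>, \<open>s\<close> the idempotents and homotopies of splittings of \<open>K\<close> and \<open>L\<close>, the operator
  \<open>s \<odot> 1 + (\<plusminus>1) e \<odot> s\<close> is a homotopy on the action complex from the identity to \<open>e \<odot> e\<close>.\<close>

lemma action_homotopy:
  assumes K: "bounded_complex C K" and L: "bounded_complex M L"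
    and spK: "C.splitting K H \<alpha> \<pi> s" and spL: "M.splitting L H' \<alpha>' \<pi>' s'"
    and T: "bounded_complex M T"
    and cop: "\<And>r. is_coproduct M UNIV (\<lambda>i. act M (CO K i) (CO L (r - i))) (CO T r) (\<lambda>i. \<iota> i (r - i))"
    and d\<iota>: "\<And>i j. CD T (i + j) \<cdot> \<iota> i j = action_term K L \<iota> i j"
    and \<iota>: "\<And>i j. \<iota> i j \<in> Hom M (act M (CO K i) (CO L j)) (CO T (i + j))"
  obtains E S where "\<And>r. E r \<in> Hom M (CO T r) (CO T r)"
    "\<And>i j. E (i + j) \<cdot> \<iota> i j = \<iota> i j \<cdot> actA M (\<alpha> i \<cdot>\<^bsub>C\<^esub> \<pi> i) (\<alpha>' j \<cdot> \<pi>' j)"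
    "\<And>r. S r \<in> Hom M (CO T r) (CO T (r - 1))"
    "\<And>r. Add M (E r) (Add M (CD T (r - 1) \<cdot> S r) (S (r + 1) \<cdot> CD T r)) = Ident M (CO T r)"
proof -
  note kD = C.complexD[OF K] and lD = M.complexD[OF L] and tD = M.complexD[OF T]
  define e where "e i = \<alpha> i \<cdot>\<^bsub>C\<^esub> \<pi> i" for i
  define e' where "e' j = \<alpha>' j \<cdot> \<pi>' j" for j
  have e: "e i \<in> Hom C (CO K i) (CO K i)" for i
    unfolding e_def using C.Cmp_Hom[OF C.splittingD(3,2)[OF spK]] .
  have e': "e' j \<in> Hom M (CO L j) (CO L j)" for j
    unfolding e'_def using M.Cmp_Hom[OF M.splittingD(3,2)[OF spL]] .
  note sK = C.splittingD(4,10)[OF spK] and sL = M.splittingD(4,10)[OF spL]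
  have de: "CD K i \<cdot>\<^bsub>C\<^esub> e i = Zer C (CO K i) (CO K (i + 1))" for i
    unfolding e_def using kD C.HomD[OF C.splittingD(2)[OF spK, of i]] C.HomD[OF C.splittingD(3)[OF spK, of i]]
      C.splittingD(6)[OF spK, of i] C.Cmp_assoc_Ar[of "\<pi> i" "\<alpha> i" "CD K i", symmetric]
    by (simp add: C.dist)
  have ed: "e (i + 1) \<cdot>\<^bsub>C\<^esub> CD K i = Zer C (CO K i) (CO K (i + 1))" for i
    unfolding e_def using kD C.HomD[OF C.splittingD(2)[OF spK, of "i + 1"]] C.HomD[OF C.splittingD(3)[OF spK, of "i + 1"]]
      C.splittingD(9)[OF spK, of i]
    by (simp add: C.arr C.dist)
  have hK: "Add C (e i) (Add C (CD K (i - 1) \<cdot>\<^bsub>C\<^esub> s i) (s (i + 1) \<cdot>\<^bsub>C\<^esub> CD K i)) = Ident C (CO K i)" for i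
    unfolding e_def by (rule C.splittingD(8)[OF spK])
  have hL: "Add M (e' j) (Add M (CD L (j - 1) \<cdot> s' j) (s' (j + 1) \<cdot> CD L j)) = Ident M (CO L j)" for j
    unfolding e'_def by (rule M.splittingD(8)[OF spL])
  have \<iota>m1: "\<iota> (i - 1) j \<in> Hom M (act M (CO K (i - 1)) (CO L j)) (CO T (i + j - 1))"
    and \<iota>m2: "\<iota> i (j - 1) \<in> Hom M (act M (CO K i) (CO L (j - 1))) (CO T (i + j - 1))"
    and \<iota>p1: "\<iota> (i + 1) j \<in> Hom M (act M (CO K (i + 1)) (CO L j)) (CO T (i + j + 1))"
    and \<iota>p2: "\<iota> i (j + 1) \<in> Hom M (act M (CO K i) (CO L (j + 1))) (CO T (i + j + 1))" for i j
    using \<iota>[of "i - 1" j] \<iota>[of i "j - 1"] \<iota>[of "i + 1" j] \<iota>[of i "j + 1"] by (simp_all add: algebra_simps)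
  have \<iota>pm: "\<iota> (i + 1) (j - 1) \<in> Hom M (act M (CO K (i + 1)) (CO L (j - 1))) (CO T (i + j))"
    and \<iota>mp: "\<iota> (i - 1) (j + 1) \<in> Hom M (act M (CO K (i - 1)) (CO L (j + 1))) (CO T (i + j))" for i j
    using \<iota>[of "i + 1" "j - 1"] \<iota>[of "i - 1" "j + 1"] by (simp_all add: algebra_simps)
  define S0 where "S0 i j = Add M (\<iota> (i - 1) j \<cdot> actA M (s i) (Ident M (CO L j)))
      (Scl M (sgn_deg i) (\<iota> i (j - 1) \<cdot> actA M (e i) (s' j)))" for i j
  have S0: "S0 i j \<in> Hom M (act M (CO K i) (CO L j)) (CO T (i + j - 1))" for i j
    unfolding S0_def
    using act.FA_Hom[OF sK(1) M.Id_Hom[OF lD(1)]] act.FA_Hom[OF e sL(1)] \<iota>m1 \<iota>m2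
    by (intro M.Add_Hom M.Scl_Hom) (blast intro: M.Cmp_Hom)+
  have "\<exists>f. f \<in> Hom M (CO T r) (CO T r) \<and> (\<forall>i. f \<cdot> \<iota> i (r - i) = \<iota> i (r - i) \<cdot> actA M (e i) (e' (r - i)))" for r
  proof -
    have "\<iota> i (r - i) \<cdot> actA M (e i) (e' (r - i)) \<in> Hom M (act M (CO K i) (CO L (r - i))) (CO T r)" for i
      using M.Cmp_Hom[OF act.FA_Hom[OF e e'] \<iota>[of i "r - i"]] by simp
    then show ?thesis by (rule M.coproductE[OF cop[of r] tD(1)[of r]]) blast
  qed
  then obtain E where E: "\<And>r. E r \<in> Hom M (CO T r) (CO T r)"
    and E': "\<And>r i. E r \<cdot> \<iota> i (r - i) = \<iota> i (r - i) \<cdot> actA M (e i) (e' (r - i))" by metis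
  have "\<exists>f. f \<in> Hom M (CO T r) (CO T (r - 1)) \<and> (\<forall>i. f \<cdot> \<iota> i (r - i) = S0 i (r - i))" for r
  proof -
    have "S0 i (r - i) \<in> Hom M (act M (CO K i) (CO L (r - i))) (CO T (r - 1))" for i
      using S0[of i "r - i"] by simp
    then show ?thesis by (rule M.coproductE[OF cop[of r] tD(1)[of "r - 1"]]) blast
  qed
  then obtain S where S: "\<And>r. S r \<in> Hom M (CO T r) (CO T (r - 1))"
    and S': "\<And>r i. S r \<cdot> \<iota> i (r - i) = S0 i (r - i)" by metis
  have E\<iota>: "E (i + j) \<cdot> \<iota> i j = \<iota> i j \<cdot> actA M (e i) (e' j)" for i j using E'[of "i + j" i] by simp
  have S\<iota>: "S (i + j) \<cdot> \<iota> i j = S0 i j" for i j using S'[of "i + j" i] by simp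
  have S1: "S (r + 1) \<in> Hom M (CO T (r + 1)) (CO T r)" for r using S[of "r + 1"] by simp
  have d1: "CD T (i + j - 1) \<cdot> \<iota> (i - 1) j = action_term K L \<iota> (i - 1) j"
    and d2: "CD T (i + j - 1) \<cdot> \<iota> i (j - 1) = action_term K L \<iota> i (j - 1)" for i j
    using d\<iota>[of "i - 1" j] d\<iota>[of i "j - 1"] by (simp_all add: algebra_simps)
  have s1: "S (i + j + 1) \<cdot> \<iota> (i + 1) j = S0 (i + 1) j"
    and s2: "S (i + j + 1) \<cdot> \<iota> i (j + 1) = S0 i (j + 1)" for i j
    using S\<iota>[of "i + 1" j] S\<iota>[of i "j + 1"] by (simp_all add: algebra_simps)
  \<comment> \<open>The homotopy identity on one summand. Terms in which \<open>CD K\<close> meets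
    \<open>e\<close> vanish, and the mixed term \<open>s \<odot> d\<close> appears twice with
    opposite signs.\<close>
  have key: "Add M (\<iota> i j \<cdot> actA M (e i) (e' j)) (Add M (CD T (i + j - 1) \<cdot> S0 i j) (S (i + j + 1) \<cdot> action_term K L \<iota> i j)) = \<iota> i j" for i j
  proof -
    note h = kD lD tD M.HomD[OF \<iota>m1[of i j]] M.HomD[OF \<iota>m2[of i j]] M.HomD[OF \<iota>p1[of i j]] M.HomD[OF \<iota>p2[of i j]]
      M.HomD[OF \<iota>pm[of i j]] M.HomD[OF \<iota>mp[of i j]] M.HomD[OF \<iota>[of i j]]
      C.HomD[OF e] M.HomD[OF e'] C.HomD[OF sK(1)] C.HomD[OF sK(2)] M.HomD[OF sL(1)] M.HomD[OF sL(2)]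
    note b = act.Ar_FA act.Src_FA act.Tgt_FA act.FO_Ob act.FA_Cmp_Ar
    let ?x = "\<iota> (i - 1) (j + 1) \<cdot> actA M (s i) (CD L j)"
    have "CD T (i + j - 1) \<cdot> S0 i j = Add M ((CD T (i + j - 1) \<cdot> \<iota> (i - 1) j) \<cdot> actA M (s i) (Ident M (CO L j)))
       (Scl M (sgn_deg i) ((CD T (i + j - 1) \<cdot> \<iota> i (j - 1)) \<cdot> actA M (e i) (s' j)))"
      unfolding S0_def using h
      by (simp add: M.lin M.Cmp_Add_right_Ar M.Cmp_Scl_right_Ar C.arr act.Ar_FA act.Src_FA act.Tgt_FA)
    also have "\<dots> = Add M (Add M (\<iota> i j \<cdot> actA M (CD K (i - 1) \<cdot>\<^bsub>C\<^esub> s i) (Ident M (CO L j)))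
        (Scl M (- sgn_deg i) ?x)) (\<iota> i j \<cdot> actA M (e i) (CD L (j - 1) \<cdot> s' j))"
      unfolding d1 d2 action_term_def using h de[of i] sgn_deg(3)[of i]
      by (simp add: M.lin M.dist C.arr b act.bif_dist sgn_deg(2))
    finally have 1: "CD T (i + j - 1) \<cdot> S0 i j = \<dots>" .
    have "S (i + j + 1) \<cdot> action_term K L \<iota> i j =
       Add M ((S (i + j + 1) \<cdot> \<iota> (i + 1) j) \<cdot> actA M (CD K i) (Ident M (CO L j)))
         (Scl M (sgn_deg i) ((S (i + j + 1) \<cdot> \<iota> i (j + 1)) \<cdot> actA M (Ident C (CO K i)) (CD L j)))"
      unfolding action_term_def using h M.HomD[OF S1[of "i + j"]]
      by (simp add: M.lin M.Cmp_Add_right_Ar M.Cmp_Scl_right_Ar C.arr act.Ar_FA act.Src_FA act.Tgt_FA)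
    also have "\<dots> = Add M (\<iota> i j \<cdot> actA M (s (i + 1) \<cdot>\<^bsub>C\<^esub> CD K i) (Ident M (CO L j)))
        (Add M (Scl M (sgn_deg i) ?x) (\<iota> i j \<cdot> actA M (e i) (s' (j + 1) \<cdot> CD L j)))"
      unfolding s1 s2 S0_def using h ed[of i] sgn_deg(3)[of i]
      by (simp add: M.lin M.dist C.arr b act.bif_dist sgn_deg(1))
    finally have 2: "S (i + j + 1) \<cdot> action_term K L \<iota> i j = \<dots>" .
    let ?p = "actA M (CD K (i - 1) \<cdot>\<^bsub>C\<^esub> s i) (Ident M (CO L j))"
    let ?q = "actA M (s (i + 1) \<cdot>\<^bsub>C\<^esub> CD K i) (Ident M (CO L j))"
    let ?u = "actA M (e i) (e' j)" let ?v = "actA M (e i) (CD L (j - 1) \<cdot> s' j)"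
    let ?w = "actA M (e i) (s' (j + 1) \<cdot> CD L j)"
    \<comment> \<open>The identity splits as \<open>e \<odot> 1\<close> plus the homotopy part of
      \<open>K\<close>, and then \<open>e \<odot> 1\<close> splits as \<open>e \<odot> e'\<close>
      plus the homotopy part of \<open>L\<close>.\<close>
    have "actA M (e i) (Ident M (CO L j)) = Add M ?u (Add M ?v ?w)"
      unfolding hL[symmetric] using h by (simp add: M.lin act.FA_Add_right_Ar)
    moreover have "Ident M (act M (CO K i) (CO L j)) = Add M (actA M (e i) (Ident M (CO L j))) (Add M ?p ?q)"
      using h act.FA_Id[OF kD(1)[of i] lD(1)[of j]] unfolding hK[symmetric]
      by (simp add: C.lin M.lin act.FA_Add_left_Ar)
    ultimately have 3: "Ident M (act M (CO K i) (CO L j)) = Add M (Add M ?u (Add M ?v ?w)) (Add M ?p ?q)" by simp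
    have "\<iota> i j = \<iota> i j \<cdot> Ident M (act M (CO K i) (CO L j))" using h by (simp add: M.arr)
    also have "\<dots> = Add M (Add M (\<iota> i j \<cdot> ?u) (Add M (\<iota> i j \<cdot> ?v) (\<iota> i j \<cdot> ?w))) (Add M (\<iota> i j \<cdot> ?p) (\<iota> i j \<cdot> ?q))"
      unfolding 3 using h
      by (simp add: C.arr M.Ar_Cmp M.Src_Cmp M.Tgt_Cmp M.Src_Id M.Tgt_Id M.Ar_Id M.Ar_Add M.Src_Add M.Tgt_Add
          M.Cmp_Add_right_Ar act.Ar_FA act.Src_FA act.Tgt_FA)
    finally have 4: "\<iota> i j = \<dots>" .
    have x0: "Add M (Scl M (- sgn_deg i) ?x) (Scl M (sgn_deg i) ?x) = Zer M (act M (CO K i) (CO L j)) (CO T (i + j))"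
      using h by (simp add: M.lin M.dist b)
    \<comment> \<open>Opaque names reduce the rest to reordering a sum of six arrows and their
      multiples.\<close>
    define P Q U V W X where "P = \<iota> i j \<cdot> ?p" and "Q = \<iota> i j \<cdot> ?q" and "U = \<iota> i j \<cdot> ?u"
      and "V = \<iota> i j \<cdot> ?v" and "W = \<iota> i j \<cdot> ?w" and "X = ?x"
    have hom: "P \<in> Hom M (act M (CO K i) (CO L j)) (CO T (i + j))" "Q \<in> Hom M (act M (CO K i) (CO L j)) (CO T (i + j))"
      "U \<in> Hom M (act M (CO K i) (CO L j)) (CO T (i + j))" "V \<in> Hom M (act M (CO K i) (CO L j)) (CO T (i + j))"
      "W \<in> Hom M (act M (CO K i) (CO L j)) (CO T (i + j))" "X \<in> Hom M (act M (CO K i) (CO L j)) (CO T (i + j))"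
      unfolding P_def Q_def U_def V_def W_def X_def Hom_def using h
      by (simp_all add: M.lin C.arr act.Ar_FA act.Src_FA act.Tgt_FA)
    note hom' = M.HomD[OF hom(1)] M.HomD[OF hom(2)] M.HomD[OF hom(3)] M.HomD[OF hom(4)] M.HomD[OF hom(5)] M.HomD[OF hom(6)]
    have "Add M U (Add M (Add M (Add M P (Scl M (- sgn_deg i) X)) V) (Add M Q (Add M (Scl M (sgn_deg i) X) W))) =
        Add M (Add M U (Add M V W)) (Add M (Add M P Q) (Add M (Scl M (- sgn_deg i) X) (Scl M (sgn_deg i) X)))"
      using hom' by (simp add: M.lin M.add_ac)
    also have "\<dots> = Add M (Add M U (Add M V W)) (Add M P Q)"
      using hom' x0 by (simp add: M.lin M.Add_Zer_right X_def[symmetric])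
    finally show ?thesis
      using 4 unfolding 1 2 P_def[symmetric] Q_def[symmetric] U_def[symmetric] V_def[symmetric] W_def[symmetric] X_def[symmetric]
      by simp
  qed
  have "Add M (E r) (Add M (CD T (r - 1) \<cdot> S r) (S (r + 1) \<cdot> CD T r)) = Ident M (CO T r)" for r
  proof (rule M.coproduct_ext[OF cop[of r] _ M.Id_Hom[OF tD(1)]])
    have "CD T (r - 1) \<cdot> S r \<in> Hom M (CO T r) (CO T r)" "S (r + 1) \<cdot> CD T r \<in> Hom M (CO T r) (CO T r)"
      using M.Cmp_Hom[OF S M.complex_Hom(2)[OF T]] M.Cmp_Hom[OF M.complex_Hom(1)[OF T] S1] .
    then show "Add M (E r) (Add M (CD T (r - 1) \<cdot> S r) (S (r + 1) \<cdot> CD T r)) \<in> Hom M (CO T r) (CO T r)"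
      using E by (intro M.Add_Hom)
    fix i :: int
    note h = tD M.HomD[OF E[of r]] M.HomD[OF S[of r]] M.HomD[OF S1[of r]] M.HomD[OF \<iota>[of i "r - i"]]
    have "CD T r \<cdot> \<iota> i (r - i) = action_term K L \<iota> i (r - i)" using d\<iota>[of i "r - i"] by simp
    then have "Add M (E r) (Add M (CD T (r - 1) \<cdot> S r) (S (r + 1) \<cdot> CD T r)) \<cdot> \<iota> i (r - i) =
       Add M (\<iota> i (r - i) \<cdot> actA M (e i) (e' (r - i))) (Add M (CD T (r - 1) \<cdot> S0 i (r - i)) (S (r + 1) \<cdot> action_term K L \<iota> i (r - i)))"
      using h S'[of r i] E'[of r i] by (simp add: M.lin M.Cmp_Add_left_Ar)
    also have "\<dots> = \<iota> i (r - i)" using key[of i "r - i"] by simp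
    finally show "Add M (E r) (Add M (CD T (r - 1) \<cdot> S r) (S (r + 1) \<cdot> CD T r)) \<cdot> \<iota> i (r - i) =
        Ident M (CO T r) \<cdot> \<iota> i (r - i)" using h by (simp add: M.arr)
  qed
  then show ?thesis using that[of E S] E S E\<iota> unfolding e_def e'_def by blast
qed

text \<open>A cocycle representing \<open>P\<close> stays nonzero under the idempotent
  \<open>E\<close>, which on each summand factors through the product of the cohomology objects. So
  \<open>P\<close> maps nontrivially to such a product, and hence to a product of simple
  summands.\<close>

lemma kuenneth:
  assumes K: "bounded_complex C K" and L: "bounded_complex M L" and T: "is_action_complex C M K L T"
    and P: "is_simple M P" and occ: "M.occurs T r P"
  obtains i X N where "is_simple C X" "is_simple M N" "C.occurs K i X" "M.occurs L (r - i) N"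
    "direct_summand M P (act M X N)"
proof -
  obtain \<iota> where bT: "bounded_complex M T"
    and cop: "\<And>r. is_coproduct M UNIV (\<lambda>i. act M (CO K i) (CO L (r - i))) (CO T r) (\<lambda>i. \<iota> i (r - i))"
    and d\<iota>: "\<And>i j. CD T (i + j) \<cdot> \<iota> i j = action_term K L \<iota> i j"
    and \<iota>: "\<And>i j. \<iota> i j \<in> Hom M (act M (CO K i) (CO L j)) (CO T (i + j))"
    proof (rule action_complexE[OF T], goal_cases)
    case (1 \<iota>)
    show ?case by (rule 1(1)[OF 1(2-5)])
  qed
  obtain H \<alpha> \<pi> s where spK: "C.splitting K H \<alpha> \<pi> s" using C.splitting_exists[OF K] .
  obtain H' \<alpha>' \<pi>' s' where spL: "M.splitting L H' \<alpha>' \<pi>' s'" using M.splitting_exists[OF L] .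
  obtain E S where E: "\<And>r. E r \<in> Hom M (CO T r) (CO T r)"
    and E\<iota>: "\<And>i j. E (i + j) \<cdot> \<iota> i j = \<iota> i j \<cdot> actA M (\<alpha> i \<cdot>\<^bsub>C\<^esub> \<pi> i) (\<alpha>' j \<cdot> \<pi>' j)"
    and S: "\<And>r. S r \<in> Hom M (CO T r) (CO T (r - 1))"
    and hom: "\<And>r. Add M (E r) (Add M (CD T (r - 1) \<cdot> S r) (S (r + 1) \<cdot> CD T r)) = Ident M (CO T r)"
    proof (rule action_homotopy[OF K L spK spL bT cop d\<iota> \<iota>], goal_cases)
    case (1 E S)
    show ?case by (rule 1(1)[OF 1(2-5)])
  qed
  obtain x where x: "x \<in> Hom M P (CO T r)" "CD T r \<cdot> x = Zer M P (CO T (r + 1))"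
    "\<And>y. y \<in> Hom M P (CO T (r - 1)) \<Longrightarrow> CD T (r - 1) \<cdot> y \<noteq> x"
    using occ unfolding M.occurs_def by blast
  have S1: "S (r + 1) \<in> Hom M (CO T (r + 1)) (CO T r)" using S[of "r + 1"] by simp
  note h = M.complexD[OF bT] M.HomD[OF E[of r]] M.HomD[OF S[of r]] M.HomD[OF S1] M.HomD[OF x(1)]
  \<comment> \<open>Otherwise the homotopy would exhibit the cocycle \<open>x\<close> as a
    coboundary.\<close>
  have "E r \<cdot> x \<noteq> Zer M P (CO T r)"
  proof
    assume 0: "E r \<cdot> x = Zer M P (CO T r)"
    have "x = Add M (E r) (Add M (CD T (r - 1) \<cdot> S r) (S (r + 1) \<cdot> CD T r)) \<cdot> x"
      unfolding hom using h by (simp add: M.arr)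
    also have "\<dots> = CD T (r - 1) \<cdot> (S r \<cdot> x)" using h 0 x(2) by (simp add: M.lin M.dist)
    finally show False using x(3)[OF M.Cmp_Hom[OF x(1) S]] by simp
  qed
  then obtain i g where g: "g \<in> Hom M (CO T r) (act M (CO K i) (CO L (r - i)))"
    "E r \<cdot> (\<iota> i (r - i) \<cdot> (g \<cdot> x)) \<noteq> Zer M P (CO T r)"
    by (rule M.coproduct_detect_Cmp[OF cop[of r] finite_action[OF K L] x(1) E[of r]]) blast
  define j where "j = r - i"
  have r: "r = i + j" by (simp add: j_def)
  \<comment> \<open>On the summand \<open>(i, j)\<close> the idempotent \<open>E\<close> passes
    through the product of the cohomology objects; \<open>y\<close> is the image of
    \<open>g x\<close> there.\<close>
  define y where "y = actA M (\<pi> i) (\<pi>' j) \<cdot> (g \<cdot> x)"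
  note sK = C.splittingD[OF spK, of i] and sL = M.splittingD[OF spL, of j]
  have g': "g \<in> Hom M (CO T r) (act M (CO K i) (CO L j))" using g(1) by (simp add: j_def)
  note h = h M.HomD[OF g'] C.HomD[OF sK(2)] C.HomD[OF sK(3)] M.HomD[OF sL(2)] M.HomD[OF sL(3)]
    M.HomD[OF \<iota>[of i j, folded r]]
  have y: "y \<in> Hom M P (act M (H i) (H' j))"
    unfolding y_def by (rule M.Cmp_Hom[OF M.Cmp_Hom[OF x(1) g'] act.FA_Hom[OF sK(3) sL(3)]])
  have "E r \<cdot> (\<iota> i j \<cdot> (g \<cdot> x)) = (E r \<cdot> \<iota> i j) \<cdot> (g \<cdot> x)" using h by (simp add: M.arr)
  also have "\<dots> = (\<iota> i j \<cdot> actA M (\<alpha> i \<cdot>\<^bsub>C\<^esub> \<pi> i) (\<alpha>' j \<cdot> \<pi>' j)) \<cdot> (g \<cdot> x)" using E\<iota>[of i j] r by simp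
  also have "\<dots> = \<iota> i j \<cdot> (actA M (\<alpha> i) (\<alpha>' j) \<cdot> y)"
    unfolding y_def using h by (simp add: M.arr C.arr act.bif)
  finally have "\<iota> i j \<cdot> (actA M (\<alpha> i) (\<alpha>' j) \<cdot> y) \<noteq> Zer M P (CO T r)" using g(2) by (simp add: j_def)
  moreover have "\<iota> i j \<cdot> (actA M (\<alpha> i) (\<alpha>' j) \<cdot> Zer M P (act M (H i) (H' j))) = Zer M P (CO T r)"
    using h by (simp add: M.lin M.dist act.Ar_FA act.Src_FA act.Tgt_FA act.FO_Ob)
  ultimately have y0: "y \<noteq> Zer M P (act M (H i) (H' j))" by auto
  obtain n :: nat and F inc where copK: "is_coproduct C {..<n} F (H i) inc" and F: "\<And>l. l < n \<Longrightarrow> is_simple C (F l)"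
    proof (rule C.decomposition[OF sK(1)], goal_cases)
    case (1 n F inc)
    show ?case by (rule 1(1)[OF 1(2,3)])
  qed
  obtain n' :: nat and G jnc where copL: "is_coproduct M {..<n'} G (H' j) jnc" and G: "\<And>l. l < n' \<Longrightarrow> is_simple M (G l)"
    proof (rule M.decomposition[OF sL(1)], goal_cases)
    case (1 n F inc)
    show ?case by (rule 1(1)[OF 1(2,3)])
  qed
  obtain a b v where ab: "a \<in> {..<n}" "b \<in> {..<n'}" and v: "v \<in> Hom M P (act M (F a) (G b))"
    "v \<noteq> Zer M P (act M (F a) (G b))"
    using act.detect_FO[OF copK _ copL _ y y0] by auto
  have Fa: "is_simple C (F a)" and Gb: "is_simple M (G b)" using F G ab by auto
  obtain k where k: "k \<in> Hom C (H i) (F a)" "k \<cdot>\<^bsub>C\<^esub> inc a = Ident C (F a)" using C.coproduct_retraction[OF copK ab(1)] by blast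
  have "inc a \<noteq> Zer C (F a) (H i)"
    using k C.simpleD[OF Fa] C.HomD[OF k(1)] C.Cmp_Zer_right[of k "F a" "H i"] by auto
  then have 1: "C.occurs K i (F a)" using C.occurs_iff[OF K spK] C.coproductD(3)[OF copK ab(1)] by blast
  obtain k where k: "k \<in> Hom M (H' j) (G b)" "k \<cdot> jnc b = Ident M (G b)" using M.coproduct_retraction[OF copL ab(2)] by blast
  have "jnc b \<noteq> Zer M (G b) (H' j)"
    using k M.simpleD[OF Gb] M.HomD[OF k(1)] M.Cmp_Zer_right[of k "G b" "H' j"] by auto
  then have 2: "M.occurs L j (G b)" using M.occurs_iff[OF L spL] M.coproductD(3)[OF copL ab(2)] by blast
  show ?thesis
    using that[OF Fa Gb 1] 2 M.simple_direct_summand_iff[OF P] v unfolding j_def by blast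
qed

text \<open>In total degree \<open>i + j - 1\<close> the action complex is zero, so any nonzero
  arrow into the summand \<open>X \<odot> N\<close> of degree \<open>i + j\<close> is a cocycle that
  is no coboundary.\<close>

lemma kuenneth_stalks:
  assumes X: "is_simple C X" and N: "is_simple M N" and P: "is_simple M P"
    and sum: "direct_summand M P (act M X N)"
    and T: "is_action_complex C M (C.stalk_at i X) (M.stalk_at j N) T"
  shows "M.occurs T (i + j) P"
proof -
  let ?K = "C.stalk_at i X" and ?L = "M.stalk_at j N"
  have X': "X \<in> Ob C" and N': "N \<in> Ob M" using C.simpleD(1)[OF X] M.simpleD(1)[OF N] .
  note bK = C.stalk_at_bounded[OF X'] and bL = M.stalk_at_bounded[OF N']
  obtain \<iota> where bT: "bounded_complex M T"
    and cop: "\<And>r. is_coproduct M UNIV (\<lambda>i'. act M (CO ?K i') (CO ?L (r - i'))) (CO T r) (\<lambda>i. \<iota> i (r - i))"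
    and d\<iota>: "\<And>i' j'. CD T (i' + j') \<cdot> \<iota> i' j' = action_term ?K ?L \<iota> i' j'"
    and \<iota>: "\<And>i' j'. \<iota> i' j' \<in> Hom M (act M (CO ?K i') (CO ?L j')) (CO T (i' + j'))"
    proof (rule action_complexE[OF T], goal_cases)
    case (1 \<iota>)
    show ?case by (rule 1(1)[OF 1(2-5)])
  qed
  have \<iota>ij: "\<iota> i j \<in> Hom M (act M X N) (CO T (i + j))"
    using \<iota>[of i j] by (simp add: C.CO_stalk_at M.CO_stalk_at)
  have "\<iota> (i + 1) j \<in> Hom M (act M (CO ?K (i + 1)) N) (CO T (i + j + 1))"
    "\<iota> i (j + 1) \<in> Hom M (act M X (CO ?L (j + 1))) (CO T (i + j + 1))"
    using \<iota>[of "i + 1" j] \<iota>[of i "j + 1"] by (simp_all add: algebra_simps C.CO_stalk_at M.CO_stalk_at)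
  note h = M.HomD[OF this(1)] M.HomD[OF this(2)] M.HomD[OF \<iota>ij] M.complexD[OF bT] X' N'
    C.complexD(1)[OF bK] M.complexD(1)[OF bL]
  obtain u where u: "u \<in> Hom M P (act M X N)" "u \<noteq> Zer M P (act M X N)"
    using sum M.simple_direct_summand_iff[OF P] by blast
  have KL: "CO ?K i = X" "CO ?L j = N" by (simp_all add: C.CO_stalk_at M.CO_stalk_at)
  have "CD T (i + j) \<cdot> \<iota> i j = Zer M (act M X N) (CO T (i + j + 1))"
    unfolding d\<iota> action_term_def C.CD_stalk_at[OF X'] M.CD_stalk_at[OF N'] KL
    using h by (simp add: C.arr M.lin M.dist act.Ar_FA act.Src_FA act.Tgt_FA act.FO_Ob act.bif_dist)
  then have "CD T (i + j) \<cdot> (\<iota> i j \<cdot> u) = Zer M P (CO T (i + j + 1))"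
    using h M.HomD[OF u(1)] M.Cmp_assoc_Ar[of u "\<iota> i j" "CD T (i + j)", symmetric] by (simp add: M.dist)
  moreover have "CD T (i + j - 1) \<cdot> y \<noteq> \<iota> i j \<cdot> u" if y: "y \<in> Hom M P (CO T (i + j - 1))" for y
  proof
    assume eq: "CD T (i + j - 1) \<cdot> y = \<iota> i j \<cdot> u"
    have "is_zero_object M (CO T (i + j - 1))"
    proof (rule M.coproduct_zero[OF cop])
      fix i'
      have "i' \<noteq> i \<or> i + j - 1 - i' \<noteq> j" by linarith
      then have "is_zero_object C (CO ?K i') \<or> is_zero_object M (CO ?L (i + j - 1 - i'))"
        using C.chosen_zero_object M.chosen_zero_object by (auto simp: C.CO_stalk_at M.CO_stalk_at)
      then show "is_zero_object M (act M (CO ?K i') (CO ?L (i + j - 1 - i')))"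
        using act.FO_zero h by blast
    qed
    then have "\<iota> i j \<cdot> u = Zer M P (CO T (i + j))"
      using M.zero_object_factor[OF y M.complex_Hom(2)[OF bT, of "i + j"]] eq by simp
    moreover obtain k where k: "k \<in> Hom M (CO T (i + j)) (act M X N)" "k \<cdot> \<iota> i j = Ident M (act M X N)"
      using M.coproduct_retraction[OF cop[of "i + j"], of i] by (auto simp: KL)
    have "k \<cdot> (\<iota> i j \<cdot> u) = u"
      using k(2) h M.HomD[OF u(1)] M.HomD[OF k(1)] M.Cmp_assoc_Ar[of u "\<iota> i j" k, symmetric] by (simp add: M.arr)
    ultimately show False using u(2) M.HomD[OF u(1)] M.HomD[OF k(1)] by (simp add: M.dist)
  qed
  ultimately show ?thesis unfolding M.occurs_def using M.Cmp_Hom[OF u(1) \<iota>ij] by blast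
qed

text \<open>\<open>action_summand\<close> asks for some representatives of the three classes.
  Transport of a nonzero arrow along isomorphisms shows that all representatives serve equally
  well.\<close>

lemma action_summand_iff:
  assumes "is_simple C x" "is_simple M n" "is_simple M r"
  shows "action_summand C M (iso_class C x) (iso_class M n) (iso_class M r) \<longleftrightarrow>
    direct_summand M r (act M x n)"
proof
  assume "direct_summand M r (act M x n)"
  then show "action_summand C M (iso_class C x) (iso_class M n) (iso_class M r)"
    unfolding action_summand_def
    using C.Irr_classesI[OF assms(1)] M.Irr_classesI[OF assms(2)] M.Irr_classesI[OF assms(3)]
      C.iso_class_refl[OF C.simpleD(1)[OF assms(1)]] M.iso_class_refl[OF M.simpleD(1)[OF assms(2)]]
      M.iso_class_refl[OF M.simpleD(1)[OF assms(3)]] by blast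
next
  assume "action_summand C M (iso_class C x) (iso_class M n) (iso_class M r)"
  then obtain x' n' r' where x': "x' \<in> iso_class C x" and n': "n' \<in> iso_class M n" and r': "r' \<in> iso_class M r"
    and sum: "direct_summand M r' (act M x' n')"
    unfolding action_summand_def by blast
  have "is_simple M r'" using M.simple_iso_class[OF assms(3) r'] .
  then obtain u where u: "u \<in> Hom M r' (act M x' n')" "u \<noteq> Zer M r' (act M x' n')"
    using sum M.simple_direct_summand_iff by blast
  obtain f f' where f: "f \<in> Hom C x x'" "f' \<in> Hom C x' x" "f \<cdot>\<^bsub>C\<^esub> f' = Ident C x'"
    using x' unfolding C.iso_class_iff by blast
  obtain g g' where g: "g \<in> Hom M n n'" "g' \<in> Hom M n' n" "g \<cdot> g' = Ident M n'"
    using n' unfolding M.iso_class_iff by blast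
  obtain k k' where k: "k \<in> Hom M r r'" "k' \<in> Hom M r' r" "k \<cdot> k' = Ident M r'"
    using r' unfolding M.iso_class_iff by blast
  let ?v = "actA M f' g' \<cdot> (u \<cdot> k)"
  note h = C.HomD[OF f(1)] C.HomD[OF f(2)] M.HomD[OF g(1)] M.HomD[OF g(2)] M.HomD[OF k(1)] M.HomD[OF k(2)] M.HomD[OF u(1)]
  have v: "?v \<in> Hom M r (act M x n)"
    using M.Cmp_Hom[OF M.Cmp_Hom[OF k(1) u(1)] act.FA_Hom[OF f(2) g(2)]] .
  have "actA M f g \<cdot> (?v \<cdot> k') = u"
    using h f(3) g(3) k(3) by (simp add: M.arr act.bif)
  moreover have "actA M f g \<cdot> (Zer M r (act M x n) \<cdot> k') = Zer M r' (act M x' n')"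
    using h by (simp add: M.lin M.dist act.Ar_FA act.Src_FA act.Tgt_FA act.FO_Ob)
  ultimately have "?v \<noteq> Zer M r (act M x n)" using u(2) by metis
  then show "direct_summand M r (act M x n)" using M.simple_direct_summand_iff[OF assms(3)] v by blast
qed

lemma action_summandE:
  assumes "action_summand C M X N P"
  obtains x n r where "is_simple C x" "is_simple M n" "is_simple M r" "X = iso_class C x"
    "N = iso_class M n" "P = iso_class M r" "direct_summand M r (act M x n)"
proof -
  obtain x n r where xnr: "x \<in> X" "n \<in> N" "r \<in> P" "direct_summand M r (act M x n)"
    and cl: "X \<in> Irr_classes C" "N \<in> Irr_classes M" "P \<in> Irr_classes M"
    using assms unfolding action_summand_def by blast
  show ?thesis
    by (rule that[OF C.Irr_classesD(1)[OF cl(1) xnr(1)] M.Irr_classesD(1)[OF cl(2) xnr(2)]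
          M.Irr_classesD(1)[OF cl(3) xnr(3)] C.Irr_classesD(2)[OF cl(1) xnr(1)]
          M.Irr_classesD(2)[OF cl(2) xnr(2)] M.Irr_classesD(2)[OF cl(3) xnr(3)] xnr(4)])
qed

lemma derived_act_complex:
  assumes "bounded_complex C K" "bounded_complex M L"
  shows "is_action_complex C M K L (derived_act C M K L)"
  unfolding derived_act_def using action_complex_exists[OF assms] by (rule someI_ex)

text \<open>Testing on stalks gives two opposite inequalities. Conversely, each simple object in the
  cohomology of the product comes from a triple by \<open>kuenneth\<close>, and the bounds for its
  two factors add up to the required bound.\<close>

theorem module_deviations_iff:
  "m \<in> module_deviations C M (shift_t_structure C q) (shift_t_structure M p) \<longleftrightarrow>
    (\<forall>X N P. action_summand C M X N P \<longrightarrow> p P = q X + p N - m)"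
proof
  assume m: "m \<in> module_deviations C M (shift_t_structure C q) (shift_t_structure M p)"
  show "\<forall>X N P. action_summand C M X N P \<longrightarrow> p P = q X + p N - m"
  proof (intro allI impI)
    fix X N P assume "action_summand C M X N P"
    then obtain x n r where x: "is_simple C x" and n: "is_simple M n" and r: "is_simple M r"
      and cl: "X = iso_class C x" "N = iso_class M n" "P = iso_class M r"
      and sum: "direct_summand M r (act M x n)" by (rule action_summandE)
    \<comment> \<open>These are the only degrees in which the two stalks satisfy both the upper and
      the lower bound, at level 0 for \<open>C\<close> and at level \<open>m\<close> for
      \<open>M\<close>.\<close>
    define i j where "i = - q X" and "j = m - p N"
    let ?K = "C.stalk_at i x" and ?L = "M.stalk_at j n"
    note bK = C.stalk_at_bounded[OF C.simpleD(1)[OF x], of i]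
      and bL = M.stalk_at_bounded[OF M.simpleD(1)[OF n], of j]
    have K: "l = i \<and> iso_class C S = X" if "is_simple C S" "C.occurs ?K l S" for l S
      using C.occurs_stalk_atD[OF x that] C.iso_class_eq cl by blast
    have L: "l = j \<and> iso_class M S = N" if "is_simple M S" "M.occurs ?L l S" for l S
      using M.occurs_stalk_atD[OF n that] M.iso_class_eq cl by blast
    have "?K \<in> t_le C (shift_t_structure C q) 0" "?K \<in> t_ge C (shift_t_structure C q) 0"
      unfolding C.t_le_iff C.t_ge_iff using bK by (auto dest!: K simp: i_def)
    moreover have "?L \<in> t_le M (shift_t_structure M p) m" "?L \<in> t_ge M (shift_t_structure M p) m"
      unfolding M.t_le_iff M.t_ge_iff using bL by (auto dest!: L simp: j_def)
    ultimately have "derived_act C M ?K ?L \<in> t_le M (shift_t_structure M p) 0"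
      "derived_act C M ?K ?L \<in> t_ge M (shift_t_structure M p) 0"
      using m unfolding module_deviations_def by blast+
    moreover have "M.occurs (derived_act C M ?K ?L) (i + j) r"
      by (rule kuenneth_stalks[OF x n r sum derived_act_complex[OF bK bL]])
    ultimately have "p P \<le> 0 - (i + j)" "0 - (i + j) \<le> p P"
      unfolding M.t_le_iff M.t_ge_iff cl using r by blast+
    then show "p P = q X + p N - m" by (simp add: i_def j_def)
  qed
next
  assume eq: "\<forall>X N P. action_summand C M X N P \<longrightarrow> p P = q X + p N - m"
  \<comment> \<open>One equation serves both inclusions; only the direction of the inequalities for
    the factors differs below.\<close>
  have occ: "\<exists>i X N. is_simple C X \<and> is_simple M N \<and> C.occurs K i X \<and> M.occurs L (r - i) N \<and>
      p (iso_class M P) = q (iso_class C X) + p (iso_class M N) - m"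
    if K: "bounded_complex C K" and L: "bounded_complex M L" and P: "is_simple M P"
      and occ: "M.occurs (derived_act C M K L) r P" for K L P r
  proof -
    obtain i X N where X: "is_simple C X" and N: "is_simple M N" and o: "C.occurs K i X" "M.occurs L (r - i) N"
      and sum: "direct_summand M P (act M X N)"
      by (rule kuenneth[OF K L derived_act_complex[OF K L] P occ])
    have "action_summand C M (iso_class C X) (iso_class M N) (iso_class M P)"
      unfolding action_summand_iff[OF X N P] by (rule sum)
    then show ?thesis using eq X N o by blast
  qed
  have bounded: "bounded_complex M (derived_act C M K L)"
    if "bounded_complex C K" "bounded_complex M L" for K L
    using derived_act_complex[OF that] by (simp add: is_action_complex_def)
  have "derived_act C M K L \<in> t_le M (shift_t_structure M p) 0"
    if "K \<in> t_le C (shift_t_structure C q) 0" "L \<in> t_le M (shift_t_structure M p) m" for K L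
    unfolding M.t_le_iff
  proof (intro conjI allI impI)
    have K: "bounded_complex C K" and L: "bounded_complex M L"
      and Kq: "\<And>j S. is_simple C S \<Longrightarrow> C.occurs K j S \<Longrightarrow> q (iso_class C S) \<le> 0 - j"
      and Lp: "\<And>j S. is_simple M S \<Longrightarrow> M.occurs L j S \<Longrightarrow> p (iso_class M S) \<le> m - j"
      using that unfolding C.t_le_iff M.t_le_iff by blast+
    show "bounded_complex M (derived_act C M K L)" by (rule bounded[OF K L])
    fix r P assume "is_simple M P" "M.occurs (derived_act C M K L) r P"
    then obtain i X N where "is_simple C X" "is_simple M N" "C.occurs K i X" "M.occurs L (r - i) N"
      and e: "p (iso_class M P) = q (iso_class C X) + p (iso_class M N) - m" using occ[OF K L] by blast
    then have "q (iso_class C X) \<le> 0 - i" "p (iso_class M N) \<le> m - (r - i)" using Kq Lp by blast+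
    then show "p (iso_class M P) \<le> 0 - r" using e by linarith
  qed
  moreover have "derived_act C M K L \<in> t_ge M (shift_t_structure M p) 0"
    if "K \<in> t_ge C (shift_t_structure C q) 0" "L \<in> t_ge M (shift_t_structure M p) m" for K L
    unfolding M.t_ge_iff
  proof (intro conjI allI impI)
    have K: "bounded_complex C K" and L: "bounded_complex M L"
      and Kq: "\<And>j S. is_simple C S \<Longrightarrow> C.occurs K j S \<Longrightarrow> 0 - j \<le> q (iso_class C S)"
      and Lp: "\<And>j S. is_simple M S \<Longrightarrow> M.occurs L j S \<Longrightarrow> m - j \<le> p (iso_class M S)"
      using that unfolding C.t_ge_iff M.t_ge_iff by blast+
    show "bounded_complex M (derived_act C M K L)" by (rule bounded[OF K L])
    fix r P assume "is_simple M P" "M.occurs (derived_act C M K L) r P"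
    then obtain i X N where "is_simple C X" "is_simple M N" "C.occurs K i X" "M.occurs L (r - i) N"
      and e: "p (iso_class M P) = q (iso_class C X) + p (iso_class M N) - m" using occ[OF K L] by blast
    then have "0 - i \<le> q (iso_class C X)" "m - (r - i) \<le> p (iso_class M N)" using Kq Lp by blast+
    then show "0 - r \<le> p (iso_class M P)" using e by linarith
  qed
  ultimately show "m \<in> module_deviations C M (shift_t_structure C q) (shift_t_structure M p)"
    unfolding module_deviations_def by blast
qed

end

section \<open>The grading of a module category\<close>

context category
begin

text \<open>The trivial decomposition of an object lets \<open>detect_FO\<close> split the other
  argument alone.\<close>

lemma coproduct_single: "S \<in> Ob C \<Longrightarrow> is_coproduct C {i} (\<lambda>_. S) S (\<lambda>_. Ident C S)"
  by (rule coproductI) (auto simp: Id_Hom Id_right)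

end

context semisimple_module_category
begin

lemma grading_group: "group (grading_group C)"
  unfolding grading_group_def by (rule presented_group_is_group)

lemma grading_deg_carrier: "X \<in> Irr_classes C \<Longrightarrow> grading_deg C X \<in> carrier (grading_group C)"
  by (auto simp: grading_deg_def grading_group_def presented_group_def)

lemma grading_deg_tens:
  assumes "is_simple C x" "is_simple C y" "is_simple C z" "direct_summand C z (tens C x y)"
  shows "grading_deg C (iso_class C z) =
    grading_deg C (iso_class C x) \<otimes>\<^bsub>grading_group C\<^esub> grading_deg C (iso_class C y)"
proof (rule grading_deg_multiplicative)
  show "tensor_summand C (iso_class C x) (iso_class C y) (iso_class C z)"
    unfolding tensor_summand_def
    using C.Irr_classesI[OF assms(1)] C.Irr_classesI[OF assms(2)] C.Irr_classesI[OF assms(3)]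
      C.iso_class_refl[OF C.simpleD(1)[OF assms(1)]] C.iso_class_refl[OF C.simpleD(1)[OF assms(2)]]
      C.iso_class_refl[OF C.simpleD(1)[OF assms(3)]] assms(4) by blast
qed

text \<open>The unit is a summand of its own square, so its degree is an idempotent of a
  group.\<close>

lemma grading_deg_unit: "grading_deg C (iso_class C (unit_ob C)) = \<one>\<^bsub>grading_group C\<^esub>"
proof -
  interpret group "grading_group C" by (rule grading_group)
  let ?u = "unit_ob C"
  have l: "lunit C ?u \<in> Hom C (tens C ?u ?u) ?u" "is_isomorphism C (lunit C ?u)"
    using C.lunit_Hom[OF C.unit_Ob] by auto
  have "direct_summand C ?u (tens C ?u ?u)"
    by (rule C.simple_direct_summandI_epic[OF C.unit_simple l(1) C.isomorphism_nonzero[OF C.unit_simple l]])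
  then have "grading_deg C (iso_class C ?u) =
      grading_deg C (iso_class C ?u) \<otimes>\<^bsub>grading_group C\<^esub> grading_deg C (iso_class C ?u)"
    using grading_deg_tens C.unit_simple by blast
  then show ?thesis
    using grading_deg_carrier[OF C.Irr_classesI[OF C.unit_simple]] r_cancel_one by metis
qed

text \<open>The edges of the graph of \<open>M\<close>, labelled by degrees. Identities, composites
  and reversals of labelled edges exist and match the operations of the grading group.\<close>

definition linked where
  "linked g N P \<longleftrightarrow> (\<exists>X. action_summand C M X N P \<and> grading_deg C X = g)"

lemma linkedD:
  assumes "linked g N P"
  shows "N \<in> Irr_classes M" "P \<in> Irr_classes M" "g \<in> carrier (grading_group C)"
  using assms grading_deg_carrier by (auto simp: linked_def action_summand_def)

lemma linked_iff:
  assumes "is_simple M n" "is_simple M r"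
  shows "linked g (iso_class M n) (iso_class M r) \<longleftrightarrow>
    (\<exists>x u. is_simple C x \<and> grading_deg C (iso_class C x) = g \<and> u \<in> Hom M r (act M x n) \<and> u \<noteq> Zer M r (act M x n))"
proof
  assume "linked g (iso_class M n) (iso_class M r)"
  then obtain X where X: "action_summand C M X (iso_class M n) (iso_class M r)" "grading_deg C X = g"
    unfolding linked_def by blast
  then have "X \<in> Irr_classes C" by (simp add: action_summand_def)
  then obtain x where x: "is_simple C x" "X = iso_class C x" using C.Irr_classesE by metis
  then have "direct_summand M r (act M x n)" using X(1) action_summand_iff[OF x(1) assms] by simp
  then show "\<exists>x u. is_simple C x \<and> grading_deg C (iso_class C x) = g \<and> u \<in> Hom M r (act M x n) \<and> u \<noteq> Zer M r (act M x n)"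
    using x X(2) M.simple_direct_summand_iff[OF assms(2)] by blast
next
  assume "\<exists>x u. is_simple C x \<and> grading_deg C (iso_class C x) = g \<and> u \<in> Hom M r (act M x n) \<and> u \<noteq> Zer M r (act M x n)"
  then obtain x where x: "is_simple C x" "grading_deg C (iso_class C x) = g" "direct_summand M r (act M x n)"
    using M.simple_direct_summand_iff[OF assms(2)] by blast
  then show "linked g (iso_class M n) (iso_class M r)"
    unfolding linked_def using action_summand_iff[OF x(1) assms] by blast
qed

lemma act_simple_decomposition:
  assumes X: "is_coproduct C {..<k::nat} F X inc" and u: "u \<in> Hom M r (act M X n)" "u \<noteq> Zer M r (act M X n)"
    and n: "n \<in> Ob M"
  obtains a v where "a < k" "v \<in> Hom M r (act M (F a) n)" "v \<noteq> Zer M r (act M (F a) n)"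
  by (rule act.detect_FO[OF X _ M.coproduct_single[OF n, of 0] _ u]) (use that in auto)

lemma linked_refl:
  assumes "N \<in> Irr_classes M"
  shows "linked \<one>\<^bsub>grading_group C\<^esub> N N"
proof -
  obtain n where n: "is_simple M n" "N = iso_class M n" using M.Irr_classesE[OF assms] by metis
  have m: "munit M n \<in> Hom M (act M (unit_ob C) n) n" "is_isomorphism M (munit M n)"
    using mun_Hom[OF M.simpleD(1)[OF n(1)]] by auto
  obtain u where u: "u \<in> Hom M n (act M (unit_ob C) n)" "munit M n \<cdot> u = Ident M n"
    using M.isomorphismE[OF m(2,1)] by metis
  have "u \<noteq> Zer M n (act M (unit_ob C) n)"
    using u M.simpleD[OF n(1)] M.HomD[OF m(1)] M.Cmp_Zer_right[of "munit M n" n "act M (unit_ob C) n"] by auto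
  then show ?thesis
    unfolding n(2) linked_iff[OF n(1) n(1)] using C.unit_simple grading_deg_unit u(1) by blast
qed

text \<open>The composite \<open>q \<rightarrow> y \<odot> r \<rightarrow> y \<odot> (x \<odot>
  n)\<close> is nonzero because \<open>y \<odot> u\<close> is split. Read in
  \<open>(y \<otimes> x) \<odot> n\<close>, it is detected on a simple summand of
  \<open>y \<otimes> x\<close>, whose degree is the product \<open>h g\<close> in this
  order.\<close>

lemma linked_trans:
  assumes "linked g N P" "linked h P Q"
  shows "linked (h \<otimes>\<^bsub>grading_group C\<^esub> g) N Q"
proof -
  obtain n where n: "is_simple M n" "N = iso_class M n" using M.Irr_classesE[OF linkedD(1)[OF assms(1)]] by metis
  obtain r where r: "is_simple M r" "P = iso_class M r" using M.Irr_classesE[OF linkedD(2)[OF assms(1)]] by metis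
  obtain q where q: "is_simple M q" "Q = iso_class M q" using M.Irr_classesE[OF linkedD(2)[OF assms(2)]] by metis
  obtain x u where x: "is_simple C x" "grading_deg C (iso_class C x) = g"
    and u: "u \<in> Hom M r (act M x n)" "u \<noteq> Zer M r (act M x n)"
    using assms(1) unfolding n(2) r(2) linked_iff[OF n(1) r(1)] by blast
  obtain y v where y: "is_simple C y" "grading_deg C (iso_class C y) = h"
    and v: "v \<in> Hom M q (act M y r)" "v \<noteq> Zer M q (act M y r)"
    using assms(2) unfolding q(2) r(2) linked_iff[OF r(1) q(1)] by blast
  obtain k where k: "k \<in> Hom M (act M x n) r" "k \<cdot> u = Ident M r" using M.simple_split_monic[OF r(1) u] .
  note ob = C.simpleD(1)[OF x(1)] C.simpleD(1)[OF y(1)] M.simpleD(1)[OF n(1)]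
  have ms: "massoc M y x n \<in> Hom M (act M (tens C y x) n) (act M y (act M x n))" "is_isomorphism M (massoc M y x n)"
    using masc_Hom[OF ob(2,1,3)] by auto
  obtain m where m: "m \<in> Hom M (act M y (act M x n)) (act M (tens C y x) n)"
    "massoc M y x n \<cdot> m = Ident M (act M y (act M x n))"
    using M.isomorphismE[OF ms(2,1)] by metis
  let ?f = "actA M (Ident C y) u" and ?k = "actA M (Ident C y) k"
  have f: "?f \<in> Hom M (act M y r) (act M y (act M x n))" and k': "?k \<in> Hom M (act M y (act M x n)) (act M y r)"
    using act.FA_Hom[OF C.Id_Hom[OF ob(2)]] u k by blast+
  note a = M.HomD[OF f] M.HomD[OF k'] M.HomD[OF m(1)] M.HomD[OF ms(1)] M.HomD[OF v(1)]
  have kf: "?k \<cdot> ?f = Ident M (act M y r)"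
    using ob M.HomD[OF u(1)] M.HomD[OF k(1)] k(2) by (simp add: C.arr act.FA_Cmp_Ar act.FA_Id)
  define w where "w = m \<cdot> (?f \<cdot> v)"
  have w: "w \<in> Hom M q (act M (tens C y x) n)" unfolding w_def using M.Cmp_Hom[OF M.Cmp_Hom[OF v(1) f] m(1)] .
  have "?k \<cdot> (massoc M y x n \<cdot> w) = ?k \<cdot> ((massoc M y x n \<cdot> m) \<cdot> (?f \<cdot> v))"
    unfolding w_def using a by (simp add: M.Cmp_assoc_Ar M.Ar_Cmp M.Src_Cmp M.Tgt_Cmp)
  also have "\<dots> = (?k \<cdot> ?f) \<cdot> v" unfolding m(2) using a by (simp add: M.arr)
  also have "\<dots> = v" unfolding kf using a by (simp add: M.arr)
  finally have "?k \<cdot> (massoc M y x n \<cdot> w) = v" .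
  moreover have "?k \<cdot> (massoc M y x n \<cdot> Zer M q (act M (tens C y x) n)) = Zer M q (act M y r)"
    using a by (simp add: M.dist)
  ultimately have w0: "w \<noteq> Zer M q (act M (tens C y x) n)" using v(2) by metis
  obtain l :: nat and F inc where cop: "is_coproduct C {..<l} F (tens C y x) inc"
    and F: "\<And>i. i < l \<Longrightarrow> is_simple C (F i)"
    using C.decomposition[OF tens.FO_Ob[OF ob(2,1)]] by metis
  obtain z t where z: "z < l" and t: "t \<in> Hom M q (act M (F z) n)" "t \<noteq> Zer M q (act M (F z) n)"
    by (rule act_simple_decomposition[OF cop w w0 ob(3)])
  obtain p where p: "p \<in> Hom C (tens C y x) (F z)" "p \<cdot>\<^bsub>C\<^esub> inc z = Ident C (F z)"
    using C.coproduct_retraction[OF cop, of z] z by auto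
  have "direct_summand C (F z) (tens C y x)"
    using C.split_monic_direct_summand[OF C.coproductD(3)[OF cop] p] z by simp
  then have "grading_deg C (iso_class C (F z)) = h \<otimes>\<^bsub>grading_group C\<^esub> g"
    using grading_deg_tens[OF y(1) x(1) F[OF z]] x(2) y(2) by simp
  then show ?thesis unfolding n(2) q(2) linked_iff[OF n(1) q(1)] using F[OF z] t by blast
qed

text \<open>Both halves of the symmetry of the graph use a left dual \<open>D\<close> of \<open>x\<close>: the adjunct
  \<open>D \<odot> r \<rightarrow> n\<close> of a nonzero arrow \<open>r \<rightarrow> x \<odot> n\<close> is nonzero, and every summand of \<open>D\<close> has the degree
  inverse to that of \<open>x\<close>.\<close>

lemma dual_evaluation_nonzero:
  assumes D: "D \<in> Ob C" and x: "x \<in> Ob C" and ev: "ev \<in> Hom C (tens C D x) (unit_ob C)"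
    and coev: "coev \<in> Hom C (unit_ob C) (tens C x D)" and ia: "is_inverse C (assoc_ar C D x D) ia"
    and zz: "lunit C D \<cdot>\<^bsub>C\<^esub> tensA C ev (Ident C D) \<cdot>\<^bsub>C\<^esub> ia \<cdot>\<^bsub>C\<^esub> tensA C (Ident C D) coev = runit C D"
    and f: "f \<in> Hom C Y D" and 0: "ev \<cdot>\<^bsub>C\<^esub> tensA C f (Ident C x) = Zer C (tens C Y x) (unit_ob C)"
  shows "f = Zer C Y D"
proof -
  note Y = C.HomD(4)[OF f]
  have as: "assoc_ar C Z x D \<in> Hom C (tens C (tens C Z x) D) (tens C Z (tens C x D))"
    "is_isomorphism C (assoc_ar C Z x D)" if "Z \<in> Ob C" for Z
    using C.asc_Hom[OF that x D] by auto
  have ia': "ia \<in> Hom C (tens C D (tens C x D)) (tens C (tens C D x) D)"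
    "ia \<cdot>\<^bsub>C\<^esub> assoc_ar C D x D = Ident C (tens C (tens C D x) D)"
    using ia C.HomD[OF as(1)[OF D]] by (auto simp: is_inverse_def)
  obtain ib where ib: "ib \<in> Hom C (tens C Y (tens C x D)) (tens C (tens C Y x) D)"
    "assoc_ar C Y x D \<cdot>\<^bsub>C\<^esub> ib = Ident C (tens C Y (tens C x D))"
    using C.isomorphismE[OF as(2)[OF Y] as(1)[OF Y]] by metis
  have ru: "runit C Z \<in> Hom C (tens C Z (unit_ob C)) Z" "is_isomorphism C (runit C Z)" if "Z \<in> Ob C" for Z
    using C.runit_Hom[OF that] by auto
  have lu: "lunit C D \<in> Hom C (tens C (unit_ob C) D) D" using C.lunit_Hom[OF D] by auto
  define p where "p = tensA C ev (Ident C D)"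
  define q where "q = tensA C (Ident C D) coev"
  define q' where "q' = tensA C (Ident C Y) coev"
  define f1 where "f1 = tensA C f (Ident C (unit_ob C))"
  define f2 where "f2 = tensA C f (Ident C (tens C x D))"
  define f3 where "f3 = tensA C (tensA C f (Ident C x)) (Ident C D)"
  note I = C.Id_Hom[OF x] C.Id_Hom[OF D] C.Id_Hom[OF Y] C.Id_Hom[OF C.unit_Ob] C.Id_Hom[OF tens.FO_Ob[OF x D]]
  have H: "p \<in> Hom C (tens C (tens C D x) D) (tens C (unit_ob C) D)"
    "q \<in> Hom C (tens C D (unit_ob C)) (tens C D (tens C x D))"
    "q' \<in> Hom C (tens C Y (unit_ob C)) (tens C Y (tens C x D))"
    "f1 \<in> Hom C (tens C Y (unit_ob C)) (tens C D (unit_ob C))"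
    "f2 \<in> Hom C (tens C Y (tens C x D)) (tens C D (tens C x D))"
    "f3 \<in> Hom C (tens C (tens C Y x) D) (tens C (tens C D x) D)"
    unfolding p_def q_def q'_def f1_def f2_def f3_def
    by (intro tens.FA_Hom ev coev f I)+
  note h = C.HomD[OF f] C.HomD[OF ev] C.HomD[OF coev] C.HomD[OF H(1)] C.HomD[OF H(2)] C.HomD[OF H(3)] C.HomD[OF H(4)]
    C.HomD[OF H(5)] C.HomD[OF H(6)] C.HomD[OF ia'(1)] C.HomD[OF ib(1)] C.HomD[OF lu] C.HomD[OF ru(1)[OF D]]
    C.HomD[OF ru(1)[OF Y]] C.HomD[OF as(1)[OF D]] C.HomD[OF as(1)[OF Y]] x D Y
  have e1: "q \<cdot>\<^bsub>C\<^esub> f1 = f2 \<cdot>\<^bsub>C\<^esub> q'"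
    unfolding q_def f1_def f2_def q'_def using h by (simp add: tens.FA_Cmp_Ar C.arr)
  have "assoc_ar C D x D \<cdot>\<^bsub>C\<^esub> f3 = f2 \<cdot>\<^bsub>C\<^esub> assoc_ar C Y x D"
    unfolding f3_def f2_def using C.asc_natural[OF f I(1,2)] tens.FA_Id[OF x D] by simp
  then have "ia \<cdot>\<^bsub>C\<^esub> ((assoc_ar C D x D \<cdot>\<^bsub>C\<^esub> f3) \<cdot>\<^bsub>C\<^esub> ib) = ia \<cdot>\<^bsub>C\<^esub> ((f2 \<cdot>\<^bsub>C\<^esub> assoc_ar C Y x D) \<cdot>\<^bsub>C\<^esub> ib)" by simp
  moreover have "ia \<cdot>\<^bsub>C\<^esub> ((assoc_ar C D x D \<cdot>\<^bsub>C\<^esub> f3) \<cdot>\<^bsub>C\<^esub> ib) = (ia \<cdot>\<^bsub>C\<^esub> assoc_ar C D x D) \<cdot>\<^bsub>C\<^esub> (f3 \<cdot>\<^bsub>C\<^esub> ib)"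
    "ia \<cdot>\<^bsub>C\<^esub> ((f2 \<cdot>\<^bsub>C\<^esub> assoc_ar C Y x D) \<cdot>\<^bsub>C\<^esub> ib) = ia \<cdot>\<^bsub>C\<^esub> (f2 \<cdot>\<^bsub>C\<^esub> (assoc_ar C Y x D \<cdot>\<^bsub>C\<^esub> ib))"
    using h by (simp_all add: C.arr)
  ultimately have e2: "ia \<cdot>\<^bsub>C\<^esub> f2 = f3 \<cdot>\<^bsub>C\<^esub> ib" unfolding ia'(2) ib(2) using h by (simp add: C.arr)
  have e3: "p \<cdot>\<^bsub>C\<^esub> f3 = Zer C (tens C (tens C Y x) D) (tens C (unit_ob C) D)"
    unfolding p_def f3_def using h 0 by (simp add: tens.FA_Cmp_Ar tens.bif C.arr tens.bif_dist)
  \<comment> \<open>The duality identity writes the identity of \<open>D\<close> through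
    \<open>ev\<close>; naturality moves \<open>f\<close> next to \<open>ev\<close>, where the
    composite vanishes.\<close>
  have "f \<cdot>\<^bsub>C\<^esub> runit C Y = runit C D \<cdot>\<^bsub>C\<^esub> f1" unfolding f1_def using C.runit_natural[OF f] by simp
  also have "\<dots> = (((lunit C D \<cdot>\<^bsub>C\<^esub> p) \<cdot>\<^bsub>C\<^esub> ia) \<cdot>\<^bsub>C\<^esub> q) \<cdot>\<^bsub>C\<^esub> f1" using zz unfolding p_def q_def by simp
  also have "\<dots> = lunit C D \<cdot>\<^bsub>C\<^esub> (p \<cdot>\<^bsub>C\<^esub> (ia \<cdot>\<^bsub>C\<^esub> (q \<cdot>\<^bsub>C\<^esub> f1)))" using h by (simp add: C.arr)
  also have "\<dots> = lunit C D \<cdot>\<^bsub>C\<^esub> (p \<cdot>\<^bsub>C\<^esub> ((ia \<cdot>\<^bsub>C\<^esub> f2) \<cdot>\<^bsub>C\<^esub> q'))" unfolding e1 using h by (simp add: C.arr)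
  also have "\<dots> = lunit C D \<cdot>\<^bsub>C\<^esub> ((p \<cdot>\<^bsub>C\<^esub> f3) \<cdot>\<^bsub>C\<^esub> (ib \<cdot>\<^bsub>C\<^esub> q'))" unfolding e2 using h by (simp add: C.arr)
  also have "\<dots> = Zer C (tens C Y (unit_ob C)) D" unfolding e3 using h by (simp add: C.lin C.dist)
  finally have e4: "f \<cdot>\<^bsub>C\<^esub> runit C Y = Zer C (tens C Y (unit_ob C)) D" .
  obtain rv where rv: "rv \<in> Hom C Y (tens C Y (unit_ob C))" "runit C Y \<cdot>\<^bsub>C\<^esub> rv = Ident C Y"
    using C.isomorphismE[OF ru(2)[OF Y] ru(1)[OF Y]] by metis
  have "f = (f \<cdot>\<^bsub>C\<^esub> runit C Y) \<cdot>\<^bsub>C\<^esub> rv" using rv h C.HomD[OF rv(1)] by (simp add: C.arr)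
  then show ?thesis unfolding e4 using h C.HomD[OF rv(1)] by (simp add: C.dist)
qed

lemma dual_adjunct_nonzero:
  assumes D: "D \<in> Ob C" and x: "x \<in> Ob C" and ev: "ev \<in> Hom C (tens C D x) (unit_ob C)"
    and coev: "coev \<in> Hom C (unit_ob C) (tens C x D)"
    and zz: "runit C x \<cdot>\<^bsub>C\<^esub> tensA C (Ident C x) ev \<cdot>\<^bsub>C\<^esub> assoc_ar C x D x \<cdot>\<^bsub>C\<^esub> tensA C coev (Ident C x) = lunit C x"
    and n: "n \<in> Ob M" and u: "u \<in> Hom M r (act M x n)" "u \<noteq> Zer M r (act M x n)"
  obtains v where "v \<in> Hom M (act M D r) n" "v \<noteq> Zer M (act M D r) n"
proof -
  let ?I = "unit_ob C"
  note r = M.HomD(4)[OF u(1)] and I = C.unit_Ob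
  have xn: "act M x n \<in> Ob M" using act.FO_Ob x n by blast
  have tD: "tens C D x \<in> Ob C" "tens C x D \<in> Ob C" using tens.FO_Ob x D by blast+
  have ms: "massoc M Y Z N \<in> Hom M (act M (tens C Y Z) N) (act M Y (act M Z N))" "is_isomorphism M (massoc M Y Z N)"
    if "Y \<in> Ob C" "Z \<in> Ob C" "N \<in> Ob M" for Y Z N
    using masc_Hom[OF that] by auto
  have mu: "munit M N \<in> Hom M (act M ?I N) N" "is_isomorphism M (munit M N)" if "N \<in> Ob M" for N
    using mun_Hom[OF that] by auto
  have as: "assoc_ar C x D x \<in> Hom C (tens C (tens C x D) x) (tens C x (tens C D x))" using C.asc_Hom[OF x D x] by auto
  have ru: "runit C x \<in> Hom C (tens C x ?I) x" using C.runit_Hom[OF x] by auto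
  have lu: "lunit C x \<in> Hom C (tens C ?I x) x" "is_isomorphism C (lunit C x)" using C.lunit_Hom[OF x] by auto
  obtain mi where mi: "mi \<in> Hom M (act M D (act M x n)) (act M (tens C D x) n)"
    "mi \<cdot> massoc M D x n = Ident M (act M (tens C D x) n)"
    using M.isomorphismE[OF ms(2,1)[OF D x n]] by metis
  obtain pi where pi: "pi \<in> Hom M (act M (tens C x D) (act M x n)) (act M (tens C (tens C x D) x) n)"
    "massoc M (tens C x D) x n \<cdot> pi = Ident M (act M (tens C x D) (act M x n))"
    "pi \<cdot> massoc M (tens C x D) x n = Ident M (act M (tens C (tens C x D) x) n)"
    using M.isomorphismE[OF ms(2,1)[OF tD(2) x n]] by metis
  obtain mj where mj: "mj \<in> Hom M (act M ?I (act M x n)) (act M (tens C ?I x) n)"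
    "massoc M ?I x n \<cdot> mj = Ident M (act M ?I (act M x n))"
    using M.isomorphismE[OF ms(2,1)[OF I x n]] by metis
  obtain lv where lv: "lv \<in> Hom C x (tens C ?I x)" "lv \<cdot>\<^bsub>C\<^esub> lunit C x = Ident C (tens C ?I x)"
    using C.isomorphismE[OF lu(2,1)] by metis
  obtain mv where mv: "mv \<in> Hom M r (act M ?I r)" "munit M r \<cdot> mv = Ident M r"
    using M.isomorphismE[OF mu(2,1)[OF r]] by metis
  \<comment> \<open>The adjunct of \<open>u\<close>, through
    \<open>D \<odot> r \<rightarrow> D \<odot> (x \<odot> n)\<close>, the inverse associator, the
    evaluation and the unit isomorphism.\<close>
  define v where "v = munit M n \<cdot> (actA M ev (Ident M n) \<cdot> (mi \<cdot> actA M (Ident C D) u))"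
  note J = C.Id_Hom[OF x] C.Id_Hom[OF D] C.Id_Hom[OF I] C.Id_Hom[OF tD(2)] M.Id_Hom[OF n] M.Id_Hom[OF r] M.Id_Hom[OF xn]
  have evn: "actA M ev (Ident M n) \<in> Hom M (act M (tens C D x) n) (act M ?I n)"
    and Du: "actA M (Ident C D) u \<in> Hom M (act M D r) (act M D (act M x n))"
    by (intro act.FA_Hom ev J u)+
  have v: "v \<in> Hom M (act M D r) n"
    unfolding v_def by (rule M.Cmp_Hom[OF M.Cmp_Hom[OF M.Cmp_Hom[OF Du mi(1)] evn] mu(1)[OF n]])
  have "v \<noteq> Zer M (act M D r) n"
  proof
    assume v0: "v = Zer M (act M D r) n"
    define A1 where "A1 = actA M (Ident C x) (munit M n)"
    define A2 where "A2 = actA M (Ident C x) (actA M ev (Ident M n))"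
    define A3 where "A3 = actA M (Ident C x) mi"
    define A4 where "A4 = actA M (Ident C x) (actA M (Ident C D) u)"
    define B1 where "B1 = actA M (Ident C (tens C x D)) u"
    define c1 where "c1 = actA M coev (Ident M r)"
    define c2 where "c2 = actA M coev (Ident M (act M x n))"
    define U1 where "U1 = actA M (Ident C ?I) u"
    define s where "s = actA M (assoc_ar C x D x) (Ident M n)"
    define t where "t = actA M (tensA C coev (Ident C x)) (Ident M n)"
    define w where "w = actA M (tensA C (Ident C x) ev) (Ident M n)"
    define R where "R = actA M (runit C x) (Ident M n)"
    define L where "L = actA M (lunit C x) (Ident M n)"
    define m1 where "m1 = massoc M x D r"
    define m2 where "m2 = massoc M x D (act M x n)"
    define m3 where "m3 = massoc M x (tens C D x) n"
    define m4 where "m4 = massoc M x ?I n"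
    have H: "A1 \<in> Hom M (act M x (act M ?I n)) (act M x n)"
      "A2 \<in> Hom M (act M x (act M (tens C D x) n)) (act M x (act M ?I n))"
      "A3 \<in> Hom M (act M x (act M D (act M x n))) (act M x (act M (tens C D x) n))"
      "A4 \<in> Hom M (act M x (act M D r)) (act M x (act M D (act M x n)))"
      "B1 \<in> Hom M (act M (tens C x D) r) (act M (tens C x D) (act M x n))"
      "c1 \<in> Hom M (act M ?I r) (act M (tens C x D) r)"
      "c2 \<in> Hom M (act M ?I (act M x n)) (act M (tens C x D) (act M x n))"
      "U1 \<in> Hom M (act M ?I r) (act M ?I (act M x n))"
      "s \<in> Hom M (act M (tens C (tens C x D) x) n) (act M (tens C x (tens C D x)) n)"
      "t \<in> Hom M (act M (tens C ?I x) n) (act M (tens C (tens C x D) x) n)"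
      "w \<in> Hom M (act M (tens C x (tens C D x)) n) (act M (tens C x ?I) n)"
      "R \<in> Hom M (act M (tens C x ?I) n) (act M x n)"
      "L \<in> Hom M (act M (tens C ?I x) n) (act M x n)"
      "m1 \<in> Hom M (act M (tens C x D) r) (act M x (act M D r))"
      "m2 \<in> Hom M (act M (tens C x D) (act M x n)) (act M x (act M D (act M x n)))"
      "m3 \<in> Hom M (act M (tens C x (tens C D x)) n) (act M x (act M (tens C D x) n))"
      "m4 \<in> Hom M (act M (tens C x ?I) n) (act M x (act M ?I n))"
      unfolding A1_def A2_def A3_def A4_def B1_def c1_def c2_def U1_def s_def t_def w_def R_def L_def m1_def m2_def m3_def m4_def
      by (intro act.FA_Hom tens.FA_Hom ms(1) mu(1) mi as ru lu ev coev u J x D n r xn I tD)+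
    note h = H[THEN M.HomD(1)] H[THEN M.HomD(2)] H[THEN M.HomD(3)] H[THEN M.HomD(4)] H[THEN M.HomD(5)]
      M.HomD[OF pi(1)] M.HomD[OF mj(1)]
    note ar = C.HomD[OF ev] C.HomD[OF coev] M.HomD[OF u(1)] C.HomD[OF as] C.HomD[OF ru] C.HomD[OF lu(1)] M.HomD[OF mi(1)]
      M.HomD[OF mu(1)[OF n]] x D n r I xn tD M.HomD[OF evn] M.HomD[OF Du] M.HomD[OF ms(1)[OF D x n]]
    have A: "actA M (Ident C x) v = A1 \<cdot> (A2 \<cdot> (A3 \<cdot> A4))"
      unfolding v_def A1_def A2_def A3_def A4_def using ar
      by (simp add: act.FA_Cmp_Ar C.arr M.Ar_Cmp M.Src_Cmp M.Tgt_Cmp)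
    have B: "A4 \<cdot> m1 = m2 \<cdot> B1"
      unfolding A4_def m1_def m2_def B1_def using masc_natural[OF J(1,2) u(1)] tens.FA_Id[OF x D] by simp
    have Cc: "B1 \<cdot> c1 = c2 \<cdot> U1"
      unfolding B1_def c1_def c2_def U1_def using ar by (simp add: act.FA_Cmp_Ar C.arr M.arr)
    have E3: "A3 \<cdot> actA M (Ident C x) (massoc M D x n) = Ident M (act M x (act M (tens C D x) n))"
      unfolding A3_def using ar mi(2) act.FO_Ob by (simp add: act.FA_Cmp_Ar C.arr act.FA_Id)
    have pent: "(actA M (Ident C x) (massoc M D x n) \<cdot> m3) \<cdot> s = m2 \<cdot> massoc M (tens C x D) x n"
      unfolding m3_def s_def m2_def by (rule mod_pentagon[OF x D x n])
    \<comment> \<open>The module pentagon, rewritten in terms of the inverse associators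
      \<open>mi\<close> and \<open>pi\<close>.\<close>
    have Dm: "A3 \<cdot> m2 = m3 \<cdot> (s \<cdot> pi)"
    proof -
      have a: "actA M (Ident C x) (massoc M D x n) \<in> Hom M (act M x (act M (tens C D x) n)) (act M x (act M D (act M x n)))"
        by (intro act.FA_Hom J ms x D n)
      note g = h M.HomD[OF a] M.HomD[OF ms(1)[OF tD(2) x n]]
      have "A3 \<cdot> m2 = A3 \<cdot> ((m2 \<cdot> massoc M (tens C x D) x n) \<cdot> pi)" using g pi(2) by (simp add: M.arr)
      also have "\<dots> = (A3 \<cdot> actA M (Ident C x) (massoc M D x n)) \<cdot> (m3 \<cdot> (s \<cdot> pi))"
        unfolding pent[symmetric] using g by (simp add: M.arr)
      also have "\<dots> = m3 \<cdot> (s \<cdot> pi)" unfolding E3 using g by (simp add: M.arr)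
      finally show ?thesis .
    qed
    have E: "pi \<cdot> c2 = t \<cdot> mj"
    proof -
      note g = h M.HomD[OF ms(1)[OF tD(2) x n]] M.HomD[OF ms(1)[OF I x n]]
      have nat: "massoc M (tens C x D) x n \<cdot> t = c2 \<cdot> massoc M ?I x n"
        unfolding t_def c2_def using masc_natural[OF coev J(1,5)] act.FA_Id[OF x n] by simp
      have "pi \<cdot> c2 = pi \<cdot> ((c2 \<cdot> massoc M ?I x n) \<cdot> mj)" using g mj(2) by (simp add: M.arr)
      also have "\<dots> = (pi \<cdot> massoc M (tens C x D) x n) \<cdot> (t \<cdot> mj)" unfolding nat[symmetric] using g by (simp add: M.arr)
      also have "\<dots> = t \<cdot> mj" unfolding pi(3) using g by (simp add: M.arr)
      finally show ?thesis .
    qed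
    have F: "A2 \<cdot> m3 = m4 \<cdot> w"
      unfolding A2_def m3_def m4_def w_def by (rule masc_natural[OF J(1) ev J(5), symmetric])
    have G: "A1 \<cdot> m4 = R" unfolding A1_def m4_def R_def by (rule mod_triangle[OF x n])
    have Z: "R \<cdot> (w \<cdot> (s \<cdot> t)) = L"
      unfolding R_def w_def s_def t_def L_def zz[symmetric] using ar
      by (simp add: act.FA_Cmp_Ar C.arr M.arr tens.Ar_FA tens.Src_FA tens.Tgt_FA)
    \<comment> \<open>Coevaluation followed by \<open>x \<odot> v\<close> equals
      \<open>1 \<odot> u\<close> up to structure isomorphisms, by the duality identity in
      \<open>Z\<close>. Thus \<open>v = 0\<close> forces \<open>u = 0\<close>.\<close>
    have "actA M (Ident C x) v \<cdot> (m1 \<cdot> c1) = A1 \<cdot> (A2 \<cdot> (A3 \<cdot> ((A4 \<cdot> m1) \<cdot> c1)))"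
      unfolding A using h by (simp add: M.arr)
    also have "\<dots> = A1 \<cdot> (A2 \<cdot> (A3 \<cdot> (m2 \<cdot> (B1 \<cdot> c1))))" unfolding B using h by (simp add: M.arr)
    also have "\<dots> = A1 \<cdot> (A2 \<cdot> ((A3 \<cdot> m2) \<cdot> (c2 \<cdot> U1)))" unfolding Cc using h by (simp add: M.arr)
    also have "\<dots> = A1 \<cdot> ((A2 \<cdot> m3) \<cdot> (s \<cdot> ((pi \<cdot> c2) \<cdot> U1)))" unfolding Dm using h by (simp add: M.arr)
    also have "\<dots> = (A1 \<cdot> m4) \<cdot> (w \<cdot> (s \<cdot> (t \<cdot> (mj \<cdot> U1))))" unfolding E F using h by (simp add: M.arr)
    also have "\<dots> = (R \<cdot> (w \<cdot> (s \<cdot> t))) \<cdot> (mj \<cdot> U1)" unfolding G using h by (simp add: M.arr)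
    finally have W: "actA M (Ident C x) v \<cdot> (m1 \<cdot> c1) = L \<cdot> (mj \<cdot> U1)" unfolding Z .
    have "actA M (Ident C x) v \<cdot> (m1 \<cdot> c1) = Zer M (act M ?I r) (act M x n)"
      unfolding v0 using h ar by (simp add: act.bif_dist C.arr M.arr M.dist act.FO_Ob)
    then have LU: "L \<cdot> (mj \<cdot> U1) = Zer M (act M ?I r) (act M x n)" using W by simp
    define L' where "L' = actA M lv (Ident M n)"
    have L': "L' \<in> Hom M (act M x n) (act M (tens C ?I x) n)" unfolding L'_def by (intro act.FA_Hom lv J)
    have L'L: "L' \<cdot> L = Ident M (act M (tens C ?I x) n)"
      unfolding L'_def L_def using ar C.HomD[OF lv(1)] lv(2) tens.FO_Ob by (simp add: act.FA_Cmp_Ar M.arr act.FA_Id)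
    note g = h M.HomD[OF L'] M.HomD[OF ms(1)[OF I x n]]
    have "U1 = massoc M ?I x n \<cdot> ((L' \<cdot> L) \<cdot> (mj \<cdot> U1))"
      unfolding L'L using g mj(2) M.Cmp_assoc_Ar[of U1 mj "massoc M ?I x n", symmetric] by (simp add: M.arr)
    also have "\<dots> = massoc M ?I x n \<cdot> (L' \<cdot> (L \<cdot> (mj \<cdot> U1)))" using g by (simp add: M.arr)
    also have "\<dots> = Zer M (act M ?I r) (act M ?I (act M x n))" unfolding LU using g by (simp add: M.lin M.dist)
    finally have U0: "U1 = Zer M (act M ?I r) (act M ?I (act M x n))" .
    have "u \<cdot> munit M r = munit M (act M x n) \<cdot> U1" unfolding U1_def by (rule mun_natural[OF u(1), symmetric])
    also have "\<dots> = Zer M (act M ?I r) (act M x n)"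
      unfolding U0 using h M.HomD[OF mu(1)[OF xn]] by (simp add: M.dist)
    finally have um: "u \<cdot> munit M r = Zer M (act M ?I r) (act M x n)" .
    have "u = (u \<cdot> munit M r) \<cdot> mv" using ar mv(2) M.HomD[OF mu(1)[OF r]] M.HomD[OF mv(1)] by (simp add: M.arr)
    then have "u = Zer M r (act M x n)" unfolding um using ar M.HomD[OF mv(1)] by (simp add: M.dist)
    then show False using u(2) by simp
  qed
  then show ?thesis using that v by blast
qed

lemma linked_sym:
  assumes "linked g N P"
  shows "linked (inv\<^bsub>grading_group C\<^esub> g) P N"
proof -
  interpret G: group "grading_group C" by (rule grading_group)
  obtain n where n: "is_simple M n" "N = iso_class M n" using M.Irr_classesE[OF linkedD(1)[OF assms(1)]] by metis
  obtain r where r: "is_simple M r" "P = iso_class M r" using M.Irr_classesE[OF linkedD(2)[OF assms(1)]] by metis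
  obtain x u where x: "is_simple C x" "grading_deg C (iso_class C x) = g"
    and u: "u \<in> Hom M r (act M x n)" "u \<noteq> Zer M r (act M x n)"
    using assms(1) unfolding n(2) r(2) linked_iff[OF n(1) r(1)] by blast
  note x' = C.simpleD(1)[OF x(1)] and n' = M.simpleD(1)[OF n(1)] and r' = M.simpleD(1)[OF r(1)]
  obtain D where "is_left_dual C D x" using C.rigid[OF x'] by blast
  then obtain ev coev ia where D: "D \<in> Ob C" and ev: "ev \<in> Hom C (tens C D x) (unit_ob C)"
    and coev: "coev \<in> Hom C (unit_ob C) (tens C x D)" and ia: "is_inverse C (assoc_ar C D x D) ia"
    and z1: "runit C x \<cdot>\<^bsub>C\<^esub> tensA C (Ident C x) ev \<cdot>\<^bsub>C\<^esub> assoc_ar C x D x \<cdot>\<^bsub>C\<^esub> tensA C coev (Ident C x) = lunit C x"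
    and z2: "lunit C D \<cdot>\<^bsub>C\<^esub> tensA C ev (Ident C D) \<cdot>\<^bsub>C\<^esub> ia \<cdot>\<^bsub>C\<^esub> tensA C (Ident C D) coev = runit C D"
    unfolding is_left_dual_def by blast
  obtain v where v: "v \<in> Hom M (act M D r) n" "v \<noteq> Zer M (act M D r) n"
    by (rule dual_adjunct_nonzero[OF D x' ev coev z1 n' u])
  obtain l :: nat and F inc where cop: "is_coproduct C {..<l} F D inc" and F: "\<And>i. i < l \<Longrightarrow> is_simple C (F i)"
    using C.decomposition[OF D] by metis
  obtain a where a: "a \<in> {..<l}" "v \<cdot> actA M (inc a) (Ident M r) \<noteq> Zer M (act M (F a) r) n"
    by (rule act.detect_left[OF cop _ v r']) auto
  have Fa: "is_simple C (F a)" using F a by simp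
  note inc = C.coproductD(3)[OF cop a(1)]
  have "direct_summand M n (act M (F a) r)"
    by (rule M.simple_direct_summandI_epic[OF n(1) M.Cmp_Hom[OF act.FA_Hom[OF inc M.Id_Hom[OF r']] v(1)] a(2)])
  then have w: "\<exists>w. w \<in> Hom M n (act M (F a) r) \<and> w \<noteq> Zer M n (act M (F a) r)"
    using M.simple_direct_summand_iff[OF n(1)] by blast
  obtain k where k: "k \<in> Hom C D (F a)" "k \<cdot>\<^bsub>C\<^esub> inc a = Ident C (F a)" using C.coproduct_retraction[OF cop a(1)] by blast
  have "inc a \<noteq> Zer C (F a) D"
    using k C.simpleD[OF Fa] C.HomD[OF k(1)] C.Cmp_Zer_right[of k "F a" D] by auto
  \<comment> \<open>The evaluation does not vanish on the summand \<open>F a\<close> of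
    \<open>D\<close>, so the unit is a summand of \<open>F a \<otimes> x\<close>, which fixes the
    degree of \<open>F a\<close>.\<close>
  then have e: "ev \<cdot>\<^bsub>C\<^esub> tensA C (inc a) (Ident C x) \<noteq> Zer C (tens C (F a) x) (unit_ob C)"
    using dual_evaluation_nonzero[OF D x' ev coev ia z2 inc] by blast
  have "direct_summand C (unit_ob C) (tens C (F a) x)"
    by (rule C.simple_direct_summandI_epic[OF C.unit_simple C.Cmp_Hom[OF tens.FA_Hom[OF inc C.Id_Hom[OF x']] ev] e])
  then have "grading_deg C (iso_class C (F a)) \<otimes>\<^bsub>grading_group C\<^esub> g = \<one>\<^bsub>grading_group C\<^esub>"
    using grading_deg_tens[OF Fa x(1) C.unit_simple] grading_deg_unit x(2) by simp
  then have "grading_deg C (iso_class C (F a)) = inv\<^bsub>grading_group C\<^esub> g"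
    using G.inv_equality grading_deg_carrier C.Irr_classesI[OF Fa] linkedD(3)[OF assms] by metis
  then show ?thesis unfolding n(2) r(2) linked_iff[OF r(1) n(1)] using Fa w by blast
qed

end

section \<open>Components and shift functions\<close>

context semisimple_module_category
begin

lemma module_edges_iff: "(N, P) \<in> module_edges C M \<longleftrightarrow> (\<exists>g. linked g N P)"
  by (auto simp: module_edges_def linked_def)

text \<open>Being linked by some label is already reflexive, symmetric and transitive, so the
  closure of the edge relation adds nothing, and any member of the component can serve as
  base.\<close>

lemma component_iff:
  assumes "\<Omega> \<in> module_components C M" "M0 \<in> \<Omega>"
  shows "P \<in> \<Omega> \<longleftrightarrow> (\<exists>g. linked g M0 P)"
proof -
  let ?E = "(module_edges C M \<union> (module_edges C M)\<inverse>)\<^sup>*"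
  have E: "(N, P) \<in> ?E \<longleftrightarrow> (\<exists>g. linked g N P)" if "N \<in> Irr_classes M" for N P
  proof
    assume "(N, P) \<in> ?E"
    then show "\<exists>g. linked g N P"
    proof (induction rule: rtrancl_induct)
      case base
      then show ?case using linked_refl[OF that] by blast
    next
      case (step P Q)
      then show ?case using linked_trans linked_sym module_edges_iff by blast
    qed
  next
    assume "\<exists>g. linked g N P"
    then show "(N, P) \<in> ?E" using module_edges_iff by blast
  qed
  obtain N where N: "N \<in> Irr_classes M" "\<Omega> = {P \<in> Irr_classes M. (N, P) \<in> ?E}"
    using assms(1) unfolding module_components_def by blast
  obtain h where h: "linked h N M0" using assms(2) N E by blast
  have "P \<in> \<Omega> \<longleftrightarrow> (\<exists>g. linked g N P)"
    unfolding N(2) using E[OF N(1)] linkedD(2) by blast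
  also have "\<dots> \<longleftrightarrow> (\<exists>g. linked g M0 P)"
    using linked_trans[OF h] linked_trans[OF linked_sym[OF h]] by blast
  finally show ?thesis .
qed

lemma component_Irr:
  assumes "\<Omega> \<in> module_components C M" "M0 \<in> \<Omega>"
  shows "M0 \<in> Irr_classes M"
  using assms unfolding module_components_def by blast

text \<open>A simple summand of \<open>X \<odot> n\<close> already occurs in
  \<open>x \<odot> n\<close> for a simple summand \<open>x\<close> of \<open>X\<close>, so arbitrary
  objects of degree \<open>g\<close> can be replaced by simple ones.\<close>

lemma graded_part_summand_iff:
  assumes n: "is_simple M n" and r: "is_simple M r"
  shows "(\<exists>X \<in> graded_part C g. direct_summand M r (act M X n)) \<longleftrightarrow> linked g (iso_class M n) (iso_class M r)"
proof
  assume "\<exists>X \<in> graded_part C g. direct_summand M r (act M X n)"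
  then obtain X where X: "X \<in> graded_part C g" "direct_summand M r (act M X n)" by blast
  obtain k :: nat and F inc where F: "\<forall>i<k. F i \<in> {x. is_simple C x \<and> grading_deg C (iso_class C x) = g}"
    and cop: "is_coproduct C {..<k} F X inc"
    using X(1) unfolding graded_part_def finite_sums_def by blast
  obtain u where u: "u \<in> Hom M r (act M X n)" "u \<noteq> Zer M r (act M X n)"
    using X(2) M.simple_direct_summand_iff[OF r] by blast
  obtain a v where "a < k" "v \<in> Hom M r (act M (F a) n)" "v \<noteq> Zer M r (act M (F a) n)"
    by (rule act_simple_decomposition[OF cop u M.simpleD(1)[OF n]])
  then show "linked g (iso_class M n) (iso_class M r)"
    unfolding linked_iff[OF n r] using F by blast
next
  assume "linked g (iso_class M n) (iso_class M r)"
  then obtain x u where x: "is_simple C x" "grading_deg C (iso_class C x) = g"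
    and u: "u \<in> Hom M r (act M x n)" "u \<noteq> Zer M r (act M x n)"
    unfolding linked_iff[OF n r] by blast
  have "x \<in> graded_part C g"
    unfolding graded_part_def by (rule C.finite_sums_single) (use x C.simpleD(1) in auto)
  then show "\<exists>X \<in> graded_part C g. direct_summand M r (act M X n)"
    using u M.simple_direct_summand_iff[OF r] by blast
qed

lemma component_stabilizer_iff:
  assumes "M0 \<in> Irr_classes M"
  shows "g \<in> component_stabilizer C M M0 \<longleftrightarrow> linked g M0 M0"
proof -
  have "(\<exists>X \<in> graded_part C g. direct_summand M n (act M X n)) \<longleftrightarrow> linked g M0 M0" if "n \<in> M0" for n
    using graded_part_summand_iff[of n n g] M.Irr_classesD[OF assms that] by simp
  moreover obtain n where "n \<in> M0" using M.Irr_classesE[OF assms] by metis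
  ultimately show ?thesis unfolding component_stabilizer_def using linkedD(3) by blast
qed

lemma stabilizer_subgroup:
  assumes "M0 \<in> Irr_classes M"
  shows "subgroup (component_stabilizer C M M0) (grading_group C)"
proof -
  interpret group "grading_group C" by (rule grading_group)
  show ?thesis
    using linked_refl[OF assms] linked_trans linked_sym linkedD(3)
    by unfold_locales (auto simp: component_stabilizer_iff[OF assms])
qed

text \<open>Two labels \<open>g\<close> and \<open>h\<close> leading from the base to the same
  \<open>P\<close> differ by the loop \<open>inv h g\<close> at the base, an element of the
  stabilizer.\<close>

lemma coset_linked:
  assumes M0: "M0 \<in> Irr_classes M" and g: "g \<in> carrier (grading_group C)" and h: "linked h M0 P"
  shows "h <#\<^bsub>grading_group C\<^esub> component_stabilizer C M M0 = g <#\<^bsub>grading_group C\<^esub> component_stabilizer C M M0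
    \<longleftrightarrow> linked g M0 P"
proof -
  interpret group "grading_group C" by (rule grading_group)
  let ?H = "component_stabilizer C M M0"
  note H = stabilizer_subgroup[OF M0] and hc = linkedD(3)[OF h]
  have "linked g M0 P \<longleftrightarrow> g \<in> h <#\<^bsub>grading_group C\<^esub> ?H"
  proof
    assume "linked g M0 P"
    then have "linked (inv\<^bsub>grading_group C\<^esub> h \<otimes>\<^bsub>grading_group C\<^esub> g) M0 M0"
      using linked_trans linked_sym[OF h] by blast
    moreover have "g = h \<otimes>\<^bsub>grading_group C\<^esub> (inv\<^bsub>grading_group C\<^esub> h \<otimes>\<^bsub>grading_group C\<^esub> g)"
      using g hc by (simp add: m_assoc[symmetric])
    ultimately show "g \<in> h <#\<^bsub>grading_group C\<^esub> ?H"
      unfolding l_coset_def using component_stabilizer_iff[OF M0] by blast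
  next
    assume "g \<in> h <#\<^bsub>grading_group C\<^esub> ?H"
    then obtain k where "linked k M0 M0" "g = h \<otimes>\<^bsub>grading_group C\<^esub> k"
      unfolding l_coset_def using component_stabilizer_iff[OF M0] by blast
    then show "linked g M0 P" using linked_trans h by blast
  qed
  moreover have "g \<in> g <#\<^bsub>grading_group C\<^esub> ?H"
    unfolding l_coset_def using subgroup.one_closed[OF H] r_one[OF g] by force
  ultimately show ?thesis using l_repr_independence[OF _ hc H] by blast
qed

text \<open>The definite description in \<open>module_degree\<close> is meaningful because all
  labels leading to \<open>P\<close> lie in one left coset.\<close>

lemma module_degree_eq:
  assumes M0: "M0 \<in> Irr_classes M" and g: "linked g M0 P"
  shows "module_degree C M M0 P = g <#\<^bsub>grading_group C\<^esub> component_stabilizer C M M0"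
proof -
  obtain r where r: "r \<in> P" using M.Irr_classesE[OF linkedD(2)[OF g]] by metis
  obtain n where n: "n \<in> M0" using M.Irr_classesE[OF M0] by metis
  have iff: "(\<exists>X \<in> graded_part C h. \<exists>n \<in> M0. \<exists>r \<in> P. direct_summand M r (act M X n)) \<longleftrightarrow> linked h M0 P" for h
  proof -
    have "(\<exists>X \<in> graded_part C h. direct_summand M r (act M X n)) \<longleftrightarrow> linked h M0 P" if "n \<in> M0" "r \<in> P" for n r
      using graded_part_summand_iff[of n r h] M.Irr_classesD[OF M0 that(1)]
        M.Irr_classesD[OF linkedD(2)[OF g] that(2)] by simp
    then show ?thesis using r n by blast
  qed
  show ?thesis
    unfolding module_degree_def iff
    using g linkedD(3) coset_linked[OF M0 linkedD(3) g] by (intro the_equality) blast+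
qed

text \<open>A simple object that is a finite sum of simple objects maps nontrivially to one of them
  and is therefore isomorphic to it.\<close>

lemma module_graded_part_iff:
  assumes r: "is_simple M r"
  shows "r \<in> module_graded_part C M \<Omega> M0 K \<longleftrightarrow>
    iso_class M r \<in> \<Omega> \<and> module_degree C M M0 (iso_class M r) = K"
proof
  assume "r \<in> module_graded_part C M \<Omega> M0 K"
  then obtain k :: nat and F inc where
    F: "\<forall>i<k. F i \<in> {r. is_simple M r \<and> iso_class M r \<in> \<Omega> \<and> module_degree C M M0 (iso_class M r) = K}"
    and cop: "is_coproduct M {..<k} F r inc"
    unfolding module_graded_part_def finite_sums_def by blast
  note r' = M.simpleD[OF r]
  obtain i g where i: "i \<in> {..<k}" "g \<in> Hom M r (F i)" "g \<cdot> Ident M r \<noteq> Zer M r (F i)"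
    by (rule M.coproduct_detect[OF cop _ M.Id_Hom[OF r'(1)] r'(3)]) auto
  have "g \<noteq> Zer M r (F i)" using i(2,3) M.Id_right by simp
  then have "is_isomorphism M g" using M.Schur[OF r _ i(2)] F i(1) by blast
  then have "F i \<in> iso_class M r" using i(2) M.HomD(5)[OF i(2)] unfolding iso_class_def by blast
  then have "iso_class M (F i) = iso_class M r" by (rule M.iso_class_eq)
  then show "iso_class M r \<in> \<Omega> \<and> module_degree C M M0 (iso_class M r) = K" using F i(1) by force
next
  assume "iso_class M r \<in> \<Omega> \<and> module_degree C M M0 (iso_class M r) = K"
  then show "r \<in> module_graded_part C M \<Omega> M0 K"
    unfolding module_graded_part_def by (intro M.finite_sums_single) (use r M.simpleD(1) in auto)
qed

text \<open>This eliminates cosets and graded parts: what remains is a statement about labelled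
  edges out of the base object.\<close>

lemma coset_formula_iff:
  assumes \<Omega>: "\<Omega> \<in> module_components C M" "M0 \<in> \<Omega>"
  shows "coset_formula C M \<chi> \<Omega> M0 c p \<longleftrightarrow> (\<forall>g P. linked g M0 P \<longrightarrow> p P = c + \<chi> g)"
proof -
  note M0 = component_Irr[OF \<Omega>]
  let ?H = "component_stabilizer C M M0"
  have deg: "iso_class M r \<in> \<Omega> \<and> module_degree C M M0 (iso_class M r) = g <#\<^bsub>grading_group C\<^esub> ?H \<longleftrightarrow>
      linked g M0 (iso_class M r)" if g: "g \<in> carrier (grading_group C)" for g r
    unfolding component_iff[OF \<Omega>] using module_degree_eq[OF M0] coset_linked[OF M0 g] by metis
  have part: "r \<in> module_graded_part C M \<Omega> M0 (g <#\<^bsub>grading_group C\<^esub> ?H) \<longleftrightarrow> linked g M0 (iso_class M r)"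
    if "g \<in> carrier (grading_group C)" "is_simple M r" for g r
    using module_graded_part_iff[OF that(2)] deg[OF that(1)] by simp
  have "coset_formula C M \<chi> \<Omega> M0 c p \<longleftrightarrow>
      (\<forall>g \<in> carrier (grading_group C). \<forall>r. is_simple M r \<longrightarrow> linked g M0 (iso_class M r) \<longrightarrow>
        p (iso_class M r) = c + \<chi> g)"
    unfolding coset_formula_def using part by blast
  also have "\<dots> \<longleftrightarrow> (\<forall>g P. linked g M0 P \<longrightarrow> p P = c + \<chi> g)"
  proof (intro iffI allI impI)
    fix g P
    assume all: "\<forall>g \<in> carrier (grading_group C). \<forall>r. is_simple M r \<longrightarrow> linked g M0 (iso_class M r) \<longrightarrow>
        p (iso_class M r) = c + \<chi> g" and l: "linked g M0 P"
    obtain r where "is_simple M r" "P = iso_class M r" using M.Irr_classesE[OF linkedD(2)[OF l]] by metis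
    then show "p P = c + \<chi> g" using all l linkedD(3)[OF l] by blast
  qed blast
  finally show ?thesis .
qed

lemma degree_compatible_linked:
  "degree_compatible C M \<chi> S p \<longleftrightarrow> (\<forall>g. \<forall>N \<in> S. \<forall>P \<in> S. linked g N P \<longrightarrow> p P = p N + \<chi> g)"
  unfolding degree_compatible_def linked_def by blast

text \<open>A label \<open>h\<close> from the base to \<open>N\<close> followed by an edge
  \<open>g\<close> is a label \<open>g h\<close> to \<open>P\<close>, and \<open>\<chi>\<close>
  turns the product into a sum.\<close>

lemma coset_formula_compatible:
  assumes \<Omega>: "\<Omega> \<in> module_components C M" "M0 \<in> \<Omega>" and \<chi>: "\<chi> \<in> hom (grading_group C) integer_group"
    and c: "coset_formula C M \<chi> \<Omega> M0 c p"
  shows "degree_compatible C M \<chi> \<Omega> p"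
  unfolding degree_compatible_linked
proof (intro allI ballI impI)
  fix g N P assume N: "N \<in> \<Omega>" and l: "linked g N P"
  obtain h where h: "linked h M0 N" using N component_iff[OF \<Omega>] by blast
  have "p N = c + \<chi> h" "p P = c + \<chi> (g \<otimes>\<^bsub>grading_group C\<^esub> h)"
    using c h linked_trans[OF h l] unfolding coset_formula_iff[OF \<Omega>] by blast+
  then show "p P = p N + \<chi> g"
    using hom_mult[OF \<chi> linkedD(3)[OF l] linkedD(3)[OF h]] by simp
qed

lemma coset_formula_exists:
  assumes \<Omega>: "\<Omega> \<in> module_components C M" "M0 \<in> \<Omega>" and \<chi>: "\<chi> \<in> hom (grading_group C) integer_group"
    and 0: "\<forall>g \<in> component_stabilizer C M M0. \<chi> g = 0"
  shows "\<exists>p. coset_formula C M \<chi> \<Omega> M0 c p"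
proof -
  interpret \<chi>: group_hom "grading_group C" integer_group \<chi>
    by (intro group_hom.intro group_hom_axioms.intro grading_group group_integer_group \<chi>)
  note M0 = component_Irr[OF \<Omega>]
  \<comment> \<open>Any label leading to \<open>P\<close> will do: two of them differ by an element
    of the stabilizer, on which \<open>\<chi>\<close> vanishes.\<close>
  define p where "p P = c + \<chi> (SOME g. linked g M0 P)" for P
  have "p P = c + \<chi> g" if g: "linked g M0 P" for g P
  proof -
    define h where "h = (SOME g. linked g M0 P)"
    have h: "linked h M0 P" unfolding h_def using g by (rule someI)
    have "inv\<^bsub>grading_group C\<^esub> h \<otimes>\<^bsub>grading_group C\<^esub> g \<in> component_stabilizer C M M0"
      using component_stabilizer_iff[OF M0] linked_trans[OF g linked_sym[OF h]] by blast
    then have "\<chi> (inv\<^bsub>grading_group C\<^esub> h \<otimes>\<^bsub>grading_group C\<^esub> g) = 0" using 0 by blast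
    then show ?thesis
      using \<chi>.hom_mult[OF \<chi>.G.inv_closed[OF linkedD(3)[OF h]] linkedD(3)[OF g]] \<chi>.hom_inv[OF linkedD(3)[OF h]]
      by (simp add: p_def h_def)
  qed
  then show ?thesis unfolding coset_formula_iff[OF \<Omega>] by blast
qed

lemma compatible_imp:
  assumes \<Omega>: "\<Omega> \<in> module_components C M" "M0 \<in> \<Omega>" and p: "degree_compatible C M \<chi> \<Omega> p"
  shows "\<forall>g \<in> component_stabilizer C M M0. \<chi> g = 0" "coset_formula C M \<chi> \<Omega> M0 (p M0) p"
proof -
  have eq: "p P = p M0 + \<chi> g" if "linked g M0 P" for g P
    using p \<Omega>(2) component_iff[OF \<Omega>] that unfolding degree_compatible_linked by blast
  show "\<forall>g \<in> component_stabilizer C M M0. \<chi> g = 0"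
  proof
    fix g assume "g \<in> component_stabilizer C M M0"
    then show "\<chi> g = 0" using eq[of g M0] component_stabilizer_iff[OF component_Irr[OF \<Omega>]] by simp
  qed
  show "coset_formula C M \<chi> \<Omega> M0 (p M0) p" unfolding coset_formula_iff[OF \<Omega>] using eq by blast
qed

end

theorem theoremB:
  fixes C :: "('o, 'm, 'k::alg_closed_field) tencat"
    and M :: "('o, 'm, 'p, 'n, 'k) modcat"
    and \<chi> :: "'o set word set \<Rightarrow> int"
    and d :: int
    and q :: "'o set \<Rightarrow> int"
    and p :: "'p set \<Rightarrow> int"
  assumes "tensor_category C" and "semisimple_category C"
    and "module_category C M" and "locally_finite M" and "semisimple_category M"
    and "\<exists>N \<in> Ob M. \<not> is_zero_object M N"
    and "\<chi> \<in> hom (grading_group C) integer_group"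
    and "\<And>X. X \<in> Irr_classes C \<Longrightarrow> q X = \<chi> (grading_deg C X) + d"
  defines "dev \<equiv> module_deviations C M (shift_t_structure C q) (shift_t_structure M p)"
  shows
    "(\<forall>m. m \<in> dev \<longleftrightarrow>
        (\<forall>X N P. action_summand C M X N P \<longrightarrow> p P = q X + p N - m))
     \<and>
     (dev \<noteq> {} \<longleftrightarrow> degree_compatible C M \<chi> (Irr_classes M) p)
     \<and>
     (dev \<noteq> {} \<longrightarrow> dev = {d})
     \<and>
     (\<forall>\<Omega> \<in> module_components C M. \<forall>M0 \<in> \<Omega>.
        ((\<exists>p'. degree_compatible C M \<chi> \<Omega> p') \<longleftrightarrow> (\<forall>g \<in> component_stabilizer C M M0. \<chi> g = 0)) \<and>
        ((\<forall>g \<in> component_stabilizer C M M0. \<chi> g = 0) \<longrightarrow>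
           (\<forall>p'. degree_compatible C M \<chi> \<Omega> p' \<longleftrightarrow> (\<exists>c. coset_formula C M \<chi> \<Omega> M0 c p')) \<and>
           (\<forall>c. \<exists>p'. degree_compatible C M \<chi> \<Omega> p' \<and> coset_formula C M \<chi> \<Omega> M0 c p')))
     \<and>
     (\<forall>\<S> base c. \<S> \<subseteq> module_components C M \<and>
        (\<forall>\<Omega> \<in> \<S>. base \<Omega> \<in> \<Omega> \<and> (\<forall>g \<in> component_stabilizer C M (base \<Omega>). \<chi> g = 0)) \<longrightarrow>
        (\<exists>p'. degree_compatible C M \<chi> (\<Union>\<S>) p' \<and>
           (\<forall>\<Omega> \<in> \<S>. coset_formula C M \<chi> \<Omega> (base \<Omega>) (c \<Omega>) p')))"
proof -
  interpret semisimple_module_category C M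
    by (intro semisimple_module_category.intro semisimple_module_category_axioms.intro assms)
  note \<chi> = assms(7) and q = assms(8)
  interpret \<chi>: group_hom "grading_group C" integer_group \<chi>
    by (intro group_hom.intro group_hom_axioms.intro grading_group group_integer_group \<chi>)
  have dev_iff: "m \<in> dev \<longleftrightarrow> (\<forall>X N P. action_summand C M X N P \<longrightarrow> p P = q X + p N - m)" for m
    unfolding dev_def by (rule module_deviations_iff)
  \<comment> \<open>If \<open>M\<close> had no simple object, there would be no triples and every
    integer would be a deviation; a nonzero module category excludes this.\<close>
  obtain N where N: "N \<in> Irr_classes M"
    using assms(6) M.nonzero_simple_summand M.Irr_classesI by metis
  obtain X where X: "action_summand C M X N N" "grading_deg C X = \<one>\<^bsub>grading_group C\<^esub>"
    using linked_refl[OF N] unfolding linked_def by blast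
  have XI: "X \<in> Irr_classes C" if "action_summand C M X N P" for X N P
    using that by (simp add: action_summand_def)
  \<comment> \<open>An object of trivial degree links \<open>N\<close> to itself, so the criterion
    reads \<open>p N = d + p N - m\<close>.\<close>
  have dev_d: "m = d" if "m \<in> dev" for m
  proof -
    have "p N = q X + p N - m" using that X(1) dev_iff by blast
    then show ?thesis using q[OF XI[OF X(1)]] X(2) \<chi>.hom_one by simp
  qed
  have d_iff: "d \<in> dev \<longleftrightarrow> degree_compatible C M \<chi> (Irr_classes M) p"
  proof -
    have "d \<in> dev \<longleftrightarrow> (\<forall>X N P. action_summand C M X N P \<longrightarrow> p P = p N + \<chi> (grading_deg C X))"
      unfolding dev_iff using q XI by (smt (verit, best))
    also have "\<dots> \<longleftrightarrow> degree_compatible C M \<chi> (Irr_classes M) p"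
    proof -
      have "N \<in> Irr_classes M \<and> P \<in> Irr_classes M" if "action_summand C M X N P" for X N P
        using that by (simp add: action_summand_def)
      then show ?thesis unfolding degree_compatible_def by blast
    qed
    finally show ?thesis .
  qed
  have part3: "((\<exists>p'. degree_compatible C M \<chi> \<Omega> p') \<longleftrightarrow> (\<forall>g \<in> component_stabilizer C M M0. \<chi> g = 0)) \<and>
      ((\<forall>g \<in> component_stabilizer C M M0. \<chi> g = 0) \<longrightarrow>
         (\<forall>p'. degree_compatible C M \<chi> \<Omega> p' \<longleftrightarrow> (\<exists>c. coset_formula C M \<chi> \<Omega> M0 c p')) \<and>
         (\<forall>c. \<exists>p'. degree_compatible C M \<chi> \<Omega> p' \<and> coset_formula C M \<chi> \<Omega> M0 c p'))"
    if \<Omega>: "\<Omega> \<in> module_components C M" "M0 \<in> \<Omega>" for \<Omega> M0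
    using compatible_imp[OF \<Omega>] coset_formula_compatible[OF \<Omega> \<chi>] coset_formula_exists[OF \<Omega> \<chi>] by metis
  have part4: "\<exists>p'. degree_compatible C M \<chi> (\<Union>\<S>) p' \<and> (\<forall>\<Omega> \<in> \<S>. coset_formula C M \<chi> \<Omega> (base \<Omega>) (c \<Omega>) p')"
    if \<S>: "\<S> \<subseteq> module_components C M"
      and base: "\<forall>\<Omega> \<in> \<S>. base \<Omega> \<in> \<Omega> \<and> (\<forall>g \<in> component_stabilizer C M (base \<Omega>). \<chi> g = 0)" for \<S> base c
  proof -
    have "\<forall>\<Omega> \<in> \<S>. \<exists>p. coset_formula C M \<chi> \<Omega> (base \<Omega>) (c \<Omega>) p"
      using coset_formula_exists[OF _ _ \<chi>] \<S> base by blast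
    then obtain f where f: "\<And>\<Omega>. \<Omega> \<in> \<S> \<Longrightarrow> coset_formula C M \<chi> \<Omega> (base \<Omega>) (c \<Omega>) (f \<Omega>)" by metis
    have eq: "\<Omega>' = \<Omega>" if "\<Omega> \<in> \<S>" "\<Omega>' \<in> \<S>" "P \<in> \<Omega>" "P \<in> \<Omega>'" for \<Omega> \<Omega>' P
      using component_iff[of \<Omega> P] component_iff[of \<Omega>' P] that \<S> by blast
    \<comment> \<open>Distinct components are disjoint, so solutions with independently prescribed
      constants can be glued.\<close>
    define p' where "p' P = f (THE \<Omega>. \<Omega> \<in> \<S> \<and> P \<in> \<Omega>) P" for P
    have p': "p' P = f \<Omega> P" if "\<Omega> \<in> \<S>" "P \<in> \<Omega>" for \<Omega> P
    proof -
      have "(THE \<Omega>. \<Omega> \<in> \<S> \<and> P \<in> \<Omega>) = \<Omega>" using that eq by (intro the_equality) blast+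
      then show ?thesis by (simp add: p'_def)
    qed
    have cf: "coset_formula C M \<chi> \<Omega> (base \<Omega>) (c \<Omega>) p'" if "\<Omega> \<in> \<S>" for \<Omega>
    proof -
      have \<Omega>: "\<Omega> \<in> module_components C M" "base \<Omega> \<in> \<Omega>" using that \<S> base by auto
      show ?thesis
        using f[OF that] p'[OF that] component_iff[OF \<Omega>] unfolding coset_formula_iff[OF \<Omega>] by metis
    qed
    \<comment> \<open>No edge leaves a component, so the equation on the union reduces to the
      equation on each member.\<close>
    have "degree_compatible C M \<chi> (\<Union>\<S>) p'"
      unfolding degree_compatible_linked
    proof (intro allI ballI impI)
      fix g N P assume "N \<in> \<Union>\<S>" and l: "linked g N P"
      then obtain \<Omega> where \<Omega>: "\<Omega> \<in> \<S>" "N \<in> \<Omega>" by blast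
      then have \<Omega>': "\<Omega> \<in> module_components C M" "base \<Omega> \<in> \<Omega>" using \<S> base by auto
      have "P \<in> \<Omega>" using component_iff[OF \<Omega>'(1) \<Omega>(2)] l by blast
      then show "p' P = p' N + \<chi> g"
        using coset_formula_compatible[OF \<Omega>' \<chi> cf[OF \<Omega>(1)]] \<Omega>(2) l unfolding degree_compatible_linked by blast
    qed
    then show ?thesis using cf by blast
  qed
  show ?thesis
  proof (intro conjI)
    show "\<forall>m. m \<in> dev \<longleftrightarrow> (\<forall>X N P. action_summand C M X N P \<longrightarrow> p P = q X + p N - m)"
      by (rule allI[OF dev_iff])
    show "dev \<noteq> {} \<longleftrightarrow> degree_compatible C M \<chi> (Irr_classes M) p" using dev_d d_iff by blast
    show "dev \<noteq> {} \<longrightarrow> dev = {d}" using dev_d by blast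
  qed ((intro ballI part3; assumption), (intro allI impI part4; elim conjE; assumption))
qed

end
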